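(* Let $\lambda\in P^+$ be a dominant integral weight of $\mathfrak g$. The algebra $\mathbf A_\lambda$ is a graded polynomial algebra in variables $T_{i,r}$ of grade $2r$, $1\le i\le n$, $1\le r\le \lambda(\alpha_i^\vee)$.
   Context: Everything is over $\mathbb C$; $n\ge 1$. Let $\widehat{\mathfrak g}$ be the affine Kac–Moody algebra of type $A_{2n}^{(2)}$ with Cartan subalgebra $\widehat{\mathfrak h}$, simple roots $\alpha_0,\dots,\alpha_n$ and simple coroots $\alpha_0^\vee,\dots,\alpha_n^\vee$, nodes labelled as in Kac's Table Aff 2: for $n=1$, $\alpha_1(\alpha_0^\vee)=-4$, $\alpha_0(\alpha_1^\vee)=-1$; for $n\ge2$, the nodes form a chain $0,1,\dots,n$ with $\alpha_1(\alpha_0^\vee)=-2$, $\alpha_0(\alpha_1^\vee)=-1$, $\alpha_n(\alpha_{n-1}^\vee)=-2$, $\alpha_{n-1}(\alpha_n^\vee)=-1$, and $\alpha_j(\alpha_i^\vee)=-1$ for the other adjacent pairs. The non-divisible positive imaginary root is $\delta=2\alpha_0+\dots+2\alpha_{n-1}+\alpha_n$. Let $\mathfrak g\subset\widehat{\mathfrak g}$ be the simple subalgebra attached to the nodes $1,\dots,n$ (type $A_1$ if $n=1$, $C_n$ if $n\ge 2$), $\mathfrak h$ its Cartan subalgebra, $R$, $R^\pm$ its roots and positive/negative roots with basis $\alpha_1,\dots,\alpha_n$, $\mathfrak n^\pm$ its nilpotent subalgebras, $R_\ell,R_s$ the long and short roots (for $n=1$: $R_\ell=R$, $R_s=\emptyset$),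 $R^\pm_\ell=R_\ell\cap R^\pm$, $R^\pm_s=R_s\cap R^\pm$, $P$ the weight lattice, $P^+$ the dominant weights, $\bar Q^+=\bigoplus_{i=1}^{n-1}\mathbb Z_+\alpha_i\oplus\mathbb Z_+\tfrac12\alpha_n$. The hyperspecial current algebra is $\mathfrak{Cg}=\mathfrak h\oplus\widehat{\mathfrak n}^+\oplus\mathfrak n^-$, where $\widehat{\mathfrak n}^+$ is the sum of all positive root spaces of $\widehat{\mathfrak g}$. It is $\mathbb Z_+$-graded: a root space $\widehat{\mathfrak g}_\beta$ has grade $\beta(d)$, where $\alpha_0(d)=1$, $\alpha_i(d)=0$ for $1\le i\le n$ (so $\delta(d)=2$), and $\mathfrak h$ has grade $0$; the grade zero part is $\mathfrak g$. Put $\widehat R_{\rm re}(\pm)=R^\pm\cup(R_s^\pm+\mathbb N\delta)\cup(R_\ell^\pm+2\mathbb N\delta)\cup\frac12(R_\ell^\pm+(2\mathbb Z_++1)\delta)$ with $\mathbb N=\{1,2,\dots\}$, $\mathfrak{Cn}^\pm=\bigoplus_{\beta\in\widehat R_{\rm re}(\pm)}\widehat{\mathfrak g}_\beta$, and $\mathfrak{Ch}_+=\bigoplus_{k>0}\widehat{\mathfrak g}_{k\delta}$ (an abelian subalgebra of $\mathfrak{Cg}$, since the centre is not included). Then $\mathfrak{Cg}=\mathfrak{Cn}^+\oplus(\mathfrak h\oplus\mathfrak{Ch}_+)\oplus\mathfrak{Cn}^-$. Here $\mathbf U(\cdot)$ is the universal enveloping algebra, with the induced grading. For $\lambda\in P^+$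 let $V(\lambda)$ be the irreducible finite-dimensional $\mathfrak g$-module of highest weight $\lambda$. The global Weyl module $W(\lambda)$ is the maximal quotient of $\mathbf U(\mathfrak{Cg})\otimes_{\mathbf U(\mathfrak g)}V(\lambda)$ whose $\mathfrak h$-weights lie in $\lambda-\bar Q^+$; equivalently, it is the $\mathfrak{Cg}$-module generated by $w_\lambda$ with relations $\mathfrak{Cn}^+w_\lambda=0$, $hw_\lambda=\lambda(h)w_\lambda$ ($h\in\mathfrak h$), $x_{-\alpha}^{\lambda(\alpha^\vee)+1}w_\lambda=0$ for $\alpha\in R^+$, where $x_{-\alpha}$ is a nonzero vector of the root space of $-\alpha$. There is a well-defined right action of $\mathbf U(\mathfrak{Ch}_+)$ on $W(\lambda)$, $(yw_\lambda)u=yuw_\lambda$ for $y\in\mathbf U(\mathfrak{Cg})$, $u\in\mathbf U(\mathfrak{Ch}_+)$. Put $\mathrm{Ann}(w_\lambda)=\{u\in\mathbf U(\mathfrak{Ch}_+):uw_\lambda=0\}$, a graded ideal, and $\mathbf A_\lambda=\mathbf U(\mathfrak{Ch}_+)/\mathrm{Ann}(w_\lambda)$. *)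

theory Defs
  imports
    Complex_Main
    "HOL-Library.Function_Algebras"
    "HOL-Library.Poly_Mapping"
    "HOL-Algebra.QuotRing"
begin

section \<open>Complex Lie algebras\<close>

text \<open>The underlying set of a Lie algebra is the whole type; subalgebras are sets.\<close>

record 'g lie_algebra =
  smul :: "complex \<Rightarrow> 'g \<Rightarrow> 'g"
  bracket :: "'g \<Rightarrow> 'g \<Rightarrow> 'g"

definition lie_algebra :: "('g::ab_group_add, 'm) lie_algebra_scheme \<Rightarrow> bool" where
  "lie_algebra G \<longleftrightarrow>
     vector_space (smul G) \<and>
     (\<forall>x. Vector_Spaces.linear (smul G) (smul G) (\<lambda>y. bracket G x y)) \<and>
     (\<forall>y. Vector_Spaces.linear (smul G) (smul G) (\<lambda>x. bracket G x y)) \<and>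
     (\<forall>x. bracket G x x = 0) \<and>
     (\<forall>x y z. bracket G x (bracket G y z) + bracket G y (bracket G z x)
               + bracket G z (bracket G x y) = 0)"

definition lie_subalgebra :: "('g::ab_group_add, 'm) lie_algebra_scheme \<Rightarrow> 'g set \<Rightarrow> bool" where
  "lie_subalgebra G S \<longleftrightarrow>
     module.subspace (smul G) S \<and> (\<forall>x\<in>S. \<forall>y\<in>S. bracket G x y \<in> S)"

definition lie_ideal :: "('g::ab_group_add, 'm) lie_algebra_scheme \<Rightarrow> 'g set \<Rightarrow> bool" where
  "lie_ideal G I \<longleftrightarrow>
     module.subspace (smul G) I \<and> (\<forall>x. \<forall>y\<in>I. bracket G x y \<in> I)"

definition lie_generated :: "('g::ab_group_add, 'm) lie_algebra_scheme \<Rightarrow> 'g set \<Rightarrow> 'g set" where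
  "lie_generated G X = \<Inter>{S. lie_subalgebra G S \<and> X \<subseteq> S}"


section \<open>Kac--Moody algebras\<close>

record 'g kac_moody = "'g lie_algebra" +
  cartan :: "'g set"
  gen_e :: "nat \<Rightarrow> 'g"
  gen_f :: "nat \<Rightarrow> 'g"
  simple_coroot :: "nat \<Rightarrow> 'g"
  simple_root :: "nat \<Rightarrow> 'g \<Rightarrow> complex"

text \<open>
  The dual space of a subspace \<open>V\<close>. A functional on \<open>V\<close> is extended by \<open>0\<close> outside \<open>V\<close>, so
  that equality of HOL functions is equality of functionals.
\<close>

definition dual :: "('g::ab_group_add, 'm) lie_algebra_scheme \<Rightarrow> 'g set \<Rightarrow> ('g \<Rightarrow> complex) set" where
  "dual G V = {\<phi>. (\<forall>x\<in>V. \<forall>y\<in>V. \<phi> (x + y) = \<phi> x + \<phi> y) \<and>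
                  (\<forall>c. \<forall>x\<in>V. \<phi> (smul G c x) = c * \<phi> x) \<and>
                  (\<forall>x. x \<notin> V \<longrightarrow> \<phi> x = 0)}"

definition matrix_rank :: "nat \<Rightarrow> (nat \<Rightarrow> nat \<Rightarrow> int) \<Rightarrow> nat" where
  "matrix_rank N A =
     vector_space.dim (\<lambda>(c::complex) v. (\<lambda>j::nat. c * v j))
       ((\<lambda>i j. if j < N then of_int (A i j) else 0) ` {..<N})"

text \<open>
  \<open>G\<close> is the Kac--Moody algebra of the matrix \<open>A\<close> with nodes \<open>0, \<dots>, N - 1\<close>: the first group of
  conditions says that the Cartan subalgebra with the simple roots and coroots is a realization
  of \<open>A\<close>, where \<open>A i j = \<alpha>\<^sub>j(\<alpha>\<^sub>i\<^sup>\<or>)\<close>; the second one gives the relations of the Chevalley generators;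
  the third one says that \<open>G\<close> is the quotient of the Lie algebra with these generators and
  relations by its largest ideal that meets the Cartan subalgebra trivially.
\<close>

definition kac_moody_algebra ::
    "nat \<Rightarrow> (nat \<Rightarrow> nat \<Rightarrow> int) \<Rightarrow> ('g::ab_group_add, 'm) kac_moody_scheme \<Rightarrow> bool" where
  "kac_moody_algebra N A G \<longleftrightarrow>
     lie_algebra G \<and>
     (module.subspace (smul G) (cartan G) \<and>
      vector_space.dim (smul G) (cartan G) + matrix_rank N A = 2 * N \<and>
      (\<forall>i<N. simple_coroot G i \<in> cartan G) \<and>
      (\<forall>i<N. simple_root G i \<in> dual G (cartan G)) \<and>
      (\<forall>c. (\<Sum>i<N. smul G (c i) (simple_coroot G i)) = 0 \<longrightarrow> (\<forall>i<N. c i = 0)) \<and>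
      (\<forall>c. (\<forall>h\<in>cartan G. (\<Sum>i<N. c i * simple_root G i h) = 0) \<longrightarrow> (\<forall>i<N. c i = 0)) \<and>
      (\<forall>i<N. \<forall>j<N. simple_root G j (simple_coroot G i) = of_int (A i j))) \<and>
     ((\<forall>h\<in>cartan G. \<forall>h'\<in>cartan G. bracket G h h' = 0) \<and>
      (\<forall>i<N. \<forall>j<N. bracket G (gen_e G i) (gen_f G j) = (if i = j then simple_coroot G i else 0)) \<and>
      (\<forall>h\<in>cartan G. \<forall>i<N. bracket G h (gen_e G i) = smul G (simple_root G i h) (gen_e G i)) \<and>
      (\<forall>h\<in>cartan G. \<forall>i<N. bracket G h (gen_f G i) = smul G (- simple_root G i h) (gen_f G i))) \<and>
     (lie_generated G (cartan G \<union> gen_e G ` {..<N} \<union> gen_f G ` {..<N}) = UNIV \<and>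
      (\<forall>I. lie_ideal G I \<and> I \<inter> cartan G = {0} \<longrightarrow> I = {0}))"

definition root_space ::
    "('g::ab_group_add, 'm) kac_moody_scheme \<Rightarrow> ('g \<Rightarrow> complex) \<Rightarrow> 'g set" where
  "root_space G \<beta> = {x. \<forall>h\<in>cartan G. bracket G h x = smul G (\<beta> h) x}"

definition roots :: "('g::ab_group_add, 'm) kac_moody_scheme \<Rightarrow> ('g \<Rightarrow> complex) set" where
  "roots G = {\<beta>\<in>dual G (cartan G). \<beta> \<noteq> 0 \<and> (\<exists>x\<in>root_space G \<beta>. x \<noteq> 0)}"

definition root_combination ::
    "('g, 'm) kac_moody_scheme \<Rightarrow> nat set \<Rightarrow> (nat \<Rightarrow> complex) \<Rightarrow> 'g \<Rightarrow> complex" where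
  "root_combination G I c = (\<lambda>h. \<Sum>i\<in>I. c i * simple_root G i h)"

definition sum_of_root_spaces ::
    "('g::ab_group_add, 'm) kac_moody_scheme \<Rightarrow> ('g \<Rightarrow> complex) set \<Rightarrow> 'g set" where
  "sum_of_root_spaces G B = module.span (smul G) (\<Union>\<beta>\<in>B. root_space G \<beta>)"

text \<open>
  The coroot of a real root \<open>\<beta>\<close>: the element of the line \<open>[\<gg>\<^sub>\<beta>, \<gg>\<^sub>-\<^sub>\<beta>]\<close> on which \<open>\<beta>\<close> takes
  the value \<open>2\<close>.
\<close>

definition coroot :: "('g::ab_group_add, 'm) kac_moody_scheme \<Rightarrow> ('g \<Rightarrow> complex) \<Rightarrow> 'g" where
  "coroot G \<beta> = (THE h.
     h \<in> module.span (smul G) {bracket G x y | x y. x \<in> root_space G \<beta> \<and> y \<in> root_space G (- \<beta>)} \<and>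
     \<beta> h = 2)"


section \<open>The affine algebra of type $A_{2n}^{(2)}$\<close>

definition cartan_matrix_A2n2 :: "nat \<Rightarrow> nat \<Rightarrow> nat \<Rightarrow> int" where
  "cartan_matrix_A2n2 n i j =
     (if i = j then 2
      else if n = 1 then (if i = 0 \<and> j = 1 then - 4 else - 1)
      else if (i = 0 \<and> j = 1) \<or> (i = n - 1 \<and> j = n) then - 2
      else if j = i + 1 \<or> i = j + 1 then - 1
      else 0)"

definition affine_A2n2 :: "nat \<Rightarrow> ('g::ab_group_add, 'm) kac_moody_scheme \<Rightarrow> bool" where
  "affine_A2n2 n G \<longleftrightarrow> kac_moody_algebra (n + 1) (cartan_matrix_A2n2 n) G"

definition delta :: "nat \<Rightarrow> ('g, 'm) kac_moody_scheme \<Rightarrow> 'g \<Rightarrow> complex" where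
  "delta n G = root_combination G {..n} (\<lambda>i. if i = n then 1 else 2)"

definition positive_roots ::
    "nat \<Rightarrow> ('g::ab_group_add, 'm) kac_moody_scheme \<Rightarrow> ('g \<Rightarrow> complex) set" where
  "positive_roots n G = {\<beta>\<in>roots G. \<exists>c. \<beta> = root_combination G {..n} (\<lambda>i. of_nat (c i))}"

subsection \<open>The finite part\<close>

text \<open>
  The roots of the simple subalgebra of the nodes \<open>1, \<dots>, n\<close> are taken as functionals on the
  full Cartan subalgebra, so that multiples of \<open>\<delta>\<close> can be added to them.
\<close>

definition fin_algebra :: "nat \<Rightarrow> ('g::ab_group_add, 'm) kac_moody_scheme \<Rightarrow> 'g set" where
  "fin_algebra n G = lie_generated G (gen_e G ` {1..n} \<union> gen_f G ` {1..n})"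

definition fin_cartan :: "nat \<Rightarrow> ('g::ab_group_add, 'm) kac_moody_scheme \<Rightarrow> 'g set" where
  "fin_cartan n G = module.span (smul G) (simple_coroot G ` {1..n})"

definition fin_roots ::
    "nat \<Rightarrow> ('g::ab_group_add, 'm) kac_moody_scheme \<Rightarrow> ('g \<Rightarrow> complex) set" where
  "fin_roots n G = {\<beta>\<in>roots G. \<exists>x\<in>fin_algebra n G. x \<noteq> 0 \<and> x \<in> root_space G \<beta>}"

definition fin_pos_roots ::
    "nat \<Rightarrow> ('g::ab_group_add, 'm) kac_moody_scheme \<Rightarrow> ('g \<Rightarrow> complex) set" where
  "fin_pos_roots n G =
     {\<beta>\<in>fin_roots n G. \<exists>c. \<beta> = root_combination G {1..n} (\<lambda>i. of_nat (c i))}"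

definition fin_neg_roots ::
    "nat \<Rightarrow> ('g::ab_group_add, 'm) kac_moody_scheme \<Rightarrow> ('g \<Rightarrow> complex) set" where
  "fin_neg_roots n G =
     {\<beta>\<in>fin_roots n G. \<exists>c. \<beta> = root_combination G {1..n} (\<lambda>i. - of_nat (c i))}"

text \<open>
  The squared length \<open>(\<beta>|\<beta>)\<close> for the Weyl group invariant form given by the symmetrization
  \<open>(\<alpha>\<^sub>i|\<alpha>\<^sub>j) = D\<^sub>i \<alpha>\<^sub>j(\<alpha>\<^sub>i\<^sup>\<or>)\<close> of the Cartan matrix of the nodes \<open>1, \<dots>, n\<close>, with
  \<open>D\<^sub>n = 2\<close> and \<open>D\<^sub>i = 1\<close> for \<open>i < n\<close>.
\<close>

definition root_norm ::
    "nat \<Rightarrow> ('g::ab_group_add, 'm) kac_moody_scheme \<Rightarrow> ('g \<Rightarrow> complex) \<Rightarrow> int" where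
  "root_norm n G \<beta> = (THE q. \<exists>c. \<beta> = root_combination G {1..n} (\<lambda>i. of_int (c i)) \<and>
     q = (\<Sum>i\<in>{1..n}. \<Sum>j\<in>{1..n}.
            c i * c j * (if i = n then 2 else 1) * cartan_matrix_A2n2 n i j))"

definition long_roots ::
    "nat \<Rightarrow> ('g::ab_group_add, 'm) kac_moody_scheme \<Rightarrow> ('g \<Rightarrow> complex) set" where
  "long_roots n G = {\<beta>\<in>fin_roots n G. \<forall>\<gamma>\<in>fin_roots n G. root_norm n G \<gamma> \<le> root_norm n G \<beta>}"

definition short_roots ::
    "nat \<Rightarrow> ('g::ab_group_add, 'm) kac_moody_scheme \<Rightarrow> ('g \<Rightarrow> complex) set" where
  "short_roots n G = fin_roots n G - long_roots n G"

definition dominant_weights ::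
    "nat \<Rightarrow> ('g::ab_group_add, 'm) kac_moody_scheme \<Rightarrow> ('g \<Rightarrow> complex) set" where
  "dominant_weights n G =
     {\<Lambda>\<in>dual G (fin_cartan n G). \<forall>i\<in>{1..n}. \<Lambda> (simple_coroot G i) \<in> \<nat>}"

definition nat_pairing :: "('g \<Rightarrow> complex) \<Rightarrow> 'g \<Rightarrow> nat" where
  "nat_pairing \<Lambda> h = (THE m. \<Lambda> h = of_nat m)"

subsection \<open>The hyperspecial current algebra\<close>

definition current_algebra :: "nat \<Rightarrow> ('g::ab_group_add, 'm) kac_moody_scheme \<Rightarrow> 'g set" where
  "current_algebra n G =
     module.span (smul G) (fin_cartan n G \<union> sum_of_root_spaces G (positive_roots n G)
                             \<union> sum_of_root_spaces G (fin_neg_roots n G))"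

text \<open>
  The scaling element is determined up to the centre; the values of roots on it do not depend
  on the choice.
\<close>

definition scaling_element :: "nat \<Rightarrow> ('g::ab_group_add, 'm) kac_moody_scheme \<Rightarrow> 'g" where
  "scaling_element n G =
     (SOME d. d \<in> cartan G \<and> simple_root G 0 d = 1 \<and> (\<forall>i\<in>{1..n}. simple_root G i d = 0))"

definition current_component ::
    "nat \<Rightarrow> ('g::ab_group_add, 'm) kac_moody_scheme \<Rightarrow> nat \<Rightarrow> 'g set" where
  "current_component n G k =
     module.span (smul G)
       ((if k = 0 then fin_cartan n G else {0}) \<union>
        sum_of_root_spaces G
          {\<beta>\<in>positive_roots n G \<union> fin_neg_roots n G. \<beta> (scaling_element n G) = of_nat k})"

definition real_roots_pos ::
    "nat \<Rightarrow> ('g::ab_group_add, 'm) kac_moody_scheme \<Rightarrow> ('g \<Rightarrow> complex) set" where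
  "real_roots_pos n G =
     fin_pos_roots n G \<union>
     {\<lambda>h. \<alpha> h + of_nat k * delta n G h | \<alpha> k.
        \<alpha> \<in> short_roots n G \<inter> fin_pos_roots n G \<and> k \<ge> 1} \<union>
     {\<lambda>h. \<alpha> h + 2 * of_nat k * delta n G h | \<alpha> k.
        \<alpha> \<in> long_roots n G \<inter> fin_pos_roots n G \<and> k \<ge> 1} \<union>
     {\<lambda>h. (\<alpha> h + (2 * of_nat k + 1) * delta n G h) / 2 | \<alpha> k.
        \<alpha> \<in> long_roots n G \<inter> fin_pos_roots n G}"

definition current_n_plus :: "nat \<Rightarrow> ('g::ab_group_add, 'm) kac_moody_scheme \<Rightarrow> 'g set" where
  "current_n_plus n G = sum_of_root_spaces G (real_roots_pos n G)"

definition current_h_plus :: "nat \<Rightarrow> ('g::ab_group_add, 'm) kac_moody_scheme \<Rightarrow> 'g set" where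
  "current_h_plus n G =
     sum_of_root_spaces G {\<lambda>h. of_nat k * delta n G h | k. k \<ge> (1::nat)}"


section \<open>Graded algebras\<close>

text \<open>
  A unital graded complex algebra: a ring with the structure map of the scalars and the
  homogeneous components.
\<close>

record 'a graded_algebra = "'a ring" +
  scalar :: "complex \<Rightarrow> 'a"
  component :: "nat \<Rightarrow> 'a set"

definition graded_algebra_iso ::
    "('a, 'm) graded_algebra_scheme \<Rightarrow> ('b, 'k) graded_algebra_scheme \<Rightarrow> ('a \<Rightarrow> 'b) set" where
  "graded_algebra_iso A B =
     {\<phi>\<in>ring_iso A B. (\<forall>c. \<phi> (scalar A c) = scalar B c) \<and>
                      (\<forall>k. \<phi> ` component A k = component B k)}"

text \<open>
  The polynomial algebra in the variables \<open>T\<^sub>v\<close>, \<open>v \<in> V\<close>, with \<open>T\<^sub>v\<close> of grade \<open>w v\<close>. A monomial is a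
  finitely supported exponent vector.
\<close>

definition poly_algebra ::
    "'v set \<Rightarrow> ('v \<Rightarrow> nat) \<Rightarrow> (('v \<Rightarrow>\<^sub>0 nat) \<Rightarrow>\<^sub>0 complex) graded_algebra" where
  "poly_algebra V w =
     \<lparr>carrier = {p. \<forall>m\<in>Poly_Mapping.keys p. Poly_Mapping.keys m \<subseteq> V},
      mult = (*), one = 1, zero = 0, add = (+),
      scalar = Poly_Mapping.single 0,
      component = (\<lambda>k. {p. \<forall>m\<in>Poly_Mapping.keys p. Poly_Mapping.keys m \<subseteq> V \<and>
         (\<Sum>v\<in>Poly_Mapping.keys m. Poly_Mapping.lookup m v * w v) = k})\<rparr>"

definition is_graded_polynomial_algebra ::
    "('a, 'm) graded_algebra_scheme \<Rightarrow> 'v set \<Rightarrow> ('v \<Rightarrow> nat) \<Rightarrow> bool" where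
  "is_graded_polynomial_algebra A V w \<longleftrightarrow> graded_algebra_iso (poly_algebra V w) A \<noteq> {}"


section \<open>Universal enveloping algebras\<close>

text \<open>
  Words form the free monoid, so \<open>'a word \<Rightarrow>\<^sub>0 complex\<close> with the convolution product is the free
  associative algebra on \<open>'a\<close>.
\<close>

datatype 'a word = Word (letters: "'a list")

instantiation word :: (type) monoid_add
begin

definition zero_word :: "'a word" where "zero_word = Word []"

definition plus_word :: "'a word \<Rightarrow> 'a word \<Rightarrow> 'a word" where
  "plus_word u v = Word (letters u @ letters v)"

instance
  by standard (simp_all add: zero_word_def plus_word_def)

end

definition letter :: "'g \<Rightarrow> 'g word \<Rightarrow>\<^sub>0 complex" where
  "letter x = Poly_Mapping.single (Word [x]) 1"

definition free_ring :: "'g set \<Rightarrow> ('g word \<Rightarrow>\<^sub>0 complex) ring" where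
  "free_ring S =
     \<lparr>carrier = {p. \<forall>w\<in>Poly_Mapping.keys p. set (letters w) \<subseteq> S},
      mult = (*), one = 1, zero = 0, add = (+)\<rparr>"

lemma ring_free_ring: "ring (free_ring S)"
proof -
  have A: "abelian_group (free_ring S)"
  proof (rule abelian_groupI)
    fix x assume "x \<in> carrier (free_ring S)"
    thus "\<exists>y\<in>carrier (free_ring S). y \<oplus>\<^bsub>free_ring S\<^esub> x = \<zero>\<^bsub>free_ring S\<^esub>"
      by (intro bexI[of _ "-x"]) (auto simp: free_ring_def)
  qed (use Poly_Mapping.keys_add in \<open>fastforce simp: free_ring_def algebra_simps\<close>)+
  have M: "Group.monoid (free_ring S)"
    by standard (use keys_mult in \<open>fastforce simp: free_ring_def algebra_simps plus_word_def zero_word_def\<close>)+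
  show ?thesis
    by (rule ringI[OF A M]) (auto simp: free_ring_def algebra_simps)
qed

text \<open>
  The enveloping algebra of a subalgebra \<open>S\<close> is the quotient of the free associative algebra on the
  set \<open>S\<close> by the two-sided ideal that makes the map \<open>letter\<close> linear and turns the bracket
  into the commutator. This is the usual quotient of the tensor algebra, since the linearity
  relations alone give the tensor algebra of \<open>S\<close>.
\<close>

definition uea_relations ::
    "('g::ab_group_add, 'm) lie_algebra_scheme \<Rightarrow> 'g set \<Rightarrow> ('g word \<Rightarrow>\<^sub>0 complex) set" where
  "uea_relations G S =
     {letter (x + y) - (letter x + letter y) | x y. x \<in> S \<and> y \<in> S} \<union>
     {letter (smul G c x) - Poly_Mapping.single 0 c * letter x | c x. x \<in> S} \<union>
     {letter x * letter y - letter y * letter x - letter (bracket G x y) | x y. x \<in> S \<and> y \<in> S}"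

definition uea_ideal ::
    "('g::ab_group_add, 'm) lie_algebra_scheme \<Rightarrow> 'g set \<Rightarrow> ('g word \<Rightarrow>\<^sub>0 complex) set" where
  "uea_ideal G S = Idl\<^bsub>free_ring S\<^esub> (uea_relations G S)"

text \<open>The grading is the one induced by a family \<open>gr\<close> of homogeneous subspaces of \<open>S\<close>.\<close>

definition uea ::
    "('g::ab_group_add, 'm) lie_algebra_scheme \<Rightarrow> 'g set \<Rightarrow> (nat \<Rightarrow> 'g set)
      \<Rightarrow> ('g word \<Rightarrow>\<^sub>0 complex) set graded_algebra" where
  "uea G S gr =
     ring.extend (free_ring S Quot uea_ideal G S)
       (graded_algebra.fields
          (\<lambda>c. uea_ideal G S +>\<^bsub>free_ring S\<^esub> Poly_Mapping.single 0 c)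
          (\<lambda>k. {uea_ideal G S +>\<^bsub>free_ring S\<^esub> p | p.
                 \<forall>w\<in>Poly_Mapping.keys p. \<exists>ks. list_all2 (\<lambda>x l. x \<in> S \<inter> gr l) (letters w) ks
                                                \<and> sum_list ks = k}))"

definition uea_embed ::
    "('g::ab_group_add, 'm) lie_algebra_scheme \<Rightarrow> 'g set \<Rightarrow> 'g \<Rightarrow> ('g word \<Rightarrow>\<^sub>0 complex) set" where
  "uea_embed G S x = uea_ideal G S +>\<^bsub>free_ring S\<^esub> letter x"

text \<open>
  The homomorphism of enveloping algebras induced by an inclusion of subalgebras into \<open>T\<close>: it
  enlarges a coset of the smaller ideal to the coset of the ideal for \<open>T\<close> that contains it.
\<close>

definition uea_map ::
    "('g::ab_group_add, 'm) lie_algebra_scheme \<Rightarrow> 'g set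
      \<Rightarrow> ('g word \<Rightarrow>\<^sub>0 complex) set \<Rightarrow> ('g word \<Rightarrow>\<^sub>0 complex) set" where
  "uea_map G T X = uea_ideal G T <+>\<^bsub>free_ring T\<^esub> X"


section \<open>Global Weyl modules\<close>

definition left_ideal_generated :: "('a, 'm) ring_scheme \<Rightarrow> 'a set \<Rightarrow> 'a set" where
  "left_ideal_generated R X =
     \<Inter>{J. additive_subgroup J R \<and> (\<forall>a\<in>carrier R. \<forall>x\<in>J. a \<otimes>\<^bsub>R\<^esub> x \<in> J) \<and> X \<subseteq> J}"

record ('a, 'w) left_module =
  mod_carrier :: "'w set"
  mod_zero :: "'w"
  mod_add :: "'w \<Rightarrow> 'w \<Rightarrow> 'w"
  mod_act :: "'a \<Rightarrow> 'w \<Rightarrow> 'w"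

text \<open>The left module \<open>R / J\<close> for a left ideal \<open>J\<close>, with \<open>a (J + x) = J + a x\<close>.\<close>

definition cyclic_module :: "('a, 'm) ring_scheme \<Rightarrow> 'a set \<Rightarrow> ('a, 'a set) left_module" where
  "cyclic_module R J =
     \<lparr>mod_carrier = a_rcosets\<^bsub>R\<^esub> J, mod_zero = J, mod_add = set_add R,
      mod_act = (\<lambda>a X. J <+>\<^bsub>R\<^esub> (a <#\<^bsub>R\<^esub> X))\<rparr>"

definition current_uea ::
    "nat \<Rightarrow> ('g::ab_group_add, 'm) kac_moody_scheme
      \<Rightarrow> ('g word \<Rightarrow>\<^sub>0 complex) set graded_algebra" where
  "current_uea n G = uea G (current_algebra n G) (current_component n G)"

definition current_h_uea ::
    "nat \<Rightarrow> ('g::ab_group_add, 'm) kac_moody_scheme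
      \<Rightarrow> ('g word \<Rightarrow>\<^sub>0 complex) set graded_algebra" where
  "current_h_uea n G = uea G (current_h_plus n G) (current_component n G)"

definition weyl_relations ::
    "nat \<Rightarrow> ('g::ab_group_add, 'm) kac_moody_scheme \<Rightarrow> ('g \<Rightarrow> complex)
      \<Rightarrow> ('g word \<Rightarrow>\<^sub>0 complex) set set" where
  "weyl_relations n G \<Lambda> =
     (let U = current_uea n G; \<iota> = uea_embed G (current_algebra n G) in
      {\<iota> x | x. x \<in> current_n_plus n G} \<union>
      {\<iota> h \<ominus>\<^bsub>U\<^esub> scalar U (\<Lambda> h) | h. h \<in> fin_cartan n G} \<union>
      {\<iota> x [^]\<^bsub>U\<^esub> (nat_pairing \<Lambda> (coroot G \<alpha>) + 1) | x \<alpha>.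
         \<alpha> \<in> fin_pos_roots n G \<and> x \<in> root_space G (- \<alpha>) \<and> x \<noteq> 0})"

definition global_weyl_module ::
    "nat \<Rightarrow> ('g::ab_group_add, 'm) kac_moody_scheme \<Rightarrow> ('g \<Rightarrow> complex)
      \<Rightarrow> (('g word \<Rightarrow>\<^sub>0 complex) set, ('g word \<Rightarrow>\<^sub>0 complex) set set) left_module" where
  "global_weyl_module n G \<Lambda> =
     cyclic_module (current_uea n G) (left_ideal_generated (current_uea n G) (weyl_relations n G \<Lambda>))"

definition weyl_generator ::
    "nat \<Rightarrow> ('g::ab_group_add, 'm) kac_moody_scheme \<Rightarrow> ('g \<Rightarrow> complex)
      \<Rightarrow> ('g word \<Rightarrow>\<^sub>0 complex) set set" where
  "weyl_generator n G \<Lambda> =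
     left_ideal_generated (current_uea n G) (weyl_relations n G \<Lambda>)
       +>\<^bsub>current_uea n G\<^esub> \<one>\<^bsub>current_uea n G\<^esub>"

definition weyl_annihilator ::
    "nat \<Rightarrow> ('g::ab_group_add, 'm) kac_moody_scheme \<Rightarrow> ('g \<Rightarrow> complex)
      \<Rightarrow> ('g word \<Rightarrow>\<^sub>0 complex) set set" where
  "weyl_annihilator n G \<Lambda> =
     {u\<in>carrier (current_h_uea n G).
        mod_act (global_weyl_module n G \<Lambda>) (uea_map G (current_algebra n G) u) (weyl_generator n G \<Lambda>)
          = mod_zero (global_weyl_module n G \<Lambda>)}"

definition weyl_algebra ::
    "nat \<Rightarrow> ('g::ab_group_add, 'm) kac_moody_scheme \<Rightarrow> ('g \<Rightarrow> complex)
      \<Rightarrow> ('g word \<Rightarrow>\<^sub>0 complex) set set graded_algebra" where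
  "weyl_algebra n G \<Lambda> =
     (let U = current_h_uea n G; I = weyl_annihilator n G \<Lambda> in
      ring.extend (U Quot I)
        (graded_algebra.fields
           (\<lambda>c. I +>\<^bsub>U\<^esub> scalar U c)
           (\<lambda>k. (\<lambda>u. I +>\<^bsub>U\<^esub> u) ` component U k)))"

end

theory Submission
 imports Defs "HOL-Library.Product_Lexorder" "HOL-Library.Nat_Bijection" "HOL-Computational_Algebra.Computational_Algebra"
begin

text \<open>
 The affine algebra acts on quasi-periodic sequences of period \<open>N = 2n + 1\<close>: a root vector becomes a
 band matrix, determined by a shift \<open>k\<close> and a coefficient function, so that every element is
 controlled by its matrix \<open>Phi\<close>. Evaluating the period at nonzero parameters and passing to the
 fermionic Fock space of finitely many such evaluations (``sites'') gives modules with a vacuum that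
 satisfies the defining relations of the global Weyl module; a site of type \<open>j\<close> contributes the
 \<open>j\<close>-th fundamental weight. The imaginary root vectors act on the vacuum by power sums of
 the parameters, hence the elements \<open>Ehat (j, r)\<close>, obtained from them by Newton's recursion, act by the
 elementary symmetric functions of the parameters of the sites of type \<open>j\<close>. With \<open>\<Lambda>(\<alpha>\<^sub>j\<^sup>\<or>)\<close> sites of each
 type \<open>j\<close> this shows that the \<open>Ehat (j, r)\<close> with \<open>r \<le> \<Lambda>(\<alpha>\<^sub>j\<^sup>\<or>)\<close> are algebraically independent modulo the annihilator.

 Conversely, in rank one \<open>Y^(dr) f_j^r\<close> is congruent to a polynomial in the imaginary root vectors modulo
 the left ideal of \<open>\<CC>n\<^sup>+\<close>. Evaluating it on all Fock spaces identifies this polynomial as a nonzero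
 multiple of \<open>Ehat (j, r)\<close>, which therefore annihilates the generator for \<open>r > \<Lambda>(\<alpha>\<^sub>j\<^sup>\<or>)\<close>.
\<close>

text \<open>The algebra is a quotient by a maximal ideal, so a map into matrices cannot be declared
  on generators by checking Serre relations. Pairs of an element and a matrix are generated in
  parallel instead, and the resulting relation is shown to be the graph of a function. The element 0
  has matrix 0, since a traceless periodic band matrix commuting with all opposite generators
  vanishes. Conversely an element of nonzero height with matrix 0 is 0, since otherwise it would
  lead to an ideal that misses the Cartan subalgebra.

  The exponent d is 1 for j < n, where Y has the root \<open>\<alpha>\<^sub>j + \<delta>\<close>.
  For j = n this root does not occur in Cn+, but \<open>(\<alpha>\<^sub>n + \<delta>) / 2\<close>
  does, so d = 2. In both cases the product has weight \<open>r \<delta>\<close> and grade 2r, the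
  grade of \<open>Ehat (j, r)\<close>.

  Moving Y to the right also produces elements of the finite Cartan subalgebra. They are kept as
  variables (j, 0), which a Fock space evaluates to the number of sites of type j. Hence this number
  has to vary when the polynomial in the imaginary root vectors is identified; it is fixed by
  \<Lambda> only in the study of the annihilator.\<close>

lemma (in vector_space) eigenvectors_independent:
 assumes "finite K" "inj_on e K"
  and add: "\<And>x y. T (x + y) = T x + T y" and sc: "\<And>c x. T (scale c x) = scale c (T x)"
  and ev: "\<And>k. k \<in> K \<Longrightarrow> T (x k) = scale (e k) (x k)"
  and "sum x K = 0" "k \<in> K"
 shows "x k = 0"
 using assms(1,2) ev assms(6,7)
proof (induction K arbitrary: x k rule: finite_induct)
 case (insert a K)
 have T0: "T 0 = 0" using sc[of 0 0] by simp
 have Tsum: "T (sum y L) = (\<Sum>k\<in>L. T (y k))" for y :: "'c \<Rightarrow> 'b" and L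
  by (induction L rule: infinite_finite_induct) (auto simp: T0 add)
 have "0 = T (sum x (insert a K)) - scale (e a) (sum x (insert a K))"
  unfolding insert.prems(3) using T0 by simp
 also have "\<dots> = (\<Sum>k\<in>K. scale (e k - e a) (x k))"
  using insert.hyps insert.prems(2) by (simp add: Tsum scale_sum_right scale_right_distrib scale_left_diff_distrib
   sum_subtractf add)
 finally have s: "(\<Sum>k\<in>K. scale (e k - e a) (x k)) = 0" by simp
 have z: "scale (e k - e a) (x k) = 0" if "k \<in> K" for k
  by (rule insert.IH[OF _ _ s that]) (use insert.prems in \<open>auto simp: sc ac_simps\<close>)
 have z': "x k = 0" if "k \<in> K" for k
  using z[OF that] insert.prems(1) insert.hyps that by (auto simp: inj_on_def)
 moreover have "x a = 0" using insert.prems(3) insert.hyps z' by simp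
 ultimately show ?case using insert.prems by auto
qed simp

section \<open>The Lie algebra axioms and a dual basis of the simple roots\<close>

locale A2n2 =
 fixes G :: "('g::ab_group_add) kac_moody" and n :: nat
 assumes n1: "n \<ge> 1" and affine: "affine_A2n2 n G"
begin

abbreviation sm where "sm \<equiv> smul G"
abbreviation br where "br \<equiv> bracket G"
abbreviation H where "H \<equiv> cartan G"
abbreviation al where "al \<equiv> simple_root G"
abbreviation cv where "cv \<equiv> simple_coroot G"
abbreviation A where "A \<equiv> cartan_matrix_A2n2 n"

lemma km: "kac_moody_algebra (n + 1) A G"
 using affine by (simp add: affine_A2n2_def)

lemma lie: "lie_algebra G" using km by (simp add: kac_moody_algebra_def)

sublocale V: vector_space "smul G" using lie by (simp add: lie_algebra_def)

lemma br_add_r: "br x (y + z) = br x y + br x z"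
 and br_sm_r: "br x (sm c y) = sm c (br x y)"
 using lie by (auto simp: lie_algebra_def Vector_Spaces.linear_iff)

lemma br_add_l: "br (x + y) z = br x z + br y z"
 and br_sm_l: "br (sm c x) y = sm c (br x y)"
 using lie by (auto simp: lie_algebra_def Vector_Spaces.linear_iff)

lemma br_self [simp]: "br x x = 0" using lie by (auto simp: lie_algebra_def)

lemma br_anti: "br y x = - br x y"
proof -
 have "br (x + y) (x + y) = br x x + br x y + (br y x + br y y)"
  by (simp only: br_add_l br_add_r) (simp add: algebra_simps)
 hence "br x y + br y x = 0" by simp
 thus ?thesis by (metis add_eq_0_iff)
qed

lemma br_0 [simp]: "br x 0 = 0" "br 0 x = 0"
 using br_add_r[of x 0 0] br_add_l[of 0 0 x] by auto

lemma br_minus_r: "br x (- y) = - br x y"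
 using br_add_r[of x y "- y"] by (simp add: eq_neg_iff_add_eq_0 add.commute)

lemma br_diff_r: "br x (y - z) = br x y - br x z"
 by (metis br_add_r br_minus_r diff_conv_add_uminus)

lemma br_sum_r: "br x (sum y K) = (\<Sum>k\<in>K. br x (y k))"
 by (induction K rule: infinite_finite_induct) (auto simp: br_add_r)

lemma br_sum_l: "br (sum y K) x = (\<Sum>k\<in>K. br (y k) x)"
 by (induction K rule: infinite_finite_induct) (auto simp: br_add_l)

lemma jac: "br x (br y z) = br (br x y) z + br y (br x z)"
proof -
 have "br x (br y z) + br y (br z x) + br z (br x y) = 0" using lie by (auto simp: lie_algebra_def)
 moreover have "br y (br z x) = - br y (br x z)" by (metis br_anti br_minus_r)
 moreover have "br z (br x y) = - br (br x y) z" by (rule br_anti)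
 ultimately show ?thesis by (simp add: algebra_simps eq_neg_iff_add_eq_0)
qed

lemma H_subspace: "V.subspace H" using km by (simp add: kac_moody_algebra_def)

lemma H0: "0 \<in> H" and H_add: "x \<in> H \<Longrightarrow> y \<in> H \<Longrightarrow> x + y \<in> H"
 and H_sm: "x \<in> H \<Longrightarrow> sm c x \<in> H"
 using H_subspace by (auto simp: V.subspace_def)

lemma H_diff: "x \<in> H \<Longrightarrow> y \<in> H \<Longrightarrow> x - y \<in> H"
 using H_subspace by (rule V.subspace_diff)

lemma H_sum: "(\<And>k. k \<in> K \<Longrightarrow> x k \<in> H) \<Longrightarrow> sum x K \<in> H"
 using H_subspace by (rule V.subspace_sum)

lemma cv_H: "i \<le> n \<Longrightarrow> cv i \<in> H" using km by (simp add: kac_moody_algebra_def)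

lemma al_dual: "i \<le> n \<Longrightarrow> al i \<in> dual G H" using km by (simp add: kac_moody_algebra_def)

lemma al_add: "i \<le> n \<Longrightarrow> x \<in> H \<Longrightarrow> y \<in> H \<Longrightarrow> al i (x + y) = al i x + al i y"
 and al_sm: "i \<le> n \<Longrightarrow> x \<in> H \<Longrightarrow> al i (sm c x) = c * al i x"
 and al_out: "i \<le> n \<Longrightarrow> x \<notin> H \<Longrightarrow> al i x = 0"
 using al_dual[of i] by (auto simp: dual_def)

lemma al_cv: "i \<le> n \<Longrightarrow> j \<le> n \<Longrightarrow> al j (cv i) = of_int (A i j)"
 using km by (simp add: kac_moody_algebra_def)

lemma al_indep:
 assumes "\<And>h. h \<in> H \<Longrightarrow> (\<Sum>i\<le>n. c i * al i h) = 0" "i \<le> n"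
 shows "c i = 0"
 using km assms by (auto simp: kac_moody_algebra_def lessThan_Suc_atMost)

lemma HH0: "h \<in> H \<Longrightarrow> h' \<in> H \<Longrightarrow> br h h' = 0"
 using km by (simp add: kac_moody_algebra_def)

lemma br_ef: "i \<le> n \<Longrightarrow> j \<le> n \<Longrightarrow> br (gen_e G i) (gen_f G j) = (if i = j then cv i else 0)"
 using km by (simp add: kac_moody_algebra_def)

lemma br_he: "h \<in> H \<Longrightarrow> i \<le> n \<Longrightarrow> br h (gen_e G i) = sm (al i h) (gen_e G i)"
 using km by (simp add: kac_moody_algebra_def)

lemma br_hf: "h \<in> H \<Longrightarrow> i \<le> n \<Longrightarrow> br h (gen_f G i) = sm (- al i h) (gen_f G i)"
 using km by (simp add: kac_moody_algebra_def)

lemma generated: "lie_generated G (H \<union> gen_e G ` {..n} \<union> gen_f G ` {..n}) = UNIV"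
 using km by (simp add: kac_moody_algebra_def lessThan_Suc_atMost)

lemma no_ideal: "lie_ideal G I \<Longrightarrow> I \<inter> H = {0} \<Longrightarrow> I = {0}"
 using km by (simp add: kac_moody_algebra_def)

lemma gen_closure:
 assumes "\<And>h. h \<in> H \<Longrightarrow> h \<in> S" "\<And>i. i \<le> n \<Longrightarrow> gen_e G i \<in> S" "\<And>i. i \<le> n \<Longrightarrow> gen_f G i \<in> S"
  and "V.subspace S" "\<And>x y. x \<in> S \<Longrightarrow> y \<in> S \<Longrightarrow> br x y \<in> S"
 shows "x \<in> S"
proof -
 have "lie_subalgebra G S" using assms by (auto simp: lie_subalgebra_def)
 hence "lie_generated G (H \<union> gen_e G ` {..n} \<union> gen_f G ` {..n}) \<subseteq> S"
  using assms by (auto simp: lie_generated_def)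
 thus ?thesis using generated by auto
qed

text \<open>By the Jacobi identity the elements y with [y, I] inside I form a subalgebra, so they
  are everything once they include the generators.\<close>

lemma ideal_criterion:
 assumes "V.subspace I" "\<And>h x. h \<in> H \<Longrightarrow> x \<in> I \<Longrightarrow> br h x \<in> I"
  and "\<And>i x. i \<le> n \<Longrightarrow> x \<in> I \<Longrightarrow> br (gen_e G i) x \<in> I"
  and "\<And>i x. i \<le> n \<Longrightarrow> x \<in> I \<Longrightarrow> br (gen_f G i) x \<in> I"
 shows "lie_ideal G I"
proof -
 have "y \<in> {y. \<forall>x\<in>I. br y x \<in> I}" for y
 proof (rule gen_closure)
  show "V.subspace {y. \<forall>x\<in>I. br y x \<in> I}"
   using assms(1) by (auto simp: V.subspace_def br_add_l br_sm_l)
  fix a b assume ab: "a \<in> {y. \<forall>x\<in>I. br y x \<in> I}" "b \<in> {y. \<forall>x\<in>I. br y x \<in> I}"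
  have "br (br a b) x = br a (br b x) - br b (br a x)" for x by (simp add: jac[of a])
  thus "br a b \<in> {y. \<forall>x\<in>I. br y x \<in> I}" using ab assms(1) by (auto intro: V.subspace_diff)
 qed (use assms in auto)
 thus ?thesis using assms(1) by (auto simp: lie_ideal_def)
qed

lemma al_0 [simp]: "i \<le> n \<Longrightarrow> al i 0 = 0" using al_sm[of i 0 0] H0 by simp

lemma al_diff: "i \<le> n \<Longrightarrow> x \<in> H \<Longrightarrow> y \<in> H \<Longrightarrow> al i (x - y) = al i x - al i y"
 using al_add[of i "x - y" y] H_diff[of x y] by simp

lemma al_sum: "i \<le> n \<Longrightarrow> (\<And>k. k \<in> K \<Longrightarrow> x k \<in> H) \<Longrightarrow> al i (sum x K) = (\<Sum>k\<in>K. al i (x k))"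
 by (induction K rule: infinite_finite_induct) (auto simp: al_add H_sum)

text \<open>A dual basis built one root at a time in the manner of Gram-Schmidt, from the linear
  independence of the simple roots alone. The projection \<open>pr\<close> removes the components
  along the dual vectors found so far.\<close>

lemma ex_al_aux:
 assumes "finite J" "J \<subseteq> {..n}"
 shows "\<exists>b. \<forall>i\<in>J. b i \<in> H \<and> (\<forall>j\<in>J. al j (b i) = (if i = j then 1 else 0))"
 using assms
proof (induction J rule: finite_induct)
 case (insert m J)
 then obtain b where b: "\<And>i. i \<in> J \<Longrightarrow> b i \<in> H"
  "\<And>i j. i \<in> J \<Longrightarrow> j \<in> J \<Longrightarrow> al j (b i) = (if i = j then 1 else 0)" by auto
 define pr where "pr h = h - (\<Sum>i\<in>J. sm (al i h) (b i))" for h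
 have m: "m \<le> n" and J: "\<And>i. i \<in> J \<Longrightarrow> i \<le> n" using insert.prems by auto
 have sH: "(\<Sum>i\<in>J. sm (al i h) (b i)) \<in> H" for h by (intro H_sum H_sm b)
 have prH: "h \<in> H \<Longrightarrow> pr h \<in> H" for h
  unfolding pr_def by (intro H_diff sH)
 have als: "k \<le> n \<Longrightarrow> al k (\<Sum>i\<in>J. sm (al i h) (b i)) = (\<Sum>i\<in>J. al i h * al k (b i))" for k h
  by (subst al_sum) (auto simp: al_sm b H_sm)
 have pr0: "al j (pr h) = 0" if "h \<in> H" "j \<in> J" for h j
 proof -
  have "(\<Sum>i\<in>J. al i h * al j (b i)) = (\<Sum>i\<in>J. if i = j then al i h else 0)"
   using that b by (intro sum.cong) auto
  also have "\<dots> = al j h" using that insert.hyps by simp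
  finally show ?thesis using that sH J by (simp add: pr_def al_diff als)
 qed
 have "\<exists>h\<in>H. al m (pr h) \<noteq> 0"
 proof (rule ccontr)
  assume neg: "\<not> ?thesis"
  \<comment> \<open>If \<open>al m\<close> vanished on all projections, these would be the
    coefficients of a nontrivial relation between the simple roots.\<close>
  define c where "c i = (if i = m then 1 else if i \<in> J then - al m (b i) else 0)" for i
  have "(\<Sum>i\<le>n. c i * al i h) = 0" if h: "h \<in> H" for h
  proof -
   have "(\<Sum>i\<le>n. c i * al i h) = (\<Sum>i\<in>insert m J. c i * al i h)"
    by (rule sum.mono_neutral_right) (use insert.prems in \<open>auto simp: c_def\<close>)
   also have "\<dots> = al m h + (\<Sum>i\<in>J. - al m (b i) * al i h)"
    using insert.hyps by (auto simp: c_def intro!: sum.cong)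
   also have "\<dots> = al m (pr h)"
    using h m sH by (simp add: pr_def al_diff als sum_negf mult.commute)
   finally show ?thesis using neg h by simp
  qed
  from al_indep[OF this m] show False by (simp add: c_def)
 qed
 then obtain h where h: "h \<in> H" "al m (pr h) \<noteq> 0" by auto
 define u where "u = sm (1 / al m (pr h)) (pr h)"
 have u: "u \<in> H" "al m u = 1" "\<And>j. j \<in> J \<Longrightarrow> al j u = 0"
  using h prH m J pr0 by (auto simp: u_def H_sm al_sm)
 define b' where "b' i = (if i = m then u else b i - sm (al m (b i)) u)" for i
 show ?case
 proof (intro exI[of _ b'] ballI conjI)
  fix i assume i: "i \<in> insert m J"
  show "b' i \<in> H" using i u b by (auto simp: b'_def intro!: H_diff H_sm)
  fix j assume j: "j \<in> insert m J"
  show "al j (b' i) = (if i = j then 1 else 0)"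
   using i j u b J m insert.hyps by (auto simp: b'_def al_diff al_sm H_sm)
 qed
qed auto

lemma ex_al: "\<exists>h\<in>H. \<forall>i\<le>n. al i h = v i"
proof -
 obtain b where b: "\<And>i. i \<le> n \<Longrightarrow> b i \<in> H"
  "\<And>i j. i \<le> n \<Longrightarrow> j \<le> n \<Longrightarrow> al j (b i) = (if i = j then 1 else 0)"
  using ex_al_aux[of "{..n}"] by auto
 have "al j (\<Sum>i\<le>n. sm (v i) (b i)) = v j" if "j \<le> n" for j
 proof -
  have "al j (\<Sum>i\<le>n. sm (v i) (b i)) = (\<Sum>i\<le>n. if i = j then v i else 0)"
   using that b by (subst al_sum) (auto simp: H_sm al_sm if_distrib[of "\<lambda>x. _ * x"] cong: if_cong)
  thus ?thesis using that by simp
 qed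
 thus ?thesis using b by (intro bexI[of _ "\<Sum>i\<le>n. sm (v i) (b i)"]) (auto intro!: H_sum H_sm)
qed

subsection \<open>Realisation by band matrices\<close>

text \<open>The matrices are those of the loop algebra of sl_N, fixed by an involution. Rows and
  columns are unrolled to the integers, and moving the column by N is multiplication by the loop
  variable.\<close>

definition N :: int where "N = 2 * int n + 1"

text \<open>The node attached to the step from i to i + 1. Over one period the nodes read 0, 1, ...,
  n, n - 1, ..., 0, a sequence invariant under the reflection of m to -1 - m.\<close>

definition lab :: "int \<Rightarrow> nat" where
 "lab i = (if i mod N \<le> int n then nat (i mod N) else nat (2 * int n - i mod N))"

text \<open>Node 0 labels two adjacent steps, which form the three-dimensional representation of
  sl_2. The factor 2 in \<open>f\<^sub>0\<close> makes the value of \<open>\<alpha>\<^sub>0\<close>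
  on \<open>[e\<^sub>0, f\<^sub>0]\<close> equal to 2.\<close>

definition ka :: "nat \<Rightarrow> complex" where "ka i = (if i = 0 then 2 else 1)"

text \<open>The commutator of two band matrices, one with entry \<open>c i\<close> at (i, i + k),
  the other with entry \<open>d i\<close> at (i, i + l).\<close>

definition bc :: "int \<Rightarrow> int \<Rightarrow> (int \<Rightarrow> complex) \<Rightarrow> (int \<Rightarrow> complex) \<Rightarrow> int \<Rightarrow> complex" where
 "bc k l c d = (\<lambda>i. c i * d (i + k) - d i * c (i + l))"

text \<open>The diagonal matrix of h, normalised to vanish at 0. Its successive differences are the
  values of the simple roots, so it is periodic only up to multiples of \<delta>(h).\<close>

definition pih :: "'g \<Rightarrow> int \<Rightarrow> complex" where
 "pih h i = (\<Sum>l\<in>{i..<0}. al (lab l) h) - (\<Sum>l\<in>{0..<i}. al (lab l) h)"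

definition g :: "int \<Rightarrow> nat \<Rightarrow> 'g" where "g s i = (if s = 1 then gen_e G i else gen_f G i)"

definition cg :: "int \<Rightarrow> nat \<Rightarrow> int \<Rightarrow> complex" where
 "cg s i m = (if s = 1 then (if lab m = i then 1 else 0) else (if lab (m - 1) = i then ka i else 0))"

lemma N3: "N \<ge> 3" using n1 by (simp add: N_def)

lemma mod_bounds: "0 \<le> i mod N" "i mod N < N" using N3 by simp_all

lemma lab_le: "lab i \<le> n" using mod_bounds[of i] by (auto simp: lab_def N_def)

lemma lab_shift [simp]: "lab (i + N) = lab i" "lab (i + m * N) = lab i"
 by (auto simp: lab_def)

lemma mod_neg1: "(- 1 - i) mod N = N - 1 - i mod N"
proof -
 have "(- 1 - i) = (N - 1 - i mod N) + (- 1 - i div N) * N"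
  using div_mult_mod_eq[of i N] by (simp add: algebra_simps)
 hence "(- 1 - i) mod N = (N - 1 - i mod N) mod N" by (metis mod_mult_self1)
 thus ?thesis using mod_bounds[of i] by simp
qed

lemma lab_refl: "lab (- 1 - i) = lab i"
proof -
 have r: "(- 1 - i) mod N = 2 * int n - i mod N" using mod_neg1[of i] by (simp add: N_def)
 show ?thesis unfolding lab_def r using mod_bounds[of i] by (auto simp: N_def)
qed

lemma lab_self: "i \<le> n \<Longrightarrow> lab (int i) = i" using N3 by (auto simp: lab_def N_def)

lemma pih_0 [simp]: "pih h 0 = 0" by (simp add: pih_def)

lemma pih_step: "pih h i - pih h (i + 1) = al (lab i) h"
proof (cases "i < 0")
 case True
 hence "{i..<0} = insert i {i+1..<0}" by auto
 thus ?thesis using True by (simp add: pih_def)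
next
 case False
 hence "{0..<i+1} = insert i {0..<i}" by auto
 thus ?thesis using False by (simp add: pih_def)
qed

lemma step_unique:
 fixes u v :: "int \<Rightarrow> complex"
 assumes "u 0 = v 0" "\<And>i. u i - u (i + 1) = v i - v (i + 1)"
 shows "u i = v i"
proof (induction i rule: int_induct[where k = 0])
 case (step1 i) thus ?case using assms(2)[of i] by simp
next
 case (step2 i) thus ?case using assms(2)[of "i - 1"] by simp
qed (rule assms)

lemma pih_neg: "pih h (- i) = - pih h i"
proof -
 have "- pih h (- i) = pih h i"
 proof (rule step_unique)
  fix i
  have "pih h (- i - 1) - pih h (- i) = al (lab i) h"
  proof -
   have e: "- i - 1 = - 1 - i" "- 1 - i + 1 = - i" by simp_all
   show ?thesis using pih_step[of h "- 1 - i"] unfolding e lab_refl .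
  qed
  moreover have "- (i + 1) = - i - 1" by simp
  ultimately show "- pih h (- i) - - pih h (- (i + 1)) = pih h i - pih h (i + 1)"
   using pih_step[of h i] by simp
 qed simp
 hence "- (- pih h (- i)) = - pih h i" by (rule arg_cong)
 thus ?thesis by simp
qed

lemma pih_period: "pih h (i + N) = pih h i + pih h N"
proof -
 have "pih h (i + N) - pih h N = pih h i"
 proof (rule step_unique)
  fix i show "pih h (i + N) - pih h N - (pih h (i + 1 + N) - pih h N) = pih h i - pih h (i + 1)"
   using pih_step[of h "i + N"] pih_step[of h i] by (simp add: algebra_simps)
 qed simp
 thus ?thesis by (simp add: algebra_simps)
qed

lemma pih_period_mult: "pih h (i + m * N) = pih h i + of_int m * pih h N"
proof (induction m rule: int_induct[where k = 0])
 case (step1 m) thus ?case using pih_period[of h "i + m * N"] by (simp add: algebra_simps)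
next
 case (step2 m) thus ?case using pih_period[of h "i + (m - 1) * N"] by (simp add: algebra_simps)
qed simp

lemma pih_add: "x \<in> H \<Longrightarrow> y \<in> H \<Longrightarrow> pih (x + y) i = pih x i + pih y i"
 by (simp add: pih_def al_add lab_le sum.distrib)

lemma pih_sm: "x \<in> H \<Longrightarrow> pih (sm c x) i = c * pih x i"
 by (simp add: pih_def al_sm lab_le sum_distrib_left algebra_simps)

lemma pih_zero [simp]: "pih 0 i = 0" by (simp add: pih_def lab_le)

lemma ex_pih:
 fixes u :: "int \<Rightarrow> complex"
 assumes u0: "u 0 = 0" and st: "\<And>i. u i - u (i + 1) = v (lab i)"
 shows "\<exists>h\<in>H. pih h = u \<and> (\<forall>i\<le>n. al i h = v i)"
proof -
 obtain h where h: "h \<in> H" "\<And>i. i \<le> n \<Longrightarrow> al i h = v i"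
  using ex_al[of v] by auto
 have "pih h i = u i" for i
  by (rule step_unique) (use u0 h in \<open>simp_all add: pih_step st lab_le\<close>)
 thus ?thesis using h by auto
qed

lemma lab_cases:
 obtains (left) "i mod N \<le> int n" "i mod N = int (lab i)"
 | (right) "i mod N > int n" "(- 1 - i) mod N \<le> int n" "(- 1 - i) mod N = int (lab i)" "lab i < n"
proof (cases "i mod N \<le> int n")
 case True
 moreover have "i mod N = int (lab i)" using True mod_bounds(1)[of i] by (simp add: lab_def)
 ultimately show ?thesis by (rule left)
next
 case False
 have r: "(- 1 - i) mod N = 2 * int n - i mod N" using mod_neg1[of i] by (simp add: N_def)
 have l: "lab i = nat (2 * int n - i mod N)" using False by (simp add: lab_def)
 have "i mod N \<le> 2 * int n" using mod_bounds[of i] by (simp add: N_def)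
 hence "(- 1 - i) mod N = int (lab i)" "lab i < n" "i mod N > int n" "(- 1 - i) mod N \<le> int n"
  using False unfolding r l by linarith+
 thus ?thesis using right by blast
qed

lemma mod_eq_add: "i mod N = j mod N \<Longrightarrow> \<exists>m. i = j + m * N"
proof -
 assume "i mod N = j mod N"
 hence "i = j + (i div N - j div N) * N"
  using div_mult_mod_eq[of i N] div_mult_mod_eq[of j N] unfolding left_diff_distrib by linarith
 thus ?thesis ..
qed

text \<open>The steps of an odd periodic function are periodic and invariant under the reflection of
  m to -1 - m, so they depend on the label only and can be prescribed by the values of the simple
  roots.\<close>

lemma ex_pih_odd:
 fixes u :: "int \<Rightarrow> complex"
 assumes odd: "\<And>i. u (- i) = - u i" and per: "\<And>i. u (i + N) = u i"
 shows "\<exists>h\<in>H. pih h = u"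
proof -
 have u0: "u 0 = 0" using odd[of 0] by simp
 have perm: "u (i + m * N) = u i" for i m
 proof (induction m rule: int_induct[where k = 0])
  case (step1 m) thus ?case using per[of "i + m * N"] by (simp add: algebra_simps)
 next
  case (step2 m) thus ?case using per[of "i + (m - 1) * N"] by (simp add: algebra_simps)
 qed simp
 have st: "u i - u (i + 1) = u (int (lab i)) - u (int (lab i) + 1)" for i
 proof (cases i rule: lab_cases)
  case left
  then obtain m where "i = int (lab i) + m * N" using mod_eq_add[of i "int (lab i)"]
   by (metis mod_mod_trivial)
  hence "u i = u (int (lab i))" "u (i + 1) = u (int (lab i) + 1)"
   using perm[of "int (lab i)" m] perm[of "int (lab i) + 1" m] by (simp_all add: algebra_simps)
  thus ?thesis by simp
 next
  case right
  then obtain m where "- 1 - i = int (lab i) + m * N" using mod_eq_add[of "- 1 - i" "int (lab i)"]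
   by (metis mod_mod_trivial)
  hence "i = - (int (lab i) + 1) + (- m) * N" "i + 1 = - int (lab i) + (- m) * N"
   by (simp_all add: algebra_simps)
  hence "u i = u (- (int (lab i) + 1))" "u (i + 1) = u (- int (lab i))" using perm by metis+
  thus ?thesis using odd[of "int (lab i) + 1"] odd[of "int (lab i)"] by simp
 qed
 show ?thesis using ex_pih[of u "\<lambda>l. u (int l) - u (int l + 1)"] u0 st by blast
qed

end

context A2n2
begin

lemma lab_eqD:
 assumes "lab a = lab b"
 shows "N dvd a - b \<or> N dvd a + b + 1"
proof -
 have "\<exists>m. a = int (lab a) + m * N \<or> - 1 - a = int (lab a) + m * N" for a
  by (cases a rule: lab_cases) (metis mod_div_mult_eq)+
 then obtain x y where x: "a = int (lab a) + x * N \<or> - 1 - a = int (lab a) + x * N"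
  and y: "b = int (lab a) + y * N \<or> - 1 - b = int (lab a) + y * N"
  using assms by metis
 have "a - b = (x - y) * N \<or> a - b = (y - x) * N \<or> a + b + 1 = (x - y) * N \<or> a + b + 1 = (y - x) * N"
  using x y by (auto simp: algebra_simps)
 thus ?thesis by (metis dvd_triv_right)
qed

text \<open>The walk through the labels goes up or down by one and turns back at its ends. At n both
  neighbours are n - 1. At 0 one neighbour is 0 again, which the truncated subtraction 0 - 1 = 0
  expresses.\<close>

lemma lab_neighbours:
 "(lab (m - 1) = lab m - 1 \<and> lab (m + 1) = (if lab m = n then n - 1 else lab m + 1)) \<or>
  (lab (m + 1) = lab m - 1 \<and> lab (m - 1) = (if lab m = n then n - 1 else lab m + 1))"
proof -
 have low: "lab (m - 1) = lab m - 1 \<and> lab (m + 1) = (if lab m = n then n - 1 else lab m + 1)"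
  if "m mod N = int (lab m)" for m
 proof -
  define l where "l = lab m"
  have ln: "l \<le> n" unfolding l_def by (rule lab_le)
  have "m = int l + (m div N) * N" using that div_mult_mod_eq[of m N] unfolding l_def by linarith
  then obtain z where z: "m = int l + z * N" by blast
  have "m - 1 = (int l - 1) + z * N" "m + 1 = (int l + 1) + z * N" using z by simp_all
  hence sh: "lab (m - 1) = lab (int l - 1)" "lab (m + 1) = lab (int l + 1)"
   by (simp_all only: lab_shift)
  have l1: "lab (int l - 1) = l - 1"
  proof (cases "l = 0")
   case True thus ?thesis using lab_refl[of 0] lab_self[of 0] by simp
  next
   case False
   hence "int l - 1 = int (l - 1)" by simp
   moreover have "lab (int (l - 1)) = l - 1" using ln by (intro lab_self) simp
   ultimately show ?thesis by (simp only:)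
  qed
  have "lab (int l + 1) = (if l = n then n - 1 else l + 1)"
  proof (cases "l = n")
   case True
   have "lab (int n + 1) = lab (- 1 - (int n + 1) + N)" by (simp only: lab_shift lab_refl)
   also have "- 1 - (int n + 1) + N = int (n - 1)" using n1 by (simp add: N_def)
   finally show ?thesis using True lab_self[of "n - 1"] by simp
  next
   case False
   hence "lab (int (l + 1)) = l + 1" using ln by (intro lab_self) simp
   thus ?thesis using False by (simp add: add.commute)
  qed
  with sh l1 show ?thesis by (simp add: l_def)
 qed
 show ?thesis
 proof (cases m rule: lab_cases)
  case left thus ?thesis using low by blast
 next
  case right
  have "lab (m + 1) = lab (- 1 - m - 1)" "lab (m - 1) = lab (- 1 - m + 1)"
   using lab_refl[of "m + 1"] lab_refl[of "m - 1"] by (simp_all add: algebra_simps)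
  thus ?thesis using low[of "- 1 - m"] right by (simp add: lab_refl)
 qed
qed

text \<open>Here the Cartan matrix enters: up to the factor \<open>ka i\<close>, its row i is the
  negative second difference of the indicator function of the label i along the walk.\<close>

lemma cartan_identity:
 assumes "i \<le> n"
 shows "ka i * (2 * of_bool (lab m = i) - of_bool (lab (m - 1) = i) - of_bool (lab (m + 1) = i))
    = of_int (A i (lab m))"
proof -
 have "ka i * (2 * of_bool (l = i) - of_bool (l - 1 = i) - of_bool ((if l = n then n - 1 else l + 1) = i))
    = of_int (A i l)" if "l \<le> n" for l
  using that assms n1 by (cases "n = 1") (auto simp: cartan_matrix_A2n2_def ka_def)
 note a = this[OF lab_le[of m]]
 from lab_neighbours[of m] show ?thesis
 proof (elim disjE conjE)
  assume e: "lab (m - 1) = lab m - 1" "lab (m + 1) = (if lab m = n then n - 1 else lab m + 1)"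
  show ?thesis unfolding e by (rule a)
 next
  assume e: "lab (m + 1) = lab m - 1" "lab (m - 1) = (if lab m = n then n - 1 else lab m + 1)"
  have c: "w * (x - y - z) = w * (x - z - y)" for w x y z :: complex by simp
  show ?thesis unfolding e by (rule trans[OF c a])
 qed
qed

lemma pih_cv:
 assumes "i \<le> n"
 shows "pih (cv i) m = ka i * (of_bool (lab m = i) - of_bool (lab (m - 1) = i))"
proof -
 have alg: "a = w * (x - y) - w * (z - x)" if "w * (2 * x - y - z) = a" for a w x y z :: complex
  using that by (simp add: algebra_simps)
 show ?thesis
proof (rule step_unique[where u = "pih (cv i)" and i = m
  and v = "\<lambda>m. ka i * (of_bool (lab m = i) - of_bool (lab (m - 1) = i))"])
 have "lab (- 1) = lab 0" using lab_refl[of 0] by simp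
 thus "pih (cv i) 0 = ka i * (of_bool (lab 0 = i) - of_bool (lab (0 - 1) = i))" by simp
 fix m show "pih (cv i) m - pih (cv i) (m + 1) = ka i * (of_bool (lab m = i) - of_bool (lab (m - 1) = i)) -
   ka i * (of_bool (lab (m + 1) = i) - of_bool (lab (m + 1 - 1) = i))"
  using alg[OF cartan_identity[OF assms, of m]] unfolding pih_step al_cv[OF assms lab_le]
  by (simp only: add_diff_cancel_right')
qed
qed

lemma cg_per: "cg s i (m + N) = cg s i m"
 using lab_shift(1)[of m] lab_shift(1)[of "m - 1"] by (simp add: cg_def algebra_simps)

lemma cg_sym: "s = 1 \<or> s = - 1 \<Longrightarrow> cg s i (- m - s) = cg s i m"
proof -
 have "- 1 - m = - m - 1" "- 1 - (m - 1) = - m" by simp_all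
 hence "lab (- m - 1) = lab m" "lab (- m) = lab (m - 1)" using lab_refl[of m] lab_refl[of "m - 1"] by metis+
 thus "s = 1 \<or> s = - 1 \<Longrightarrow> ?thesis" by (auto simp: cg_def)
qed

section \<open>Pairs of an algebra element and a band matrix\<close>

lemma bc_anti: "bc l k d c = (\<lambda>i. - bc k l c d i)"
 by (auto simp: bc_def)

lemma bc_jac: "bc a (b + e) x (bc b e y z) m
  = bc (a + b) e (bc a b x y) z m + bc b (a + e) y (bc a e x z) m"
 by (simp add: bc_def algebra_simps)

lemma bc_add_r: "bc k l c (\<lambda>m. d m + e m) = (\<lambda>m. bc k l c d m + bc k l c e m)"
 and bc_add_l: "bc k l (\<lambda>m. d m + e m) c = (\<lambda>m. bc k l d c m + bc k l e c m)"
 and bc_sm_r: "bc k l c (\<lambda>m. a * d m) = (\<lambda>m. a * bc k l c d m)"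
 and bc_sm_l: "bc k l (\<lambda>m. a * d m) c = (\<lambda>m. a * bc k l d c m)"
 and bc_0_r: "bc k l c (\<lambda>m. 0) = (\<lambda>m. 0)"
 and bc_0_l: "bc k l (\<lambda>m. 0) c = (\<lambda>m. 0)"
 by (auto simp: bc_def algebra_simps)

lemma bc_cg_h:
 assumes "s = 1 \<or> s = - 1"
 shows "bc 0 s (pih h) (cg s i) = (\<lambda>m. of_int s * al i h * cg s i m)"
proof
 fix m show "bc 0 s (pih h) (cg s i) m = of_int s * al i h * cg s i m"
  using pih_step[of h m] pih_step[of h "m - 1"] assms by (auto simp: bc_def cg_def algebra_simps)
qed

lemma br_h_g: "h \<in> H \<Longrightarrow> i \<le> n \<Longrightarrow> s = 1 \<or> s = - 1 \<Longrightarrow> br h (g s i) = sm (of_int s * al i h) (g s i)"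
 by (auto simp: g_def br_he br_hf)

lemma bc_ef:
 assumes "i \<le> n" "j \<le> n"
 shows "bc 1 (- 1) (cg 1 i) (cg (- 1) j) = pih (if i = j then cv i else 0)"
 using assms by (auto simp: fun_eq_iff bc_def cg_def pih_cv)

lemma opp_gens:
 assumes "i \<le> n" "j \<le> n" "s = 1 \<or> s = - 1"
 shows "br (g (- s) i) (g s j) \<in> H \<and> bc (- s) s (cg (- s) i) (cg s j) = pih (br (g (- s) i) (g s j))"
proof -
 have neg: "pih (- h) = (\<lambda>m. - pih h m)" if "h \<in> H" for h
  using that pih_sm[of h "- 1"] by (simp add: fun_eq_iff)
 have "br (g (- 1) i) (g 1 j) = - (if j = i then cv j else 0)"
  using assms br_ef[of j i] by (subst br_anti) (simp add: g_def)
 moreover have "br (g 1 i) (g (- 1) j) = (if i = j then cv i else 0)"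
  using assms br_ef[of i j] by (simp add: g_def)
 moreover have "- x \<in> H" if "x \<in> H" for x using H_sm[OF that, of "- 1"] by simp
 ultimately show ?thesis
  using assms bc_ef[of i j] bc_ef[of j i] H0 cv_H neg
  by (auto simp: bc_anti[of "- 1" 1])
qed

text \<open>All pairs of an element x and a coefficient function c obtained in parallel from the
  generators of sign s; k is the height. Whether c is determined by x is settled only afterwards, in
  \<open>P_zero_coef\<close>.\<close>

inductive P :: "int \<Rightarrow> nat \<Rightarrow> 'g \<Rightarrow> (int \<Rightarrow> complex) \<Rightarrow> bool" for s where
 P_gen: "i \<le> n \<Longrightarrow> P s 1 (g s i) (cg s i)"
| P_br: "P s k x c \<Longrightarrow> i \<le> n \<Longrightarrow> P s (Suc k) (br (g s i) x) (bc s (s * int k) (cg s i) c)"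
| P_zero: "k \<ge> 1 \<Longrightarrow> P s k 0 (\<lambda>_. 0)"
| P_add: "P s k x c \<Longrightarrow> P s k y d \<Longrightarrow> P s k (x + y) (\<lambda>m. c m + d m)"
| P_sm: "P s k x c \<Longrightarrow> P s k (sm a x) (\<lambda>m. a * c m)"

definition T :: "int \<Rightarrow> 'g \<Rightarrow> (int \<Rightarrow> complex) \<Rightarrow> bool" where
 "T k x c = (if k = 0 then x \<in> H \<and> c = pih x
   else if k > 0 then P 1 (nat k) x c else P (- 1) (nat (- k)) x c)"

lemma P_pos: "P s k x c \<Longrightarrow> k \<ge> 1"
 by (induction rule: P.induct) auto

lemma T_P: "s = 1 \<or> s = - 1 \<Longrightarrow> k \<ge> 1 \<Longrightarrow> T (s * int k) x c = P s k x c"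
 by (auto simp: T_def)

lemma T_0: "T 0 x c \<longleftrightarrow> x \<in> H \<and> c = pih x" by (simp add: T_def)

lemma T_cases:
 assumes "T k x c"
 obtains "k = 0" "x \<in> H" "c = pih x"
 | s m where "s = 1 \<or> s = - 1" "k = s * int m" "m \<ge> 1" "P s m x c"
proof -
 consider "k = 0" | "k > 0" | "k < 0" by linarith
 thus ?thesis
 proof cases
  case 1 thus ?thesis using assms that(1) by (simp add: T_def)
 next
  case 2 thus ?thesis using assms that(2)[of 1 "nat k"] by (simp add: T_def)
 next
  case 3 thus ?thesis using assms that(2)[of "- 1" "nat (- k)"] by (simp add: T_def)
 qed
qed

lemma T_zero: "T k 0 (\<lambda>_. 0)"
 by (auto simp: T_def H0 fun_eq_iff intro: P_zero)

lemma T_add: "T k x c \<Longrightarrow> T k y d \<Longrightarrow> T k (x + y) (\<lambda>m. c m + d m)"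
 by (auto simp: T_def H_add fun_eq_iff pih_add intro: P_add split: if_splits)

lemma T_sm: "T k x c \<Longrightarrow> T k (sm a x) (\<lambda>m. a * c m)"
 by (auto simp: T_def H_sm fun_eq_iff pih_sm intro: P_sm split: if_splits)

lemma P_h:
 assumes "P s k x c" "h \<in> H" "s = 1 \<or> s = - 1"
 shows "P s k (br h x) (bc 0 (s * int k) (pih h) c)"
 using assms(1)
proof induction
 case (P_gen i)
 show ?case using assms P_gen P_sm[OF P.P_gen[OF P_gen, of s]] by (simp add: bc_cg_h br_h_g)
next
 case (P_br k x c i)
 have "br h (br (g s i) x) = sm (of_int s * al i h) (br (g s i) x) + br (g s i) (br h x)"
  using assms P_br.hyps by (subst jac) (simp add: br_h_g br_sm_l)
 moreover have "bc 0 (s * int (Suc k)) (pih h) (bc s (s * int k) (cg s i) c)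
  = (\<lambda>m. of_int s * al i h * bc s (s * int k) (cg s i) c m
    + bc s (s * int k) (cg s i) (bc 0 (s * int k) (pih h) c) m)"
  using bc_jac[of 0 s "s * int k" "pih h" "cg s i" c] assms(3)
  by (simp add: fun_eq_iff bc_cg_h bc_sm_l distrib_left)
 ultimately show ?case using P_br by (auto intro!: P_add P_sm P.P_br)
next
 case (P_zero k) thus ?case by (simp add: bc_0_r P.P_zero)
next
 case (P_add k x c y d) thus ?case by (simp add: br_add_r bc_add_r P.P_add)
next
 case (P_sm k x c a) thus ?case by (simp add: br_sm_r bc_sm_r P.P_sm)
qed

lemma T_h:
 assumes "T k x c" "h \<in> H"
 shows "T k (br h x) (bc 0 k (pih h) c)"
 using assms(1)
proof (cases rule: T_cases)
 case 1
 thus ?thesis using assms HH0 by (simp add: T_0 H0 fun_eq_iff bc_def)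
next
 case (2 s m)
 thus ?thesis using P_h[OF _ assms(2)] by (simp add: T_P)
qed

lemma T_same:
 assumes "T (s * int k) x c" "i \<le> n" "s = 1 \<or> s = - 1"
 shows "T (s * int k + s) (br (g s i) x) (bc s (s * int k) (cg s i) c)"
proof (cases "k = 0")
 case True
 hence x: "x \<in> H" "c = pih x" using assms by (auto simp: T_0)
 have "br (g s i) x = sm (- (of_int s * al i x)) (g s i)"
  using x assms by (subst br_anti) (simp add: br_h_g)
 moreover have "bc s 0 (cg s i) c = (\<lambda>m. - (of_int s * al i x) * cg s i m)"
  using x assms by (subst bc_anti) (simp add: bc_cg_h)
 moreover have "T (s * int 1) (sm (- (of_int s * al i x)) (g s i)) (\<lambda>m. - (of_int s * al i x) * cg s i m)"
  by (intro T_sm) (use assms P_gen in \<open>simp only: T_P le_refl\<close>)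
 ultimately show ?thesis using True by simp
next
 case False
 hence "P s (Suc k) (br (g s i) x) (bc s (s * int k) (cg s i) c)"
  using assms by (intro P_br) (auto simp: T_P)
 moreover have "s * int k + s = s * int (Suc k)" by (simp add: algebra_simps)
 ultimately show ?thesis using assms(3) by (simp only: T_P)
qed

text \<open>The opposite generator is moved inwards by the Jacobi identity. Where it meets a
  generator it leaves a Cartan element with the matching diagonal, so the height drops by one on
  both sides of the pair.\<close>

lemma P_opp:
 assumes "P s k x c" "i \<le> n" "s = 1 \<or> s = - 1"
 shows "T (s * int k - s) (br (g (- s) i) x) (bc (- s) (s * int k) (cg (- s) i) c)"
 using assms(1)
proof induction
 case (P_gen j)
 thus ?case using opp_gens[of i j s] assms by (auto simp: T_0)
next
 case (P_br k x c j)
 define h where "h = br (g (- s) i) (g s j)"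
 have h: "h \<in> H" "bc (- s) s (cg (- s) i) (cg s j) = pih h"
  using opp_gens[of i j s] assms P_br by (auto simp: h_def)
 have k: "k \<ge> 1" using P_br P_pos by auto
 have e: "br (g (- s) i) (br (g s j) x) = br h x + br (g s j) (br (g (- s) i) x)"
  unfolding h_def by (rule jac)
 have e': "bc (- s) (s * int (Suc k)) (cg (- s) i) (bc s (s * int k) (cg s j) c)
  = (\<lambda>m. bc 0 (s * int k) (pih h) c m + bc s (s * int k - s) (cg s j) (bc (- s) (s * int k) (cg (- s) i) c) m)"
  using bc_jac[of "- s" s "s * int k" "cg (- s) i" "cg s j" c] h by (simp add: fun_eq_iff distrib_left)
 have km: "s * int k - s = s * int (k - 1)" using k by (simp add: of_nat_diff algebra_simps)
 have "T (s * int k) (br h x) (bc 0 (s * int k) (pih h) c)"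
  using P_br k h assms by (intro T_h) (auto simp: T_P)
 moreover have "T (s * int (k - 1) + s) (br (g s j) (br (g (- s) i) x))
   (bc s (s * int (k - 1)) (cg s j) (bc (- s) (s * int k) (cg (- s) i) c))"
  using P_br assms km by (intro T_same) auto
 moreover have "s * int (k - 1) + s = s * int k" using km by simp
 ultimately have "T (s * int k) (br (g (- s) i) (br (g s j) x))
   (bc (- s) (s * int (Suc k)) (cg (- s) i) (bc s (s * int k) (cg s j) c))"
  unfolding e e' using km by (metis T_add)
 thus ?case by (simp add: algebra_simps)
next
 case (P_zero k) thus ?case by (simp add: bc_0_r T_zero)
next
 case (P_add k x c y d) thus ?case by (simp add: br_add_r bc_add_r T_add)
next
 case (P_sm k x c a) thus ?case by (simp add: br_sm_r bc_sm_r T_sm)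
qed

lemma T_gen:
 assumes "T k x c" "i \<le> n" "s = 1 \<or> s = - 1"
 shows "T (k + s) (br (g s i) x) (bc s k (cg s i) c)"
 using assms(1)
proof (cases rule: T_cases)
 case 1
 thus ?thesis using T_same[of s 0 x c i] assms by simp
next
 case (2 t m)
 show ?thesis
 proof (cases "s = t")
  case True thus ?thesis using T_same[of s m x c i] assms 2 by simp
 next
  case False
  hence "s = - t" using 2 assms by auto
  thus ?thesis using P_opp[of t m x c i] 2 assms by simp
 qed
qed

lemma P_br_T:
 assumes "P s k x c" "T l y d" "s = 1 \<or> s = - 1"
 shows "T (s * int k + l) (br x y) (bc (s * int k) l c d)"
 using assms(1,2)
proof (induction arbitrary: l y d)
 case (P_gen i)
 thus ?case using T_gen[of l y d i s] assms by (simp add: add.commute)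
next
 case (P_br k x c i)
 have e: "br (br (g s i) x) y = br (g s i) (br x y) + sm (- 1) (br x (br (g s i) y))"
  using jac[of "g s i" x y] by simp
 have E: "bc (s * int (Suc k)) l (bc s (s * int k) (cg s i) c) d m
  = bc s (s * int k + l) (cg s i) (bc (s * int k) l c d) m
   + (- 1) * bc (s * int k) (s + l) c (bc s l (cg s i) d) m" for m
  using bc_jac[of s "s * int k" l "cg s i" c d m] by (simp add: distrib_left)
 have t1: "T (s * int k + l + s) (br (g s i) (br x y)) (bc s (s * int k + l) (cg s i) (bc (s * int k) l c d))"
  using P_br assms(3) by (intro T_gen) auto
 have t2: "T (s * int k + (l + s)) (br x (br (g s i) y)) (bc (s * int k) (l + s) c (bc s l (cg s i) d))"
  using P_br assms(3) by (intro P_br.IH T_gen) auto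
 have t3: "T (s * int k + l + s) (br x (br (g s i) y)) (bc (s * int k) (s + l) c (bc s l (cg s i) d))"
  using t2 by (simp add: ac_simps)
 have "T (s * int k + l + s) (br (br (g s i) x) y) (bc (s * int (Suc k)) l (bc s (s * int k) (cg s i) c) d)"
  unfolding e ext[of "bc (s * int (Suc k)) l (bc s (s * int k) (cg s i) c) d", OF E]
  by (rule T_add[OF t1 T_sm[OF t3]])
 thus ?case by (simp add: algebra_simps)
next
 case (P_zero k) thus ?case by (simp add: bc_0_l T_zero)
next
 case (P_add k x c y d) thus ?case by (simp add: br_add_l bc_add_l T_add)
next
 case (P_sm k x c a) thus ?case by (simp add: br_sm_l bc_sm_l T_sm)
qed

text \<open>The pairs form a graded Lie subalgebra of the product of the two Lie algebras, as both
  components are bracketed in parallel.\<close>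

lemma T_br:
 assumes "T k x c" "T l y d"
 shows "T (k + l) (br x y) (bc k l c d)"
 using assms(1)
proof (cases rule: T_cases)
 case 1 thus ?thesis using T_h[OF assms(2)] by simp
next
 case (2 s m) thus ?thesis using P_br_T[OF _ assms(2)] by simp
qed

section \<open>The principal grading; existence of the matrix of an element\<close>

definition h0 :: 'g where "h0 = (SOME h. h \<in> H \<and> (\<forall>i\<le>n. al i h = 1))"

lemma h0: "h0 \<in> H" "i \<le> n \<Longrightarrow> al i h0 = 1"
 using someI_ex[of "\<lambda>h. h \<in> H \<and> (\<forall>i\<le>n. al i h = 1)"] ex_al[of "\<lambda>_. 1"]
 by (auto simp: h0_def)

lemma pih_h0: "pih h0 m = - of_int m"
 by (rule step_unique) (auto simp: pih_step h0 lab_le)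

lemma P_eigen: "P s k x c \<Longrightarrow> s = 1 \<or> s = - 1 \<Longrightarrow> br h0 x = sm (of_int (s * int k)) x"
proof (induction rule: P.induct)
 case (P_gen i) thus ?case using h0 by (simp add: br_h_g)
next
 case (P_br k x c i)
 thus ?case using h0 by (subst jac)
  (simp add: br_h_g br_sm_l br_sm_r V.scale_left_distrib[symmetric] distrib_left)
qed (auto simp: br_add_r V.scale_right_distrib br_sm_r ac_simps)

lemma T_eigen: "T k x c \<Longrightarrow> br h0 x = sm (of_int k) x"
 by (cases rule: T_cases) (auto simp: HH0 h0 P_eigen)

lemma graded_zero:
 fixes M :: int
 assumes "\<And>k. br h0 (xs k) = sm (of_int k) (xs k)" "(\<Sum>k\<in>{-M..M}. xs k) = 0" "\<And>k. \<bar>k\<bar> > M \<Longrightarrow> xs k = 0"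
 shows "xs k = 0"
proof (cases "k \<in> {-M..M}")
 case True
 show ?thesis
  by (rule V.eigenvectors_independent[of "{-M..M}" of_int "br h0" xs])
   (use assms True in \<open>auto simp: br_add_r br_sm_r inj_on_def\<close>)
qed (use assms(3)[of k] in auto)

text \<open>Finite sums of homogeneous pairs. This relation is total because its domain is a
  subalgebra containing the generators, and single-valued because the heights separate and
  \<open>T\<close> relates 0 only to 0.\<close>

definition Rel :: "'g \<Rightarrow> (int \<Rightarrow> int \<Rightarrow> complex) \<Rightarrow> bool" where
 "Rel x a \<longleftrightarrow> (\<exists>xs (M::int). (\<forall>k. T k (xs k) (a k)) \<and> (\<forall>k. \<bar>k\<bar> > M \<longrightarrow> xs k = 0) \<and> x = (\<Sum>k\<in>{-M..M}. xs k))"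

lemma sum_extend:
 fixes xs :: "int \<Rightarrow> 'x::comm_monoid_add" and M :: int
 assumes "\<forall>k. \<bar>k\<bar> > M \<longrightarrow> xs k = 0" "M \<le> M'"
 shows "(\<Sum>k\<in>{-M..M}. xs k) = (\<Sum>k\<in>{-M'..M'}. xs k)"
 by (rule sum.mono_neutral_left) (use assms in auto)

lemma Rel_add:
 assumes "Rel x a" "Rel y b"
 shows "Rel (x + y) (\<lambda>k m. a k m + b k m)"
proof -
 obtain xs M where x: "\<forall>k. T k (xs k) (a k)" "\<forall>k. \<bar>k\<bar> > M \<longrightarrow> xs k = 0" "x = (\<Sum>k\<in>{-M..M}. xs k)"
  using assms by (auto simp: Rel_def)
 obtain ys M' where y: "\<forall>k. T k (ys k) (b k)" "\<forall>k. \<bar>k\<bar> > M' \<longrightarrow> ys k = 0" "y = (\<Sum>k\<in>{-M'..M'}. ys k)"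
  using assms by (auto simp: Rel_def)
 show ?thesis unfolding Rel_def
  by (rule exI[of _ "\<lambda>k. xs k + ys k"], rule exI[of _ "max M M'"])
   (use x y sum_extend[OF x(2), of "max M M'"] sum_extend[OF y(2), of "max M M'"]
    in \<open>auto simp: sum.distrib intro!: T_add\<close>)
qed

lemma Rel_sm: "Rel x a \<Longrightarrow> Rel (sm e x) (\<lambda>k m. e * a k m)"
 unfolding Rel_def
 apply clarify
 subgoal for xs M
  by (rule exI[of _ "\<lambda>k. sm e (xs k)"], rule exI[of _ M]) (auto simp: V.scale_sum_right intro!: T_sm)
 done

lemma Rel_T: "T k x c \<Longrightarrow> Rel x (\<lambda>l m. if l = k then c m else 0)"
 unfolding Rel_def
 by (rule exI[of _ "\<lambda>l. if l = k then x else 0"], rule exI[of _ "\<bar>k\<bar>"])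
  (auto simp: T_zero sum.delta')

lemma Rel_total: "\<exists>a. Rel x a"
proof -
 have z: "Rel 0 (\<lambda>_ _. 0)" using Rel_T[OF T_zero, of 0] by (simp cong: if_cong)
 have sumR: "\<exists>a. Rel (sum xs K) a" if "\<And>k. k \<in> K \<Longrightarrow> \<exists>a. Rel (xs k) a" for xs and K :: "int set"
  using that
 proof (induction K rule: infinite_finite_induct)
  case (insert k K)
  have "\<exists>b. Rel (sum xs K) b" using insert.IH insert.prems by simp
  moreover have "\<exists>a. Rel (xs k) a" using insert.prems by simp
  ultimately obtain a b where "Rel (xs k) a" "Rel (sum xs K) b" by blast
  hence "Rel (xs k + sum xs K) (\<lambda>l m. a l m + b l m)" by (rule Rel_add)
  thus ?case using insert.hyps by auto
 qed (use z in auto)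
 have "x \<in> {x. \<exists>a. Rel x a}"
 proof (rule gen_closure)
  show "V.subspace {x. \<exists>a. Rel x a}"
   using z Rel_add Rel_sm by (auto simp: V.subspace_def) blast+
  fix x y assume "x \<in> {x. \<exists>a. Rel x a}" "y \<in> {x. \<exists>a. Rel x a}"
  then obtain a b where "Rel x a" "Rel y b" by auto
  then obtain xs ys and M M' :: int where x: "\<forall>k. T k (xs k) (a k)" "x = (\<Sum>k\<in>{-M..M}. xs k)"
   and y: "\<forall>k. T k (ys k) (b k)" "y = (\<Sum>k\<in>{-M'..M'}. ys k)"
   by (auto simp: Rel_def)
  show "br x y \<in> {x. \<exists>a. Rel x a}"
   unfolding x y br_sum_l br_sum_r mem_Collect_eq
   by (intro sumR exI[of _ "\<lambda>l m. if l = _ then _ m else 0"]) (rule Rel_T[OF T_br], use x y in auto)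
 next
  fix h assume "h \<in> H"
  thus "h \<in> {x. \<exists>a. Rel x a}" using Rel_T[of 0 h] by (auto simp: T_0)
 next
  fix i assume i: "i \<le> n"
  have "T 1 (gen_e G i) (cg 1 i)" using P_gen[of i 1] i by (simp add: T_def g_def)
  thus "gen_e G i \<in> {x. \<exists>a. Rel x a}" using Rel_T by blast
  have "T (- 1) (gen_f G i) (cg (- 1) i)" using P_gen[of i "- 1"] i by (simp add: T_def g_def)
  thus "gen_f G i \<in> {x. \<exists>a. Rel x a}" using Rel_T by blast
 qed
 thus ?thesis by simp
qed

lemma per_sum_shift:
 fixes f :: "int \<Rightarrow> complex"
 assumes "\<And>m. f (m + N) = f m"
 shows "(\<Sum>m\<in>{0..<N}. f (m + a)) = (\<Sum>m\<in>{0..<N}. f m)"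
proof -
 have st: "(\<Sum>m\<in>{0..<N}. f (m + b + 1)) = (\<Sum>m\<in>{0..<N}. f (m + b))" for b
 proof -
  have "(\<Sum>m\<in>{0..<N}. f (m + b + 1)) = (\<Sum>m\<in>{1..<N+1}. f (m + b))"
   by (rule sum.reindex_bij_witness[of _ "\<lambda>m. m - 1" "\<lambda>m. m + 1"]) (auto simp: algebra_simps)
  also have "{1..<N+1} = insert N {1..<N}" using N3 by auto
  also have "(\<Sum>m\<in>insert N {1..<N}. f (m + b)) = f b + (\<Sum>m\<in>{1..<N}. f (m + b))"
   using assms[of b] by (simp add: add.commute)
  also have "\<dots> = (\<Sum>m\<in>insert 0 {1..<N}. f (m + b))" by simp
  also have "insert 0 {1..<N} = {0..<N}" using N3 by auto
  finally show ?thesis .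
 qed
 show ?thesis
 proof (induction a rule: int_induct[where k = 0])
  case (step1 a) thus ?case using st[of a] by (simp add: add.assoc)
 next
  case (step2 a) thus ?case using st[of "a - 1"] by (simp add: algebra_simps)
 qed simp
qed

lemma per_mult:
 fixes f :: "int \<Rightarrow> 'x"
 assumes "\<And>m. f (m + N) = f m"
 shows "f (m + z * N) = f m"
proof (induction z rule: int_induct[where k = 0])
 case (step1 z) thus ?case using assms[of "m + z * N"] by (simp add: algebra_simps)
next
 case (step2 z) thus ?case using assms[of "m + (z - 1) * N"] by (simp add: algebra_simps)
qed simp

lemma P_per: "P s k x c \<Longrightarrow> c (m + N) = c m"
proof (induction arbitrary: m rule: P.induct)
 case (P_gen i) show ?case by (rule cg_per)
next
 case (P_br k x c i)
 have "c (m + N + s) = c (m + s)" using P_br.IH[of "m + s"] by (simp add: ac_simps)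
 moreover have "cg s i (m + N + s * int k) = cg s i (m + s * int k)"
  using cg_per[of s i "m + s * int k"] by (simp add: ac_simps)
 ultimately show ?case using P_br.IH[of m] cg_per[of s i m] by (simp add: bc_def)
qed auto

text \<open>Invariance under the twisting involution: the entry at (m, m + sk) equals up to sign the
  one at the mirror position (-m - sk, -m). The sign is fixed by the generators, which are invariant
  and have height 1.\<close>

lemma P_sym:
 assumes "P s k x c" "s = 1 \<or> s = - 1"
 shows "c (- m - s * int k) = - ((- 1) ^ k) * c m"
 using assms(1)
proof (induction arbitrary: m rule: P.induct)
 case (P_gen i) thus ?case using cg_sym[OF assms(2)] by simp
next
 case (P_br k x c i)
 have e: "- m - s * int (Suc k) = - (m + s * int k) - s" "- (m + s * int k) - s + s = - m - s * int k"
  "- (m + s * int k) - s = - (m + s) - s * int k" "- (m + s) - s * int k + s * int k = - m - s"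
  by (simp_all add: algebra_simps)
 have "cg s i (- m - s * int (Suc k)) = cg s i (m + s * int k)"
  unfolding e(1) by (rule cg_sym[OF assms(2)])
 moreover have "c (- m - s * int (Suc k) + s) = - ((- 1) ^ k) * c m"
  unfolding e(1,2) by (rule P_br.IH)
 moreover have "c (- m - s * int (Suc k)) = - ((- 1) ^ k) * c (m + s)"
  unfolding e(1,3) by (rule P_br.IH)
 moreover have "cg s i (- m - s * int (Suc k) + s * int k) = cg s i m"
  unfolding e(1,3,4) by (rule cg_sym[OF assms(2)])
 ultimately show ?case by (simp add: bc_def algebra_simps)
qed (auto simp: algebra_simps)

text \<open>When N divides the shift, the band is a diagonal matrix over the loop ring and the sum
  over a period is its trace. A trace vanishes on commutators, and generators never have such a
  shift.\<close>

lemma P_trace: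
 assumes "P s k x c" "s = 1 \<or> s = - 1" "N dvd int k"
 shows "(\<Sum>m\<in>{0..<N}. c m) = 0"
 using assms(1,3)
proof (induction rule: P.induct)
 case (P_gen i) thus ?case using N3 zdvd_imp_le[of N 1] by simp
next
 case (P_br k x c i)
 obtain z where z: "int (Suc k) = N * z" using P_br.prems by (auto elim: dvdE)
 have "cg s i (m + s * int k) = cg s i (m - s)" for m
 proof -
  have "s * int k = s * (N * z) - s" unfolding z[symmetric] by (simp add: algebra_simps)
  hence "m + s * int k = (m - s) + (s * z) * N" by (simp add: algebra_simps)
  thus ?thesis using per_mult[of "cg s i" "m - s" "s * z"] cg_per by metis
 qed
 hence "(\<Sum>m\<in>{0..<N}. c m * cg s i (m + s * int k)) = (\<Sum>m\<in>{0..<N}. (\<lambda>m. c (m + s) * cg s i m) (m + (- s)))"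
  by (simp add: algebra_simps)
 also have "\<dots> = (\<Sum>m\<in>{0..<N}. c (m + s) * cg s i m)"
 proof (rule per_sum_shift)
  fix m show "c (m + N + s) * cg s i (m + N) = c (m + s) * cg s i m"
   using P_per[OF P_br.hyps(1), of "m + s"] cg_per[of s i m] by (simp add: ac_simps)
 qed
 finally show ?case by (simp add: bc_def sum_subtractf mult.commute)
qed (auto simp: sum.distrib sum_distrib_left[symmetric])

text \<open>If N divides k, commuting with the generators makes c constant, and the trace condition
  leaves 0. Otherwise a nonzero value at m forces equal labels at both ends of the band, at m and
  also at m - s. Both coincidences must come from the reflection, and subtracting them would give
  that N divides 2.\<close>

lemma coef_centraliser:
 assumes per: "\<And>m. c (m + N) = c m" and tr: "N dvd k \<Longrightarrow> (\<Sum>m\<in>{0..<N}. c m) = 0"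
  and s: "s = 1 \<or> s = - 1"
  and z: "\<And>i m. i \<le> n \<Longrightarrow> bc (- s) (s * k) (cg (- s) i) c m = 0"
 shows "c m = 0"
proof -
 define L where "L m = (if s = 1 then lab (m - 1) else lab m)" for m
 have Ln: "L m \<le> n" for m by (simp add: L_def lab_le)
 have Lc: "cg (- s) i m = 0 \<longleftrightarrow> L m \<noteq> i" for i m
  using s by (auto simp: L_def cg_def ka_def)
 have Lc': "cg (- s) (L m) m' = cg (- s) (L m) m" if "L m' = L m" for m m'
  using s that by (auto simp: L_def cg_def ka_def)
 have eq: "cg (- s) i m * c (m - s) = c m * cg (- s) i (m + s * k)" if "i \<le> n" for i m
  using z[OF that, of m] by (simp add: bc_def)
 have step: "c (m - s) = c m" if "L (m + s * k) = L m" for m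
  using eq[OF Ln, of m m] Lc[of "L m" m] Lc'[OF that] by auto
 have step': "c m = 0" if "L (m + s * k) \<noteq> L m" for m
 proof -
  have "cg (- s) (L (m + s * k)) m = 0" "cg (- s) (L (m + s * k)) (m + s * k) \<noteq> 0" using Lc that by auto
  thus ?thesis using eq[OF Ln, of "m + s * k" m] by auto
 qed
 show ?thesis
 proof (cases "N dvd k")
  case True
  then obtain w where w: "k = N * w" by (auto elim: dvdE)
  have "L (m + s * k) = L m" for m
  proof -
   have e: "m + s * k = m + (s * w) * N" "m + (s * w) * N - 1 = (m - 1) + (s * w) * N" by (simp_all add: w)
   show ?thesis unfolding L_def e lab_shift ..
  qed
  hence st: "c (m - s) = c m" for m using step by blast
  hence st1: "c (m + 1) = c m" for m using s st[of "m + 1"] st[of m]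
   by (metis add_diff_cancel_right' diff_minus_eq_add)
  have const: "c m = c 0" for m
  proof (induction m rule: int_induct[where k = 0])
   case (step1 a) thus ?case using st1[of a] by simp
  next
   case (step2 a) thus ?case using st1[of "a - 1"] by simp
  qed simp
  have "of_int N * c 0 = (\<Sum>m\<in>{0..<N}. c 0)" using N3 by simp
  also have "\<dots> = (\<Sum>m\<in>{0..<N}. c m)" by (intro sum.cong) (auto simp: const[symmetric])
  finally show ?thesis using tr[OF True] N3 const[of m] by simp
 next
  case False
  show ?thesis
  proof (rule ccontr)
   assume nz: "c m \<noteq> 0"
   have 1: "L (m + s * k) = L m" using step' nz by blast
   hence "c (m - s) \<noteq> 0" using step nz by metis
   hence 2: "L (m - s + s * k) = L (m - s)" using step' by blast
   have nd: "\<not> N dvd s * k" using False s by auto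
   \<comment> \<open>With this offset \<open>L m\<close> is \<open>lab (m - e)\<close> for either
     sign.\<close>
   define e where "e = (if s = 1 then 1 else 0 :: int)"
   have "N dvd (m + s * k - e) + (m - e) + 1"
    using 1 nd lab_eqD[of "m + s * k - e" "m - e"] by (auto simp: L_def e_def split: if_splits)
   moreover have "N dvd (m - s + s * k - e) + (m - s - e) + 1"
    using 2 nd lab_eqD[of "m - s + s * k - e" "m - s - e"] by (auto simp: L_def e_def split: if_splits)
   ultimately have "N dvd ((m + s * k - e) + (m - e) + 1) - ((m - s + s * k - e) + (m - s - e) + 1)"
    by (rule dvd_diff)
   hence "N dvd 2 * s" by (simp add: algebra_simps)
   hence "N dvd 2" using s by auto
   thus False using N3 zdvd_imp_le[of N 2] by simp
  qed
 qed
qed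

text \<open>Induction on the height. The bracket of 0 with an opposite generator is 0 of smaller
  height, so by induction c commutes with every opposite generator and
  \<open>coef_centraliser\<close> applies.\<close>

lemma P_zero_coef:
 assumes "P s k x c" "x = 0" "s = 1 \<or> s = - 1"
 shows "c m = 0"
 using assms
proof (induction k arbitrary: x c m)
 case 0 thus ?case using P_pos by force
next
 case (Suc k)
 show ?case
 proof (rule coef_centraliser[OF P_per[OF Suc.prems(1)] P_trace[OF Suc.prems(1,3)] Suc.prems(3)])
  fix i m assume i: "i \<le> n"
  have "T (s * int (Suc k) - s) (br (g (- s) i) x) (bc (- s) (s * int (Suc k)) (cg (- s) i) c)"
   using Suc i by (intro P_opp) auto
  hence t: "T (s * int k) 0 (bc (- s) (s * int (Suc k)) (cg (- s) i) c)"
   using Suc by (simp add: algebra_simps)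
  show "bc (- s) (s * int (Suc k)) (cg (- s) i) c m = 0"
  proof (cases "k = 0")
   case True thus ?thesis using t by (simp add: T_0)
  next
   case False
   thus ?thesis using t Suc.IH[OF _ _ Suc.prems(3)] Suc.prems(3) by (simp add: T_P)
  qed
 qed
qed

inductive idl :: "int \<Rightarrow> 'g \<Rightarrow> 'g \<Rightarrow> bool" for s x where
 idl_base: "idl s x x"
| idl_g: "idl s x y \<Longrightarrow> i \<le> n \<Longrightarrow> idl s x (br (g s i) y)"
| idl_h: "idl s x y \<Longrightarrow> h \<in> H \<Longrightarrow> idl s x (br h y)"
| idl_add: "idl s x y \<Longrightarrow> idl s x z \<Longrightarrow> idl s x (y + z)"
| idl_sm: "idl s x y \<Longrightarrow> idl s x (sm a y)"

text \<open>As x commutes with the opposite generators, the ideal it generates is spanned using only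
  H and the generators of sign s. It therefore lives in heights of sign s, misses H, and vanishes by
  the maximality in the definition of the algebra.\<close>

lemma P_centraliser:
 assumes "P s k x c" "s = 1 \<or> s = - 1" "\<And>i. i \<le> n \<Longrightarrow> br (g (- s) i) x = 0"
 shows "x = 0"
proof -
 define I where "I = Collect (idl s x)"
 have z: "idl s x 0" using idl_sm[OF idl_base, of s x 0] by simp
 have opp: "idl s x (br (g (- s) i) y)" if "idl s x y" "i \<le> n" for y i
  using that
 proof induction
  case idl_base thus ?case using assms(3) z by simp
 next
  case (idl_g y j)
  have "br (g (- s) i) (br (g s j) y) = br (br (g (- s) i) (g s j)) y + br (g s j) (br (g (- s) i) y)"
   by (rule jac)
  thus ?case using opp_gens[OF that(2) idl_g.hyps(2) assms(2)] idl_g that(2)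
   by (auto intro!: idl.idl_add idl.idl_h[OF idl_g.hyps(1)] idl.idl_g)
 next
  case (idl_h y h)
  have "br (g (- s) i) h = sm (- (of_int (- s) * al i h)) (g (- s) i)"
   using idl_h that(2) assms(2) by (subst br_anti, subst br_h_g) auto
  hence "br (g (- s) i) (br h y) = sm (- (of_int (- s) * al i h)) (br (g (- s) i) y) + br h (br (g (- s) i) y)"
   by (subst jac) (simp add: br_sm_l)
  thus ?case using idl_h that(2) by (auto intro!: idl.idl_add idl.idl_sm idl.idl_h)
 qed (auto simp: br_add_r br_sm_r intro: idl_add idl_sm)
 have "lie_ideal G I"
 proof (rule ideal_criterion)
  show "V.subspace I" unfolding V.subspace_def I_def using z by (auto intro: idl_add idl_sm)
  fix i y assume i: "i \<le> n" "y \<in> I"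
  hence "idl s x (br (g s i) y)" "idl s x (br (g (- s) i) y)" using opp by (auto simp: I_def intro: idl_g)
  thus "br (gen_e G i) y \<in> I" "br (gen_f G i) y \<in> I"
   using assms(2) by (auto simp: I_def g_def)
 qed (auto simp: I_def intro: idl_h)
 moreover have "I \<inter> H = {0}"
 proof -
  have gr: "\<exists>ys (M::int). (\<forall>k. \<exists>c. T k (ys k) c) \<and> (\<forall>k. \<bar>k\<bar> > M \<longrightarrow> ys k = 0)
    \<and> (\<forall>k. s * k \<le> 0 \<longrightarrow> ys k = 0) \<and> y = (\<Sum>k\<in>{-M..M}. ys k)" if "idl s x y" for y
   using that
  proof induction
   case idl_base
   have "T (s * int k) x c" using assms P_pos[OF assms(1)] by (simp add: T_P)
   thus ?case
    using assms(2) P_pos[OF assms(1)] T_zero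
    by (intro exI[of _ "\<lambda>l. if l = s * int k then x else 0"] exI[of _ "\<bar>s * int k\<bar>"])
     (auto simp: sum.delta')
  next
   case (idl_g y i)
   then obtain ys and M :: int where y: "\<forall>k. \<exists>c. T k (ys k) c" "\<forall>k. \<bar>k\<bar> > M \<longrightarrow> ys k = 0"
    "\<forall>k. s * k \<le> 0 \<longrightarrow> ys k = 0" "y = (\<Sum>k\<in>{-M..M}. ys k)" by blast
   show ?case
   proof (rule exI[of _ "\<lambda>k. br (g s i) (ys (k - s))"], rule exI[of _ "M + 1"], intro conjI allI impI)
    fix k
    obtain c where "T (k - s) (ys (k - s)) c" using y by blast
    from T_gen[OF this idl_g.hyps(2) assms(2)]
    have "T k (br (g s i) (ys (k - s))) (bc s (k - s) (cg s i) c)" by simp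
    thus "\<exists>c. T k (br (g s i) (ys (k - s))) c" by blast
   next
    fix k :: int assume "\<bar>k\<bar> > M + 1"
    hence "\<bar>k - s\<bar> > M" using assms(2) by auto
    hence "ys (k - s) = 0" using y(2) by blast
    thus "br (g s i) (ys (k - s)) = 0" by simp
   next
    fix k :: int assume "s * k \<le> 0"
    hence "s * (k - s) \<le> 0" using assms(2) by auto
    thus "br (g s i) (ys (k - s)) = 0" using y(3) by simp
   next
    have "br (g s i) y = (\<Sum>k\<in>{-M..M}. br (g s i) (ys k))" by (simp add: y(4) br_sum_r)
    also have "\<dots> = (\<Sum>k\<in>{-M + s..M + s}. br (g s i) (ys (k - s)))"
     by (rule sum.reindex_bij_witness[of _ "\<lambda>k. k - s" "\<lambda>k. k + s"]) auto
    also have "\<dots> = (\<Sum>k\<in>{-(M+1)..M+1}. br (g s i) (ys (k - s)))"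
     by (rule sum.mono_neutral_left) (use y(2) assms(2) in auto)
    finally show "br (g s i) y = (\<Sum>k\<in>{-(M+1)..M+1}. br (g s i) (ys (k - s)))" .
   qed
  next
   case (idl_h y h)
   then obtain ys and M :: int where y: "\<forall>k. \<exists>c. T k (ys k) c" "\<forall>k. \<bar>k\<bar> > M \<longrightarrow> ys k = 0"
    "\<forall>k. s * k \<le> 0 \<longrightarrow> ys k = 0" "y = (\<Sum>k\<in>{-M..M}. ys k)" by blast
   thus ?case using T_h[OF _ idl_h.hyps(2)]
    by (intro exI[of _ "\<lambda>k. br h (ys k)"] exI[of _ M]) (auto simp: br_sum_r, blast)
  next
   case (idl_add y z)
   then obtain ys zs and M M' :: int where y: "\<forall>k. \<exists>c. T k (ys k) c" "\<forall>k. \<bar>k\<bar> > M \<longrightarrow> ys k = 0"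
    "\<forall>k. s * k \<le> 0 \<longrightarrow> ys k = 0" "y = (\<Sum>k\<in>{-M..M}. ys k)"
    and w: "\<forall>k. \<exists>c. T k (zs k) c" "\<forall>k. \<bar>k\<bar> > M' \<longrightarrow> zs k = 0"
    "\<forall>k. s * k \<le> 0 \<longrightarrow> zs k = 0" "z = (\<Sum>k\<in>{-M'..M'}. zs k)" by blast
   have "\<forall>k. \<exists>c. T k (ys k + zs k) c" using y(1) w(1) T_add by meson
   thus ?case using y w sum_extend[OF y(2), of "max M M'"] sum_extend[OF w(2), of "max M M'"]
    by (intro exI[of _ "\<lambda>k. ys k + zs k"] exI[of _ "max M M'"]) (auto simp: sum.distrib)
  next
   case (idl_sm y a)
   then obtain ys and M :: int where y: "\<forall>k. \<exists>c. T k (ys k) c" "\<forall>k. \<bar>k\<bar> > M \<longrightarrow> ys k = 0"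
    "\<forall>k. s * k \<le> 0 \<longrightarrow> ys k = 0" "y = (\<Sum>k\<in>{-M..M}. ys k)" by blast
   have "\<forall>k. \<exists>c. T k (sm a (ys k)) c" using y(1) T_sm by meson
   thus ?case using y
    by (intro exI[of _ "\<lambda>k. sm a (ys k)"] exI[of _ M]) (auto simp: V.scale_sum_right)
  qed
  have "y = 0" if y: "idl s x y" "y \<in> H" for y
  proof -
   obtain ys and M :: int where ys: "\<forall>k. \<exists>c. T k (ys k) c" "\<forall>k. \<bar>k\<bar> > M \<longrightarrow> ys k = 0"
    "\<forall>k. s * k \<le> 0 \<longrightarrow> ys k = 0" "y = (\<Sum>k\<in>{-M..M}. ys k)" using gr[OF y(1)] by blast
   have ext: "y = (\<Sum>k\<in>{-max M 0..max M 0}. ys k)" using sum_extend[OF ys(2), of "max M 0"] ys(4) by simp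
   have ev: "br h0 (ys k) = sm (of_int k) (ys k)" for k using ys(1) T_eigen by blast
   \<comment> \<open>An element of H has height 0, so the components of y in heights of sign s must
     cancel against y separately.\<close>
   have "(\<lambda>k. ys k - (if k = 0 then y else 0)) 0 = 0"
    by (rule graded_zero[of _ "max M 0"])
     (use ev ext ys(2) y h0 in \<open>auto simp: br_diff_r V.scale_right_diff_distrib HH0 sum_subtractf sum.delta'\<close>)
   thus ?thesis using ys(3) by simp
  qed
  thus ?thesis using z H0 by (auto simp: I_def)
 qed
 ultimately have "I = {0}" by (rule no_ideal)
 thus ?thesis using idl_base[of s x] by (auto simp: I_def)
qed

end

definition sg :: "int \<Rightarrow> complex" where "sg k = (if even k then 1 else - 1)"

lemma sg_mult_self [simp]: "sg k * sg k = 1" by (simp add: sg_def)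

lemma sg_add: "sg (a + b) = sg a * sg b" and sg_diff: "sg (a - b) = sg a * sg b"
 and sg_minus: "sg (- a) = sg a"
 by (auto simp: sg_def)

context A2n2
begin

lemma sg_N: "sg N = - 1" "sg (k * N) = sg k" by (auto simp: sg_def N_def)

lemma P1_lin:
 "P s k x c \<Longrightarrow> k = 1 \<Longrightarrow> \<exists>a. x = (\<Sum>j\<le>n. sm (a j) (g s j)) \<and> c = (\<lambda>m. \<Sum>j\<le>n. a j * cg s j m)"
proof (induction rule: P.induct)
 case (P_gen i)
 have A: "g s i = (\<Sum>j\<le>n. sm (of_bool (j = i)) (g s j))"
 proof -
  have "(\<Sum>j\<le>n. sm (of_bool (j = i)) (g s j)) = (\<Sum>j\<in>{i}. sm (of_bool (j = i)) (g s j))"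
   by (rule sum.mono_neutral_right) (use P_gen in auto)
  thus ?thesis by simp
 qed
 have B: "cg s i m = (\<Sum>j\<le>n. of_bool (j = i) * cg s j m)" for m
 proof -
  have "(\<Sum>j\<le>n. of_bool (j = i) * cg s j m) = (\<Sum>j\<in>{i}. of_bool (j = i) * cg s j m)"
   by (rule sum.mono_neutral_right) (use P_gen in auto)
  thus ?thesis by simp
 qed
 show ?case by (rule exI) (rule conjI[OF A ext[of "cg s i", OF B]])
next
 case (P_br k x c i) thus ?case using P_pos[of s k x c] by simp
next
 case (P_zero k) thus ?case by (intro exI[of _ "\<lambda>_. 0"]) simp
next
 case (P_add k x c y d)
 then obtain a b where "x = (\<Sum>j\<le>n. sm (a j) (g s j))" "c = (\<lambda>m. \<Sum>j\<le>n. a j * cg s j m)"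
  "y = (\<Sum>j\<le>n. sm (b j) (g s j))" "d = (\<lambda>m. \<Sum>j\<le>n. b j * cg s j m)" by blast
 thus ?case by (intro exI[of _ "\<lambda>j. a j + b j"])
  (auto simp: V.scale_left_distrib distrib_right sum.distrib)
next
 case (P_sm k x c b)
 then obtain a where "x = (\<Sum>j\<le>n. sm (a j) (g s j))" "c = (\<lambda>m. \<Sum>j\<le>n. a j * cg s j m)" by blast
 thus ?case by (intro exI[of _ "\<lambda>j. b * a j"])
  (auto simp: V.scale_sum_right sum_distrib_left mult.assoc)
qed

text \<open>The counterpart of \<open>P_zero_coef\<close>: the brackets of x with opposite
  generators have matrix 0 and smaller height, so they vanish by induction and
  \<open>P_centraliser\<close> gives x = 0. In height 1 the coefficients are read off
  directly.\<close>

lemma P_inj: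
 assumes "P s k x c" "s = 1 \<or> s = - 1" "\<And>m. c m = 0"
 shows "x = 0"
 using assms(1,3)
proof (induction k arbitrary: x c)
 case 0 thus ?case using P_pos by force
next
 case (Suc k)
 show ?case
 proof (cases "k = 0")
  case True
  then obtain a where a: "x = (\<Sum>j\<le>n. sm (a j) (g s j))" "c = (\<lambda>m. \<Sum>j\<le>n. a j * cg s j m)"
   using P1_lin Suc.prems(1) by fastforce
  have "a j = 0" if "j \<le> n" for j
  proof -
   \<comment> \<open>A row in which generator j is the only generator of sign s with a nonzero
     coefficient.\<close>
   define m where "m = (if s = 1 then int j else int j + 1)"
   have cgm: "cg s i m = (if i = j then (if s = 1 then 1 else ka j) else 0)" for i
    using lab_self[OF that] by (auto simp: cg_def m_def)
   have "0 = (\<Sum>i\<le>n. a i * cg s i m)" using Suc.prems(2)[of m] a by simp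
   also have "\<dots> = (\<Sum>i\<in>{j}. a i * cg s i m)"
    by (rule sum.mono_neutral_right) (use that cgm in auto)
   finally show ?thesis using cgm[of j] by (auto simp: ka_def split: if_splits)
  qed
  thus ?thesis using a by simp
 next
  case False
  show ?thesis
  proof (rule P_centraliser[OF Suc.prems(1) assms(2)])
   fix i assume i: "i \<le> n"
   have "T (s * int (Suc k) - s) (br (g (- s) i) x) (bc (- s) (s * int (Suc k)) (cg (- s) i) c)"
    by (intro P_opp Suc.prems i assms(2))
   moreover have "s * int (Suc k) - s = s * int k" by (simp add: algebra_simps)
   ultimately have "P s k (br (g (- s) i) x) (bc (- s) (s * int (Suc k)) (cg (- s) i) c)"
    using False assms(2) by (simp add: T_P)
   thus "br (g (- s) i) x = 0"
    by (rule Suc.IH) (simp add: bc_def Suc.prems(2))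
  qed
 qed
qed

lemma T_zero_coef: "T k 0 c \<Longrightarrow> c m = 0"
 by (cases rule: T_cases) (auto intro: P_zero_coef)

lemma T_inj: "T k x c \<Longrightarrow> k \<noteq> 0 \<Longrightarrow> (\<And>m. c m = 0) \<Longrightarrow> x = 0"
 by (cases rule: T_cases) (auto intro: P_inj)

lemma Rel_0: "Rel 0 a \<Longrightarrow> a k m = 0"
proof -
 assume "Rel 0 a"
 then obtain xs and M :: int where x: "\<forall>k. T k (xs k) (a k)" "\<forall>k. \<bar>k\<bar> > M \<longrightarrow> xs k = 0"
  "0 = (\<Sum>k\<in>{-M..M}. xs k)"
  by (auto simp: Rel_def)
 have "xs k = 0"
  by (rule graded_zero[of xs M]) (use x(2,3) T_eigen[OF x(1)[rule_format]] in auto)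
 thus ?thesis using x(1) T_zero_coef by metis
qed

lemma Rel_unique: "Rel x a \<Longrightarrow> Rel x b \<Longrightarrow> a = b"
proof -
 assume ab: "Rel x a" "Rel x b"
 have "Rel (x + sm (- 1) x) (\<lambda>k m. a k m + (- 1) * b k m)"
  by (intro Rel_add Rel_sm ab)
 hence "Rel 0 (\<lambda>k m. a k m + (- 1) * b k m)" by simp
 from Rel_0[OF this] show ?thesis by (auto simp: fun_eq_iff)
qed

section \<open>The matrix of an element and the matrices of root vectors\<close>

definition Phi :: "'g \<Rightarrow> int \<Rightarrow> int \<Rightarrow> complex" where "Phi x = (THE a. Rel x a)"

lemma Rel_Phi: "Rel x (Phi x)"
proof -
 obtain a where a: "Rel x a" using Rel_total by auto
 show ?thesis unfolding Phi_def by (rule theI[of "Rel x", OF a]) (rule Rel_unique[OF _ a])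
qed

lemma Phi_eqI: "Rel x a \<Longrightarrow> Phi x = a"
 by (rule Rel_unique[OF Rel_Phi])

lemma Phi_add: "Phi (x + y) k m = Phi x k m + Phi y k m"
 using Phi_eqI[OF Rel_add[OF Rel_Phi Rel_Phi], of x y] by simp

lemma Phi_sm: "Phi (sm c x) k m = c * Phi x k m"
 using Phi_eqI[OF Rel_sm[OF Rel_Phi], of c x] by simp

lemma Phi_T: "T k x c \<Longrightarrow> Phi x l m = (if l = k then c m else 0)"
 using Phi_eqI[OF Rel_T, of k x c] by simp

lemma Phi_0 [simp]: "Phi 0 k m = 0" using Phi_sm[of 0 0] by simp

lemma Phi_minus: "Phi (- x) k m = - Phi x k m"
 using Phi_add[of x "- x" k m] by (simp add: eq_neg_iff_add_eq_0 add.commute)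

lemma Phi_diff: "Phi (x - y) k m = Phi x k m - Phi y k m"
 using Phi_add[of x "- y"] by (simp add: Phi_minus)

lemma Phi_decomp:
 obtains xs and M :: int where "\<And>k. T k (xs k) (Phi x k)" "\<And>k. \<bar>k\<bar> > M \<Longrightarrow> xs k = 0"
  "x = (\<Sum>k\<in>{-M..M}. xs k)"
 using Rel_Phi[of x] unfolding Rel_def by blast

lemma Phi_induct:
 assumes "\<And>k x c. T k x c \<Longrightarrow> Q x" "\<And>x y. Q x \<Longrightarrow> Q y \<Longrightarrow> Q (x + y)"
 shows "Q x"
proof -
 obtain xs and M :: int where x: "\<And>k. T k (xs k) (Phi x k)" "x = (\<Sum>k\<in>{-M..M}. xs k)"
  by (rule Phi_decomp[of x]) blast
 have "Q 0" by (rule assms(1)[OF T_zero])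
 moreover have "Q (xs k)" for k by (rule assms(1)[OF x(1)])
 ultimately have "Q (sum xs K)" for K :: "int set"
  by (induction K rule: infinite_finite_induct) (auto intro: assms(2))
 thus ?thesis using x by simp
qed

lemma Phi_bounded: "\<exists>M. \<forall>k m. \<bar>k\<bar> > M \<longrightarrow> Phi x k m = 0"
proof -
 obtain xs and M :: int where x: "\<And>k. T k (xs k) (Phi x k)" "\<And>k. \<bar>k\<bar> > M \<Longrightarrow> xs k = 0"
  by (rule Phi_decomp[of x]) blast
 thus ?thesis using T_zero_coef by metis
qed

lemma Phi_finite: "finite {k. Phi x k m \<noteq> 0}"
proof -
 obtain M where M: "\<forall>k m. \<bar>k\<bar> > M \<longrightarrow> Phi x k m = 0" using Phi_bounded by blast
 have "{k. Phi x k m \<noteq> 0} \<subseteq> {-M..M}"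
 proof
  fix k assume "k \<in> {k. Phi x k m \<noteq> 0}"
  hence "\<not> \<bar>k\<bar> > M" using M by blast
  thus "k \<in> {-M..M}" by auto
 qed
 thus ?thesis by (rule finite_subset) simp
qed

lemma Phi_per: "k \<noteq> 0 \<Longrightarrow> Phi x k (m + N) = Phi x k m"
proof -
 assume k: "k \<noteq> 0"
 obtain xs where "T k (xs k) (Phi x k)" by (rule Phi_decomp[of x]) blast
 thus ?thesis by (cases rule: T_cases) (use k P_per in auto)
qed

lemma Phi_sym: "k \<noteq> 0 \<Longrightarrow> Phi x k (- m - k) = - sg k * Phi x k m"
proof -
 assume k: "k \<noteq> 0"
 obtain xs where "T k (xs k) (Phi x k)" by (rule Phi_decomp[of x]) blast
 thus ?thesis
 proof (cases rule: T_cases)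
  case (2 s l)
  have "sg k = (- 1) ^ l" using 2 by (auto simp: sg_def)
  thus ?thesis using P_sym[OF 2(4,1), of m] 2 by simp
 qed (use k in auto)
qed

lemma Phi_trace: "k \<noteq> 0 \<Longrightarrow> N dvd k \<Longrightarrow> (\<Sum>m\<in>{0..<N}. Phi x k m) = 0"
proof -
 assume k: "k \<noteq> 0" "N dvd k"
 obtain xs where "T k (xs k) (Phi x k)" by (rule Phi_decomp[of x]) blast
 thus ?thesis
 proof (cases rule: T_cases)
  case (2 s l)
  thus ?thesis using P_trace[OF 2(4,1)] k by auto
 qed (use k in auto)
qed

lemma Phi_H: "h \<in> H \<Longrightarrow> Phi h k m = (if k = 0 then pih h m else 0)"
 using Phi_T[of 0 h "pih h"] by (simp add: T_0)

lemma Phi_h: "h \<in> H \<Longrightarrow> Phi (br h x) k m = (pih h m - pih h (m + k)) * Phi x k m"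
proof (induction x rule: Phi_induct)
 case (1 l x c)
 thus ?case using Phi_T[OF T_h[OF 1(1,2)], of k m] Phi_T[OF 1(1), of k m]
  by (auto simp: bc_def algebra_simps)
next
 case (2 x y) thus ?case by (simp add: br_add_r Phi_add algebra_simps)
qed

text \<open>Only the component of height 0 can be lost: a Cartan element on which all simple roots
  vanish has zero diagonal. This kernel is the centre.\<close>

lemma Phi_inj: "(\<And>k m. Phi x k m = 0) \<Longrightarrow> x \<in> H"
proof -
 assume z: "\<And>k m. Phi x k m = 0"
 obtain xs and M :: int where x: "\<And>k. T k (xs k) (Phi x k)" "x = (\<Sum>k\<in>{-M..M}. xs k)"
  by (rule Phi_decomp[of x]) blast
 have "xs k \<in> H" for k
 proof (cases "k = 0")
  case True thus ?thesis using x(1)[of 0] by (simp add: T_0)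
 next
  case False thus ?thesis using T_inj[OF x(1) False] z H0 by simp
 qed
 thus ?thesis unfolding x(2) by (rule H_sum)
qed

lemma rsD: "x \<in> root_space G \<beta> \<Longrightarrow> h \<in> H \<Longrightarrow> br h x = sm (\<beta> h) x"
 by (simp add: root_space_def)

lemma rs_Phi: "x \<in> root_space G \<beta> \<Longrightarrow> h \<in> H \<Longrightarrow> Phi x k m \<noteq> 0 \<Longrightarrow> \<beta> h = pih h m - pih h (m + k)"
 using Phi_h[of h x k m] by (simp add: rsD Phi_sm)

lemma rs_inj: "x \<in> root_space G \<beta> \<Longrightarrow> (\<And>k m. Phi x k m = 0) \<Longrightarrow> h \<in> H \<Longrightarrow> \<beta> h \<noteq> 0 \<Longrightarrow> x = 0"
 using Phi_inj[of x] HH0[of h x] rsD[of x \<beta> h] by auto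

lemma rs_zero: "0 \<in> root_space G \<beta>" by (simp add: root_space_def)

lemma rs_add: "x \<in> root_space G \<beta> \<Longrightarrow> y \<in> root_space G \<beta> \<Longrightarrow> x + y \<in> root_space G \<beta>"
 by (simp add: root_space_def br_add_r V.scale_right_distrib)

lemma rs_sm: "x \<in> root_space G \<beta> \<Longrightarrow> sm c x \<in> root_space G \<beta>"
 by (simp add: root_space_def br_sm_r mult.commute)

lemma rs_diff: "x \<in> root_space G \<beta> \<Longrightarrow> y \<in> root_space G \<beta> \<Longrightarrow> x - y \<in> root_space G \<beta>"
 by (simp add: root_space_def br_diff_r V.scale_right_diff_distrib)

lemma rs_br:
 assumes "x \<in> root_space G \<beta>" "y \<in> root_space G \<gamma>" "\<And>h. h \<in> H \<Longrightarrow> \<epsilon> h = \<beta> h + \<gamma> h"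
 shows "br x y \<in> root_space G \<epsilon>"
 using assms by (auto simp: root_space_def jac[of _ x y] br_sm_l br_sm_r V.scale_left_distrib)

lemma rs_I:
 assumes "T k x c" "\<And>h m. h \<in> H \<Longrightarrow> c m \<noteq> 0 \<Longrightarrow> \<beta> h = pih h m - pih h (m + k)" "k \<noteq> 0"
 shows "x \<in> root_space G \<beta>"
 unfolding root_space_def
proof safe
 fix h assume h: "h \<in> H"
 have "T k (br h x + sm (- \<beta> h) x) (\<lambda>m. bc 0 k (pih h) c m + - \<beta> h * c m)"
  by (intro T_add T_sm T_h assms h)
 hence "br h x + sm (- \<beta> h) x = 0"
 proof (rule T_inj)
  fix m show "bc 0 k (pih h) c m + - \<beta> h * c m = 0"
   by (cases "c m = 0") (simp_all add: bc_def assms(2)[OF h, of m] algebra_simps)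
 qed (rule assms(3))
 thus "br h x = sm (\<beta> h) x" by simp
qed

subsection \<open>Explicit root vectors\<close>

text \<open>The entry (i, j) together with its mirror image (-j, -i), both repeated with period N;
  the shift of this band is j - i.\<close>

definition Xc :: "int \<Rightarrow> int \<Rightarrow> int \<Rightarrow> complex" where
 "Xc i j m = of_bool (N dvd m - i) - sg (i + j) * of_bool (N dvd m + j)"

text \<open>A diagonal matrix in loop degree k with entry 1 at j and the mirror entry at -j. The
  last term, at the fixed point 0 of the reflection, makes the trace vanish.\<close>

definition Zc :: "int \<Rightarrow> int \<Rightarrow> int \<Rightarrow> complex" where
 "Zc j k m = of_bool (N dvd m - j) - sg k * of_bool (N dvd m + j) - (1 - sg k) * of_bool (N dvd m)"

lemma lab_cong: "N dvd a - b \<Longrightarrow> lab a = lab b"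
proof -
 assume "N dvd a - b"
 hence "a mod N = b mod N" by (simp add: mod_eq_dvd_iff)
 thus ?thesis by (simp add: lab_def)
qed

lemma ndvd: "0 < a \<Longrightarrow> a < N \<Longrightarrow> \<not> N dvd a" "0 < a \<Longrightarrow> a < N \<Longrightarrow> \<not> N dvd 2 * a"
proof -
 assume a: "0 < a" "a < N"
 thus "\<not> N dvd a" using zdvd_imp_le by fastforce
 have "coprime N 2" by (simp add: N_def)
 thus "\<not> N dvd 2 * a" using \<open>\<not> N dvd a\<close> coprime_dvd_mult_right_iff by blast
qed

lemma lab_pos: "0 < i \<Longrightarrow> i < 2 * int n \<Longrightarrow> lab i \<noteq> 0"
 by (auto simp: lab_def N_def)

lemma lab0_iff: "lab m = 0 \<longleftrightarrow> N dvd m \<or> N dvd m + 1"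
proof -
 have "lab 0 = 0" using lab_self[of 0] by simp
 thus ?thesis using lab_eqD[of m 0] lab_cong[of m 0] lab_cong[of m "- 1"] lab_refl[of 0] by auto
qed

text \<open>The bracket with the generator of label \<open>lab i\<close> lengthens the band by one.
  Strictly between 0 and 2n no step has label 0, so that generator does not touch the other end of
  the band.\<close>

lemma hasX_0: "0 < i \<Longrightarrow> i \<le> 2 * int n \<Longrightarrow> \<exists>x. T i x (Xc 0 i)"
proof (induction i rule: int_gr_induct[where k = 0])
 case base
 have "T 1 (g 1 0) (cg 1 0)" using P_gen[of 0 1] by (simp add: T_def)
 moreover have "cg 1 0 = Xc 0 1"
 proof
  fix m
  have "\<not> (N dvd m \<and> N dvd m + 1)" using ndvd(1)[of 1] N3 by (auto simp: dvd_add_right_iff)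
  thus "cg 1 0 m = Xc 0 1 m" by (auto simp: cg_def Xc_def lab0_iff sg_def)
 qed
 ultimately show ?case by auto
next
 case (step i)
 then obtain x where x: "T i x (Xc 0 i)" by auto
 have i: "0 < i" "i < 2 * int n" using step by auto
 have "T (i + 1) (br x (g 1 (lab i))) (bc i 1 (Xc 0 i) (cg 1 (lab i)))"
  by (rule T_br[OF x]) (use P_gen[of "lab i" 1] lab_le in \<open>simp add: T_def\<close>)
 moreover have "bc i 1 (Xc 0 i) (cg 1 (lab i)) m = Xc 0 (i + 1) m" for m
 proof -
  have l0: "lab i \<noteq> 0" using lab_pos i by auto
  have 1: "cg 1 (lab i) (m + i) = 1" if "N dvd m" using lab_cong[of "m + i" i] that by (simp add: cg_def)
  have 2: "cg 1 (lab i) (m + i) = 0" if "N dvd m + i"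
   using lab0_iff[of "m + i"] that l0 by (simp add: cg_def)
  have 3: "cg 1 (lab i) m = 0" if "N dvd m + 1"
   using lab0_iff[of m] that l0 by (simp add: cg_def)
  have 4: "cg 1 (lab i) m = 1" if "N dvd m + 1 + i"
  proof -
   have "m - (- 1 - i) = m + 1 + i" by simp
   hence "lab m = lab i" using lab_cong[of m "- 1 - i"] that unfolding lab_refl by (simp only:)
   thus ?thesis by (simp add: cg_def)
  qed
  show ?thesis
   using 1 2 3 4 by (auto simp: bc_def Xc_def sg_add ac_simps) (auto simp: sg_def)
 qed
 ultimately show ?case by (metis ext)
qed

text \<open>Up to sign this is the mirror image of \<open>Xc 0 (N - j)\<close>, translated by one
  period.\<close>

lemma hasX_N:
 assumes "0 < j" "j \<le> 2 * int n"
 shows "\<exists>x. T (N - j) x (Xc j N)"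
proof -
 obtain x where x: "T (N - j) x (Xc 0 (N - j))" using hasX_0[of "N - j"] assms by (auto simp: N_def)
 have "Xc j N = (\<lambda>m. - sg (j + N) * Xc 0 (N - j) m)"
 proof
  fix m
  have "N dvd m + (N - j) \<longleftrightarrow> N dvd m - j"
   using dvd_add_times_triv_right_iff[of N "m - j" 1] by (simp add: algebra_simps)
  moreover have "N dvd m + N \<longleftrightarrow> N dvd m" by simp
  ultimately show "Xc j N m = - sg (j + N) * Xc 0 (N - j) m"
   by (simp add: Xc_def sg_add sg_diff sg_N algebra_simps)
 qed
 thus ?thesis using T_sm[OF x] by metis
qed

lemma dvd_shift: "N dvd a + k * N \<longleftrightarrow> N dvd a" "N dvd a + N \<longleftrightarrow> N dvd a"
 by (simp_all add: dvd_add_left_iff)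

lemma bool_alg:
 fixes s t u :: complex
 assumes "\<not> (a \<and> b)" "\<not> (a \<and> c)" "\<not> (b \<and> c)" "u * t = s"
 shows "(of_bool b - u * of_bool a) * (of_bool b - t * of_bool a) - (of_bool a - t * of_bool c) * (of_bool a - u * of_bool c)
  = of_bool b - s * of_bool c - (1 - s) * of_bool a"
 using assms by auto

lemma bc_XX:
 assumes "0 < j" "j \<le> 2 * int n"
 shows "bc (k * N - j) j (Xc j (k * N)) (Xc 0 j) = Zc j k"
proof
 fix m
 define a b c where "a = (N dvd m)" and "b = (N dvd m - j)" and "c = (N dvd m + j)"
 have jN: "j < N" using assms by (simp add: N_def)
 have ab: "\<not> (a \<and> b)" using ndvd(1)[OF assms(1) jN] dvd_diff[of N m "m - j"] by (auto simp: a_def b_def)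
 have ac: "\<not> (a \<and> c)" using ndvd(1)[OF assms(1) jN] dvd_diff[of N "m + j" m] by (auto simp: a_def c_def)
 have bd: "\<not> (b \<and> c)" using ndvd(2)[OF assms(1) jN] dvd_diff[of N "m + j" "m - j"] by (auto simp: b_def c_def)
 have e: "m + (k * N - j) - 0 = m - j + k * N" "m + (k * N - j) + j = m + k * N" "m + j - j = m"
  "m + j + k * N = m + j + k * N" "m - 0 = m" by simp_all
 have s: "sg (j + k * N) * sg (0 + j) = sg k" by (simp add: sg_add sg_N mult.commute)
 show "bc (k * N - j) j (Xc j (k * N)) (Xc 0 j) m = Zc j k m"
  unfolding bc_def Xc_def e dvd_shift Zc_def a_def[symmetric] b_def[symmetric] c_def[symmetric]
  by (rule bool_alg[OF ab ac bd s])
qed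

text \<open>The factor 3 is the difference of the diagonal entries 1 at j and -2 at 0 of
  \<open>Zc j 1\<close>. The bracket raises the loop degree by one and leaves the finite part of the
  root unchanged.\<close>

lemma bc_ZX:
 assumes "0 < j" "j \<le> 2 * int n"
 shows "bc N (k * N - j) (Zc j 1) (Xc j (k * N)) = (\<lambda>m. 3 * Xc j ((k + 1) * N) m)"
proof
 fix m
 have jN: "j < N" using assms by (simp add: N_def)
 have X: "Xc j (k * N) (m + N) = Xc j (k * N) m"
 proof -
  have "m + N - j = m - j + N" by simp
  thus ?thesis by (simp only: Xc_def dvd_shift)
 qed
 have Z: "Zc j 1 (m + (k * N - j)) = of_bool (N dvd m - 2 * j) + of_bool (N dvd m) - 2 * of_bool (N dvd m - j)"
  using dvd_shift(1)[of "m - 2 * j" k] dvd_shift(1)[of "m - j" k] by (simp add: Zc_def dvd_shift sg_def algebra_simps)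
 have Z': "Zc j 1 m = of_bool (N dvd m - j) + of_bool (N dvd m + j) - 2 * of_bool (N dvd m)"
  by (simp add: Zc_def sg_def)
 have X': "Xc j (k * N) m = of_bool (N dvd m - j) - sg (j + k) * of_bool (N dvd m)"
  "Xc j ((k + 1) * N) m = of_bool (N dvd m - j) + sg (j + k) * of_bool (N dvd m)"
  unfolding Xc_def dvd_shift by (simp_all add: sg_add sg_N) (simp add: sg_def)
 have 1: "\<not> N dvd m" "\<not> N dvd m + j" "\<not> N dvd m - 2 * j" if "N dvd m - j"
  using ndvd[OF assms(1) jN] that dvd_diff[of N m "m - j"] dvd_diff[of N "m + j" "m - j"]
   dvd_diff[of N "m - j" "m - 2 * j"] by auto
 have 2: "\<not> N dvd m + j" "\<not> N dvd m - 2 * j" if "N dvd m"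
  using ndvd[OF assms(1) jN] that dvd_diff[of N m "m - 2 * j"] dvd_diff[of N "m + j" m] by auto
 show "bc N (k * N - j) (Zc j 1) (Xc j (k * N)) m = 3 * Xc j ((k + 1) * N) m"
  unfolding bc_def X Z Z' X' using 1 2 by (cases "N dvd m - j"; cases "N dvd m") auto
qed

lemma hasX_kN:
 assumes "0 < j" "j \<le> 2 * int n" "k \<ge> 1"
 shows "\<exists>x. T (k * N - j) x (Xc j (k * N))"
 using assms(3)
proof (induction k rule: int_ge_induct)
 case base thus ?case using hasX_N[OF assms(1,2)] by simp
next
 case (step k)
 obtain x where x: "T (k * N - j) x (Xc j (k * N))" using step by auto
 obtain y where y: "T (N - j) y (Xc j N)" using hasX_N[OF assms(1,2)] by auto
 obtain w where w: "T j w (Xc 0 j)" using hasX_0[OF assms(1,2)] by auto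
 have "T N (br y w) (Zc j 1)" using T_br[OF y w] bc_XX[OF assms(1,2), of 1] by simp
 from T_br[OF this x] have "T ((k + 1) * N - j) (br (br y w) x) (\<lambda>m. 3 * Xc j ((k + 1) * N) m)"
  unfolding bc_ZX[OF assms(1,2)] by (simp add: algebra_simps)
 from T_sm[OF this, of "1/3"] show ?case by auto
qed

lemma hasZ:
 assumes "0 < j" "j \<le> 2 * int n" "k \<ge> 1"
 shows "\<exists>z. T (k * N) z (Zc j k)"
proof -
 obtain x where x: "T (k * N - j) x (Xc j (k * N))" using hasX_kN[OF assms] by auto
 obtain w where w: "T j w (Xc 0 j)" using hasX_0[OF assms(1,2)] by auto
 show ?thesis using T_br[OF x w] by (auto simp: bc_XX[OF assms(1,2)])
qed

lemma hasX_Nl: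
 assumes "0 < j" "j \<le> 2 * int n" "0 < l" "l \<le> 2 * int n" "j \<noteq> l"
 shows "\<exists>x. T (N + l - j) x (Xc j (N + l))"
proof -
 obtain x where x: "T (N - j) x (Xc j N)" using hasX_N[OF assms(1,2)] by auto
 obtain w where w: "T l w (Xc 0 l)" using hasX_0[OF assms(3,4)] by auto
 have jN: "j < N" "l < N" using assms by (auto simp: N_def)
 have nj: "\<not> N dvd j" "\<not> N dvd l" "\<not> N dvd l - j"
 proof -
  show "\<not> N dvd j" "\<not> N dvd l" using ndvd(1) assms jN by auto
  show "\<not> N dvd l - j"
  proof (cases "l > j")
   case True thus ?thesis using ndvd(1)[of "l - j"] jN assms by auto
  next
   case False
   hence "\<not> N dvd j - l" using ndvd(1)[of "j - l"] jN assms by auto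
   thus ?thesis by (metis dvd_minus_iff minus_diff_eq)
  qed
 qed
 have "bc (N - j) l (Xc j N) (Xc 0 l) m = Xc j (N + l) m" for m
 proof -
  have X: "Xc j N m = of_bool (N dvd m - j) + sg j * of_bool (N dvd m)"
   "Xc j N (m + l) = of_bool (N dvd m + l - j) + sg j * of_bool (N dvd m + l)"
   "Xc 0 l m = of_bool (N dvd m) - sg l * of_bool (N dvd m + l)"
   unfolding Xc_def dvd_shift by (simp_all add: sg_add sg_N)
  have "N dvd m + (N - j) \<longleftrightarrow> N dvd m - j" "N dvd m + (N - j) + l \<longleftrightarrow> N dvd m + l - j"
   "N dvd m + (N + l) \<longleftrightarrow> N dvd m + l"
   using dvd_shift(2)[of "m - j"] dvd_shift(2)[of "m + l - j"] dvd_shift(2)[of "m + l"]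
   by (simp_all add: algebra_simps)
  hence X': "Xc 0 l (m + (N - j)) = of_bool (N dvd m - j) - sg l * of_bool (N dvd m + l - j)"
   "Xc j (N + l) m = of_bool (N dvd m - j) + sg j * sg l * of_bool (N dvd m + l)"
   unfolding Xc_def by (simp_all add: sg_add sg_N)
  have 1: "\<not> N dvd m" "\<not> N dvd m + l - j" if "N dvd m - j"
   using nj that dvd_diff[of N m "m - j"] dvd_diff[of N "m + l - j" "m - j"] by auto
  have 2: "\<not> N dvd m + l - j" "\<not> N dvd m + l" if "N dvd m"
   using nj that dvd_diff[of N "m + l - j" m] dvd_diff[of N "m + l" m] by (auto simp: algebra_simps)
  have 3: "\<not> N dvd m + l - j" if "N dvd m + l"
   using nj that dvd_diff[of N "m + l" "m + l - j"] by auto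
  show ?thesis unfolding bc_def X X' using 1 2 3
   by (cases "N dvd m - j"; cases "N dvd m"; cases "N dvd m + l") auto
 qed
 hence "bc (N - j) l (Xc j N) (Xc 0 l) = Xc j (N + l)" by (rule ext)
 moreover have "T (N - j + l) (br x w) (bc (N - j) l (Xc j N) (Xc 0 l))" by (rule T_br[OF x w])
 ultimately show ?thesis by (auto simp: algebra_simps)
qed

end

subsection \<open>Polynomials as finitely supported functions\<close>

lemma pm_induct:
 fixes p :: "'k \<Rightarrow>\<^sub>0 ('c::comm_monoid_add)"
 assumes "Q 0" "\<And>m c. Q (Poly_Mapping.single m c)" "\<And>p q. Q p \<Longrightarrow> Q q \<Longrightarrow> Q (p + q)"
 shows "Q p"
proof -
 have "p = (\<Sum>m\<in>Poly_Mapping.keys p. Poly_Mapping.single m (Poly_Mapping.lookup p m))"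
  by (rule poly_mapping_eqI)
   (simp add: lookup_sum lookup_single when_def in_keys_iff)
 moreover have "Q (\<Sum>m\<in>K. Poly_Mapping.single m (Poly_Mapping.lookup p m))" for K
  by (induction K rule: infinite_finite_induct) (use assms in auto)
 ultimately show ?thesis by metis
qed

definition mon :: "('v \<Rightarrow> 'b::comm_ring_1) \<Rightarrow> ('v \<Rightarrow>\<^sub>0 nat) \<Rightarrow> 'b" where
 "mon f m = (\<Prod>v\<in>Poly_Mapping.keys m. f v ^ Poly_Mapping.lookup m v)"

lemma mon_superset:
 "finite K \<Longrightarrow> Poly_Mapping.keys m \<subseteq> K \<Longrightarrow> mon f m = (\<Prod>v\<in>K. f v ^ Poly_Mapping.lookup m v)"
 unfolding mon_def by (rule prod.mono_neutral_left) (auto simp: in_keys_iff)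

lemma mon_add: "mon f (m + m') = mon f m * mon f m'"
proof -
 let ?K = "Poly_Mapping.keys m \<union> Poly_Mapping.keys m'"
 have "mon f (m + m') = (\<Prod>v\<in>?K. f v ^ Poly_Mapping.lookup (m + m') v)"
  by (rule mon_superset) (auto dest: subsetD[OF Poly_Mapping.keys_add])
 also have "\<dots> = (\<Prod>v\<in>?K. f v ^ Poly_Mapping.lookup m v) * (\<Prod>v\<in>?K. f v ^ Poly_Mapping.lookup m' v)"
  by (simp add: lookup_add power_add prod.distrib)
 also have "\<dots> = mon f m * mon f m'"
  by (subst (1 2) mon_superset[of ?K]) auto
 finally show ?thesis .
qed

lemma mon_0 [simp]: "mon f 0 = 1" by (simp add: mon_def)

lemma mon_single [simp]: "mon f (Poly_Mapping.single v k) = f v ^ k"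
 by (cases "k = 0") (auto simp: mon_def)

locale poly_subst =
 fixes \<kappa> :: "complex \<Rightarrow> 'b::comm_ring_1" and f :: "'v \<Rightarrow> 'b"
 assumes k0: "\<kappa> 0 = 0" and k1: "\<kappa> 1 = 1" and kadd: "\<kappa> (a + b) = \<kappa> a + \<kappa> b" and kmult: "\<kappa> (a * b) = \<kappa> a * \<kappa> b"
begin

definition psubst :: "(('v \<Rightarrow>\<^sub>0 nat) \<Rightarrow>\<^sub>0 complex) \<Rightarrow> 'b" where
 "psubst q = (\<Sum>m\<in>Poly_Mapping.keys q. \<kappa> (Poly_Mapping.lookup q m) * mon f m)"

lemma psubst_0 [simp]: "psubst 0 = 0" by (simp add: psubst_def)

lemma psubst_add: "psubst (p + q) = psubst p + psubst q"
 unfolding psubst_def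
 by (rule setsum_keys_plus_distrib[where f = "\<lambda>m c. \<kappa> c * mon f m"]) (simp_all add: k0 kadd algebra_simps)

lemma psubst_single [simp]: "psubst (Poly_Mapping.single m c) = \<kappa> c * mon f m"
 by (cases "c = 0") (auto simp: psubst_def k0)

lemma psubst_1 [simp]: "psubst 1 = 1"
 using psubst_single[of 0 1] by (simp add: k1)

lemma psubst_mult: "psubst (p * q) = psubst p * psubst q"
proof (induction p rule: pm_induct)
 case (2 m c)
 show ?case
  by (induction q rule: pm_induct)
   (auto simp: mult_single kmult mon_add distrib_left psubst_add algebra_simps)
qed (auto simp: psubst_add algebra_simps)

lemma psubst_minus: "psubst (- p) = - psubst p"
 using psubst_add[of p "- p"] by (simp add: eq_neg_iff_add_eq_0 add.commute)

lemma psubst_diff: "psubst (p - q) = psubst p - psubst q"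
 using psubst_add[of p "- q"] by (simp add: psubst_minus)

end

text \<open>Induction on the variables: with the others fixed, the sum is a polynomial in the
  remaining variable with infinitely many zeros, so its coefficients vanish and the induction
  hypothesis applies to the one that contains m.\<close>

lemma grid_coeffs_zero:
 fixes c :: "'m \<Rightarrow> complex" and e :: "'m \<Rightarrow> 'v \<Rightarrow> nat"
 assumes "finite V" "finite S" "\<And>v. v \<in> V \<Longrightarrow> infinite (B v)"
  and "\<And>m m'. m \<in> S \<Longrightarrow> m' \<in> S \<Longrightarrow> (\<And>v. v \<in> V \<Longrightarrow> e m v = e m' v) \<Longrightarrow> m = m'"
  and "\<And>\<tau>. (\<And>v. v \<in> V \<Longrightarrow> \<tau> v \<in> B v) \<Longrightarrow> (\<Sum>m\<in>S. c m * (\<Prod>v\<in>V. \<tau> v ^ e m v)) = 0"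
  and "m \<in> S"
 shows "c m = 0"
 using assms(1,2,3,4,5,6)
proof (induction V arbitrary: S m rule: finite_induct)
 case empty
 have "m' = m" if "m' \<in> S" for m' by (rule empty.prems(3)[OF that empty.prems(5)]) simp
 hence "S = {m}" using empty.prems(5) by blast
 thus ?case using empty.prems(4)[of "\<lambda>_. undefined"] by simp
next
 case (insert v V)
 define S' where "S' = {m'\<in>S. e m' v = e m v}"
 show ?case
 proof (rule insert.IH[of S'])
  show "finite S'" using insert.prems by (simp add: S'_def)
  show "infinite (B w)" if "w \<in> V" for w using insert.prems that by auto
  show "m1 = m2" if "m1 \<in> S'" "m2 \<in> S'" "\<And>w. w \<in> V \<Longrightarrow> e m1 w = e m2 w" for m1 m2
   by (rule insert.prems(3)) (use that in \<open>auto simp: S'_def\<close>)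
  show "m \<in> S'" using insert.prems by (simp add: S'_def)
  fix \<tau> assume \<tau>: "\<And>w. w \<in> V \<Longrightarrow> \<tau> w \<in> B w"
  define p where "p = (\<Sum>m\<in>S. Polynomial.monom (c m * (\<Prod>w\<in>V. \<tau> w ^ e m w)) (e m v))"
  have "poly p x = 0" if "x \<in> B v" for x
  proof -
   have ne: "w \<noteq> v" if "w \<in> V" for w using insert.hyps that by auto
   have "(\<Sum>m\<in>S. c m * (\<Prod>w\<in>insert v V. (\<tau>(v := x)) w ^ e m w)) = 0"
    using \<tau> that ne by (intro insert.prems(4)) auto
   also have "(\<Sum>m\<in>S. c m * (\<Prod>w\<in>insert v V. (\<tau>(v := x)) w ^ e m w)) =
     (\<Sum>m\<in>S. c m * (\<Prod>w\<in>V. \<tau> w ^ e m w) * x ^ e m v)"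
   proof (rule sum.cong)
    fix m
    have "(\<Prod>w\<in>V. (\<tau>(v := x)) w ^ e m w) = (\<Prod>w\<in>V. \<tau> w ^ e m w)"
     by (rule prod.cong) (auto simp: ne)
    thus "c m * (\<Prod>w\<in>insert v V. (\<tau>(v := x)) w ^ e m w) = c m * (\<Prod>w\<in>V. \<tau> w ^ e m w) * x ^ e m v"
     using insert.hyps by simp
   qed simp
   finally show ?thesis by (simp add: p_def poly_sum poly_monom)
  qed
  hence "B v \<subseteq> {x. poly p x = 0}" by auto
  hence "p = 0" using insert.prems(2)[of v] poly_roots_finite[of p] finite_subset by blast
  hence "coeff p (e m v) = 0" by simp
  moreover have "coeff p (e m v) = (\<Sum>m'\<in>S. if e m' v = e m v then c m' * (\<Prod>w\<in>V. \<tau> w ^ e m' w) else 0)"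
   by (simp add: p_def coeff_sum coeff_monom)
  moreover have "\<dots> = (\<Sum>m'\<in>S'. c m' * (\<Prod>w\<in>V. \<tau> w ^ e m' w))"
   unfolding S'_def using insert.prems(1) by (simp add: sum.inter_filter)
  ultimately show "(\<Sum>m'\<in>S'. c m' * (\<Prod>w\<in>V. \<tau> w ^ e m' w)) = 0" by simp
 qed
qed

interpretation ev: poly_subst "\<lambda>c. c" \<tau> for \<tau> :: "'v \<Rightarrow> complex"
 by standard auto

lemma poly_vanishes_on_grid:
 fixes q :: "('v \<Rightarrow>\<^sub>0 nat) \<Rightarrow>\<^sub>0 complex"
 assumes "finite V" "\<And>m. m \<in> Poly_Mapping.keys q \<Longrightarrow> Poly_Mapping.keys m \<subseteq> V"
  and "\<And>v. v \<in> V \<Longrightarrow> infinite (B v)"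
  and "\<And>\<tau>. (\<And>v. v \<in> V \<Longrightarrow> \<tau> v \<in> B v) \<Longrightarrow> (\<And>v. v \<notin> V \<Longrightarrow> \<tau> v = 0) \<Longrightarrow> ev.psubst \<tau> q = 0"
 shows "q = 0"
proof (rule ccontr)
 assume "q \<noteq> 0"
 then obtain m where m: "m \<in> Poly_Mapping.keys q" by fastforce
 have "Poly_Mapping.lookup q m = 0"
 proof (rule grid_coeffs_zero[OF assms(1) _ assms(3), where S = "Poly_Mapping.keys q" and e = Poly_Mapping.lookup])
  fix m1 m2 assume mm: "m1 \<in> Poly_Mapping.keys q" "m2 \<in> Poly_Mapping.keys q"
   and eq: "\<And>v. v \<in> V \<Longrightarrow> Poly_Mapping.lookup m1 v = Poly_Mapping.lookup m2 v"
  show "m1 = m2"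
  proof (rule poly_mapping_eqI)
   fix v show "Poly_Mapping.lookup m1 v = Poly_Mapping.lookup m2 v"
   proof (cases "v \<in> V")
    case False
    hence "v \<notin> Poly_Mapping.keys m1" "v \<notin> Poly_Mapping.keys m2"
     using assms(2)[OF mm(1)] assms(2)[OF mm(2)] by auto
    thus ?thesis by (simp add: in_keys_iff)
   qed (rule eq)
  qed
 next
  fix \<tau> :: "'v \<Rightarrow> complex" assume \<tau>: "\<And>v. v \<in> V \<Longrightarrow> \<tau> v \<in> B v"
  define \<tau>' where "\<tau>' v = (if v \<in> V then \<tau> v else 0)" for v
  have "ev.psubst \<tau>' q = 0" using \<tau> by (intro assms(4)) (auto simp: \<tau>'_def)
  moreover have "mon \<tau>' m = (\<Prod>v\<in>V. \<tau> v ^ Poly_Mapping.lookup m v)" if "m \<in> Poly_Mapping.keys q" for m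
   using mon_superset[OF assms(1) assms(2)[OF that], of \<tau>'] by (simp add: \<tau>'_def)
  ultimately show "(\<Sum>m\<in>Poly_Mapping.keys q. Poly_Mapping.lookup q m * (\<Prod>v\<in>V. \<tau> v ^ Poly_Mapping.lookup m v)) = 0"
   by (simp add: ev.psubst_def)
 qed (use m in auto)
 thus False using m by (simp add: in_keys_iff)
qed

subsection \<open>Power sums and elementary symmetric functions\<close>

text \<open>Newton's identity solved for the power sum of degree r + 1, with the elementary
  symmetric function of degree 0 replaced by 1. The freed value \<open>e 0\<close> serves as the
  power sum of degree 0, the number of parameters.\<close>

function newtonP :: "(nat \<Rightarrow> 'a::comm_ring_1) \<Rightarrow> nat \<Rightarrow> 'a" where
 "newtonP e 0 = e 0"
| "newtonP e (Suc r) = (- 1) ^ r * (of_nat (Suc r) * e (Suc r) - (\<Sum>k<r. (- 1) ^ k * newtonP e (Suc k) * e (r - k)))"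
 by pat_completeness auto
termination by (relation "measure snd") auto

declare newtonP.simps(2) [simp del]

definition esym :: "('s \<Rightarrow> complex) \<Rightarrow> 's set \<Rightarrow> nat \<Rightarrow> complex" where
 "esym b S r = coeff (\<Prod>s\<in>S. [:1, b s:]) r"

text \<open>Compare coefficients in F' = F * (F' / F) for the generating function F, the product of
  the factors 1 + b X.\<close>

lemma newton_identity:
 fixes b :: "'s \<Rightarrow> complex"
 assumes "finite S"
 shows "of_nat (Suc r) * esym b S (Suc r) = (\<Sum>k\<le>r. (- 1) ^ k * (\<Sum>s\<in>S. b s ^ Suc k) * esym b S (r - k))"
proof -
 define F where "F S = (\<Prod>s\<in>S. 1 + fps_const (b s) * fps_X)" for S
 \<comment> \<open>The expansion of x / (1 + x X), the logarithmic derivative of one factor.\<close>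
 define q where "q x = Abs_fps (\<lambda>k. (- 1) ^ k * x ^ Suc k)" for x :: complex
 have q: "q x * (1 + fps_const x * fps_X) = fps_const x" for x
 proof (rule fps_ext)
  fix k
  have e: "q x * (1 + fps_const x * fps_X) = q x + fps_const x * (q x * fps_X)"
   unfolding distrib_left mult_1_right by (simp only: mult.left_commute)
  show "(q x * (1 + fps_const x * fps_X)) $ k = fps_const x $ k"
   unfolding e fps_add_nth fps_mult_left_const_nth fps_X_mult_right_nth by (cases k) (simp_all add: q_def)
 qed
 have F: "fps_deriv (F S) = F S * (\<Sum>s\<in>S. q (b s))"
  using assms
 proof (induction S rule: finite_induct)
  case (insert s S)
  define L where "L = 1 + fps_const (b s) * fps_X"
  have FL: "F (insert s S) = L * F S" using insert.hyps by (simp add: F_def L_def)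
  have "fps_deriv L = q (b s) * L" using q[of "b s"] by (simp add: L_def)
  hence "fps_deriv (F (insert s S)) = L * (F S * (\<Sum>s\<in>S. q (b s))) + q (b s) * L * F S"
   unfolding FL fps_deriv_mult insert.IH by simp
  thus ?case unfolding FL using insert.hyps by (simp add: distrib_left ac_simps)
 qed (simp add: F_def)
 have E: "F S $ k = esym b S k" for k
  unfolding esym_def fps_of_poly_nth[symmetric] F_def fps_of_poly_prod fps_of_poly_linear' ..
 have "of_nat (Suc r) * esym b S (Suc r) = fps_deriv (F S) $ r" by (simp add: E)
 also have "\<dots> = (\<Sum>k=0..r. (\<Sum>s\<in>S. q (b s)) $ k * F S $ (r - k))"
  unfolding F by (subst mult.commute) (simp add: fps_mult_nth)
 also have "\<dots> = (\<Sum>k\<le>r. (- 1) ^ k * (\<Sum>s\<in>S. b s ^ Suc k) * esym b S (r - k))"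
  unfolding atLeast0AtMost E by (simp add: fps_sum_nth q_def sum_distrib_left)
 finally show ?thesis .
qed

lemma esym_0: "finite S \<Longrightarrow> esym b S 0 = 1"
 unfolding esym_def by (induction S rule: finite_induct) auto

text \<open>Factor the polynomial with constant term 1 and coefficients \<tau>. A nonzero top
  coefficient gives it exactly m roots, the constant term keeps them away from 0, and dividing by
  them brings each factor into the form 1 + b X with b nonzero.\<close>

lemma esym_surj:
 fixes \<tau> :: "nat \<Rightarrow> complex"
 assumes "m \<ge> 1 \<Longrightarrow> \<tau> m \<noteq> 0"
 shows "\<exists>b. (\<forall>s<m. b s \<noteq> 0) \<and> (\<forall>r. 1 \<le> r \<longrightarrow> r \<le> m \<longrightarrow> esym b {..<m} r = \<tau> r)"
proof -
 define p where "p = Polynomial.monom 1 0 + (\<Sum>r\<in>{1..m}. Polynomial.monom (\<tau> r) r)"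
 have cp: "coeff p r = (if r = 0 then 1 else if r \<le> m then \<tau> r else 0)" for r
  by (auto simp: p_def coeff_sum coeff_monom)
 have p0: "p \<noteq> 0" using cp[of 0] by auto
 have deg: "degree p = m"
 proof (rule antisym)
  show "degree p \<le> m" by (rule degree_le) (auto simp: cp)
  show "m \<le> degree p" using assms cp[of m] by (intro le_degree) (cases "m = 0", auto)
 qed
 obtain Z where Z: "size Z = m" "p = smult (lead_coeff p) (\<Prod>x\<in>#Z. [:- x, 1:])"
  using alg_closed_imp_factorization[OF p0] deg by auto
 obtain zs where zs: "Z = mset zs" using ex_mset by metis
 have len: "length zs = m" using Z zs by simp
 define z where "z s = zs ! s" for s
 have "(\<Prod>x\<in>#Z. [:- x, 1:]) = prod_list (map (\<lambda>x. [:- x, 1:]) zs)"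
  by (simp add: zs prod_mset_prod_list[symmetric] flip: mset_map)
 also have "\<dots> = (\<Prod>s<m. [:- z s, 1:])"
  by (simp add: prod.list_conv_set_nth z_def len atLeast0LessThan)
 finally have pz: "p = smult (lead_coeff p) (\<Prod>s<m. [:- z s, 1:])" using Z by simp
 have "poly p 0 = 1" using cp[of 0] by (simp add: poly_0_coeff_0)
 hence lz: "lead_coeff p * (\<Prod>s<m. - z s) = 1" by (subst (asm) pz) (simp add: poly_prod)
 have nz: "z s \<noteq> 0" if "s < m" for s
 proof
  assume "z s = 0"
  hence "(\<Prod>s<m. - z s) = 0" using that by (intro prod_zero) auto
  hence "lead_coeff p * (\<Prod>s<m. - z s) = 0" by (simp only: mult_zero_right)
  with lz show False by (simp only: zero_neq_one)
 qed
 have "(\<Prod>s<m. [:- z s, 1:]) = (\<Prod>s<m. smult (- z s) [:1, - (1 / z s):])"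
  by (rule prod.cong) (auto simp: nz)
 also have "\<dots> = smult (\<Prod>s<m. - z s) (\<Prod>s<m. [:1, - (1 / z s):])"
  by (rule prod_smult)
 finally have "p = smult (lead_coeff p * (\<Prod>s<m. - z s)) (\<Prod>s<m. [:1, - (1 / z s):])"
  using pz by (metis smult_smult)
 hence "p = (\<Prod>s<m. [:1, - (1 / z s):])" using lz by simp
 hence "esym (\<lambda>s. - (1 / z s)) {..<m} r = coeff p r" for r by (simp add: esym_def)
 thus ?thesis using nz by (intro exI[of _ "\<lambda>s. - (1 / z s)"]) (auto simp: cp)
qed

lemma esym_subsets:
 assumes "finite S"
 shows "esym b S r = (\<Sum>R\<in>{R. R \<subseteq> S \<and> card R = r}. \<Prod>s\<in>R. b s)"
proof -
 have "(\<Prod>s\<in>S. [:1, b s:]) = (\<Prod>s\<in>S. [:0, b s:] + 1)"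
  by (rule prod.cong) (auto simp: one_pCons)
 also have "\<dots> = (\<Sum>R\<in>Pow S. (\<Prod>s\<in>R. [:0, b s:]))"
  using assms by (subst prod_add) auto
 also have "\<dots> = (\<Sum>R\<in>Pow S. Polynomial.monom (\<Prod>s\<in>R. b s) (card R))"
 proof (rule sum.cong)
  fix R assume "R \<in> Pow S"
  hence "finite R" using assms finite_subset by auto
  thus "(\<Prod>s\<in>R. [:0, b s:]) = Polynomial.monom (\<Prod>s\<in>R. b s) (card R)"
   by (induction R rule: finite_induct) (auto simp: monom_Suc smult_monom mult.commute)
 qed simp
 finally have "esym b S r = (\<Sum>R\<in>Pow S. if card R = r then \<Prod>s\<in>R. b s else 0)"
  by (simp add: esym_def coeff_sum coeff_monom)
 also have "\<dots> = (\<Sum>R\<in>{R\<in>Pow S. card R = r}. \<Prod>s\<in>R. b s)"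
  using assms by (simp only: sum.inter_filter finite_Pow_iff)
 finally show ?thesis by simp
qed

subsection \<open>Modules over the free associative algebra\<close>

fun wact :: "('g \<Rightarrow> 'v \<Rightarrow> 'v) \<Rightarrow> 'g list \<Rightarrow> 'v \<Rightarrow> 'v" where
 "wact \<rho> [] v = v"
| "wact \<rho> (x # xs) v = \<rho> x (wact \<rho> xs v)"

locale free_rep = vector_space s for s :: "complex \<Rightarrow> 'v::ab_group_add \<Rightarrow> 'v" +
 fixes \<rho> :: "'g \<Rightarrow> 'v \<Rightarrow> 'v"
 assumes \<rho>_add: "\<rho> x (u + v) = \<rho> x u + \<rho> x v" and \<rho>_s: "\<rho> x (s c v) = s c (\<rho> x v)"
begin

definition act :: "('g word \<Rightarrow>\<^sub>0 complex) \<Rightarrow> 'v \<Rightarrow> 'v" where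
 "act p v = (\<Sum>w\<in>Poly_Mapping.keys p. s (Poly_Mapping.lookup p w) (wact \<rho> (letters w) v))"

lemma wact_append: "wact \<rho> (xs @ ys) v = wact \<rho> xs (wact \<rho> ys v)"
 by (induction xs) auto

lemma wact_add: "wact \<rho> xs (u + v) = wact \<rho> xs u + wact \<rho> xs v"
 by (induction xs) (auto simp: \<rho>_add)

lemma wact_s: "wact \<rho> xs (s c v) = s c (wact \<rho> xs v)"
 by (induction xs) (auto simp: \<rho>_s)

lemma act_add: "act (p + q) v = act p v + act q v"
 unfolding act_def
 by (rule setsum_keys_plus_distrib[where f = "\<lambda>w c. s c (wact \<rho> (letters w) v)"])
  (simp_all add: scale_left_distrib)

lemma act_0 [simp]: "act 0 v = 0" by (simp add: act_def)

lemma act_single: "act (Poly_Mapping.single w c) v = s c (wact \<rho> (letters w) v)"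
 by (cases "c = 0") (auto simp: act_def)

lemma act_scalar: "act (Poly_Mapping.single 0 c) v = s c v"
 by (simp add: act_single zero_word_def)

lemma act_1 [simp]: "act 1 v = v"
 using act_scalar[of 1] by simp

lemma act_letter [simp]: "act (letter x) v = \<rho> x v"
 by (simp add: letter_def act_single)

lemma act_v_add: "act p (u + v) = act p u + act p v"
 by (simp add: act_def wact_add scale_right_distrib sum.distrib)

lemma act_v_s: "act p (s c v) = s c (act p v)"
 by (simp add: act_def wact_s scale_sum_right mult.commute)

lemma act_v_0 [simp]: "act p 0 = 0" using act_v_s[of p 0 0] by simp

lemma act_v_sum: "act p (sum v K) = (\<Sum>k\<in>K. act p (v k))"
 by (induction K rule: infinite_finite_induct) (auto simp: act_v_add)

lemma act_minus: "act (- p) v = - act p v"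
 using act_add[of p "- p" v] by (simp add: eq_neg_iff_add_eq_0 add.commute)

lemma act_diff: "act (p - q) v = act p v - act q v"
 using act_add[of p "- q"] by (simp add: act_minus)

lemma act_mult: "act (p * q) v = act p (act q v)"
proof (induction p rule: pm_induct)
 case (2 w c)
 show ?case
  by (induction q rule: pm_induct)
   (auto simp: mult_single act_single plus_word_def wact_append wact_s distrib_left act_add wact_add
    act_v_add scale_right_distrib)
qed (auto simp: act_add algebra_simps)

lemma act_power: "act (p ^ k) v = (act p ^^ k) v"
 by (induction k) (auto simp: act_mult)

end

subsection \<open>The fermionic Fock space\<close>

locale fock =
 fixes I :: "('i::linorder) set"
 assumes fin: "finite I"
begin

text \<open>The Jordan-Wigner sign: the parity of the number of occupied indices below a.\<close>

definition csg :: "'i \<Rightarrow> 'i set \<Rightarrow> complex" where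
 "csg a U = (\<Prod>x\<in>{x\<in>I. x < a}. if x \<in> U then - 1 else 1)"

text \<open>A state is the function of its coefficients on occupied sets. So creating a reads at U
  the coefficient at U without a, and annihilating b reads the coefficient at U with b
  added.\<close>

definition cr :: "'i \<Rightarrow> ('i set \<Rightarrow> complex) \<Rightarrow> 'i set \<Rightarrow> complex" where
 "cr a f U = (if a \<in> U then csg a U * f (U - {a}) else 0)"

definition an :: "'i \<Rightarrow> ('i set \<Rightarrow> complex) \<Rightarrow> 'i set \<Rightarrow> complex" where
 "an b f U = (if b \<in> U then 0 else csg b U * f (insert b U))"

definition vac :: "'i set \<Rightarrow> 'i set \<Rightarrow> complex" where "vac S U = of_bool (U = S)"

lemma csg_sq [simp]: "csg a U * csg a U = 1"
 unfolding csg_def prod.distrib[symmetric] by (rule prod.neutral) auto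

lemma csg_insert:
 assumes "c \<in> I" "c \<notin> U"
 shows "csg a (insert c U) = (if c < a then - csg a U else csg a U)"
proof (cases "c < a")
 case True
 have A: "(\<Prod>x\<in>{x\<in>I. x < a}. if x \<in> V then - 1 else 1 :: complex) =
   (if c \<in> V then - 1 else 1) * (\<Prod>x\<in>{x\<in>I. x < a} - {c}. if x \<in> V then - 1 else 1)" for V
  by (rule prod.remove) (use fin True assms in auto)
 have B: "(\<Prod>x\<in>{x\<in>I. x < a} - {c}. if x \<in> insert c U then - 1 else 1 :: complex)
  = (\<Prod>x\<in>{x\<in>I. x < a} - {c}. if x \<in> U then - 1 else 1)" by (rule prod.cong) auto
 show ?thesis unfolding csg_def A[of "insert c U"] A[of U] B using assms True by simp
next
 case False
 thus ?thesis unfolding csg_def by (auto intro!: prod.cong)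
qed

lemma csg_remove:
 assumes "c \<in> I" "c \<in> U"
 shows "csg a (U - {c}) = (if c < a then - csg a U else csg a U)"
 using csg_insert[OF assms(1), of "U - {c}" a] assms(2) by (auto simp: insert_absorb split: if_splits)

lemma cr_add: "cr a (\<lambda>U. f U + h U) V = cr a f V + cr a h V"
 and cr_smult: "cr a (\<lambda>U. c * f U) V = c * cr a f V"
 and cr_diff: "cr a (\<lambda>U. f U - h U) V = cr a f V - cr a h V"
 and cr_minus: "cr a (\<lambda>U. - f U) V = - cr a f V"
 by (auto simp: cr_def algebra_simps)

lemma an_add: "an a (\<lambda>U. f U + h U) V = an a f V + an a h V"
 and an_smult: "an a (\<lambda>U. c * f U) V = c * an a f V"
 by (auto simp: an_def algebra_simps)

lemma cr_sum: "cr a (\<lambda>U. \<Sum>k\<in>K. f k U) V = (\<Sum>k\<in>K. cr a (f k) V)"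
 by (auto simp: cr_def sum_distrib_left)

lemma an_sum: "an a (\<lambda>U. \<Sum>k\<in>K. f k U) V = (\<Sum>k\<in>K. an a (f k) V)"
 by (auto simp: an_def sum_distrib_left)

lemma cr_an:
 assumes "a \<in> I" "b \<in> I"
 shows "cr a (an b f) U + an b (cr a f) U = (if a = b then f U else 0)"
proof (cases "a = b")
 case True
 thus ?thesis using assms
  by (auto simp: cr_def an_def csg_insert csg_remove insert_absorb mult.assoc[symmetric])
next
 case False
 hence "U - {a} \<union> {b} = insert b U - {a}" by auto
 hence e: "insert b (U - {a}) = insert b U - {a}" by auto
 have ord: "(a < b) = (\<not> b < a)" using False by auto
 show ?thesis
 proof (cases "a \<in> U \<and> b \<notin> U")
  case True
  have 1: "csg b (U - {a}) = (if a < b then - csg b U else csg b U)" using csg_remove assms True by blast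
  have 2: "csg a (insert b U) = (if b < a then - csg a U else csg a U)" using csg_insert assms True by blast
  have "cr a (an b f) U = csg a U * (csg b (U - {a}) * f (insert b U - {a}))"
   using True e by (simp add: cr_def an_def)
  moreover have "an b (cr a f) U = csg b U * (csg a (insert b U) * f (insert b U - {a}))"
   using True by (simp add: cr_def an_def)
  ultimately show ?thesis unfolding 1 2 using False ord by (cases "b < a") simp_all
 next
  case nope: False
  thus ?thesis using False by (auto simp: cr_def an_def)
 qed
qed

lemma cr_cr:
 assumes "a \<in> I" "b \<in> I"
 shows "cr a (cr b f) U = - cr b (cr a f) U"
proof (cases "a = b")
 case False
 have e: "U - {a} - {b} = U - {b} - {a}" by auto
 have ord: "(a < b) = (\<not> b < a)" using False by auto
 show ?thesis
 proof (cases "a \<in> U \<and> b \<in> U")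
  case True
  have 1: "csg b (U - {a}) = (if a < b then - csg b U else csg b U)" using csg_remove assms True by blast
  have 2: "csg a (U - {b}) = (if b < a then - csg a U else csg a U)" using csg_remove assms True by blast
  have "cr a (cr b f) U = csg a U * (csg b (U - {a}) * f (U - {a} - {b}))"
   using True False by (simp add: cr_def)
  moreover have "cr b (cr a f) U = csg b U * (csg a (U - {b}) * f (U - {a} - {b}))"
   using True False e by (simp add: cr_def)
  ultimately show ?thesis unfolding 1 2 using ord by (cases "b < a") simp_all
 next
  case nope: False
  thus ?thesis by (auto simp: cr_def)
 qed
qed (auto simp: cr_def)

lemma an_an:
 assumes "a \<in> I" "b \<in> I"
 shows "an a (an b f) U = - an b (an a f) U"
proof (cases "a = b")
 case False
 have e: "insert a (insert b U) = insert b (insert a U)" by auto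
 have ord: "(a < b) = (\<not> b < a)" using False by auto
 show ?thesis
 proof (cases "a \<notin> U \<and> b \<notin> U")
  case True
  have 1: "csg b (insert a U) = (if a < b then - csg b U else csg b U)" using csg_insert assms True by blast
  have 2: "csg a (insert b U) = (if b < a then - csg a U else csg a U)" using csg_insert assms True by blast
  have "an a (an b f) U = csg a U * (csg b (insert a U) * f (insert a (insert b U)))"
   using True False e by (simp add: an_def)
  moreover have "an b (an a f) U = csg b U * (csg a (insert b U) * f (insert a (insert b U)))"
   using True False by (simp add: an_def)
  ultimately show ?thesis unfolding 1 2 using ord by (cases "b < a") simp_all
 next
  case nope: False
  thus ?thesis by (auto simp: an_def)
 qed
qed (auto simp: an_def)

definition bil :: "('i \<Rightarrow> 'i \<Rightarrow> complex) \<Rightarrow> ('i set \<Rightarrow> complex) \<Rightarrow> 'i set \<Rightarrow> complex" where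
 "bil M f U = (\<Sum>a\<in>I. \<Sum>b\<in>I. M a b * cr a (an b f) U)"

lemma quartic:
 assumes "a \<in> I" "b \<in> I" "c \<in> I" "d \<in> I"
 shows "cr a (an b (cr c (an d f))) U - cr c (an d (cr a (an b f))) U
  = of_bool (b = c) * cr a (an d f) U - of_bool (a = d) * cr c (an b f) U"
proof -
 have 1: "cr a (an b (cr c h)) U = of_bool (b = c) * cr a h U - cr a (cr c (an b h)) U"
  if "a \<in> I" "b \<in> I" "c \<in> I" for a b c h
 proof -
  have "an b (cr c h) = (\<lambda>V. of_bool (b = c) * h V - cr c (an b h) V)"
   using cr_an[OF that(3,2), of h] by (auto simp: fun_eq_iff eq_diff_eq add.commute)
  thus ?thesis by (simp only: cr_diff cr_smult)
 qed
 have 2: "cr a (cr c (an b (an d f))) U = cr c (cr a (an d (an b f))) U"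
 proof -
  have e: "an b (an d f) = (\<lambda>V. - an d (an b f) V)" using an_an[OF assms(2,4), of f] by auto
  have e': "cr c (an b (an d f)) = (\<lambda>V. - cr c (an d (an b f)) V)"
   by (rule ext, subst e, rule cr_minus)
  have "cr a (cr c (an b (an d f))) U = - cr a (cr c (an d (an b f))) U"
   by (subst e', rule cr_minus)
  thus ?thesis using cr_cr[OF assms(1,3)] by simp
 qed
 show ?thesis using 1[OF assms(1-3), of "an d f"] 1[OF assms(3,4,1), of "an b f"] 2 by (auto simp: eq_commute[of d])
qed

text \<open>Second quantisation turns the matrix commutator into the commutator of operators. By
  \<open>quartic\<close> the terms with four creation and annihilation operators cancel, and only
  contractions of one inner index are left.\<close>

lemma bil_br:
 "bil M (bil L f) U - bil L (bil M f) U = bil (\<lambda>a d. \<Sum>c\<in>I. M a c * L c d - L a c * M c d) f U"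
proof -
 have e: "bil M (bil L f) U = (\<Sum>a\<in>I. \<Sum>b\<in>I. \<Sum>c\<in>I. \<Sum>d\<in>I. M a b * L c d * cr a (an b (cr c (an d f))) U)" for M L
 proof -
  have b: "an b (bil L f) = (\<lambda>V. \<Sum>c\<in>I. \<Sum>d\<in>I. L c d * an b (cr c (an d f)) V)" for b
   unfolding bil_def by (auto simp: fun_eq_iff an_sum an_smult)
  show ?thesis
   unfolding bil_def[of M] b by (simp add: cr_sum cr_smult sum_distrib_left mult.assoc)
 qed
 have "bil L (bil M f) U = (\<Sum>c\<in>I. \<Sum>d\<in>I. \<Sum>a\<in>I. \<Sum>b\<in>I. M a b * L c d * cr c (an d (cr a (an b f))) U)"
  unfolding e by (simp add: mult.commute)
 also have "\<dots> = (\<Sum>a\<in>I. \<Sum>b\<in>I. \<Sum>c\<in>I. \<Sum>d\<in>I. M a b * L c d * cr c (an d (cr a (an b f))) U)"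
 proof -
  have "(\<Sum>c\<in>I. \<Sum>d\<in>I. \<Sum>a\<in>I. \<Sum>b\<in>I. F a b c d) = (\<Sum>a\<in>I. \<Sum>b\<in>I. \<Sum>c\<in>I. \<Sum>d\<in>I. F a b c d)"
   for F :: "'i \<Rightarrow> 'i \<Rightarrow> 'i \<Rightarrow> 'i \<Rightarrow> complex"
  proof -
   have "(\<Sum>c\<in>I. \<Sum>d\<in>I. \<Sum>a\<in>I. \<Sum>b\<in>I. F a b c d) = (\<Sum>c\<in>I. \<Sum>a\<in>I. \<Sum>d\<in>I. \<Sum>b\<in>I. F a b c d)"
    by (rule sum.cong[OF refl], rule sum.swap)
   also have "\<dots> = (\<Sum>a\<in>I. \<Sum>c\<in>I. \<Sum>d\<in>I. \<Sum>b\<in>I. F a b c d)" by (rule sum.swap)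
   also have "\<dots> = (\<Sum>a\<in>I. \<Sum>c\<in>I. \<Sum>b\<in>I. \<Sum>d\<in>I. F a b c d)"
    by (rule sum.cong[OF refl], rule sum.cong[OF refl], rule sum.swap)
   also have "\<dots> = (\<Sum>a\<in>I. \<Sum>b\<in>I. \<Sum>c\<in>I. \<Sum>d\<in>I. F a b c d)"
    by (rule sum.cong[OF refl], rule sum.swap)
   finally show ?thesis .
  qed
  thus ?thesis .
 qed
 finally have "bil M (bil L f) U - bil L (bil M f) U
   = (\<Sum>a\<in>I. \<Sum>b\<in>I. \<Sum>c\<in>I. \<Sum>d\<in>I. M a b * L c d * (cr a (an b (cr c (an d f))) U - cr c (an d (cr a (an b f))) U))"
  unfolding e[of M L] by (simp add: sum_subtractf right_diff_distrib)
 also have "\<dots> = (\<Sum>a\<in>I. \<Sum>b\<in>I. \<Sum>c\<in>I. \<Sum>d\<in>I. M a b * L c d * of_bool (b = c) * cr a (an d f) U)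
  - (\<Sum>a\<in>I. \<Sum>b\<in>I. \<Sum>c\<in>I. \<Sum>d\<in>I. M a b * L c d * of_bool (a = d) * cr c (an b f) U)"
  by (simp add: quartic right_diff_distrib sum_subtractf mult.assoc cong: sum.cong)
 also have "(\<Sum>a\<in>I. \<Sum>b\<in>I. \<Sum>c\<in>I. \<Sum>d\<in>I. M a b * L c d * of_bool (b = c) * cr a (an d f) U)
  = (\<Sum>a\<in>I. \<Sum>b\<in>I. \<Sum>d\<in>I. M a b * L b d * cr a (an d f) U)"
 proof (rule sum.cong[OF refl], rule sum.cong[OF refl])
  fix a b assume "b \<in> I"
  have "(\<Sum>c\<in>I. \<Sum>d\<in>I. M a b * L c d * of_bool (b = c) * cr a (an d f) U)
    = (\<Sum>c\<in>I. if c = b then \<Sum>d\<in>I. M a b * L b d * cr a (an d f) U else 0)"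
   by (intro sum.cong) auto
  thus "(\<Sum>c\<in>I. \<Sum>d\<in>I. M a b * L c d * of_bool (b = c) * cr a (an d f) U) = (\<Sum>d\<in>I. M a b * L b d * cr a (an d f) U)"
   using \<open>b \<in> I\<close> fin by simp
 qed
 also have "\<dots> = (\<Sum>a\<in>I. \<Sum>d\<in>I. (\<Sum>c\<in>I. M a c * L c d) * cr a (an d f) U)"
  by (rule sum.cong[OF refl], subst sum.swap) (simp add: sum_distrib_right)
 also have "(\<Sum>a\<in>I. \<Sum>b\<in>I. \<Sum>c\<in>I. \<Sum>d\<in>I. M a b * L c d * of_bool (a = d) * cr c (an b f) U)
  = (\<Sum>a\<in>I. \<Sum>b\<in>I. \<Sum>c\<in>I. M a b * L c a * cr c (an b f) U)"
 proof (intro sum.cong refl)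
  fix a b c assume "a \<in> I"
  have "(\<Sum>d\<in>I. M a b * L c d * of_bool (a = d) * cr c (an b f) U)
    = (\<Sum>d\<in>I. if d = a then M a b * L c a * cr c (an b f) U else 0)"
   by (intro sum.cong) auto
  thus "(\<Sum>d\<in>I. M a b * L c d * of_bool (a = d) * cr c (an b f) U) = M a b * L c a * cr c (an b f) U"
   using \<open>a \<in> I\<close> fin by simp
 qed
 also have "\<dots> = (\<Sum>c\<in>I. \<Sum>b\<in>I. \<Sum>a\<in>I. M a b * L c a * cr c (an b f) U)"
 proof -
  have "(\<Sum>a\<in>I. \<Sum>b\<in>I. \<Sum>c\<in>I. F a b c) = (\<Sum>c\<in>I. \<Sum>b\<in>I. \<Sum>a\<in>I. F a b c)" for F :: "'i \<Rightarrow> 'i \<Rightarrow> 'i \<Rightarrow> complex"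
  proof -
   have "(\<Sum>a\<in>I. \<Sum>b\<in>I. \<Sum>c\<in>I. F a b c) = (\<Sum>b\<in>I. \<Sum>a\<in>I. \<Sum>c\<in>I. F a b c)" by (rule sum.swap)
   also have "\<dots> = (\<Sum>b\<in>I. \<Sum>c\<in>I. \<Sum>a\<in>I. F a b c)" by (rule sum.cong[OF refl], rule sum.swap)
   also have "\<dots> = (\<Sum>c\<in>I. \<Sum>b\<in>I. \<Sum>a\<in>I. F a b c)" by (rule sum.swap)
   finally show ?thesis .
  qed
  thus ?thesis .
 qed
 also have "\<dots> = (\<Sum>a\<in>I. \<Sum>d\<in>I. (\<Sum>c\<in>I. L a c * M c d) * cr a (an d f) U)"
  by (simp only: sum_distrib_right) (simp only: mult.commute[of "M _ _"])
 finally show ?thesis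
  unfolding bil_def[of "\<lambda>a d. \<Sum>c\<in>I. M a c * L c d - L a c * M c d"]
  by (simp only: sum_subtractf left_diff_distrib)
qed

lemma hop_zero: "b \<notin> S \<or> (a \<in> S \<and> a \<noteq> b) \<Longrightarrow> cr a (an b (vac S)) U = 0"
 by (auto simp: cr_def an_def vac_def)

lemma hop_same: "b \<in> S \<Longrightarrow> b \<in> I \<Longrightarrow> cr b (an b (vac S)) = vac S"
proof
 fix U assume b: "b \<in> S" "b \<in> I"
 have "an b (cr b (vac S)) U = 0" using b by (auto simp: an_def cr_def vac_def)
 thus "cr b (an b (vac S)) U = vac S U" using cr_an[OF b(2,2), of "vac S" U] by simp
qed

text \<open>The result carries no sign: when no other occupied index lies between a and b, the
  Jordan-Wigner signs of removal and creation agree.\<close>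

lemma hop:
 assumes "a \<in> I" "b \<in> I" "b \<in> S" "a \<notin> S"
  and between: "\<And>x. x \<in> S \<Longrightarrow> x \<noteq> b \<Longrightarrow> (x < a \<longleftrightarrow> x < b)"
 shows "cr a (an b (vac S)) = vac (insert a (S - {b}))"
proof
 fix U
 show "cr a (an b (vac S)) U = vac (insert a (S - {b})) U"
 proof (cases "a \<in> U \<and> b \<notin> U - {a} \<and> insert b (U - {a}) = S")
  case True
  have ab: "a \<noteq> b" using assms by auto
  have U: "U = insert a (S - {b})" using True ab assms by auto
  have Ua: "U - {a} = S - {b}" using U assms by auto
  have "csg a U = csg a (S - {b})"
   unfolding U using csg_insert[of a "S - {b}" a] assms by simp
  also have "\<dots> = csg b (S - {b})"
   unfolding csg_def
  proof -
   let ?h = "\<lambda>x. if x \<in> S - {b} then - 1 else 1 :: complex"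
   have "prod ?h {x \<in> I. x < c} = prod ?h {x \<in> I. x < c \<and> x \<in> S - {b}}" for c
    by (rule prod.mono_neutral_right) (use fin in auto)
   moreover have "{x \<in> I. x < a \<and> x \<in> S - {b}} = {x \<in> I. x < b \<and> x \<in> S - {b}}" using between by auto
   ultimately show "prod ?h {x \<in> I. x < a} = prod ?h {x \<in> I. x < b}" by simp
  qed
  finally show ?thesis using True Ua U ab assms by (simp add: cr_def an_def vac_def mult.assoc[symmetric] insert_absorb)
 next
  case False
  have "U \<noteq> insert a (S - {b})" using False assms by auto
  thus ?thesis using False by (auto simp: cr_def an_def vac_def)
 qed
qed

end

context A2n2
begin

subsection \<open>The action on quasi-periodic sequences\<close>

definition opx :: "'g \<Rightarrow> (int \<Rightarrow> complex) \<Rightarrow> int \<Rightarrow> complex" where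
 "opx x v i = (\<Sum>k\<in>{k. Phi x k i \<noteq> 0}. Phi x k i * v (i + k))"

lemma opx_K: "finite K \<Longrightarrow> {k. Phi x k i \<noteq> 0} \<subseteq> K \<Longrightarrow> opx x v i = (\<Sum>k\<in>K. Phi x k i * v (i + k))"
 unfolding opx_def by (rule sum.mono_neutral_left) auto

lemma opx_add: "opx (x + y) v i = opx x v i + opx y v i"
proof -
 let ?K = "{k. Phi x k i \<noteq> 0} \<union> {k. Phi y k i \<noteq> 0}"
 have K: "finite ?K" using Phi_finite by simp
 have "opx (x + y) v i = (\<Sum>k\<in>?K. Phi (x + y) k i * v (i + k))"
  by (rule opx_K[OF K]) (auto simp: Phi_add)
 also have "\<dots> = (\<Sum>k\<in>?K. Phi x k i * v (i + k)) + (\<Sum>k\<in>?K. Phi y k i * v (i + k))"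
  by (simp add: Phi_add distrib_right sum.distrib)
 also have "\<dots> = opx x v i + opx y v i"
  using opx_K[OF K, of x i v] opx_K[OF K, of y i v] by auto
 finally show ?thesis .
qed

lemma opx_sm: "opx (sm c x) v i = c * opx x v i"
proof -
 have "opx (sm c x) v i = (\<Sum>k\<in>{k. Phi x k i \<noteq> 0}. Phi (sm c x) k i * v (i + k))"
  by (rule opx_K[OF Phi_finite]) (auto simp: Phi_sm)
 thus ?thesis by (simp add: Phi_sm opx_def sum_distrib_left mult.assoc)
qed

lemma opx_T: "T k x c \<Longrightarrow> opx x v i = c i * v (i + k)"
proof -
 assume t: "T k x c"
 have "opx x v i = (\<Sum>l\<in>{k}. Phi x l i * v (i + l))"
  by (rule opx_K) (auto simp: Phi_T[OF t])
 thus ?thesis by (simp add: Phi_T[OF t])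
qed

lemma opx_v_add: "opx x (\<lambda>j. u j + v j) i = opx x u i + opx x v i"
 by (simp add: opx_def distrib_left sum.distrib)

lemma opx_v_sum: "opx x (\<lambda>j. \<Sum>r\<in>R. c r * v r j) i = (\<Sum>r\<in>R. c r * opx x (v r) i)"
 unfolding opx_def by (simp add: sum_distrib_left mult.left_commute sum.swap[of _ R])

lemma opx_br: "opx (br x y) v i = opx x (opx y v) i - opx y (opx x v) i"
proof (induction x arbitrary: i v rule: Phi_induct)
 case (1 k x c)
 show ?case
 proof (induction y arbitrary: i v rule: Phi_induct)
  case (1 l y d)
  note ax = opx_T[OF \<open>T k x c\<close>] and ay = opx_T[OF 1]
  show ?case unfolding opx_T[OF T_br[OF \<open>T k x c\<close> 1]] ax ay by (simp add: bc_def algebra_simps)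
 next
  case (2 y z)
  have "opx (y + z) v = (\<lambda>j. opx y v j + opx z v j)" for v by (rule ext) (rule opx_add)
  thus ?case using 2 by (simp add: br_add_r opx_add opx_v_add)
 qed
next
 case (2 x z)
 have "opx (x + z) v = (\<lambda>j. opx x v j + opx z v j)" for v by (rule ext) (rule opx_add)
 thus ?case using 2 by (simp add: br_add_l opx_add opx_v_add)
qed

text \<open>This fails for the scaling element, whose diagonal drifts by \<delta> over a period. It
  holds on the current algebra, and it is what makes \<open>opx\<close> preserve the sequences with
  v (i + N) = b * v i.\<close>

definition per :: "'g \<Rightarrow> bool" where "per x \<longleftrightarrow> (\<forall>i. Phi x 0 (i + N) = Phi x 0 i)"

lemma Phi_per': "per x \<Longrightarrow> Phi x k (i + N) = Phi x k i"
 by (cases "k = 0") (auto simp: per_def Phi_per)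

text \<open>The sequence with multiplier b per period that is supported on the residue class of q
  and has value 1 at q. For one period of q these form a basis of the quasi-periodic
  sequences.\<close>

definition qv :: "complex \<Rightarrow> int \<Rightarrow> int \<Rightarrow> complex" where
 "qv b q i = (if N dvd i - q then b powi ((i - q) div N) else 0)"

lemma qv_quasi: "b \<noteq> 0 \<Longrightarrow> qv b q (i + N) = b * qv b q i"
proof -
 assume b: "b \<noteq> 0"
 have e: "i + N - q = (i - q) + N" by simp
 have "(i - q + N) div N = (i - q) div N + 1" using N3 by simp
 thus ?thesis using b unfolding qv_def e dvd_shift by (simp add: power_int_add_1')
qed

lemma quasi_mult:
 fixes v :: "int \<Rightarrow> complex"
 assumes "\<And>i. v (i + N) = b * v i" "b \<noteq> 0"
 shows "v (i + z * N) = b powi z * v i"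
proof (induction z rule: int_induct[where k = 0])
 case (step1 z)
 have "b powi (1 + z) = b * b powi z" using assms(2) by (subst power_int_add) auto
 thus ?case using assms(1)[of "i + z * N"] step1 by (simp add: algebra_simps)
next
 case (step2 z)
 have "b * v (i + (z - 1) * N) = b powi z * v i"
  using assms(1)[of "i + (z - 1) * N"] step2 by (simp add: algebra_simps)
 moreover have "b powi z = b * b powi (z - 1)"
  using power_int_add_1'[of b "z - 1"] assms(2) by simp
 ultimately show ?case using assms(2) by simp
qed simp

text \<open>The representatives are 1, ..., N and not 0, ..., N - 1, so that a vacuum can occupy an
  initial segment 1, ..., j while the class of 0 comes last.\<close>

lemma residue: "\<exists>!r. r \<in> {1..N} \<and> N dvd i - r"
proof -
 define r where "r = (if i mod N = 0 then N else i mod N)"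
 have "N dvd i - i mod N" by (simp add: mod_eq_dvd_iff[symmetric])
 hence 1: "r \<in> {1..N} \<and> N dvd i - r"
 proof (cases "i mod N = 0")
  case True
  thus ?thesis using N3 by (simp add: r_def mod_eq_0_iff_dvd dvd_diff)
 next
  case False
  have "1 \<le> i mod N" "i mod N \<le> N" using False mod_bounds[of i] by linarith+
  thus ?thesis using False \<open>N dvd i - i mod N\<close> unfolding r_def by simp
 qed
 have 2: "r' = r" if "r' \<in> {1..N} \<and> N dvd i - r'" for r'
 proof -
  have "N dvd (i - r) - (i - r')" by (rule dvd_diff) (use 1 that in blast)+
  hence "N dvd r' - r" by simp
  moreover have "\<bar>r' - r\<bar> < N" using 1 that by auto
  ultimately show ?thesis using dvd_imp_le_int[of "r' - r" N] by auto
 qed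
 show ?thesis using 1 2 by blast
qed

lemma quasi_expand:
 fixes v :: "int \<Rightarrow> complex"
 assumes "\<And>i. v (i + N) = b * v i" "b \<noteq> 0"
 shows "v i = (\<Sum>r\<in>{1..N}. v r * qv b r i)"
proof -
 obtain r where r: "r \<in> {1..N}" "N dvd i - r" and u: "\<And>r'. r' \<in> {1..N} \<Longrightarrow> N dvd i - r' \<Longrightarrow> r' = r"
  using residue[of i] by blast
 have "(\<Sum>r\<in>{1..N}. v r * qv b r i) = (\<Sum>r'\<in>{r}. v r' * qv b r' i)"
 proof (rule sum.mono_neutral_right)
  show "\<forall>r'\<in>{1..N} - {r}. v r' * qv b r' i = 0"
  proof
   fix r' assume r': "r' \<in> {1..N} - {r}"
   hence "\<not> N dvd i - r'" using u[of r'] by blast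
   thus "v r' * qv b r' i = 0" by (simp add: qv_def)
  qed
 qed (use r(1) in auto)
 also have "\<dots> = b powi ((i - r) div N) * v r" using r by (simp add: qv_def)
 also have "\<dots> = v (r + ((i - r) div N) * N)" by (rule quasi_mult[of v b, symmetric]) (rule assms)+
 also have "r + ((i - r) div N) * N = i" using r by simp
 finally show ?thesis by (rule sym)
qed

lemma opx_quasi:
 assumes "per x" "\<And>i. v (i + N) = b * v i"
 shows "opx x v (i + N) = b * opx x v i"
proof -
 have "v (i + N + k) = b * v (i + k)" for k using assms(2)[of "i + k"] by (simp add: ac_simps)
 thus ?thesis by (simp add: opx_def Phi_per'[OF assms(1)] sum_distrib_left mult.left_commute)
qed

text \<open>The value of the loop x at the parameter b, as an N by N matrix with indices in 1, ...,
  N.\<close>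

definition mat :: "complex \<Rightarrow> 'g \<Rightarrow> int \<Rightarrow> int \<Rightarrow> complex" where
 "mat b x p q = opx x (qv b q) p"

lemma mat_add: "mat b (x + y) p q = mat b x p q + mat b y p q"
 and mat_sm: "mat b (sm c x) p q = c * mat b x p q"
 by (simp_all add: mat_def opx_add opx_sm)

lemma mat_nz: "mat b x p q \<noteq> 0 \<Longrightarrow> \<exists>k. Phi x k p \<noteq> 0 \<and> N dvd p + k - q"
proof (rule ccontr)
 assume nz: "mat b x p q \<noteq> 0" and neg: "\<not> ?thesis"
 have "mat b x p q = 0" unfolding mat_def opx_def
  by (rule sum.neutral) (use neg in \<open>auto simp: qv_def\<close>)
 thus False using nz by simp
qed

lemma mat_br:
 assumes "per x" "per y" "b \<noteq> 0"
 shows "mat b (br x y) p q = (\<Sum>r\<in>{1..N}. mat b x p r * mat b y r q - mat b y p r * mat b x r q)"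
proof -
 have e: "opx x (opx y (qv b q)) p = (\<Sum>r\<in>{1..N}. mat b x p r * mat b y r q)" if "per y" for x y
 proof -
  have "opx y (qv b q) = (\<lambda>i. \<Sum>r\<in>{1..N}. opx y (qv b q) r * qv b r i)"
  proof
   fix i
   have "opx y (qv b q) (j + N) = b * opx y (qv b q) j" for j
    by (rule opx_quasi[OF that]) (rule qv_quasi[OF assms(3)])
   thus "opx y (qv b q) i = (\<Sum>r\<in>{1..N}. opx y (qv b q) r * qv b r i)"
    by (rule quasi_expand) (rule assms(3))
  qed
  hence "opx x (opx y (qv b q)) p = opx x (\<lambda>i. \<Sum>r\<in>{1..N}. opx y (qv b q) r * qv b r i) p"
   by (rule arg_cong)
  also have "\<dots> = (\<Sum>r\<in>{1..N}. mat b y r q * mat b x p r)"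
   unfolding opx_v_sum mat_def ..
  finally show ?thesis by (simp only: mult.commute)
 qed
 show ?thesis unfolding mat_def[of b "br x y"] opx_br e[OF assms(1)] e[OF assms(2)] sum_subtractf ..
qed

subsection \<open>Special elements of the Cartan subalgebra\<close>

lemma pih_diff_sum: "pih h i - pih h (i + int k) = (\<Sum>l\<in>{i..<i + int k}. al (lab l) h)"
proof (induction k)
 case (Suc k)
 have "{i..<i + int (Suc k)} = insert (i + int k) {i..<i + int k}" by auto
 thus ?case using Suc pih_step[of h "i + int k"] by (simp add: algebra_simps)
qed simp

text \<open>One period of the walk meets each of the labels 0, ..., n - 1 twice and n once, and
  these are the coefficients of \<delta>.\<close>

lemma delta_pih: "delta n G h = - pih h N"
proof -
 have "{0..<N} = int ` {..n} \<union> (\<lambda>i. 2 * int n - int i) ` {..<n}"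
 proof -
  have "z \<in> int ` {..n} \<union> (\<lambda>i. 2 * int n - int i) ` {..<n}" if "0 \<le> z" "z < N" for z
  proof (cases "z \<le> int n")
   case True
   hence "z = int (nat z)" "nat z \<le> n" using that by auto
   thus ?thesis by blast
  next
   case False
   hence "z = 2 * int n - int (nat (2 * int n - z))" "nat (2 * int n - z) < n" using that by (auto simp: N_def)
   thus ?thesis by blast
  qed
  hence "{0..<N} \<subseteq> int ` {..n} \<union> (\<lambda>i. 2 * int n - int i) ` {..<n}" by (meson atLeastLessThan_iff subsetI)
  moreover have "int ` {..n} \<union> (\<lambda>i. 2 * int n - int i) ` {..<n} \<subseteq> {0..<N}" by (auto simp: N_def)
  ultimately show ?thesis by (rule antisym)
 qed
 moreover have "int ` {..n} \<inter> (\<lambda>i. 2 * int n - int i) ` {..<n} = {}" by auto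
 ultimately have "(\<Sum>l\<in>{0..<N}. al (lab l) h) = (\<Sum>l\<in>int ` {..n}. al (lab l) h)
   + (\<Sum>l\<in>(\<lambda>i. 2 * int n - int i) ` {..<n}. al (lab l) h)"
  by (simp only: sum.union_disjoint finite_imageI finite_atMost finite_lessThan)
 also have "(\<Sum>l\<in>int ` {..n}. al (lab l) h) = (\<Sum>i\<le>n. al i h)"
  by (subst sum.reindex) (auto simp: lab_self intro!: sum.cong)
 also have "(\<Sum>l\<in>(\<lambda>i. 2 * int n - int i) ` {..<n}. al (lab l) h) = (\<Sum>i<n. al i h)"
 proof (subst sum.reindex)
  show "inj_on (\<lambda>i. 2 * int n - int i) {..<n}" by (auto simp: inj_on_def)
  show "(\<Sum>i<n. ((\<lambda>l. al (lab l) h) \<circ> (\<lambda>i. 2 * int n - int i)) i) = (\<Sum>i<n. al i h)"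
  proof (rule sum.cong)
   fix i assume "i \<in> {..<n}"
   hence "lab (2 * int n - int i) = i" by (auto simp: lab_def N_def)
   thus "((\<lambda>l. al (lab l) h) \<circ> (\<lambda>i. 2 * int n - int i)) i = al i h" by simp
  qed simp
 qed
 also have "(\<Sum>i\<le>n. al i h) + (\<Sum>i<n. al i h) = delta n G h"
 proof -
  have "delta n G h = (\<Sum>i<n. (if i = n then 1 else 2) * al i h) + al n h"
   unfolding delta_def root_combination_def lessThan_Suc_atMost[symmetric] sum.lessThan_Suc by simp
  also have "(\<Sum>i<n. (if i = n then 1 else 2) * al i h) = (\<Sum>i<n. 2 * al i h)" by (rule sum.cong) auto
  also have "\<dots> = 2 * (\<Sum>i<n. al i h)" by (rule sum_distrib_left[symmetric])
  finally have d: "delta n G h = 2 * (\<Sum>i<n. al i h) + al n h" .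
  have alg: "s + a + s = 2 * s + a" for s a :: complex by simp
  show ?thesis unfolding d lessThan_Suc_atMost[symmetric] sum.lessThan_Suc by (rule alg)
 qed
 finally have s: "(\<Sum>l\<in>{0..<N}. al (lab l) h) = delta n G h" .
 have nN: "int (nat N) = N" using N3 by simp
 have "pih h 0 - pih h (0 + N) = (\<Sum>l\<in>{0..<0 + N}. al (lab l) h)"
  using pih_diff_sum[of h 0 "nat N"] unfolding nN .
 thus ?thesis unfolding add_0 s by (metis diff_0 pih_0)
qed

text \<open>The diagonal of half the sum of the positive coroots of the finite part: the simple
  roots 1, ..., n take the value 1 and \<delta> vanishes. It decreases along 1, ..., 2n, and its
  value 0 places the class of 0 between n and n + 1.\<close>

definition us :: "int \<Rightarrow> real" where
 "us m = (if m mod N = 0 then 0 else real_of_int N / 2 - real_of_int (m mod N))"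

lemma us_per: "us (m + N) = us m" by (simp add: us_def)

lemma us_odd: "us (- m) = - us m"
proof (cases "m mod N = 0")
 case True
 hence "(- m) mod N = 0" by (simp add: mod_minus_eq[symmetric] zmod_zminus1_eq_if)
 thus ?thesis using True by (simp add: us_def)
next
 case False
 hence "(- m) mod N = N - m mod N" by (simp add: zmod_zminus1_eq_if)
 moreover have "N - m mod N \<noteq> 0" using mod_bounds[of m] by auto
 ultimately show ?thesis using False by (simp add: us_def)
qed

lemma us_cong: "N dvd i - j \<Longrightarrow> us i = us j"
 by (simp add: us_def mod_eq_dvd_iff[symmetric])

lemma ex_hs: "\<exists>h\<in>H. pih h = (\<lambda>m. of_real (us m))"
 by (rule ex_pih_odd) (simp_all add: us_odd us_per)

definition hs :: 'g where "hs = (SOME h. h \<in> H \<and> pih h = (\<lambda>m. of_real (us m)))"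

lemma hs: "hs \<in> H" "pih hs m = of_real (us m)"
proof -
 have "hs \<in> H \<and> pih hs = (\<lambda>m. of_real (us m))" unfolding hs_def
  by (rule someI_ex) (use ex_hs in blast)
 thus "hs \<in> H" "pih hs m = of_real (us m)" by auto
qed

lemma us_small: "1 \<le> p \<Longrightarrow> p \<le> 2 * int n \<Longrightarrow> us p = real n + 1 / 2 - real_of_int p"
 by (simp add: us_def N_def)

lemma al_hs: "1 \<le> i \<Longrightarrow> i \<le> n \<Longrightarrow> al i hs = 1"
 using pih_step[of hs "int i"] us_small[of "int i"] us_small[of "int i + 1"]
 by (simp add: lab_self hs)

lemma delta_hs: "delta n G hs = 0"
 by (simp add: delta_pih hs us_def)

definition sc :: 'g where "sc = scaling_element n G"

lemma sc: "sc \<in> H" "al 0 sc = 1" "1 \<le> i \<Longrightarrow> i \<le> n \<Longrightarrow> al i sc = 0"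
proof -
 obtain h where "h \<in> H" "\<forall>i\<le>n. al i h = (if i = 0 then 1 else 0)"
  using ex_al[of "\<lambda>i. if i = 0 then 1 else 0"] by blast
 hence "h \<in> H \<and> al 0 h = 1 \<and> (\<forall>i\<in>{1..n}. al i h = 0)" by auto
 hence "sc \<in> H \<and> al 0 sc = 1 \<and> (\<forall>i\<in>{1..n}. al i sc = 0)"
  unfolding sc_def scaling_element_def by (rule someI)
 thus "sc \<in> H" "al 0 sc = 1" "1 \<le> i \<Longrightarrow> i \<le> n \<Longrightarrow> al i sc = 0" by auto
qed

text \<open>The difference of two diagonal entries of \<open>sc\<close> counts the steps of label 0
  between them; if it is 0, there are none.\<close>

lemma sc_entry:
 assumes "pih sc i = pih sc (i + int k)" "l \<in> {i..<i + int k}"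
 shows "lab l \<noteq> 0"
proof
 assume l: "lab l = 0"
 have v: "al (lab l) sc = of_nat (of_bool (lab l = 0))" for l using sc(2) sc(3)[of "lab l"] lab_le[of l] by (cases "lab l = 0") auto
 have "(\<Sum>l\<in>{i..<i + int k}. of_bool (lab l = 0) :: nat) > 0"
  using assms(2) l by (intro sum_pos2[of _ l]) auto
 moreover have "(\<Sum>l\<in>{i..<i + int k}. al (lab l) sc) = of_nat (\<Sum>l\<in>{i..<i + int k}. of_bool (lab l = 0))"
  unfolding v by (rule of_nat_sum[symmetric])
 ultimately have "pih sc i - pih sc (i + int k) \<noteq> 0" unfolding pih_diff_sum
  by (metis of_nat_eq_0_iff less_numeral_extra(3))
 thus False using assms(1) by simp
qed

text \<open>Both steps that touch a multiple of N carry the label 0. A path without that label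
  therefore runs strictly between two consecutive multiples of N and is shorter than a
  period.\<close>

lemma sc_entry':
 assumes "pih sc i = pih sc (i + int k)" "k \<ge> 1"
 shows "\<not> N dvd i" "\<not> N dvd i + int k" "\<not> N dvd int k"
proof -
 have l: "\<not> N dvd l \<and> \<not> N dvd l + 1" if "l \<in> {i..<i + int k}" for l
  using sc_entry[OF assms(1) that] lab0_iff by auto
 show "\<not> N dvd i" using l[of i] assms(2) by auto
 show "\<not> N dvd i + int k" using l[of "i + int k - 1"] assms(2) by auto
 show "\<not> N dvd int k"
 proof
  assume "N dvd int k"
  hence "int k \<ge> N" using assms(2) zdvd_imp_le by force
  moreover have "(- i) mod N < N" "0 \<le> (- i) mod N" using mod_bounds by auto
  ultimately have "i + (- i) mod N \<in> {i..<i + int k}" by auto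
  moreover have "N dvd i + (- i) mod N" by (simp add: mod_eq_0_iff_dvd[symmetric] mod_add_right_eq)
  ultimately show False using l by blast
 qed
qed

lemma eigen_T:
 assumes "br h0 x = sm (of_int k) x"
 shows "T k x (Phi x k)" "l \<noteq> k \<Longrightarrow> Phi x l m = 0"
proof -
 obtain xs and M :: int where x: "\<And>k. T k (xs k) (Phi x k)" "\<And>k. \<bar>k\<bar> > M \<Longrightarrow> xs k = 0"
  "x = (\<Sum>k\<in>{-M..M}. xs k)" by (rule Phi_decomp[of x]) blast
 define M' where "M' = max M \<bar>k\<bar>"
 have x3: "x = (\<Sum>k\<in>{-M'..M'}. xs k)" unfolding x(3)
  by (rule sum_extend) (use x(2) in \<open>auto simp: M'_def\<close>)
 have kM: "k \<in> {-M'..M'}" by (auto simp: M'_def)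
 have z: "xs l - (if l = k then x else 0) = 0" for l
 proof (rule graded_zero[of "\<lambda>l. xs l - (if l = k then x else 0)" M'])
  show "br h0 (xs l - (if l = k then x else 0)) = sm (of_int l) (xs l - (if l = k then x else 0))" for l
   using T_eigen[OF x(1)] assms by (auto simp: br_diff_r V.scale_right_diff_distrib)
  show "(\<Sum>l\<in>{-M'..M'}. xs l - (if l = k then x else 0)) = 0"
   using kM x3 by (simp add: sum_subtractf sum.delta')
  show "xs l - (if l = k then x else 0) = 0" if "\<bar>l\<bar> > M'" for l
   using that x(2) by (auto simp: M'_def)
 qed
 show "T k x (Phi x k)" using x(1)[of k] z[of k] by simp
 show "Phi x l m = 0" if "l \<noteq> k"
  using x(1)[of l] z[of l] that T_zero_coef by simp
qed

subsection \<open>Real roots of the finite part\<close>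

text \<open>Combinations of brackets of length k in the generators 1, ..., n of sign s: the height k
  part of a nilpotent subalgebra of the finite part.\<close>

inductive FP :: "int \<Rightarrow> nat \<Rightarrow> 'g \<Rightarrow> bool" for s where
 FP_gen: "1 \<le> i \<Longrightarrow> i \<le> n \<Longrightarrow> FP s 1 (g s i)"
| FP_br: "FP s k x \<Longrightarrow> 1 \<le> i \<Longrightarrow> i \<le> n \<Longrightarrow> FP s (Suc k) (br (g s i) x)"
| FP_zero: "k \<ge> 1 \<Longrightarrow> FP s k 0"
| FP_add: "FP s k x \<Longrightarrow> FP s k y \<Longrightarrow> FP s k (x + y)"
| FP_sm: "FP s k x \<Longrightarrow> FP s k (sm a x)"

lemma FP_pos: "FP s k x \<Longrightarrow> k \<ge> 1" by (induction rule: FP.induct) auto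

lemma sc_g: "1 \<le> i \<Longrightarrow> i \<le> n \<Longrightarrow> br sc (g s i) = 0"
 using sc by (simp add: g_def br_he br_hf)

lemma FP_sc: "FP s k x \<Longrightarrow> br sc x = 0"
proof (induction rule: FP.induct)
 case (FP_br k x i) thus ?case by (subst jac) (simp add: sc_g)
qed (auto simp: sc_g br_add_r br_sm_r)

text \<open>Up to the sign s, the eigenvalue of \<open>sc\<close> on a bracket of generators is the
  number of occurrences of generator 0. Sorting by it isolates the brackets that avoid 0.\<close>

lemma P_FP_decomp:
 "P s k x c \<Longrightarrow> s = 1 \<or> s = - 1 \<Longrightarrow> \<exists>x0 ys (M::nat). FP s k x0 \<and> x = x0 + (\<Sum>j\<in>{1..M}. ys j) \<and>
  (\<forall>j. br sc (ys j) = sm (of_int s * of_nat j) (ys j)) \<and> (\<forall>j. j > M \<or> j = 0 \<longrightarrow> ys j = 0)"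
proof (induction rule: P.induct)
 case (P_gen i)
 show ?case
 proof (cases "i = 0")
  case True
  have "br sc (g s 0) = sm (of_int s) (g s 0)" using sc P_gen by (simp add: br_h_g)
  thus ?thesis using True
   by (intro exI[of _ 0] exI[of _ "\<lambda>j. if j = 1 then g s 0 else 0"] exI[of _ 1])
    (auto intro: FP_zero)
 next
  case False
  thus ?thesis using P_gen
   by (intro exI[of _ "g s i"] exI[of _ "\<lambda>j. 0"] exI[of _ 1]) (auto intro: FP_gen[simplified])
 qed
next
 case (P_br k x c i)
 then obtain x0 ys and M :: nat where x: "FP s k x0" "x = x0 + (\<Sum>j\<in>{1..M}. ys j)"
  "\<And>j. br sc (ys j) = sm (of_int s * of_nat j) (ys j)" "\<And>j. j > M \<or> j = 0 \<Longrightarrow> ys j = 0" by blast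
 show ?case
 proof (cases "i = 0")
  case False
  have "br sc (br (g s i) (ys j)) = sm (of_int s * of_nat j) (br (g s i) (ys j))" for j
   using P_br False x(3)[of j] by (subst jac) (simp add: sc_g br_sm_r)
  moreover have "FP s (Suc k) (br (g s i) x0)" using x(1) False P_br by (intro FP_br) auto
  ultimately show ?thesis using x(2,4)
   by (intro exI[of _ "br (g s i) x0"] exI[of _ "\<lambda>j. br (g s i) (ys j)"] exI[of _ M])
    (auto simp: br_add_r br_sum_r)
 next
  case True
  define z where "z j = (if j = 0 then x0 else ys j)" for j
  have z: "br sc (z j) = sm (of_int s * of_nat j) (z j)" for j using x(3)[of j] FP_sc[OF x(1)] by (simp add: z_def)
  have zs: "x = (\<Sum>j\<in>{0..M}. z j)"
   unfolding x(2) by (subst (2) sum.atLeast_Suc_atMost) (auto simp: z_def intro!: sum.cong)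
  \<comment> \<open>Bracketing with generator 0 raises the number of its occurrences by one, hence
    the shift of the index.\<close>
  define w where "w j = (if j = 0 then 0 else br (g s 0) (z (j - 1)))" for j
  have "br sc (w j) = sm (of_int s * of_nat j) (w j)" for j
  proof (cases j)
   case (Suc j')
   have "br sc (br (g s 0) (z j')) = sm (of_int s) (br (g s 0) (z j')) + sm (of_int s * of_nat j') (br (g s 0) (z j'))"
    using sc z[of j'] P_br by (subst jac) (simp add: br_h_g br_sm_r br_sm_l)
   thus ?thesis using Suc by (simp add: w_def V.scale_left_distrib distrib_left)
  qed (simp add: w_def)
  moreover have "br (g s 0) x = (\<Sum>j\<in>{1..Suc M}. w j)"
  proof -
   have "(\<Sum>j\<in>{1..Suc M}. w j) = (\<Sum>j\<in>{0..M}. w (Suc j))"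
    using sum.shift_bounds_cl_Suc_ivl[of w 0 M] by simp
   thus ?thesis by (simp add: zs br_sum_r w_def)
  qed
  moreover have "w j = 0" if "j > Suc M \<or> j = 0" for j
   using that x(4)[of "j - 1"] by (auto simp: w_def z_def)
  ultimately show ?thesis unfolding True
   by (intro exI[of _ 0] exI[of _ w] exI[of _ "Suc M"]) (auto intro: FP_zero)
 qed
next
 case (P_zero k)
 thus ?case by (intro exI[of _ 0] exI[of _ "\<lambda>j. 0"] exI[of _ 1]) (auto intro: FP_zero)
next
 case (P_add k x c y d)
 then obtain x0 ys and M :: nat where x: "FP s k x0" "x = x0 + (\<Sum>j\<in>{1..M}. ys j)"
  "\<And>j. br sc (ys j) = sm (of_int s * of_nat j) (ys j)" "\<And>j. j > M \<or> j = 0 \<Longrightarrow> ys j = 0" by blast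
 from P_add obtain y0 zs and L :: nat where y: "FP s k y0" "y = y0 + (\<Sum>j\<in>{1..L}. zs j)"
  "\<And>j. br sc (zs j) = sm (of_int s * of_nat j) (zs j)" "\<And>j. j > L \<or> j = 0 \<Longrightarrow> zs j = 0" by blast
 have "(\<Sum>j\<in>{1..M}. ys j) = (\<Sum>j\<in>{1..max M L}. ys j)" by (rule sum.mono_neutral_left) (use x(4) in auto)
 moreover have "(\<Sum>j\<in>{1..L}. zs j) = (\<Sum>j\<in>{1..max M L}. zs j)" by (rule sum.mono_neutral_left) (use y(4) in auto)
 ultimately have "x + y = (x0 + y0) + (\<Sum>j\<in>{1..max M L}. ys j + zs j)"
  unfolding x(2) y(2) by (simp add: sum.distrib algebra_simps)
 moreover have "br sc (ys j + zs j) = sm (of_int s * of_nat j) (ys j + zs j)" for j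
  by (simp add: br_add_r x(3) y(3) V.scale_right_distrib)
 moreover have "FP s k (x0 + y0)" using x y by (intro FP_add)
 ultimately show ?case using x(4) y(4)
  by (intro exI[of _ "x0 + y0"] exI[of _ "\<lambda>j. ys j + zs j"] exI[of _ "max M L"]) auto
next
 case (P_sm k x c a)
 then obtain x0 ys and M :: nat where x: "FP s k x0" "x = x0 + (\<Sum>j\<in>{1..M}. ys j)"
  "\<And>j. br sc (ys j) = sm (of_int s * of_nat j) (ys j)" "\<And>j. j > M \<or> j = 0 \<Longrightarrow> ys j = 0" by blast
 have "sm a x = sm a x0 + (\<Sum>j\<in>{1..M}. sm a (ys j))"
  unfolding x(2) by (simp add: V.scale_right_distrib V.scale_sum_right)
 moreover have "br sc (sm a (ys j)) = sm (of_int s * of_nat j) (sm a (ys j))" for j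
  by (simp add: br_sm_r x(3) mult.commute)
 moreover have "FP s k (sm a x0)" using x by (intro FP_sm)
 ultimately show ?case using x(4)
  by (intro exI[of _ "sm a x0"] exI[of _ "\<lambda>j. sm a (ys j)"] exI[of _ M]) auto
qed

lemma P_FP:
 assumes "P s k x c" "br sc x = 0" "s = 1 \<or> s = - 1"
 shows "FP s k x"
proof -
 obtain x0 ys and M :: nat where x: "FP s k x0" "x = x0 + (\<Sum>j\<in>{1..M}. ys j)"
  "\<And>j. br sc (ys j) = sm (of_int s * of_nat j) (ys j)" using P_FP_decomp[OF assms(1,3)] by blast
 define z where "z j = (if j = 0 then x0 - x else ys j)" for j
 have "(\<Sum>j\<in>{0..M}. z j) = (x0 - x) + (\<Sum>j\<in>{1..M}. ys j)"
  by (subst sum.atLeast_Suc_atMost) (auto simp: z_def intro!: sum.cong)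
 hence s: "(\<Sum>j\<in>{0..M}. z j) = 0" using x(2) by simp
 have "z 0 = 0"
 proof (rule V.eigenvectors_independent[of "{0..M}" "\<lambda>j. of_int s * of_nat j" "br sc" z])
  fix j show "br sc (z j) = sm (of_int s * of_nat j) (z j)"
   using x(3) FP_sc[OF x(1)] assms(2) by (simp add: z_def br_diff_r)
 qed (use s assms(3) in \<open>auto simp: br_add_r br_sm_r inj_on_def\<close>)
 thus ?thesis using x(1) by (simp add: z_def)
qed

lemma fin_cartan_subspace: "V.subspace (fin_cartan n G)"
 by (simp add: fin_cartan_def)

lemma cv_fin: "1 \<le> i \<Longrightarrow> i \<le> n \<Longrightarrow> cv i \<in> fin_cartan n G"
 unfolding fin_cartan_def by (rule V.span_base) auto

lemma fin_cartan_H: "h \<in> fin_cartan n G \<Longrightarrow> h \<in> H"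
proof -
 have "cv ` {1..n} \<subseteq> H" using cv_H by auto
 hence "fin_cartan n G \<subseteq> H" unfolding fin_cartan_def by (rule V.span_minimal) (rule H_subspace)
 thus "h \<in> fin_cartan n G \<Longrightarrow> h \<in> H" by blast
qed

lemma br_e_low:
 assumes "T (- 1) y d" "1 \<le> i" "i \<le> n"
 shows "br (gen_e G i) y \<in> fin_cartan n G"
proof -
 have "P (- 1) 1 y d" using assms(1) by (simp add: T_def)
 then obtain a where y: "y = (\<Sum>j\<le>n. sm (a j) (g (- 1) j))" using P1_lin by blast
 have "br (gen_e G i) y = (\<Sum>j\<le>n. sm (a j) (if i = j then cv i else 0))"
  unfolding y br_sum_r br_sm_r using assms(3) by (intro sum.cong) (auto simp: g_def br_ef)
 also have "\<dots> \<in> fin_cartan n G"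
  using fin_cartan_subspace assms(2,3) cv_fin[of i]
  by (intro V.subspace_sum) (auto intro: V.subspace_scale V.subspace_0)
 finally show ?thesis .
qed

text \<open>Membership in H would not be enough, since \<Lambda> lives on the span of the coroots 1,
  ..., n. Each e with index i >= 1 meets an element of height -1 in a multiple of the coroot i, and
  the Jacobi identity reduces longer brackets to this case.\<close>

lemma FP_low: "FP 1 k x \<Longrightarrow> T (- int k) y d \<Longrightarrow> br x y \<in> fin_cartan n G"
proof (induction arbitrary: y d rule: FP.induct)
 case (FP_gen i) thus ?case using br_e_low by (simp add: g_def)
next
 case (FP_br k x i)
 have ge: "g 1 i = gen_e G i" by (simp add: g_def)
 have Te: "T 1 (gen_e G i) (cg 1 i)" using FP_br P_gen[of i 1] by (simp add: T_def g_def)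
 have "\<exists>c. T (int k) x c" using \<open>FP 1 k x\<close>
 proof (induction rule: FP.induct)
  case (FP_gen i) thus ?case using P_gen[of i 1] by (auto simp: T_def g_def)
 next
  case (FP_br k x i)
  then obtain c where "T (int k) x c" by auto
  from T_gen[OF this FP_br(3), of 1] show ?case by (auto simp: add.commute)
 next
  case (FP_zero k) thus ?case using T_zero by blast
 next
  case (FP_add k x y) thus ?case using T_add by blast
 next
  case (FP_sm k x a) thus ?case using T_sm by blast
 qed
 then obtain c where Tx: "T (int k) x c" by auto
 have e: "br (br (gen_e G i) x) y = br (gen_e G i) (br x y) - br x (br (gen_e G i) y)"
  by (simp add: jac[of "gen_e G i"])
 have "br (gen_e G i) (br x y) \<in> fin_cartan n G"
  using br_e_low[of "br x y" _ i] T_br[OF Tx FP_br.prems] FP_br by auto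
 moreover have "br x (br (gen_e G i) y) \<in> fin_cartan n G"
  using FP_br.IH[of "br (gen_e G i) y"] T_br[OF Te FP_br.prems] by simp
 ultimately show ?case unfolding ge e using fin_cartan_subspace by (intro V.subspace_diff)
next
 case (FP_zero k) thus ?case using fin_cartan_subspace V.subspace_0 by simp
next
 case (FP_add k x z) thus ?case using fin_cartan_subspace by (simp add: br_add_l V.subspace_add)
next
 case (FP_sm k x a) thus ?case using fin_cartan_subspace by (simp add: br_sm_l V.subspace_scale)
qed

lemma fin_combo:
 assumes "\<alpha> \<in> fin_pos_roots n G"
 obtains c k where "\<alpha> = root_combination G {1..n} (\<lambda>i. of_nat (c i))" "k \<ge> 1"
  "\<alpha> h0 = of_nat k" "\<alpha> hs = of_nat k" "\<alpha> sc = 0"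
proof -
 obtain c where c: "\<alpha> = root_combination G {1..n} (\<lambda>i. of_nat (c i))"
  and r: "\<alpha> \<in> roots G" using assms by (auto simp: fin_pos_roots_def fin_roots_def)
 define k where "k = (\<Sum>i\<in>{1..n}. c i)"
 have "k \<noteq> 0"
 proof
  assume "k = 0"
  hence "\<And>i. i \<in> {1..n} \<Longrightarrow> c i = 0" by (simp add: k_def)
  hence "\<alpha> = 0" unfolding c root_combination_def by (intro ext) simp
  thus False using r by (simp add: roots_def)
 qed
 moreover have "\<alpha> h0 = of_nat k" "\<alpha> hs = of_nat k" "\<alpha> sc = 0"
  using h0 al_hs sc(3) by (auto simp: c root_combination_def k_def)
 ultimately show ?thesis using c that by (metis One_nat_def Suc_leI gr0I)
qed

lemma ex_test: "\<not> N dvd i \<Longrightarrow> \<exists>h\<in>H. pih h = (\<lambda>m. of_bool (N dvd m - i) - of_bool (N dvd m + i))"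
proof (rule ex_pih_odd)
 fix m
 have "N dvd - m - i \<longleftrightarrow> N dvd m + i" "N dvd - m + i \<longleftrightarrow> N dvd m - i"
 proof -
  have e: "- m - i = - (m + i)" "- m + i = - (m - i)" by simp_all
  show "N dvd - m - i \<longleftrightarrow> N dvd m + i" "N dvd - m + i \<longleftrightarrow> N dvd m - i"
   unfolding e dvd_minus_iff by (rule refl)+
 qed
 thus "(of_bool (N dvd - m - i) - of_bool (N dvd - m + i) :: complex) = - (of_bool (N dvd m - i) - of_bool (N dvd m + i))"
  by simp
 have "m + N - i = m - i + N" "m + N + i = m + i + N" by simp_all
 thus "(of_bool (N dvd m + N - i) - of_bool (N dvd m + N + i) :: complex) = of_bool (N dvd m - i) - of_bool (N dvd m + i)"
  by (simp only: dvd_shift)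
qed

text \<open>Test with the Cartan element whose diagonal is 1 on the class of i and -1 on that of -i.
  The left side is then at least 1, while the right side is at most 0 unless m or the mirror row -m
  - k is congruent to i. So a root of the finite part determines the position of its entries up to
  reflection.\<close>

lemma entry_unique:
 assumes "\<And>h. h \<in> H \<Longrightarrow> pih h i - pih h (i + k) = pih h m - pih h (m + k)"
  and i: "\<not> N dvd i" "\<not> N dvd k"
 shows "N dvd m - i \<or> N dvd m + i + k"
proof (rule ccontr)
 assume neg: "\<not> ?thesis"
 obtain h where h: "h \<in> H" "pih h = (\<lambda>m. of_bool (N dvd m - i) - of_bool (N dvd m + i))" using ex_test[OF i(1)] by blast
 have i2: "\<not> N dvd i + i"
 proof -
  have "coprime N 2" by (simp add: N_def)
  hence "N dvd 2 * i \<longleftrightarrow> N dvd i" by (rule coprime_dvd_mult_right_iff)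
  moreover have "i + i = 2 * i" by simp
  ultimately show ?thesis using i(1) by (simp only: not_False_eq_True)
 qed
 have k: "\<not> N dvd i + k - i" using i by simp
 have e: "m + k + i = m + i + k" by simp
 have v1: "pih h i = 1" using i2 by (simp add: h(2))
 have v2: "pih h (i + k) = - of_bool (N dvd i + k + i)" using k by (simp add: h(2))
 have v3: "pih h m = - of_bool (N dvd m + i)" using neg by (simp add: h(2))
 have v4: "pih h (m + k) = of_bool (N dvd m + k - i)" using neg unfolding h(2) e by simp
 have "pih h i - pih h (i + k) = pih h m - pih h (m + k)" by (rule assms(1)[OF h(1)])
 hence "1 - (- of_bool (N dvd i + k + i)) = - of_bool (N dvd m + i) - (of_bool (N dvd m + k - i) :: complex)"
  unfolding v1 v2 v3 v4 .
 hence "Re (1 - (- of_bool (N dvd i + k + i))) = Re (- of_bool (N dvd m + i) - (of_bool (N dvd m + k - i)))"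
  by (rule arg_cong)
 thus False by (cases "N dvd i + k + i"; cases "N dvd m + i"; cases "N dvd m + k - i") simp_all
qed

text \<open>The root spaces of \<open>\<alpha>\<close> and \<open>-\<alpha>\<close> are lines, so that the coroot is well defined.\<close>

lemma coroot_fin:
 assumes \<alpha>: "\<alpha> \<in> fin_pos_roots n G" and y: "y \<in> root_space G (- \<alpha>)" "y \<noteq> 0"
 shows "\<exists>x h. x \<in> root_space G \<alpha> \<and> br x y = h \<and> h \<in> fin_cartan n G \<and> \<alpha> h \<noteq> 0 \<and> coroot G \<alpha> = sm (2 / \<alpha> h) h"
proof -
 obtain c k where c: "\<alpha> = root_combination G {1..n} (\<lambda>i. of_nat (c i))" "k \<ge> 1"
  and k: "\<alpha> h0 = of_nat k" "\<alpha> sc = 0" using fin_combo[OF \<alpha>] by metis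
 have \<alpha>add: "\<alpha> (u + v) = \<alpha> u + \<alpha> v" if "u \<in> H" "v \<in> H" for u v
  using that by (auto simp: c root_combination_def al_add sum.distrib distrib_left)
 have \<alpha>sm: "\<alpha> (sm a u) = a * \<alpha> u" if "u \<in> H" for a u
  using that by (auto simp: c root_combination_def al_sm sum_distrib_left mult.left_commute)
 obtain x where x: "x \<in> root_space G \<alpha>" "x \<noteq> 0"
  using \<alpha> by (auto simp: fin_pos_roots_def fin_roots_def)
 have Tx: "T (int k) x' (Phi x' (int k))" "l \<noteq> int k \<Longrightarrow> Phi x' l m = 0" if "x' \<in> root_space G \<alpha>" for x' l m
  using eigen_T[of x' "int k"] rsD[OF that h0(1)] k by auto
 have Ty: "T (- int k) y' (Phi y' (- int k))" "l \<noteq> - int k \<Longrightarrow> Phi y' l m = 0" if "y' \<in> root_space G (- \<alpha>)" for y' l m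
  using eigen_T[of y' "- int k"] rsD[OF that h0(1)] k by auto
 have nzk: "of_nat k \<noteq> (0 :: complex)" using c(2) by simp
 obtain i where i: "Phi x (int k) i \<noteq> 0"
  using rs_inj[OF x(1) _ h0(1)] x(2) Tx(2)[OF x(1)] k nzk by metis
 have ent: "\<alpha> h = pih h i - pih h (i + int k)" if "h \<in> H" for h using rs_Phi[OF x(1) that i] .
 have sci: "\<not> N dvd i" "\<not> N dvd i + int k" "\<not> N dvd int k"
  using sc_entry'[of i k] ent[OF sc(1)] k c(2) by auto
 have kne: "int k \<noteq> 0" using c(2) by simp
 have loc: "N dvd m - i \<or> N dvd m + i + int k" if "x' \<in> root_space G \<alpha>" "Phi x' (int k) m \<noteq> 0" for x' m
  by (rule entry_unique) (use ent rs_Phi[OF that(1) _ that(2)] sci in auto)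
 have loc': "N dvd m - int k - i \<or> N dvd m + i" if "y' \<in> root_space G (- \<alpha>)" "Phi y' (- int k) m \<noteq> 0" for y' m
 proof -
  have "N dvd (m - int k) - i \<or> N dvd (m - int k) + i + int k"
  proof (rule entry_unique)
   fix h assume h: "h \<in> H"
   have "- \<alpha> h = pih h m - pih h (m - int k)" using rs_Phi[OF that(1) h that(2)] by simp
   thus "pih h i - pih h (i + int k) = pih h (m - int k) - pih h (m - int k + int k)"
    using ent[OF h] by (simp add: algebra_simps)
  qed (use sci in auto)
  thus ?thesis by simp
 qed
 have xi: "Phi x' (int k) m = Phi x' (int k) i" if d: "N dvd m - i" for x' m
 proof -
  from d obtain z where "m - i = N * z" by (rule dvdE)
  hence "m = i + z * N" by (simp add: algebra_simps)
  thus ?thesis using per_mult[of "Phi x' (int k)" i z] Phi_per[OF kne] by metis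
 qed
 have xr: "Phi x' (int k) m = - sg (int k) * Phi x' (int k) i" if "N dvd m + i + int k" for x' m
 proof -
  have "(- m - int k) - i = - (m + i + int k)" by simp
  hence "N dvd (- m - int k) - i" using that by (simp only: dvd_minus_iff)
  hence "Phi x' (int k) (- m - int k) = Phi x' (int k) i" by (rule xi)
  moreover have "Phi x' (int k) (- m - int k) = - sg (int k) * Phi x' (int k) m" by (rule Phi_sym[OF kne])
  ultimately have "- sg (int k) * (- sg (int k) * Phi x' (int k) m) = - sg (int k) * Phi x' (int k) i" by metis
  thus ?thesis by (simp add: mult.assoc[symmetric])
 qed
 have kne': "- int k \<noteq> 0" using c(2) by simp
 have yi: "Phi y' (- int k) m = Phi y' (- int k) (i + int k)" if d: "N dvd m - int k - i" for y' m
 proof -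
  from d obtain z where "m - int k - i = N * z" by (rule dvdE)
  hence "m = (i + int k) + z * N" by (simp add: algebra_simps)
  thus ?thesis using per_mult[of "Phi y' (- int k)" "i + int k" z] Phi_per[OF kne'] by metis
 qed
 have yr: "Phi y' (- int k) m = - sg (int k) * Phi y' (- int k) (i + int k)" if "N dvd m + i" for y' m
 proof -
  have "- m + int k - int k - i = - (m + i)" by simp
  hence "N dvd (- m + int k) - int k - i" using that by (simp only: dvd_minus_iff)
  hence "Phi y' (- int k) (- m + int k) = Phi y' (- int k) (i + int k)" by (rule yi)
  moreover have "Phi y' (- int k) (- m - (- int k)) = - sg (- int k) * Phi y' (- int k) m" by (rule Phi_sym[OF kne'])
  ultimately have "- sg (int k) * (- sg (int k) * Phi y' (- int k) m) = - sg (int k) * Phi y' (- int k) (i + int k)"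
   by (simp add: sg_minus)
  thus ?thesis by (simp add: mult.assoc[symmetric])
 qed
 have xline: "\<exists>a. x' = sm a x" if "x' \<in> root_space G \<alpha>" for x'
 proof -
  define a where "a = Phi x' (int k) i / Phi x (int k) i"
  define w where "w = x' - sm a x"
  have w: "w \<in> root_space G \<alpha>" unfolding w_def by (intro rs_diff rs_sm that x)
  have wi: "Phi w (int k) i = 0" using i by (simp add: w_def Phi_diff Phi_sm a_def)
  have "Phi w l m = 0" for l m
  proof (cases "l = int k")
   case True
   thus ?thesis using loc[OF w, of m] xi[of m w] xr[of m w] wi by auto
  qed (use Tx(2)[OF w] in auto)
  hence "w = 0" using rs_inj[OF w _ h0(1)] k nzk by auto
  thus ?thesis by (auto simp: w_def)
 qed
 have yline: "\<exists>a. y' = sm a y" if "y' \<in> root_space G (- \<alpha>)" for y'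
 proof -
  have yik: "Phi y (- int k) (i + int k) \<noteq> 0"
  proof
   assume z: "Phi y (- int k) (i + int k) = 0"
   have "Phi y l m = 0" for l m
   proof (cases "l = - int k")
    case True
    thus ?thesis using loc'[OF y(1), of m] yi[of m y] yr[of m y] z by auto
   qed (use Ty(2)[OF y(1)] in auto)
   hence "y = 0" using rs_inj[OF y(1) _ h0(1)] k nzk by auto
   thus False using y by simp
  qed
  define a where "a = Phi y' (- int k) (i + int k) / Phi y (- int k) (i + int k)"
  define w where "w = y' - sm a y"
  have w: "w \<in> root_space G (- \<alpha>)" unfolding w_def by (intro rs_diff rs_sm that y)
  have wi: "Phi w (- int k) (i + int k) = 0" using yik by (simp add: w_def Phi_diff Phi_sm a_def)
  have "Phi w l m = 0" for l m
  proof (cases "l = - int k")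
   case True
   thus ?thesis using loc'[OF w, of m] yi[of m w] yr[of m w] wi by auto
  qed (use Ty(2)[OF w] in auto)
  hence "w = 0" using rs_inj[OF w _ h0(1)] k nzk by auto
  thus ?thesis by (auto simp: w_def)
 qed
 define h where "h = br x y"
 have Px: "P 1 k x (Phi x (int k))" using Tx(1)[OF x(1)] c(2) by (simp add: T_def)
 have "br sc x = 0" using rsD[OF x(1) sc(1)] k by simp
 hence hf: "h \<in> fin_cartan n G" unfolding h_def using FP_low[OF P_FP[OF Px] Ty(1)[OF y(1)]] by simp
 have hH: "h \<in> H" using hf by (rule fin_cartan_H)
 have "T 0 h (bc (int k) (- int k) (Phi x (int k)) (Phi y (- int k)))"
  using T_br[OF Tx(1)[OF x(1)] Ty(1)[OF y(1)]] by (simp add: h_def)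
 hence ph: "pih h m = bc (int k) (- int k) (Phi x (int k)) (Phi y (- int k)) m" for m by (simp add: T_0)
 have yik: "Phi y (- int k) (i + int k) \<noteq> 0"
 proof
  assume z: "Phi y (- int k) (i + int k) = 0"
  have "Phi y l m = 0" for l m
  proof (cases "l = - int k")
   case True
   thus ?thesis using loc'[OF y(1), of m] yi[of m y] yr[of m y] z by auto
  qed (use Ty(2)[OF y(1)] in auto)
  hence "y = 0" using rs_inj[OF y(1) _ h0(1)] k nzk by auto
  thus False using y by simp
 qed
 \<comment> \<open>The entries of x in the rows i - k and i + k vanish, as these rows are congruent
   neither to i nor to its mirror row; two equal products remain.\<close>
 have "\<alpha> h = 2 * (Phi x (int k) i * Phi y (- int k) (i + int k))"
 proof -
  have n2: "\<not> N dvd u + u" if "\<not> N dvd u" for u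
  proof -
   have "coprime N 2" by (simp add: N_def)
   hence "N dvd 2 * u \<longleftrightarrow> N dvd u" by (rule coprime_dvd_mult_right_iff)
   moreover have "u + u = 2 * u" by simp
   ultimately show ?thesis using that by (simp only: not_False_eq_True)
  qed
  have 1: "Phi x (int k) (i - int k) = 0"
  proof (rule ccontr)
   assume "\<not> ?thesis"
   from loc[OF x(1) this] have "N dvd - int k \<or> N dvd i + i" by (simp add: algebra_simps)
   thus False using sci n2 by auto
  qed
  have 2: "Phi x (int k) (i + int k) = 0"
  proof (rule ccontr)
   assume "\<not> ?thesis"
   from loc[OF x(1) this] have "N dvd int k \<or> N dvd (i + int k) + (i + int k)" by (simp add: algebra_simps)
   thus False using sci n2 by blast
  qed
  have e: "i + int k + - int k = i" "i + - int k = i - int k" by simp_all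
  show ?thesis unfolding ent[OF hH] ph bc_def e 1 2 by (simp add: mult.commute)
 qed
 hence \<alpha>h: "\<alpha> h \<noteq> 0" using i yik by simp
 let ?L = "V.span {br u v | u v. u \<in> root_space G \<alpha> \<and> v \<in> root_space G (- \<alpha>)}"
 have sub: "?L \<subseteq> V.span {h}"
 proof (rule V.span_minimal)
  show "{br u v | u v. u \<in> root_space G \<alpha> \<and> v \<in> root_space G (- \<alpha>)} \<subseteq> V.span {h}"
  proof clarify
   fix u v assume "u \<in> root_space G \<alpha>" "v \<in> root_space G (- \<alpha>)"
   then obtain a b where "u = sm a x" "v = sm b y" using xline yline by blast
   hence "br u v = sm (a * b) h" by (simp add: br_sm_l br_sm_r h_def)
   thus "br u v \<in> V.span {h}" by (simp add: V.span_scale V.span_base)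
  qed
 qed simp
 have mem: "sm (2 / \<alpha> h) h \<in> ?L"
  by (rule V.span_scale, rule V.span_base) (use x y in \<open>auto simp: h_def\<close>)
 have "coroot G \<alpha> = sm (2 / \<alpha> h) h"
  unfolding coroot_def
 proof (rule the_equality)
  show "sm (2 / \<alpha> h) h \<in> ?L \<and> \<alpha> (sm (2 / \<alpha> h) h) = 2" using mem \<alpha>h by (simp add: \<alpha>sm[OF hH])
  fix h' assume h': "h' \<in> ?L \<and> \<alpha> h' = 2"
  hence "h' \<in> V.span {h}" using sub by blast
  then obtain a where a: "h' = sm a h" by (auto simp: V.span_singleton)
  hence "a * \<alpha> h = 2" using h' \<alpha>sm[OF hH, of a] by simp
  thus "h' = sm (2 / \<alpha> h) h" using \<alpha>h a by (simp add: field_simps)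
 qed
 thus ?thesis using x(1) h_def hf \<alpha>h by blast
qed

end

section \<open>The free ring in ordinary arithmetic notation\<close>

lemma fr_ops: "add (free_ring S) = (+)" "\<zero>\<^bsub>free_ring S\<^esub> = 0" "\<one>\<^bsub>free_ring S\<^esub> = 1"
 "p \<otimes>\<^bsub>free_ring S\<^esub> q = p * q" "p \<oplus>\<^bsub>free_ring S\<^esub> q = p + q"
 by (simp_all add: free_ring_def)

lemma fr_add: "p \<in> carrier (free_ring S) \<Longrightarrow> q \<in> carrier (free_ring S) \<Longrightarrow> p + q \<in> carrier (free_ring S)"
 and fr_mult: "p \<in> carrier (free_ring S) \<Longrightarrow> q \<in> carrier (free_ring S) \<Longrightarrow> p * q \<in> carrier (free_ring S)"
 and fr_zero: "0 \<in> carrier (free_ring S)" and fr_one: "1 \<in> carrier (free_ring S)"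
 using ring.ring_simprules(1,5,2,6)[OF ring_free_ring[of S]] by (simp_all add: fr_ops)

lemma fr_minus: "p \<in> carrier (free_ring S) \<Longrightarrow> - p \<in> carrier (free_ring S)"
 by (simp add: free_ring_def)

lemma fr_diff: "p \<in> carrier (free_ring S) \<Longrightarrow> q \<in> carrier (free_ring S) \<Longrightarrow> p - q \<in> carrier (free_ring S)"
 using fr_add[of p S "- q"] fr_minus[of q S] by simp

lemma fr_letter: "x \<in> S \<Longrightarrow> letter x \<in> carrier (free_ring S)"
 by (simp add: free_ring_def letter_def)

lemma fr_scalar: "Poly_Mapping.single 0 c \<in> carrier (free_ring S)"
 by (cases "c = 0") (simp_all add: free_ring_def zero_word_def)

lemma fr_power: "p \<in> carrier (free_ring S) \<Longrightarrow> p ^ k \<in> carrier (free_ring S)"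
 by (induction k) (auto simp: fr_one fr_mult)

lemma fr_sum: "(\<And>k. k \<in> K \<Longrightarrow> p k \<in> carrier (free_ring S)) \<Longrightarrow> sum p K \<in> carrier (free_ring S)"
 by (induction K rule: infinite_finite_induct) (auto simp: fr_zero fr_add)

lemma fr_uminus: "p \<in> carrier (free_ring S) \<Longrightarrow> \<ominus>\<^bsub>free_ring S\<^esub> p = - p"
proof -
 interpret R: ring "free_ring S" by (rule ring_free_ring)
 assume p: "p \<in> carrier (free_ring S)"
 show ?thesis
  by (rule R.minus_equality) (use p fr_minus[OF p] in \<open>simp_all add: fr_ops\<close>)
qed

lemma free_ring_ideal:
 assumes "K \<subseteq> carrier (free_ring S)" "0 \<in> K" "\<And>p q. p \<in> K \<Longrightarrow> q \<in> K \<Longrightarrow> p + q \<in> K"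
  "\<And>p. p \<in> K \<Longrightarrow> - p \<in> K" "\<And>p a. p \<in> K \<Longrightarrow> a \<in> carrier (free_ring S) \<Longrightarrow> a * p \<in> K"
  "\<And>p a. p \<in> K \<Longrightarrow> a \<in> carrier (free_ring S) \<Longrightarrow> p * a \<in> K"
 shows "ideal K (free_ring S)"
proof -
 interpret R: ring "free_ring S" by (rule ring_free_ring)
 show ?thesis
 proof (rule idealI[OF ring_free_ring])
  show "subgroup K (add_monoid (free_ring S))"
  proof (rule R.add.subgroupI)
   fix p assume p: "p \<in> K"
   hence "\<ominus>\<^bsub>free_ring S\<^esub> p = - p" using assms(1) fr_uminus by blast
   thus "\<ominus>\<^bsub>free_ring S\<^esub> p \<in> K" using assms(4)[OF p] by simp
  qed (use assms in \<open>auto simp: fr_ops\<close>)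
 qed (use assms in \<open>auto simp: fr_ops\<close>)
qed

context A2n2
begin

lemma uea_relations_carrier:
 assumes "V.subspace S" "\<And>x y. x \<in> S \<Longrightarrow> y \<in> S \<Longrightarrow> br x y \<in> S"
 shows "uea_relations G S \<subseteq> carrier (free_ring S)"
 unfolding uea_relations_def
 using assms(2) V.subspace_add[OF assms(1)] V.subspace_scale[OF assms(1)]
 by (auto intro!: fr_diff fr_add fr_mult fr_letter fr_scalar)

subsection \<open>Structure of the current algebra\<close>

lemma current_subspace: "V.subspace (current_algebra n G)"
 by (simp add: current_algebra_def)

lemma sum_of_root_spaces_minimal:
 assumes "\<And>\<beta>. \<beta> \<in> B \<Longrightarrow> root_space G \<beta> \<subseteq> X" "V.subspace X"
 shows "sum_of_root_spaces G B \<subseteq> X"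
 unfolding sum_of_root_spaces_def by (rule V.span_minimal) (use assms in auto)

lemma root_combo_in_dual: "I \<subseteq> {..n} \<Longrightarrow> root_combination G I c \<in> dual G H"
proof -
 assume "I \<subseteq> {..n}"
 hence i: "i \<in> I \<Longrightarrow> i \<le> n" for i by auto
 show ?thesis using i H_add H_sm
  by (auto simp: dual_def root_combination_def al_add al_sm al_out distrib_left sum.distrib sum_distrib_left
   mult.left_commute intro!: sum.neutral)
qed

lemma rs_positive:
 assumes "x \<in> root_space G (root_combination G {..n} (\<lambda>i. of_nat (c i)))" "(\<Sum>i\<le>n. c i) \<ge> 1"
 shows "x \<in> sum_of_root_spaces G (positive_roots n G)"
proof (cases "x = 0")
 case True thus ?thesis by (simp add: sum_of_root_spaces_def V.span_zero)
next
 case False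
 let ?b = "root_combination G {..n} (\<lambda>i. of_nat (c i))"
 have "?b h0 = of_nat (\<Sum>i\<le>n. c i)" using h0 by (simp add: root_combination_def)
 hence "?b \<noteq> 0" using assms(2) by (metis of_nat_eq_0_iff not_one_le_zero zero_fun_apply)
 hence "?b \<in> positive_roots n G"
  using assms(1) False root_combo_in_dual[of "{..n}"] by (auto simp: positive_roots_def roots_def)
 thus ?thesis using assms(1) unfolding sum_of_root_spaces_def by (intro V.span_base) blast
qed

lemma rs_combo_add:
 assumes "x \<in> root_space G (root_combination G I (\<lambda>i. s * of_nat (c i)))" "j \<in> I" "finite I" "j \<le> n"
  "y \<in> root_space G (\<lambda>h. s * al j h)"
 shows "br y x \<in> root_space G (root_combination G I (\<lambda>i. s * of_nat ((c(j := c j + 1)) i)))"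
proof (rule rs_br[OF assms(5,1)])
 fix h
 show "root_combination G I (\<lambda>i. s * of_nat ((c(j := c j + 1)) i)) h = s * al j h + root_combination G I (\<lambda>i. s * of_nat (c i)) h"
 proof -
  have "root_combination G I (\<lambda>i. s * of_nat ((c(j := c j + 1)) i)) h
    = (\<Sum>i\<in>I. s * of_nat (c i) * al i h + (if i = j then s * al j h else 0))"
   unfolding root_combination_def by (rule sum.cong) (auto simp: algebra_simps)
  thus ?thesis using assms(2,3) by (simp add: sum.distrib root_combination_def)
 qed
qed

lemma g_rs: "i \<le> n \<Longrightarrow> s = 1 \<or> s = - 1 \<Longrightarrow> g s i \<in> root_space G (\<lambda>h. of_int s * al i h)"
 by (simp add: root_space_def br_h_g)

lemma g_rs_combo: "i \<in> I \<Longrightarrow> finite I \<Longrightarrow> i \<le> n \<Longrightarrow> s = 1 \<or> s = - 1 \<Longrightarrow>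
  g s i \<in> root_space G (root_combination G I (\<lambda>j. of_int s * of_nat (of_bool (j = i))))"
proof -
 assume a: "i \<in> I" "finite I" "i \<le> n" "s = 1 \<or> s = - 1"
 have "root_combination G I (\<lambda>j. of_int s * of_nat (of_bool (j = i))) = (\<lambda>h. of_int s * al i h)"
  using a(1,2) by (auto simp: root_combination_def fun_eq_iff sum.remove[of I i])
 thus ?thesis using g_rs[OF a(3,4)] by simp
qed

text \<open>The sum of the root spaces for combinations of total height k of the nodes in I, all
  with the sign s; it links brackets of generators to root spaces.\<close>

definition wsum :: "nat set \<Rightarrow> complex \<Rightarrow> nat \<Rightarrow> 'g set" where
 "wsum I s k = V.span (\<Union>c\<in>{c. (\<Sum>i\<in>I. c i) = k}. root_space G (root_combination G I (\<lambda>i. s * of_nat (c i))))"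

lemma wsum_br:
 assumes "x \<in> wsum I s k" "j \<in> I" "finite I" "j \<le> n" "y \<in> root_space G (\<lambda>h. s * al j h)"
 shows "br y x \<in> wsum I s (Suc k)"
proof -
 have "wsum I s k \<subseteq> {x. br y x \<in> wsum I s (Suc k)}"
  unfolding wsum_def
 proof (rule V.span_minimal)
  show "(\<Union>c\<in>{c. (\<Sum>i\<in>I. c i) = k}. root_space G (root_combination G I (\<lambda>i. s * of_nat (c i))))
    \<subseteq> {x. br y x \<in> V.span (\<Union>c\<in>{c. (\<Sum>i\<in>I. c i) = Suc k}. root_space G (root_combination G I (\<lambda>i. s * of_nat (c i))))}"
  proof clarify
   fix c x assume x: "x \<in> root_space G (root_combination G I (\<lambda>i. s * of_nat (c i)))" and k: "k = (\<Sum>i\<in>I. c i)"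
   have "(\<Sum>i\<in>I. (c(j := c j + 1)) i) = Suc (\<Sum>i\<in>I. c i)"
    using assms(2,3) by (simp add: sum.remove[of I j])
   thus "br y x \<in> V.span (\<Union>c'\<in>{c'. (\<Sum>i\<in>I. c' i) = Suc (\<Sum>i\<in>I. c i)}. root_space G (root_combination G I (\<lambda>i. s * of_nat (c' i))))"
    using rs_combo_add[OF x assms(2-5)] by (intro V.span_base) blast
  qed
  show "V.subspace {x. br y x \<in> V.span (\<Union>c\<in>{c. (\<Sum>i\<in>I. c i) = Suc k}. root_space G (root_combination G I (\<lambda>i. s * of_nat (c i))))}"
   by (auto simp: V.subspace_def br_add_r br_sm_r V.span_zero V.span_add V.span_scale)
 qed
 thus ?thesis using assms(1) by blast
qed

lemma wsum_gen:
 assumes "i \<in> I" "finite I" "i \<le> n" "s = 1 \<or> s = - 1"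
 shows "g s i \<in> wsum I (of_int s) 1"
proof -
 have "(\<Sum>j\<in>I. of_bool (j = i) :: nat) = 1" using assms(1,2) by (simp add: sum.remove[of I i])
 thus ?thesis unfolding wsum_def using g_rs_combo[OF assms] by (intro V.span_base) blast
qed

lemma P_wsum: "P s k x c \<Longrightarrow> s = 1 \<or> s = - 1 \<Longrightarrow> x \<in> wsum {..n} (of_int s) k"
proof (induction rule: P.induct)
 case (P_gen i) thus ?case by (intro wsum_gen) auto
next
 case (P_br k x c i) show ?case by (rule wsum_br[OF _ _ _ _ g_rs]) (use P_br in auto)
qed (auto simp: wsum_def V.span_zero V.span_add V.span_scale)

lemma P_current: "P 1 k x c \<Longrightarrow> x \<in> current_algebra n G"
proof -
 assume P: "P 1 k x c"
 have "wsum {..n} 1 k \<subseteq> sum_of_root_spaces G (positive_roots n G)"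
  unfolding wsum_def
 proof (rule V.span_minimal)
  show "(\<Union>c\<in>{c. (\<Sum>i\<in>{..n}. c i) = k}. root_space G (root_combination G {..n} (\<lambda>i. 1 * of_nat (c i))))
    \<subseteq> sum_of_root_spaces G (positive_roots n G)"
   using rs_positive P_pos[OF P] by auto
 qed (simp add: sum_of_root_spaces_def)
 moreover have "x \<in> wsum {..n} 1 k" using P_wsum[OF P] by simp
 ultimately have "x \<in> sum_of_root_spaces G (positive_roots n G)" by blast
 thus ?thesis unfolding current_algebra_def by (intro V.span_base) blast
qed

lemma f_fin: "i \<in> {1..n} \<Longrightarrow> gen_f G i \<in> fin_algebra n G" and e_fin: "i \<in> {1..n} \<Longrightarrow> gen_e G i \<in> fin_algebra n G"
 by (auto simp: fin_algebra_def lie_generated_def)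

lemma fin_algebra_closed:
 "x \<in> fin_algebra n G \<Longrightarrow> y \<in> fin_algebra n G \<Longrightarrow> br x y \<in> fin_algebra n G"
 "V.subspace (fin_algebra n G)"
proof -
 show "x \<in> fin_algebra n G \<Longrightarrow> y \<in> fin_algebra n G \<Longrightarrow> br x y \<in> fin_algebra n G"
  by (auto simp: fin_algebra_def lie_generated_def lie_subalgebra_def)
 show "V.subspace (fin_algebra n G)"
  unfolding fin_algebra_def lie_generated_def lie_subalgebra_def by (rule V.subspace_Inter) auto
qed

text \<open>
 The weight components of an element of the finite part lie in the finite part again, because
 they are spanned by words in the generators.
\<close>

lemma FP_words:
 "FP s k x \<Longrightarrow> s = 1 \<or> s = - 1 \<Longrightarrow> x \<in> V.span (\<Union>c\<in>{c. (\<Sum>i\<in>{1..n}. c i) = k}.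
   root_space G (root_combination G {1..n} (\<lambda>i. of_int s * of_nat (c i))) \<inter> fin_algebra n G)"
proof (induction rule: FP.induct)
 case (FP_gen i)
 have i: "i \<in> {1..n}" using FP_gen by simp
 have "(\<Sum>j\<in>{1..n}. of_bool (j = i) :: nat) = 1" using i by (simp add: sum.remove[of _ i])
 moreover have "g s i \<in> fin_algebra n G" using i f_fin e_fin by (simp add: g_def)
 moreover have "g s i \<in> root_space G (root_combination G {1..n} (\<lambda>j. of_int s * of_nat (of_bool (j = i))))"
  by (rule g_rs_combo) (use i FP_gen in auto)
 ultimately show ?case by (intro V.span_base UN_I[of "\<lambda>j. of_bool (j = i)"] IntI CollectI)
next
 case (FP_br k x i)
 have i: "i \<in> {1..n}" "i \<le> n" using FP_br by auto
 let ?X = "\<lambda>k. V.span (\<Union>c\<in>{c. (\<Sum>i\<in>{1..n}. c i) = k}.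
   root_space G (root_combination G {1..n} (\<lambda>i. of_int s * of_nat (c i))) \<inter> fin_algebra n G)"
 have gf: "g s i \<in> fin_algebra n G" using i f_fin e_fin by (simp add: g_def)
 have "?X k \<subseteq> {x. br (g s i) x \<in> ?X (Suc k)}"
 proof (rule V.span_minimal)
  show "(\<Union>c\<in>{c. (\<Sum>i\<in>{1..n}. c i) = k}. root_space G (root_combination G {1..n} (\<lambda>i. of_int s * of_nat (c i))) \<inter> fin_algebra n G)
    \<subseteq> {x. br (g s i) x \<in> ?X (Suc k)}"
  proof clarify
   fix c x assume x: "x \<in> root_space G (root_combination G {1..n} (\<lambda>i. of_int s * of_nat (c i)))"
    "x \<in> fin_algebra n G" and k: "k = (\<Sum>i\<in>{1..n}. c i)"
   have "(\<Sum>j\<in>{1..n}. (c(i := c i + 1)) j) = Suc (\<Sum>i\<in>{1..n}. c i)"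
    using i by (simp add: sum.remove[of _ i])
   moreover have "br (g s i) x \<in> root_space G (root_combination G {1..n} (\<lambda>j. of_int s * of_nat ((c(i := c i + 1)) j)))"
    by (rule rs_combo_add[OF x(1) i(1) _ i(2)]) (use g_rs[OF i(2) FP_br.prems] in auto)
   moreover have "br (g s i) x \<in> fin_algebra n G" using gf x(2) by (rule fin_algebra_closed)
   ultimately show "br (g s i) x \<in> ?X (Suc (\<Sum>i\<in>{1..n}. c i))" by (intro V.span_base) blast
  qed
  show "V.subspace {x. br (g s i) x \<in> ?X (Suc k)}"
   by (auto simp: V.subspace_def br_add_r br_sm_r V.span_zero V.span_add V.span_scale)
 qed
 thus ?case using FP_br by blast
qed (auto simp: V.span_zero V.span_add V.span_scale)

lemma FP_current: "FP (- 1) k x \<Longrightarrow> x \<in> current_algebra n G"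
proof -
 assume FP: "FP (- 1) k x"
 have "V.span (\<Union>c\<in>{c. (\<Sum>i\<in>{1..n}. c i) = k}.
   root_space G (root_combination G {1..n} (\<lambda>i. of_int (- 1) * of_nat (c i))) \<inter> fin_algebra n G)
   \<subseteq> sum_of_root_spaces G (fin_neg_roots n G)"
 proof (rule V.span_minimal, clarify)
  fix c x assume x: "x \<in> root_space G (root_combination G {1..n} (\<lambda>i. of_int (- 1) * of_nat (c i)))"
   "x \<in> fin_algebra n G" and k: "k = (\<Sum>i\<in>{1..n}. c i)"
  show "x \<in> sum_of_root_spaces G (fin_neg_roots n G)"
  proof (cases "x = 0")
   case True thus ?thesis by (simp add: sum_of_root_spaces_def V.span_zero)
  next
   case False
   let ?b = "root_combination G {1..n} (\<lambda>i. - of_nat (c i))"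
   have e: "root_combination G {1..n} (\<lambda>i. of_int (- 1) * of_nat (c i)) = ?b" by simp
   have "?b h0 = - of_nat k" using h0 by (simp add: root_combination_def k sum_negf)
   hence "?b \<noteq> 0" using FP_pos[OF FP] by (metis neg_equal_0_iff_equal of_nat_eq_0_iff not_one_le_zero zero_fun_apply)
   moreover have "?b \<in> dual G H" by (rule root_combo_in_dual) auto
   ultimately have "?b \<in> roots G" using x(1) False unfolding e roots_def by blast
   hence "?b \<in> fin_neg_roots n G" using x False unfolding e fin_neg_roots_def fin_roots_def by blast
   thus ?thesis using x(1) unfolding e sum_of_root_spaces_def by (intro V.span_base) blast
  qed
 qed (simp add: sum_of_root_spaces_def)
 hence "x \<in> sum_of_root_spaces G (fin_neg_roots n G)" using FP_words[OF FP] by blast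
 thus ?thesis unfolding current_algebra_def by (intro V.span_base) blast
qed

lemma fin_cartan_current: "h \<in> fin_cartan n G \<Longrightarrow> h \<in> current_algebra n G"
 unfolding current_algebra_def by (intro V.span_base) blast

text \<open>An induction principle in terms of brackets of generators instead of roots:
  \<open>fin_cartan\<close>, everything of positive height, and the negative brackets of the finite
  part. A negative root vector killed by \<open>sc\<close> is of the last kind by
  \<open>P_FP\<close>.\<close>

lemma current_minimal:
 assumes "V.subspace X" "\<And>h. h \<in> fin_cartan n G \<Longrightarrow> h \<in> X" "\<And>k x c. P 1 k x c \<Longrightarrow> x \<in> X"
  "\<And>k x. FP (- 1) k x \<Longrightarrow> x \<in> X" "x \<in> current_algebra n G"
 shows "x \<in> X"
proof -
 have "sum_of_root_spaces G (positive_roots n G) \<subseteq> X"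
 proof (rule sum_of_root_spaces_minimal[OF _ assms(1)])
  fix \<beta> assume "\<beta> \<in> positive_roots n G"
  then obtain c :: "nat \<Rightarrow> nat" where b: "\<beta> \<in> roots G" "\<beta> = root_combination G {..n} (\<lambda>i. of_nat (c i))"
   by (auto simp: positive_roots_def)
  define k where "k = (\<Sum>i\<le>n. c i)"
  have "k \<noteq> 0"
  proof
   assume "k = 0"
   hence "\<And>i. i \<le> n \<Longrightarrow> c i = 0" by (simp add: k_def)
   hence "\<beta> = 0" unfolding b root_combination_def by (intro ext) simp
   thus False using b by (simp add: roots_def)
  qed
  have bh: "\<beta> h0 = of_nat k" using h0 by (simp add: b(2) root_combination_def k_def)
  show "root_space G \<beta> \<subseteq> X"
  proof
   fix x assume x: "x \<in> root_space G \<beta>"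
   have "br h0 x = sm (of_int (int k)) x" using rsD[OF x h0(1)] bh by simp
   from eigen_T(1)[OF this] have "P 1 k x (Phi x (int k))" using \<open>k \<noteq> 0\<close> by (simp add: T_def)
   thus "x \<in> X" by (rule assms(3))
  qed
 qed
 moreover have "sum_of_root_spaces G (fin_neg_roots n G) \<subseteq> X"
 proof (rule sum_of_root_spaces_minimal[OF _ assms(1)])
  fix \<beta> assume "\<beta> \<in> fin_neg_roots n G"
  then obtain c :: "nat \<Rightarrow> nat" where b: "\<beta> \<in> roots G" "\<beta> = root_combination G {1..n} (\<lambda>i. - of_nat (c i))"
   by (auto simp: fin_neg_roots_def fin_roots_def)
  define k where "k = (\<Sum>i\<in>{1..n}. c i)"
  have "k \<noteq> 0"
  proof
   assume "k = 0"
   hence "\<And>i. i \<in> {1..n} \<Longrightarrow> c i = 0" by (simp add: k_def)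
   hence "\<beta> = 0" unfolding b root_combination_def by (intro ext) simp
   thus False using b by (simp add: roots_def)
  qed
  have bh: "\<beta> h0 = - of_nat k" using h0 by (simp add: b(2) root_combination_def k_def sum_negf)
  have bs: "\<beta> sc = 0" using sc(3) by (simp add: b(2) root_combination_def)
  show "root_space G \<beta> \<subseteq> X"
  proof
   fix x assume x: "x \<in> root_space G \<beta>"
   have "br h0 x = sm (of_int (- int k)) x" using rsD[OF x h0(1)] bh by simp
   from eigen_T(1)[OF this] have "P (- 1) k x (Phi x (- int k))" using \<open>k \<noteq> 0\<close> by (simp add: T_def)
   hence "FP (- 1) k x" by (rule P_FP) (use rsD[OF x sc(1)] bs in auto)
   thus "x \<in> X" by (rule assms(4))
  qed
 qed
 ultimately have "fin_cartan n G \<union> sum_of_root_spaces G (positive_roots n G) \<union> sum_of_root_spaces G (fin_neg_roots n G) \<subseteq> X"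
  using assms(2) by blast
 hence "current_algebra n G \<subseteq> X" unfolding current_algebra_def by (rule V.span_minimal) (rule assms(1))
 thus ?thesis using assms(5) by blast
qed

lemma br_subspace: "V.subspace X \<Longrightarrow> V.subspace {x. br y x \<in> X}"
 by (auto simp: V.subspace_def br_add_r br_sm_r)

text \<open>The critical case is height 1, where the bracket leaves the positive part. As i >= 1 it
  lands on a multiple of the coroot i, which belongs to \<open>fin_cartan\<close>.\<close>

lemma current_f:
 assumes "1 \<le> i" "i \<le> n" "x \<in> current_algebra n G"
 shows "br (g (- 1) i) x \<in> current_algebra n G"
proof -
 have "x \<in> {x. br (g (- 1) i) x \<in> current_algebra n G}"
 proof (rule current_minimal[OF br_subspace[OF current_subspace]])
  fix h assume h: "h \<in> fin_cartan n G"
  have "br (g (- 1) i) h = sm (al i h) (g (- 1) i)"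
   using fin_cartan_H[OF h] assms by (subst br_anti, subst br_h_g) auto
  moreover have "g (- 1) i \<in> current_algebra n G" by (rule FP_current[OF FP_gen[OF assms(1,2)]])
  ultimately show "h \<in> {x. br (g (- 1) i) x \<in> current_algebra n G}"
   using current_subspace by (simp add: V.subspace_scale)
 next
  fix k x assume "FP (- 1) k x"
  thus "x \<in> {x. br (g (- 1) i) x \<in> current_algebra n G}" using FP_current[OF FP_br] assms(1,2) by blast
 next
  fix k x c assume P: "P 1 k x c"
  show "x \<in> {x. br (g (- 1) i) x \<in> current_algebra n G}"
  proof (cases "k = 1")
   case True
   then obtain a where x: "x = (\<Sum>j\<le>n. sm (a j) (g 1 j))" using P1_lin[OF P] by blast
   have "br (g (- 1) i) (g 1 j) = - (if j = i then cv i else 0)" if "j \<le> n" for j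
    using that assms br_ef[of j i] by (subst br_anti) (simp add: g_def)
   hence b: "br (g (- 1) i) x = (\<Sum>j\<le>n. sm (a j) (- (if j = i then cv i else 0)))"
    unfolding x br_sum_r br_sm_r by (intro sum.cong) auto
   have "br (g (- 1) i) x \<in> fin_cartan n G"
    unfolding b using fin_cartan_subspace cv_fin[OF assms(1,2)]
    by (intro V.subspace_sum V.subspace_scale V.subspace_neg) (auto intro: V.subspace_0)
   thus ?thesis using fin_cartan_current by blast
  next
   case False
   have "T (1 * int k - 1) (br (g (- 1) i) x) (bc (- 1) (1 * int k) (cg (- 1) i) c)"
    by (rule P_opp[OF P assms(2)]) simp
   hence "P 1 (k - 1) (br (g (- 1) i) x) (bc (- 1) (1 * int k) (cg (- 1) i) c)"
    using False P_pos[OF P] by (auto simp: T_def nat_diff_distrib' split: if_splits)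
   thus ?thesis using P_current by blast
  qed
 qed (rule assms(3))
 thus ?thesis by simp
qed

lemma current_FP:
 assumes "FP (- 1) k y" "x \<in> current_algebra n G"
 shows "br y x \<in> current_algebra n G"
 using assms
proof (induction arbitrary: x rule: FP.induct)
 case (FP_gen i) thus ?case by (rule current_f)
next
 case (FP_br k y i)
 have "br (br (g (- 1) i) y) x = br (g (- 1) i) (br y x) - br y (br (g (- 1) i) x)"
  by (simp add: jac[of "g (- 1) i"])
 moreover have "br (g (- 1) i) (br y x) \<in> current_algebra n G" using FP_br by (intro current_f FP_br.IH)
 moreover have "br y (br (g (- 1) i) x) \<in> current_algebra n G" using FP_br by (intro current_f FP_br.IH)
 ultimately show ?case using V.subspace_diff[OF current_subspace] by simp
qed (use current_subspace in \<open>auto simp: br_add_l br_sm_l V.subspace_0 V.subspace_add V.subspace_scale\<close>)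

lemma current_br:
 assumes "x \<in> current_algebra n G" "y \<in> current_algebra n G"
 shows "br x y \<in> current_algebra n G"
proof -
 have neg: "br x y \<in> current_algebra n G \<longleftrightarrow> br y x \<in> current_algebra n G" for x y
  using V.subspace_neg[OF current_subspace] br_anti[of x y] br_anti[of y x] by metis
 have FPr: "br x y \<in> current_algebra n G" if "FP (- 1) k y" "x \<in> current_algebra n G" for k x y
  using current_FP[OF that] neg by blast
 have h: "br h y \<in> current_algebra n G" if h: "h \<in> fin_cartan n G" and y: "y \<in> current_algebra n G" for h y
 proof -
  have "y \<in> {y. br h y \<in> current_algebra n G}"
  proof (rule current_minimal[OF br_subspace[OF current_subspace] _ _ _ y])
   fix h' assume "h' \<in> fin_cartan n G"
   thus "h' \<in> {y. br h y \<in> current_algebra n G}"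
    using HH0 fin_cartan_H h V.subspace_0[OF current_subspace] by simp
  next
   fix k x c assume "P 1 k x c"
   from P_h[OF this fin_cartan_H[OF h]] show "x \<in> {y. br h y \<in> current_algebra n G}" using P_current by simp
  next
   fix k x assume "FP (- 1) k x"
   thus "x \<in> {y. br h y \<in> current_algebra n G}" using FPr fin_cartan_current[OF h] by blast
  qed
  thus ?thesis by simp
 qed
 have "y \<in> {y. br x y \<in> current_algebra n G}"
 proof (rule current_minimal[OF br_subspace[OF current_subspace] _ _ _ assms(2)])
  fix h' assume "h' \<in> fin_cartan n G"
  thus "h' \<in> {y. br x y \<in> current_algebra n G}" using h assms(1) neg by blast
 next
  fix k y assume "FP (- 1) k y"
  thus "y \<in> {y. br x y \<in> current_algebra n G}" using FPr assms(1) by blast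
 next
  fix k y c assume P: "P 1 k y c"
  have "x \<in> {x. br y x \<in> current_algebra n G}"
  proof (rule current_minimal[OF br_subspace[OF current_subspace] _ _ _ assms(1)])
   fix h' assume "h' \<in> fin_cartan n G"
   thus "h' \<in> {x. br y x \<in> current_algebra n G}" using h P_current[OF P] neg by blast
  next
   fix l x assume "FP (- 1) l x"
   thus "x \<in> {x. br y x \<in> current_algebra n G}" using FPr P_current[OF P] by blast
  next
   fix l x d assume P': "P 1 l x d"
   have "T (1 * int k + int l) (br y x) (bc (1 * int k) (int l) c d)"
    by (rule P_br_T[OF P]) (use P' P_pos[OF P'] in \<open>auto simp: T_def\<close>)
   hence "P 1 (nat (int k + int l)) (br y x) (bc (1 * int k) (int l) c d)" using P_pos[OF P] by (simp add: T_def)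
   thus "x \<in> {x. br y x \<in> current_algebra n G}" using P_current by blast
  qed
  thus "y \<in> {y. br x y \<in> current_algebra n G}" using neg by blast
 qed
 thus ?thesis by simp
qed

lemma per_add: "per x \<Longrightarrow> per y \<Longrightarrow> per (x + y)" and per_sm: "per x \<Longrightarrow> per (sm c x)"
 by (auto simp: per_def Phi_add Phi_sm)

lemma per_subspace: "V.subspace {x. per x}"
 by (auto simp: V.subspace_def per_add per_sm) (simp add: per_def)

lemma per_fin_cartan: "h \<in> fin_cartan n G \<Longrightarrow> per h"
proof -
 have "cv i \<in> {x. per x}" if "i \<in> {1..n}" for i
 proof -
  have i: "i \<le> n" using that by simp
  have "lab (m + N - 1) = lab (m - 1)" for m
  proof -
   have "m + N - 1 = (m - 1) + N" by simp
   thus ?thesis by (simp only: lab_shift)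
  qed
  thus ?thesis by (simp add: per_def Phi_H cv_H i pih_cv)
 qed
 hence "cv ` {1..n} \<subseteq> {x. per x}" by blast
 hence "fin_cartan n G \<subseteq> {x. per x}" unfolding fin_cartan_def by (rule V.span_minimal) (rule per_subspace)
 thus "h \<in> fin_cartan n G \<Longrightarrow> per h" by blast
qed

lemma root_Phi0:
 assumes "\<beta> \<in> roots G" "x \<in> root_space G \<beta>"
 shows "Phi x 0 m = 0"
proof (rule ccontr)
 assume nz: "Phi x 0 m \<noteq> 0"
 have "\<beta> h = 0" for h
 proof (cases "h \<in> H")
  case True
  thus ?thesis using rs_Phi[OF assms(2) True nz] by simp
 next
  case False
  thus ?thesis using assms(1) by (simp add: roots_def dual_def)
 qed
 hence "\<beta> = 0" by (simp add: fun_eq_iff)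
 thus False using assms(1) by (simp add: roots_def)
qed

lemma per_current: "x \<in> current_algebra n G \<Longrightarrow> per x"
proof -
 have "root_space G \<beta> \<subseteq> {x. per x}" if "\<beta> \<in> roots G" for \<beta>
  using root_Phi0[OF that] by (auto simp: per_def)
 hence "sum_of_root_spaces G (positive_roots n G) \<subseteq> {x. per x}" "sum_of_root_spaces G (fin_neg_roots n G) \<subseteq> {x. per x}"
  by (intro sum_of_root_spaces_minimal[OF _ per_subspace],
   force simp: positive_roots_def fin_neg_roots_def fin_roots_def)+
 moreover have "fin_cartan n G \<subseteq> {x. per x}" using per_fin_cartan by blast
 ultimately have "fin_cartan n G \<union> sum_of_root_spaces G (positive_roots n G) \<union> sum_of_root_spaces G (fin_neg_roots n G) \<subseteq> {x. per x}"
  by blast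
 hence "current_algebra n G \<subseteq> {x. per x}" unfolding current_algebra_def by (rule V.span_minimal) (rule per_subspace)
 thus "x \<in> current_algebra n G \<Longrightarrow> per x" by blast
qed

text \<open>Since \<delta> vanishes on \<open>hs\<close>, a root of Cn+ takes there the value of its
  finite part or half of it, and that value is the positive height of a positive root.\<close>

lemma real_pos_hs:
 assumes "\<beta> \<in> real_roots_pos n G"
 shows "\<exists>r::real. r > 0 \<and> \<beta> hs = of_real r"
proof -
 have fp: "\<exists>k::nat. k \<ge> 1 \<and> \<alpha> hs = of_nat k" if "\<alpha> \<in> fin_pos_roots n G" for \<alpha>
  using fin_combo[OF that] by metis
 have "\<exists>k::nat. k \<ge> 1 \<and> (\<beta> hs = of_nat k \<or> \<beta> hs = of_nat k / 2)"
  using assms unfolding real_roots_pos_def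
 proof (elim UnE)
  assume "\<beta> \<in> fin_pos_roots n G" thus ?thesis using fp by blast
 next
  assume "\<beta> \<in> {\<lambda>h. \<alpha> h + of_nat k * delta n G h | \<alpha> k. \<alpha> \<in> short_roots n G \<inter> fin_pos_roots n G \<and> k \<ge> 1}"
  then obtain \<alpha> k where "\<beta> = (\<lambda>h. \<alpha> h + of_nat k * delta n G h)" "\<alpha> \<in> fin_pos_roots n G" by blast
  thus ?thesis using fp[of \<alpha>] by (simp add: delta_hs) blast
 next
  assume "\<beta> \<in> {\<lambda>h. \<alpha> h + 2 * of_nat k * delta n G h | \<alpha> k. \<alpha> \<in> long_roots n G \<inter> fin_pos_roots n G \<and> k \<ge> 1}"
  then obtain \<alpha> k where "\<beta> = (\<lambda>h. \<alpha> h + 2 * of_nat k * delta n G h)" "\<alpha> \<in> fin_pos_roots n G" by blast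
  thus ?thesis using fp[of \<alpha>] by (simp add: delta_hs) blast
 next
  assume "\<beta> \<in> {\<lambda>h. (\<alpha> h + (2 * of_nat k + 1) * delta n G h) / 2 | \<alpha> k. \<alpha> \<in> long_roots n G \<inter> fin_pos_roots n G}"
  then obtain \<alpha> k where "\<beta> = (\<lambda>h. (\<alpha> h + (2 * of_nat k + 1) * delta n G h) / 2)" "\<alpha> \<in> fin_pos_roots n G" by blast
  thus ?thesis using fp[of \<alpha>] by (simp add: delta_hs) blast
 qed
 then obtain k :: nat where k: "k \<ge> 1" "\<beta> hs = of_nat k \<or> \<beta> hs = of_nat k / 2" by blast
 have "\<beta> hs = of_real (real k) \<or> \<beta> hs = of_real (real k / 2)" using k(2) by simp
 thus ?thesis using k(1) by (elim disjE) (force intro: exI[of _ "real k"] exI[of _ "real k / 2"])+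
qed

lemma rs_us:
 assumes "x \<in> root_space G \<beta>" "\<beta> hs = of_real r" "Phi x k m \<noteq> 0"
 shows "us m - us (m + k) = r"
proof -
 have "complex_of_real (us m - us (m + k)) = of_real r"
  using rs_Phi[OF assms(1) hs(1) assms(3)] assms(2) by (simp add: hs(2))
 thus ?thesis by (simp only: of_real_eq_iff)
qed

end

section \<open>Fock modules with finitely many sites\<close>

locale fock_data = A2n2 G n for G :: "('g::ab_group_add) kac_moody" and n +
 fixes Sg :: "nat set" and J :: "nat \<Rightarrow> nat" and b :: "nat \<Rightarrow> complex"
 assumes finSg: "finite Sg" and J: "s \<in> Sg \<Longrightarrow> 1 \<le> J s" "s \<in> Sg \<Longrightarrow> J s \<le> n"
  and bnz: "s \<in> Sg \<Longrightarrow> b s \<noteq> 0"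
begin

definition I :: "(nat \<times> int) set" where "I = Sg \<times> {1..N}"

sublocale fk: fock I by standard (simp add: I_def finSg)

definition M :: "'g \<Rightarrow> nat \<times> int \<Rightarrow> nat \<times> int \<Rightarrow> complex" where
 "M x a c = (if fst a = fst c then mat (b (fst a)) x (snd a) (snd c) else 0)"

definition rho :: "'g \<Rightarrow> ((nat \<times> int) set \<Rightarrow> complex) \<Rightarrow> (nat \<times> int) set \<Rightarrow> complex" where
 "rho x = fk.bil (M x)"

definition sF :: "complex \<Rightarrow> ((nat \<times> int) set \<Rightarrow> complex) \<Rightarrow> (nat \<times> int) set \<Rightarrow> complex" where
 "sF c f = (\<lambda>U. c * f U)"

lemma I_sum:
 assumes "s \<in> Sg" "\<And>c. c \<in> I \<Longrightarrow> fst c \<noteq> s \<Longrightarrow> F c = 0"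
 shows "(\<Sum>c\<in>I. F c) = (\<Sum>r\<in>{1..N}. F (s, r))"
proof -
 have "(\<Sum>c\<in>I. F c) = (\<Sum>c\<in>(\<lambda>r. (s, r)) ` {1..N}. F c)"
 proof (rule sum.mono_neutral_right)
  show "\<forall>c\<in>I - (\<lambda>r. (s, r)) ` {1..N}. F c = 0" using assms(2) by (force simp: I_def)
 qed (use fk.fin assms(1) in \<open>auto simp: I_def\<close>)
 also have "\<dots> = (\<Sum>r\<in>{1..N}. F (s, r))"
  by (subst sum.reindex) (auto simp: inj_on_def)
 finally show ?thesis .
qed

lemma rho_br:
 assumes "per x" "per y"
 shows "rho (br x y) f U = rho x (rho y f) U - rho y (rho x f) U"
proof -
 have e: "M (br x y) a d = (\<Sum>c\<in>I. M x a c * M y c d - M y a c * M x c d)" if ad: "a \<in> I" "d \<in> I" for a d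
 proof -
  obtain s p where a: "a = (s, p)" "s \<in> Sg" using ad(1) by (auto simp: I_def)
  have "(\<Sum>c\<in>I. M x a c * M y c d - M y a c * M x c d)
    = (\<Sum>r\<in>{1..N}. M x a (s, r) * M y (s, r) d - M y a (s, r) * M x (s, r) d)"
   by (rule I_sum[OF a(2)]) (auto simp: M_def a)
  also have "\<dots> = M (br x y) a d"
  proof (cases "fst d = s")
   case True
   thus ?thesis by (simp add: M_def a mat_br[OF assms bnz[OF a(2)]])
  next
   case False
   thus ?thesis by (auto simp: M_def a)
  qed
  finally show ?thesis by (rule sym)
 qed
 have "rho (br x y) f U = fk.bil (\<lambda>a d. \<Sum>c\<in>I. M x a c * M y c d - M y a c * M x c d) f U"
  unfolding rho_def fk.bil_def by (intro sum.cong refl) (simp only: e)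
 thus ?thesis unfolding rho_def fk.bil_br .
qed

lemma rho_f_add: "rho x (f + h) = rho x f + rho x h"
proof
 fix U
 have e: "f + h = (\<lambda>V. f V + h V)" by (simp add: fun_eq_iff)
 have "fk.an c (f + h) = (\<lambda>V. fk.an c f V + fk.an c h V)" for c unfolding e by (rule ext) (rule fk.an_add)
 thus "rho x (f + h) U = (rho x f + rho x h) U"
  by (simp add: rho_def fk.bil_def fk.cr_add distrib_left sum.distrib)
qed

lemma rho_f_s: "rho x (sF c f) = sF c (rho x f)"
proof
 fix U
 have "fk.an d (\<lambda>V. c * f V) = (\<lambda>V. c * fk.an d f V)" for d by (rule ext) (rule fk.an_smult)
 thus "rho x (sF c f) U = sF c (rho x f) U"
  by (simp add: rho_def fk.bil_def sF_def fk.cr_smult sum_distrib_left mult.left_commute)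
qed

lemma rho_f_0: "rho x 0 = 0"
proof -
 have "sF 0 f = 0" for f by (simp add: sF_def fun_eq_iff)
 thus ?thesis using rho_f_s[of x 0 0] by metis
qed

lemma rho_add: "rho (x + y) f = rho x f + rho y f"
proof
 fix U
 have "M (x + y) a c = M x a c + M y a c" for a c by (simp add: M_def mat_add)
 thus "rho (x + y) f U = (rho x f + rho y f) U"
  by (simp add: rho_def fk.bil_def distrib_right sum.distrib)
qed

lemma rho_sm: "rho (sm c x) f = sF c (rho x f)"
proof
 fix U
 have "M (sm c x) a d = c * M x a d" for a d by (simp add: M_def mat_sm)
 thus "rho (sm c x) f U = sF c (rho x f) U"
  by (simp add: rho_def fk.bil_def sF_def sum_distrib_left mult.assoc)
qed

sublocale fr: free_rep sF rho
proof unfold_locales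
 fix x c v show "rho x (sF c v) = sF c (rho x v)" by (rule rho_f_s)
qed (auto simp: sF_def rho_f_add fun_eq_iff algebra_simps)

lemma rho_0: "rho 0 f = 0" using rho_sm[of 0 0 f] by (simp add: sF_def fun_eq_iff)

text \<open>The positions 1, ..., J s are filled at every site s. The corresponding state is the
  tensor product of the highest weight vectors of the exterior powers of degree J s of the
  evaluation modules.\<close>

definition S0 :: "(nat \<times> int) set" where "S0 = Sigma Sg (\<lambda>s. {1..int (J s)})"

definition v0 :: "(nat \<times> int) set \<Rightarrow> complex" where "v0 = fk.vac S0"

lemma S0_I: "S0 \<subseteq> I"
 using J by (fastforce simp: S0_def I_def N_def)

lemma v0_nz: "v0 S0 = 1" by (simp add: v0_def fk.vac_def)

text \<open>A particle can only move from an occupied q to a position p with larger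
  \<open>us\<close>. Since q <= n this means p < q, and such p is occupied already; the position N
  is excluded because its value 0 lies below that of q.\<close>

lemma rho_upper:
 assumes "\<And>k m. Phi x k m \<noteq> 0 \<Longrightarrow> us m - us (m + k) > 0"
 shows "rho x v0 = 0"
proof
 fix U
 have "M x a c * fk.cr a (fk.an c v0) U = 0" if ac: "a \<in> I" "c \<in> I" for a c
 proof (cases "M x a c = 0")
  case False
  obtain s p q where sp: "a = (s, p)" "c = (s, q)" "mat (b s) x p q \<noteq> 0"
   using False by (cases a; cases c) (auto simp: M_def split: if_splits)
  obtain k where k: "Phi x k p \<noteq> 0" "N dvd p + k - q" using mat_nz[OF sp(3)] by blast
  have "us (p + k) = us q" using k(2) by (rule us_cong)
  hence lt: "us p > us q" using assms[OF k(1)] by simp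
  have "fk.cr a (fk.an c (fk.vac S0)) U = 0"
  proof (rule fk.hop_zero)
   show "c \<notin> S0 \<or> a \<in> S0 \<and> a \<noteq> c"
   proof (cases "c \<in> S0")
    case True
    hence s: "s \<in> Sg" "1 \<le> q" "q \<le> int (J s)" by (auto simp: S0_def sp)
    hence q: "q \<le> int n" using J(2)[of s] by linarith
    have uq: "us q = real n + 1 / 2 - real_of_int q" using s q by (intro us_small) auto
    have pN: "1 \<le> p" "p \<le> N" using ac(1) by (auto simp: I_def sp)
    have "p \<noteq> N"
    proof
     assume "p = N"
     hence "us p = 0" by (simp add: us_def)
     thus False using lt uq q by simp
    qed
    hence "p \<le> 2 * int n" using pN by (simp add: N_def)
    hence "us p = real n + 1 / 2 - real_of_int p" using pN by (intro us_small) auto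
    hence "p < q" using lt uq by simp
    thus ?thesis using s pN by (auto simp: S0_def sp)
   qed simp
  qed
  thus ?thesis by (simp add: v0_def)
 qed simp
 hence "rho x v0 U = 0" unfolding rho_def fk.bil_def by (intro sum.neutral ballI) blast
 thus "rho x v0 U = 0 U" by simp
qed

definition chi :: "'g \<Rightarrow> complex" where
 "chi x = (\<Sum>s\<in>Sg. \<Sum>p\<in>{1..int (J s)}. mat (b s) x p p)"

lemma chi_add: "chi (x + y) = chi x + chi y" and chi_sm: "chi (sm c x) = c * chi x"
 by (simp_all add: chi_def mat_add mat_sm sum.distrib sum_distrib_left)

lemma rho_diag:
 assumes "\<And>k m. Phi x k m \<noteq> 0 \<Longrightarrow> N dvd k"
 shows "rho x v0 = sF (chi x) v0"
proof
 fix U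
 have off: "M x a c * fk.cr a (fk.an c v0) U = 0" if ac: "a \<in> I" "c \<in> I" "a \<noteq> c" for a c
 proof (cases "M x a c = 0")
  case False
  obtain s p q where sp: "a = (s, p)" "c = (s, q)" "mat (b s) x p q \<noteq> 0"
   using False by (cases a; cases c) (auto simp: M_def split: if_splits)
  obtain k where k: "Phi x k p \<noteq> 0" "N dvd p + k - q" using mat_nz[OF sp(3)] by blast
  have "N dvd k" by (rule assms[OF k(1)])
  hence "N dvd (p + k - q) - k" by (rule dvd_diff[OF k(2)])
  hence "N dvd p - q" by (simp add: algebra_simps)
  moreover have "\<bar>p - q\<bar> < N" using ac by (auto simp: I_def sp)
  ultimately have "p = q" using dvd_imp_le_int[of "p - q" N] by auto
  thus ?thesis using ac(3) sp by simp
 qed simp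
 have "rho x v0 U = (\<Sum>a\<in>I. \<Sum>c\<in>{a}. M x a c * fk.cr a (fk.an c v0) U)"
  unfolding rho_def fk.bil_def
  by (intro sum.cong refl sum.mono_neutral_right) (use off fk.fin in auto)
 also have "\<dots> = (\<Sum>a\<in>I. M x a a * fk.cr a (fk.an a v0) U)" by simp
 also have "\<dots> = (\<Sum>a\<in>S0. M x a a * fk.cr a (fk.an a v0) U)"
 proof (rule sum.mono_neutral_right)
  show "\<forall>a\<in>I - S0. M x a a * fk.cr a (fk.an a v0) U = 0"
   using fk.hop_zero[of _ S0] by (simp add: v0_def)
 qed (use fk.fin S0_I in auto)
 also have "\<dots> = (\<Sum>a\<in>S0. M x a a * v0 U)"
  by (rule sum.cong) (use fk.hop_same S0_I in \<open>auto simp: v0_def subset_eq\<close>)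
 also have "\<dots> = (\<Sum>a\<in>S0. M x a a) * v0 U" by (rule sum_distrib_right[symmetric])
 also have "(\<Sum>a\<in>S0. M x a a) = chi x"
  unfolding S0_def chi_def by (subst sum.Sigma) (auto simp: finSg M_def intro!: sum.cong)
 finally show "rho x v0 U = sF (chi x) v0 U" by (simp add: sF_def)
qed

definition wt :: "(nat \<times> int) set \<Rightarrow> real" where "wt U = (\<Sum>a\<in>U \<inter> I. us (snd a))"

lemma wt_bound: "\<bar>wt U\<bar> \<le> (\<Sum>a\<in>I. \<bar>us (snd a)\<bar>)"
proof -
 have "\<bar>wt U\<bar> \<le> (\<Sum>a\<in>U \<inter> I. \<bar>us (snd a)\<bar>)" unfolding wt_def by (rule sum_abs)
 also have "\<dots> \<le> (\<Sum>a\<in>I. \<bar>us (snd a)\<bar>)" by (rule sum_mono2) (auto simp: fk.fin)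
 finally show ?thesis .
qed

lemma wt_hop:
 assumes "a \<in> U" "c \<notin> U - {a}" "a \<in> I" "c \<in> I"
 shows "wt (insert c (U - {a})) = wt U - us (snd a) + us (snd c)"
proof -
 have fin: "finite (U \<inter> I)" using fk.fin by simp
 have "U \<inter> I = insert a ((U - {a}) \<inter> I)" using assms by auto
 hence "wt U = us (snd a) + wt (U - {a})" using fk.fin by (simp add: wt_def)
 moreover have "insert c (U - {a}) \<inter> I = insert c ((U - {a}) \<inter> I)" using assms by auto
 hence "wt (insert c (U - {a})) = us (snd c) + wt (U - {a})" using fk.fin assms by (simp add: wt_def)
 ultimately show ?thesis by simp
qed

lemma rho_supp:
 assumes "\<And>k m. Phi y k m \<noteq> 0 \<Longrightarrow> us m - us (m + k) = - e"
  and f: "\<And>U. f U \<noteq> 0 \<Longrightarrow> wt U = w" and U: "rho y f U \<noteq> 0"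
 shows "wt U = w - e"
proof -
 obtain a where a: "a \<in> I" "(\<Sum>c\<in>I. M y a c * fk.cr a (fk.an c f) U) \<noteq> 0"
  using U unfolding rho_def fk.bil_def by (rule sum.not_neutral_contains_not_neutral)
 obtain c where c: "c \<in> I" "M y a c * fk.cr a (fk.an c f) U \<noteq> 0"
  using a(2) by (rule sum.not_neutral_contains_not_neutral)
 obtain s p q where sp: "a = (s, p)" "c = (s, q)" "mat (b s) y p q \<noteq> 0"
  using c(2) by (cases a; cases c) (auto simp: M_def split: if_splits)
 obtain k where k: "Phi y k p \<noteq> 0" "N dvd p + k - q" using mat_nz[OF sp(3)] by blast
 have "us (p + k) = us q" using k(2) by (rule us_cong)
 hence d: "us (snd a) - us (snd c) = - e" using assms(1)[OF k(1)] by (simp add: sp)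
 have ac: "a \<in> U" "c \<notin> U - {a}" "f (insert c (U - {a})) \<noteq> 0"
  using c(2) by (auto simp: fk.cr_def fk.an_def split: if_splits)
 have "wt U - us (snd a) + us (snd c) = w"
  using f[OF ac(3)] wt_hop[OF ac(1,2) a(1) c(1)] by simp
 thus ?thesis using d by simp
qed

text \<open>Every application lowers the weight \<open>wt\<close> of the occupied sets by e, but
  \<open>wt\<close> is bounded because I is finite.\<close>

lemma rho_nilpotent:
 assumes "\<And>k m. Phi y k m \<noteq> 0 \<Longrightarrow> us m - us (m + k) = - e" "e > 0"
 shows "\<exists>K. (rho y ^^ K) v0 = 0"
proof -
 have supp: "(rho y ^^ K) v0 U \<noteq> 0 \<Longrightarrow> wt U = wt S0 - real K * e" for K U
 proof (induction K arbitrary: U)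
  case 0 thus ?case by (auto simp: v0_def fk.vac_def split: if_splits)
 next
  case (Suc K)
  have "rho y ((rho y ^^ K) v0) U \<noteq> 0" using Suc.prems by simp
  from rho_supp[OF assms(1) Suc.IH this] show ?case by (simp add: algebra_simps)
 qed
 \<comment> \<open>Twice the bound, once for the weight of the vacuum and once for the weight of the
   set reached.\<close>
 obtain K :: nat where K: "real K * e > 2 * (\<Sum>a\<in>I. \<bar>us (snd a)\<bar>)"
  using reals_Archimedean3[OF assms(2)] by blast
 have "(rho y ^^ K) v0 U = 0" for U
 proof (rule ccontr)
  assume "\<not> ?thesis"
  hence "wt U = wt S0 - real K * e" by (rule supp)
  thus False using K wt_bound[of U] wt_bound[of S0] by linarith
 qed
 thus ?thesis by (auto simp: fun_eq_iff)
qed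

text \<open>Integrality is deduced from nilpotency. In the string v_j = y^j v0 the operator x sends
  v_j to a multiple \<open>ga j\<close> of v_(j-1), and \<open>ga\<close> must vanish at the first K
  with v_K = 0. This says that the coroot acts on the vacuum by K - 1.\<close>

lemma sl2_relation:
 assumes \<alpha>: "\<alpha> \<in> fin_pos_roots n G" and y: "y \<in> root_space G (- \<alpha>)" "y \<noteq> 0"
 shows "\<exists>m. chi (coroot G \<alpha>) = of_nat m \<and> (rho y ^^ Suc m) v0 = 0 \<and> coroot G \<alpha> \<in> fin_cartan n G"
proof -
 obtain x h where x: "x \<in> root_space G \<alpha>" "br x y = h" "h \<in> fin_cartan n G" "\<alpha> h \<noteq> 0"
  "coroot G \<alpha> = sm (2 / \<alpha> h) h" using coroot_fin[OF \<alpha> y] by blast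
 obtain c k where k: "k \<ge> 1" "\<alpha> h0 = of_nat k" "\<alpha> hs = of_nat k" using fin_combo[OF \<alpha>] by metis
 have hH: "h \<in> H" using x(3) by (rule fin_cartan_H)
 have Px: "Phi x 0 m = 0" for m
  by (rule eigen_T(2)[of x "int k"]) (use rsD[OF x(1) h0(1)] k in auto)
 have Py: "Phi y 0 m = 0" for m
  by (rule eigen_T(2)[of y "- int k"]) (use rsD[OF y(1) h0(1)] k in auto)
 have per: "per x" "per y" "per h" using Px Py per_fin_cartan[OF x(3)] by (auto simp: per_def)
 define a where "a = \<alpha> h"
 define X where "X = rho x"
 define Y where "Y = rho y"
 define v where "v j = (Y ^^ j) v0" for j
 have Xv0: "X v0 = 0" unfolding X_def
 proof (rule rho_upper)
  fix k' m assume nz: "Phi x k' m \<noteq> 0"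
  have "us m - us (m + k') = real k" by (rule rs_us[OF x(1) _ nz]) (simp add: k)
  thus "us m - us (m + k') > 0" using k by simp
 qed
 have hv0: "rho h v0 = sF (chi h) v0"
  by (rule rho_diag) (use hH in \<open>auto simp: Phi_H split: if_splits\<close>)
 have hY: "rho h (Y f) = Y (rho h f) - sF a (Y f)" for f
 proof -
  have "br h y = sm (- a) y" using rsD[OF y(1) hH] by (simp add: a_def)
  hence "rho (sm (- a) y) f U = rho h (rho y f) U - rho y (rho h f) U" for U
   using rho_br[OF per(3,2), of f U] by simp
  thus ?thesis unfolding rho_sm Y_def by (auto simp: fun_eq_iff sF_def algebra_simps)
 qed
 have XY: "X (Y f) = Y (X f) + rho h f" for f
  using rho_br[OF per(1,2), of f] x(2) by (auto simp: fun_eq_iff X_def Y_def algebra_simps)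
 have vS: "v (Suc j) = Y (v j)" for j by (simp add: v_def)
 have hv: "rho h (v j) = sF (chi h - of_nat j * a) (v j)" for j
 proof (induction j)
  case (Suc j)
  show ?case unfolding vS hY Suc unfolding Y_def rho_f_s by (auto simp: sF_def fun_eq_iff algebra_simps)
 qed (simp add: v_def hv0)
 \<comment> \<open>The sum of the eigenvalues of h on the first j vectors of the string, which are
   \<open>chi h\<close>, \<open>chi h - a\<close>, \<open>chi h - 2 * a\<close> and so on.\<close>
 define ga where "ga j = of_nat j * chi h - of_nat j * (of_nat j - 1) / 2 * a" for j :: nat
 have Xv: "X (v (Suc j)) = sF (ga (Suc j)) (v j)" for j
 proof (induction j)
  case 0
  have "X (v (Suc 0)) = Y (X v0) + rho h v0" by (simp add: vS XY v_def)
  also have "Y (X v0) = 0" unfolding Xv0 Y_def by (rule rho_f_0)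
  finally show ?case by (simp add: hv0 ga_def v_def)
 next
  case (Suc j)
  have "X (v (Suc (Suc j))) = Y (X (v (Suc j))) + rho h (v (Suc j))" by (subst vS) (rule XY)
  also have "\<dots> = sF (ga (Suc j)) (v (Suc j)) + sF (chi h - of_nat (Suc j) * a) (v (Suc j))"
   unfolding Suc hv unfolding Y_def rho_f_s by (simp only: vS Y_def)
  also have "\<dots> = sF (ga (Suc j) + (chi h - of_nat (Suc j) * a)) (v (Suc j))"
   by (auto simp: sF_def fun_eq_iff algebra_simps)
  also have "ga (Suc j) + (chi h - of_nat (Suc j) * a) = ga (Suc (Suc j))"
   by (simp add: ga_def field_simps)
  finally show ?case .
 qed
 have "\<exists>K. v K = 0" unfolding v_def Y_def
 proof (rule rho_nilpotent)
  fix k' m assume nz: "Phi y k' m \<noteq> 0"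
  show "us m - us (m + k') = - real k" by (rule rs_us[OF y(1) _ nz]) (simp add: k)
 qed (use k in simp)
 hence vK: "v (LEAST K. v K = 0) = 0" by (rule LeastI_ex)
 define K where "K = (LEAST K. v K = 0)"
 have "v 0 \<noteq> 0"
 proof
  assume "v 0 = 0"
  hence "v0 S0 = 0" by (simp add: v_def)
  thus False using v0_nz by simp
 qed
 hence "K \<noteq> 0" using vK by (metis K_def)
 then obtain m where m: "K = Suc m" by (cases K) auto
 have vm: "v m \<noteq> 0" using not_less_Least[of m "\<lambda>K. v K = 0"] m by (simp add: K_def)
 have "sF (ga (Suc m)) (v m) = 0"
 proof -
  have "v (Suc m) = 0" using vK m by (simp add: K_def)
  hence "X (v (Suc m)) = 0" unfolding X_def using rho_f_0 by simp
  thus ?thesis by (simp only: Xv)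
 qed
 hence "ga (Suc m) = 0" using vm by (auto simp: sF_def fun_eq_iff)
 hence "of_nat (Suc m) * (chi h - of_nat m / 2 * a) = 0" by (simp add: ga_def field_simps)
 moreover have "of_nat (Suc m) \<noteq> (0 :: complex)" by (rule of_nat_neq_0)
 ultimately have "chi h = of_nat m / 2 * a" by simp
 hence "chi (coroot G \<alpha>) = of_nat m" using x(4) by (simp add: x(5) chi_sm a_def field_simps)
 moreover have "v K = 0" unfolding K_def by (rule vK)
 hence "(rho y ^^ Suc m) v0 = 0" unfolding m unfolding v_def Y_def .
 moreover have "coroot G \<alpha> \<in> fin_cartan n G" unfolding x(5) using fin_cartan_subspace x(3) by (rule V.subspace_scale)
 ultimately show ?thesis by blast
qed

lemma act_n_plus: "x \<in> current_n_plus n G \<Longrightarrow> fr.act (letter x) v0 = 0"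
proof -
 have "current_n_plus n G \<subseteq> {x. rho x v0 = 0}" unfolding current_n_plus_def
 proof (rule sum_of_root_spaces_minimal)
  have "sF c 0 = 0" for c by (simp add: sF_def fun_eq_iff)
  thus "V.subspace {x. rho x v0 = 0}" unfolding V.subspace_def by (auto simp: rho_add rho_sm rho_0)
  fix \<beta> assume "\<beta> \<in> real_roots_pos n G"
  then obtain r :: real where r: "r > 0" "\<beta> hs = of_real r" using real_pos_hs by blast
  show "root_space G \<beta> \<subseteq> {x. rho x v0 = 0}"
  proof clarify
   fix x assume x: "x \<in> root_space G \<beta>"
   show "rho x v0 = 0" by (rule rho_upper) (use rs_us[OF x r(2)] r(1) in auto)
  qed
 qed
 thus "x \<in> current_n_plus n G \<Longrightarrow> fr.act (letter x) v0 = 0" by auto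
qed

lemma act_uea:
 assumes "p \<in> uea_ideal G (current_algebra n G)"
 shows "fr.act p f = 0"
proof -
 let ?S = "current_algebra n G"
 let ?K = "{p \<in> carrier (free_ring ?S). \<forall>f. fr.act p f = 0}"
 have "ideal ?K (free_ring ?S)"
  by (rule free_ring_ideal) (auto simp: fr.act_add fr.act_minus fr.act_mult fr_add fr_minus fr_mult fr_zero)
 moreover have "uea_relations G ?S \<subseteq> ?K"
 proof
  fix q assume q: "q \<in> uea_relations G ?S"
  have "fr.act q f = 0" for f
   using q unfolding uea_relations_def
  proof (elim UnE)
   assume "q \<in> {letter (x + y) - (letter x + letter y) | x y. x \<in> ?S \<and> y \<in> ?S}"
   thus ?thesis by (auto simp: fr.act_diff fr.act_add rho_add)
  next
   assume "q \<in> {letter (sm c x) - Poly_Mapping.single 0 c * letter x | c x. x \<in> ?S}"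
   thus ?thesis by (auto simp: fr.act_diff fr.act_mult fr.act_scalar rho_sm)
  next
   assume "q \<in> {letter x * letter y - letter y * letter x - letter (br x y) | x y. x \<in> ?S \<and> y \<in> ?S}"
   then obtain x y where "q = letter x * letter y - letter y * letter x - letter (br x y)" "x \<in> ?S" "y \<in> ?S"
    by blast
   thus ?thesis using rho_br[OF per_current per_current, of x y f]
    by (simp add: fr.act_diff fr.act_mult fun_eq_iff)
  qed
  thus "q \<in> ?K" using uea_relations_carrier[OF current_subspace current_br] q by blast
 qed
 ultimately have "uea_ideal G ?S \<subseteq> ?K"
  unfolding uea_ideal_def by (intro ring.genideal_minimal[OF ring_free_ring])
 thus ?thesis using assms by auto
qed

end

context A2n2
begin

subsection \<open>A basis of the imaginary root spaces\<close>

definition zz :: "nat \<Rightarrow> nat \<Rightarrow> 'g" where "zz j k = (SOME z. T (int k * N) z (Zc (int j) (int k)))"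

text \<open>The coroot of node j in loop degree k: for j < n its entries at j and j + 1 are 1 and
  -1, as for the coroot itself, and all degrees share the dual functionals \<open>omega\<close>.
  Indices j outside 1, ..., n give 0, which keeps words in \<open>eta\<close> free of side
  conditions.\<close>

definition eta :: "nat \<Rightarrow> nat \<Rightarrow> 'g" where
 "eta j k = (if 1 \<le> j \<and> j \<le> n then (if k = 0 then cv j else if j < n then zz j k - zz (j + 1) k else zz j k) else 0)"

definition etac :: "nat \<Rightarrow> nat \<Rightarrow> int \<Rightarrow> complex" where
 "etac j k m = (if j < n then Zc (int j) (int k) m - Zc (int j + 1) (int k) m else Zc (int j) (int k) m)"

lemma zz: "1 \<le> j \<Longrightarrow> j \<le> n \<Longrightarrow> k \<ge> 1 \<Longrightarrow> T (int k * N) (zz j k) (Zc (int j) (int k))"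
 unfolding zz_def by (rule someI_ex, rule hasZ) auto

lemma T_diff: "T k x c \<Longrightarrow> T k y d \<Longrightarrow> T k (x - y) (\<lambda>m. c m - d m)"
 using T_add[of k x c "sm (- 1) y" "\<lambda>m. - 1 * d m"] T_sm[of k y d "- 1"] by simp

lemma eta_T:
 assumes "1 \<le> j" "j \<le> n" "k \<ge> 1"
 shows "T (int k * N) (eta j k) (etac j k)"
proof (cases "j < n")
 case True
 have "T (int k * N) (zz j k - zz (j + 1) k) (\<lambda>m. Zc (int j) (int k) m - Zc (int (j + 1)) (int k) m)"
  by (rule T_diff[OF zz zz]) (use assms True in auto)
 moreover have "etac j k = (\<lambda>m. Zc (int j) (int k) m - Zc (int (j + 1)) (int k) m)"
  using True by (auto simp: etac_def fun_eq_iff add.commute)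
 ultimately show ?thesis using assms True by (simp add: eta_def)
next
 case False
 hence "etac j k = Zc (int j) (int k)" by (auto simp: etac_def)
 thus ?thesis using assms False zz[OF assms] by (simp add: eta_def)
qed

lemma eta_0: "1 \<le> j \<Longrightarrow> j \<le> n \<Longrightarrow> eta j 0 = cv j" by (simp add: eta_def)

lemma eta_out: "\<not> (1 \<le> j \<and> j \<le> n) \<Longrightarrow> eta j k = 0" unfolding eta_def by (rule if_not_P)

lemma pih_shift: "pih h m - pih h (m + int k * N) = of_nat k * delta n G h"
 using pih_period_mult[of h m "int k"] by (simp add: delta_pih)

lemma eta_rs:
 assumes "k \<ge> 1"
 shows "eta j k \<in> root_space G (\<lambda>h. of_nat k * delta n G h)"
proof (cases "1 \<le> j \<and> j \<le> n")
 case True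
 show ?thesis
  by (rule rs_I[OF eta_T]) (use True assms N3 in \<open>auto simp: pih_shift\<close>)
qed (simp add: eta_out rs_zero)

lemma delta_cv: "1 \<le> j \<Longrightarrow> j \<le> n \<Longrightarrow> delta n G (cv j) = 0"
proof -
 assume j: "1 \<le> j" "j \<le> n"
 have "Phi (cv j) 0 (0 + N) = Phi (cv j) 0 0" using per_fin_cartan[OF cv_fin[OF j]] unfolding per_def by blast
 thus ?thesis using cv_H[OF j(2)] by (simp add: Phi_H delta_pih)
qed

lemma eta_current: "eta j k \<in> current_algebra n G"
proof (cases "1 \<le> j \<and> j \<le> n")
 case True
 show ?thesis
 proof (cases "k = 0")
  case False
  have "0 < int k * N" using False N3 by simp
  hence "P 1 (nat (int k * N)) (eta j k) (etac j k)" using eta_T[of j k] True False N3 by (simp add: T_def)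
  thus ?thesis by (rule P_current)
 qed (use True in \<open>simp add: eta_0 cv_fin fin_cartan_current\<close>)
qed (use V.subspace_0[OF current_subspace] in \<open>simp add: eta_out\<close>)

text \<open>For k, l >= 1 both are diagonal matrices over the loop ring, so the bracket has zero
  matrix. Its height is nonzero, so by \<open>T_inj\<close> no central element is hidden in it. If
  one index is 0, the bracket is scaling by \<delta> of a coroot, which is 0.\<close>

lemma eta_commute: "br (eta j k) (eta i l) = 0"
proof (cases "(1 \<le> j \<and> j \<le> n) \<and> (1 \<le> i \<and> i \<le> n)")
 case True
 have c0: "br (eta j' 0) (eta i' l') = 0" if "1 \<le> j' \<and> j' \<le> n" "1 \<le> i' \<and> i' \<le> n" for j' i' l'
 proof (cases "l' = 0")
  case False
  have "br (cv j') (eta i' l') = sm (of_nat l' * delta n G (cv j')) (eta i' l')"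
   by (rule rsD[OF eta_rs]) (use False that cv_H in auto)
  thus ?thesis using that by (simp add: eta_0 delta_cv)
 qed (use that HH0 cv_H in \<open>simp add: eta_0\<close>)
 show ?thesis
 proof (cases "k = 0 \<or> l = 0")
  case kl: True
  show ?thesis
  proof (cases "k = 0")
   case False
   thus ?thesis using kl c0[of i j k] True br_anti[of "eta j k" "eta i l"] by simp
  qed (use c0 True in simp)
 next
  case False
  have Tj: "T (int k * N) (eta j k) (etac j k)" and Ti: "T (int l * N) (eta i l) (etac i l)"
   using eta_T True False by auto
  have Zper: "Zc a c (m + int z * N) = Zc a c m" for a c m z
  proof -
   have "m + int z * N - a = (m - a) + int z * N" "m + int z * N + a = (m + a) + int z * N" by simp_all
   thus ?thesis unfolding Zc_def by (simp only: dvd_shift)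
  qed
  have per: "etac j' k' (m + int z * N) = etac j' k' m" for j' k' m z
   by (simp add: etac_def Zper)
  have "bc (int k * N) (int l * N) (etac j k) (etac i l) m = 0" for m
   by (simp add: bc_def per)
  moreover have "int k * N + int l * N \<noteq> 0"
  proof -
   have "int k * N > 0" "int l * N > 0" using False N3 by auto
   thus ?thesis by linarith
  qed
  ultimately show ?thesis using T_inj[OF T_br[OF Tj Ti]] by blast
 qed
qed (auto simp: eta_out)

text \<open>Partial traces, dual to \<open>eta\<close> because the differences in \<open>eta\<close>
  telescope. On the part of degree k they also give the eigenvalue at the vacuum of a single site of
  type j with parameter 1.\<close>

definition omega :: "nat \<Rightarrow> nat \<Rightarrow> 'g \<Rightarrow> complex" where
 "omega j k x = (\<Sum>a\<in>{1..int j}. Phi x (int k * N) a)"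

lemma omega_add: "omega j k (x + y) = omega j k x + omega j k y"
 and omega_sm: "omega j k (sm c x) = c * omega j k x"
 by (simp_all add: omega_def Phi_add Phi_sm sum.distrib sum_distrib_left)

lemma omega_0 [simp]: "omega j k 0 = 0" by (simp add: omega_def)

lemma Zc_small: "1 \<le> a \<Longrightarrow> a \<le> int n \<Longrightarrow> 1 \<le> j \<Longrightarrow> j \<le> int n \<Longrightarrow> Zc j k a = of_bool (a = j)"
proof -
 assume a: "1 \<le> a" "a \<le> int n" "1 \<le> j" "j \<le> int n"
 have "\<not> N dvd a" "\<not> N dvd a + j" using a by (intro ndvd(1); simp add: N_def)+
 moreover have "N dvd a - j \<longleftrightarrow> a = j"
 proof
  assume "N dvd a - j"
  moreover have "\<bar>a - j\<bar> < N" using a by (auto simp: N_def)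
  ultimately show "a = j" using dvd_imp_le_int[of "a - j" N] by auto
 qed simp
 ultimately show ?thesis by (simp add: Zc_def)
qed

lemma omega_eta:
 assumes "1 \<le> j" "j \<le> n" "1 \<le> i" "i \<le> n"
 shows "omega i l (eta j k) = of_bool (i = j \<and> l = k)"
proof -
 have tel: "(\<Sum>a\<in>{1..int i}. of_bool (a = int j) - of_bool (j < n \<and> a = int j + 1) :: complex) = of_bool (i = j)"
 proof -
  have "(\<Sum>a\<in>{1..int i}. of_bool (a = int j) :: complex) = of_bool (j \<le> i)"
   using assms by (simp add: of_bool_def if_distrib cong: if_cong)
  moreover have "(\<Sum>a\<in>{1..int i}. of_bool (j < n \<and> a = int j + 1) :: complex) = of_bool (j + 1 \<le> i)"
   using assms by (cases "j < n") (auto simp: of_bool_def if_distrib cong: if_cong)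
  ultimately show ?thesis by (auto simp: sum_subtractf)
 qed
 show ?thesis
 proof (cases "k = 0")
  case True
  have e: "Phi (cv j) 0 a = of_bool (a = int j) - of_bool (j < n \<and> a = int j + 1)" if "a \<in> {1..int i}" for a
  proof -
   have "lab a = nat a" "lab (a - 1) = nat (a - 1)"
    using lab_self[of "nat a"] lab_self[of "nat (a - 1)"] that assms by auto
   thus ?thesis using that assms cv_H by (auto simp: Phi_H pih_cv ka_def)
  qed
  show ?thesis
  proof (cases "l = 0")
   case l: True
   have "omega i l (eta j k) = (\<Sum>a\<in>{1..int i}. of_bool (a = int j) - of_bool (j < n \<and> a = int j + 1))"
    unfolding omega_def l True eta_0[OF assms(1,2)] by (rule sum.cong) (auto simp: e)
   thus ?thesis using tel True l by simp
  next
   case False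
   hence "int l * N \<noteq> 0" using N3 by simp
   thus ?thesis using False True assms cv_H by (simp add: omega_def eta_0 Phi_H)
  qed
 next
  case False
  have Tj: "T (int k * N) (eta j k) (etac j k)" using eta_T assms False by auto
  have kl: "int l * N = int k * N \<longleftrightarrow> l = k" using N3 by simp
  show ?thesis
  proof (cases "l = k")
   case True
   have "etac j k a = of_bool (a = int j) - of_bool (j < n \<and> a = int j + 1)" if "a \<in> {1..int i}" for a
    using that assms by (cases "j < n") (auto simp: etac_def Zc_small)
   hence "omega i l (eta j k) = (\<Sum>a\<in>{1..int i}. of_bool (a = int j) - of_bool (j < n \<and> a = int j + 1))"
    unfolding omega_def Phi_T[OF Tj] True by (intro sum.cong) auto
   thus ?thesis using tel True by simp
  next
   case nl: False
   thus ?thesis unfolding omega_def Phi_T[OF Tj] kl by simp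
  qed
 qed
qed

lemma delta_h0: "delta n G h0 = of_int N"
 by (simp add: delta_pih pih_h0)

text \<open>After subtracting the expansion all partial traces vanish, hence the diagonal entries 1,
  ..., n. The reflection then kills the entries n + 1, ..., 2n, and the trace condition kills the
  entry at 0.\<close>

lemma imaginary_expand:
 assumes x: "x \<in> root_space G (\<lambda>h. of_nat k * delta n G h)" and k: "k \<ge> 1"
 shows "x = (\<Sum>j\<in>{1..n}. sm (omega j k x) (eta j k))"
proof -
 let ?b = "\<lambda>h. of_nat k * delta n G h"
 define y where "y = x - (\<Sum>j\<in>{1..n}. sm (omega j k x) (eta j k))"
 have "(\<Sum>j\<in>{1..n}. sm (omega j k x) (eta j k)) \<in> root_space G ?b"
 proof -
  have "(\<Sum>j\<in>K. sm (omega j k x) (eta j k)) \<in> root_space G ?b" for K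
   by (induction K rule: infinite_finite_induct) (auto intro: rs_zero rs_add rs_sm eta_rs[OF k])
  thus ?thesis .
 qed
 hence y: "y \<in> root_space G ?b" unfolding y_def by (intro rs_diff x)
 have om: "omega i k y = 0" if "1 \<le> i" "i \<le> n" for i
 proof -
  have s: "omega i k (\<Sum>j\<in>K. sm (omega j k x) (eta j k)) = (\<Sum>j\<in>K. omega j k x * omega i k (eta j k))" for K
   by (induction K rule: infinite_finite_induct) (auto simp: omega_add omega_sm)
  have "(\<Sum>j\<in>{1..n}. omega j k x * omega i k (eta j k)) = (\<Sum>j\<in>{i}. omega j k x * omega i k (eta j k))"
   by (rule sum.mono_neutral_right) (use that in \<open>auto simp: omega_eta\<close>)
  hence "omega i k (\<Sum>j\<in>{1..n}. sm (omega j k x) (eta j k)) = omega i k x"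
   using that by (simp add: s omega_eta)
  moreover have "omega i k x = omega i k y + omega i k (\<Sum>j\<in>{1..n}. sm (omega j k x) (eta j k))"
   unfolding omega_add[symmetric] by (simp add: y_def)
  ultimately show ?thesis by simp
 qed
 have kN: "int k * N \<noteq> 0" using k N3 by simp
 have "br h0 y = sm (of_int (int k * N)) y"
  using rsD[OF y h0(1)] by (simp add: delta_h0)
 note y0 = eigen_T(2)[OF this]
 let ?c = "Phi y (int k * N)"
 have c1: "?c a = 0" if "1 \<le> a" "a \<le> int n" for a
 proof -
  define i where "i = nat a"
  have i: "a = int i" "1 \<le> i" "i \<le> n" using that by (auto simp: i_def)
  have "{1..int i} = insert (int i) {1..int (i - 1)}" using i by auto
  hence "omega i k y = ?c (int i) + omega (i - 1) k y"
   unfolding omega_def by (simp only:) (rule sum.insert, use i in auto)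
  moreover have "omega (i - 1) k y = 0"
  proof (cases "i = 1")
   case True thus ?thesis by (simp add: omega_def)
  next
   case False thus ?thesis using om[of "i - 1"] i by simp
  qed
  ultimately show ?thesis using om[of i] i by simp
 qed
 have cper: "?c (m + z * N) = ?c m" for m z
  using per_mult[of ?c m z] Phi_per[OF kN] by blast
 have cneg: "?c (- m) = 0" if "?c m = 0" for m
 proof -
  have "?c (- m - int k * N) = 0" using Phi_sym[OF kN, of y m] that by simp
  thus ?thesis using cper[of "- m" "- int k"] by simp
 qed
 have c2: "?c a = 0" if "int n + 1 \<le> a" "a < N" for a
 proof -
  have "?c (- (N - a)) = 0" by (rule cneg, rule c1) (use that in \<open>auto simp: N_def\<close>)
  moreover have "- (N - a) = a + (- 1) * N" by simp
  ultimately show ?thesis using cper[of a "- 1"] by simp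
 qed
 have c12: "?c a = 0" if "1 \<le> a" "a < N" for a
  using c1[of a] c2[of a] that by (cases "a \<le> int n") auto
 have "(\<Sum>m\<in>{0..<N}. ?c m) = 0" by (rule Phi_trace[OF kN]) simp
 moreover have "(\<Sum>m\<in>{0..<N}. ?c m) = (\<Sum>m\<in>{0}. ?c m)"
  by (rule sum.mono_neutral_right) (use c12 N3 in auto)
 ultimately have c0: "?c 0 = 0" by simp
 have call: "?c m = 0" for m
 proof -
  have "?c (m mod N) = 0" using c0 c12[of "m mod N"] mod_bounds[of m] by (cases "m mod N = 0") auto
  moreover have "m = m mod N + (m div N) * N" by simp
  ultimately show ?thesis using cper[of "m mod N" "m div N"] by metis
 qed
 have "Phi y l m = 0" for l m using call[of m] y0[of l m] by (cases "l = int k * N") auto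
 moreover have "?b h0 \<noteq> 0" using k N3 by (simp add: delta_h0)
 ultimately have "y = 0" using rs_inj[OF y _ h0(1)] by blast
 thus ?thesis by (simp add: y_def)
qed

text \<open>Besides the positive multiples of \<delta> this contains the coroots 1, ..., n. Brackets
  of opposite root vectors in rank one can land in either part.\<close>

definition HH :: "'g set" where "HH = V.span {eta j k | j k. True}"

lemma eta_HH: "eta j k \<in> HH" unfolding HH_def by (rule V.span_base) blast

lemma HH_subspace: "V.subspace HH" by (simp add: HH_def)

lemma HH_current: "x \<in> HH \<Longrightarrow> x \<in> current_algebra n G"
proof -
 have "HH \<subseteq> current_algebra n G" unfolding HH_def
  by (rule V.span_minimal) (use eta_current current_subspace in auto)
 thus "x \<in> HH \<Longrightarrow> x \<in> current_algebra n G" by blast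
qed

lemma imaginary_HH: "x \<in> root_space G (\<lambda>h. of_nat k * delta n G h) \<Longrightarrow> k \<ge> 1 \<Longrightarrow> x \<in> HH"
proof -
 assume a: "x \<in> root_space G (\<lambda>h. of_nat k * delta n G h)" "k \<ge> 1"
 have "(\<Sum>j\<in>{1..n}. sm (omega j k x) (eta j k)) \<in> HH"
  using HH_subspace eta_HH by (intro V.subspace_sum V.subspace_scale) auto
 thus ?thesis using imaginary_expand[OF a] by metis
qed

lemma h_plus_HH: "x \<in> current_h_plus n G \<Longrightarrow> x \<in> HH"
proof -
 have "current_h_plus n G \<subseteq> HH" unfolding current_h_plus_def
  by (rule sum_of_root_spaces_minimal[OF _ HH_subspace]) (use imaginary_HH in blast)
 thus "x \<in> current_h_plus n G \<Longrightarrow> x \<in> HH" by blast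
qed

lemma h_plus_Phi0: "x \<in> current_h_plus n G \<Longrightarrow> Phi x 0 m = 0"
proof -
 have "current_h_plus n G \<subseteq> {x. Phi x 0 m = 0}" unfolding current_h_plus_def
 proof (rule sum_of_root_spaces_minimal)
  show "V.subspace {x. Phi x 0 m = 0}" by (simp add: V.subspace_def Phi_add Phi_sm)
  fix \<beta> assume "\<beta> \<in> {\<lambda>h. of_nat k * delta n G h | k. k \<ge> (1::nat)}"
  then obtain k :: nat where b: "\<beta> = (\<lambda>h. of_nat k * delta n G h)" "k \<ge> 1" by blast
  show "root_space G \<beta> \<subseteq> {x. Phi x 0 m = 0}"
  proof
   fix x assume x: "x \<in> root_space G \<beta>"
   have "br h0 x = sm (of_int (int k * N)) x" using rsD[OF x h0(1)] by (simp add: b delta_h0)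
   moreover have "0 \<noteq> int k * N" using b N3 by simp
   ultimately show "x \<in> {x. Phi x 0 m = 0}" using eigen_T(2) by blast
  qed
 qed
 thus "x \<in> current_h_plus n G \<Longrightarrow> Phi x 0 m = 0" by blast
qed

subsection \<open>The enveloping algebra up to congruence\<close>

abbreviation Cg where "Cg \<equiv> current_algebra n G"
abbreviation F where "F \<equiv> carrier (free_ring Cg)"
abbreviation UU where "UU \<equiv> uea_ideal G Cg"
abbreviation scl :: "complex \<Rightarrow> 'g word \<Rightarrow>\<^sub>0 complex" where "scl c \<equiv> Poly_Mapping.single 0 c"

lemma rel_F: "uea_relations G Cg \<subseteq> F"
 by (rule uea_relations_carrier[OF current_subspace current_br])

lemma UU_ideal: "ideal UU (free_ring Cg)"
 unfolding uea_ideal_def by (rule ring.genideal_ideal[OF ring_free_ring rel_F])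

lemma UU_F: "p \<in> UU \<Longrightarrow> p \<in> F"
 using additive_subgroup.a_subset[OF ideal.axioms(1)[OF UU_ideal]] by blast

lemma UU_zero: "0 \<in> UU"
 using additive_subgroup.zero_closed[OF ideal.axioms(1)[OF UU_ideal]] by (simp add: fr_ops)

lemma UU_add: "p \<in> UU \<Longrightarrow> q \<in> UU \<Longrightarrow> p + q \<in> UU"
 using additive_subgroup.a_closed[OF ideal.axioms(1)[OF UU_ideal], of p q] by (simp add: fr_ops)

lemma UU_lmult: "p \<in> UU \<Longrightarrow> a \<in> F \<Longrightarrow> a * p \<in> UU"
 using ideal.I_l_closed[OF UU_ideal, of p a] by (simp add: fr_ops)

lemma UU_rmult: "p \<in> UU \<Longrightarrow> a \<in> F \<Longrightarrow> p * a \<in> UU"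
 using ideal.I_r_closed[OF UU_ideal, of p a] by (simp add: fr_ops)

lemma UU_neg: "p \<in> UU \<Longrightarrow> - p \<in> UU"
 using UU_lmult[of p "- 1"] fr_minus[OF fr_one, of Cg] by simp

lemma UU_rel: "q \<in> uea_relations G Cg \<Longrightarrow> q \<in> UU"
 unfolding uea_ideal_def using ring.genideal_self[OF ring_free_ring rel_F] by blast

lemma UU_letter_add: "x \<in> Cg \<Longrightarrow> y \<in> Cg \<Longrightarrow> letter (x + y) - (letter x + letter y) \<in> UU"
 by (rule UU_rel) (unfold uea_relations_def, blast)

lemma UU_letter_sm: "x \<in> Cg \<Longrightarrow> letter (sm c x) - scl c * letter x \<in> UU"
 by (rule UU_rel) (unfold uea_relations_def, blast)

lemma UU_letter_br: "x \<in> Cg \<Longrightarrow> y \<in> Cg \<Longrightarrow> letter x * letter y - letter y * letter x - letter (br x y) \<in> UU"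
 by (rule UU_rel) (unfold uea_relations_def, blast)

lemma UU_letter_0: "letter 0 \<in> UU"
 using UU_letter_sm[of 0 0] V.subspace_0[OF current_subspace] by simp

lemma UU_trans: "p - q \<in> UU \<Longrightarrow> q - r \<in> UU \<Longrightarrow> p - r \<in> UU"
 using UU_add[of "p - q" "q - r"] by simp

lemma UU_sym: "p - q \<in> UU \<Longrightarrow> q - p \<in> UU"
 using UU_neg[of "p - q"] by simp

lemma scl_mult: "scl a * scl c = scl (a * c)" by (simp add: mult_single)

lemma scl_add: "scl (a + c) = scl a + scl c" by (rule single_add)

lemma scl_comm: "p * scl c = scl c * p"
 by (induction p rule: pm_induct) (auto simp: mult_single distrib_left distrib_right mult.commute)

section \<open>Polynomials in the imaginary root vectors and their normal forms\<close>

inductive AA :: "('g word \<Rightarrow>\<^sub>0 complex) \<Rightarrow> bool" where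
 AA_one: "AA 1"
| AA_eta: "AA u \<Longrightarrow> AA (letter (eta j k) * u)"
| AA_add: "AA u \<Longrightarrow> AA v \<Longrightarrow> AA (u + v)"
| AA_scl: "AA u \<Longrightarrow> AA (scl c * u)"

lemma AA_mult: "AA p \<Longrightarrow> AA q \<Longrightarrow> AA (p * q)"
 by (induction rule: AA.induct) (auto simp: mult.assoc distrib_right intro: AA_eta AA_add AA_scl)

lemma AA_zero: "AA 0" using AA_scl[OF AA_one, of 0] by simp

lemma AA_sum: "(\<And>k. k \<in> K \<Longrightarrow> AA (p k)) \<Longrightarrow> AA (sum p K)"
 by (induction K rule: infinite_finite_induct) (auto intro: AA_zero AA_add)

lemma AA_letter: "AA (letter (eta j k))" using AA_eta[OF AA_one] by simp

lemma AA_HH: "AA p \<Longrightarrow> p \<in> carrier (free_ring HH)"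
 by (induction rule: AA.induct) (auto intro: fr_one fr_mult fr_letter eta_HH fr_add fr_scalar)

lemma HH_F: "p \<in> carrier (free_ring HH) \<Longrightarrow> p \<in> F"
 using HH_current by (auto simp: free_ring_def)

lemma AA_F: "AA p \<Longrightarrow> p \<in> F" by (intro HH_F AA_HH)

lemma cm_letter: "letter (eta j k) * letter (eta i l) - letter (eta i l) * letter (eta j k) \<in> UU"
 using UU_add[OF UU_letter_br[OF eta_current eta_current, of j k i l] UU_letter_0]
 by (simp add: eta_commute)

lemma cm_step:
 assumes "a * u - u * a \<in> UU" "a * v - v * a \<in> UU" "a \<in> F" "u \<in> F" "v \<in> F"
 shows "a * (u * v) - (u * v) * a \<in> UU"
proof -
 have "a * (u * v) - (u * v) * a = (a * u - u * a) * v + u * (a * v - v * a)"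
  by (simp add: algebra_simps)
 thus ?thesis using UU_add[OF UU_rmult[OF assms(1,5)] UU_lmult[OF assms(2,4)]] by simp
qed

lemma cm_AA: "AA p \<Longrightarrow> AA q \<Longrightarrow> p * q - q * p \<in> UU"
proof (induction p rule: AA.induct)
 case (AA_eta u j k)
 have l: "letter (eta j k) * q - q * letter (eta j k) \<in> UU"
  using AA_eta.prems
 proof (induction q rule: AA.induct)
  case (AA_eta v i l)
  thus ?case by (intro cm_step cm_letter AA_F AA_letter)
 next
  case (AA_add u v)
  have "letter (eta j k) * (u + v) - (u + v) * letter (eta j k) =
   (letter (eta j k) * u - u * letter (eta j k)) + (letter (eta j k) * v - v * letter (eta j k))"
   by (simp add: algebra_simps)
  thus ?case using AA_add by (simp add: UU_add)
 next
  case (AA_scl u c)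
  have "letter (eta j k) * (scl c * u) - scl c * u * letter (eta j k) = scl c * (letter (eta j k) * u - u * letter (eta j k))"
   by (simp add: right_diff_distrib mult.assoc[symmetric] scl_comm)
  thus ?case using UU_lmult[OF AA_scl.IH fr_scalar] by simp
 qed (simp add: UU_zero)
 have "q * (letter (eta j k) * u) - (letter (eta j k) * u) * q \<in> UU"
  by (rule cm_step) (use l AA_eta UU_sym AA_F AA_letter in auto)
 thus ?case by (rule UU_sym)
next
 case (AA_add u v)
 have "(u + v) * q - q * (u + v) = (u * q - q * u) + (v * q - q * v)" by (simp add: algebra_simps)
 thus ?case using AA_add by (simp add: UU_add)
next
 case (AA_scl u c)
 have "scl c * u * q - q * (scl c * u) = scl c * (u * q - q * u)"
  by (simp add: right_diff_distrib mult.assoc[symmetric] scl_comm)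
 thus ?case using UU_lmult[OF AA_scl.IH[OF AA_scl.prems] fr_scalar] by simp
qed (simp add: UU_zero)

function Eh :: "nat \<Rightarrow> nat \<Rightarrow> 'g word \<Rightarrow>\<^sub>0 complex" where
 "Eh j 0 = 1"
| "Eh j (Suc r) = scl (1 / of_nat (Suc r)) * (\<Sum>k\<le>r. scl ((- 1) ^ k) * letter (eta j (Suc k)) * Eh j (r - k))"
 by pat_completeness auto
termination by (relation "measure snd") auto

declare Eh.simps(2) [simp del]

text \<open>\<open>Eh j 0\<close> is 1 and carries no information, so the index (j, 0) is given to
  the coroot of node j.\<close>

definition Ehat :: "nat \<times> nat \<Rightarrow> 'g word \<Rightarrow>\<^sub>0 complex" where
 "Ehat v = (if snd v = 0 then letter (eta (fst v) 0) else Eh (fst v) (snd v))"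

lemma AA_Eh: "AA (Eh j r)"
proof (induction r rule: less_induct)
 case (less r)
 show ?case
 proof (cases r)
  case (Suc r')
  have "AA (\<Sum>k\<le>r'. scl ((- 1) ^ k) * letter (eta j (Suc k)) * Eh j (r' - k))"
   using less Suc by (intro AA_sum AA_mult AA_letter AA_scl[OF AA_letter]) auto
  thus ?thesis unfolding Suc Eh.simps(2) by (rule AA_scl)
 qed (simp add: AA_one)
qed

lemma AA_Ehat: "AA (Ehat v)" by (simp add: Ehat_def AA_letter AA_Eh)

fun prodl :: "(nat \<times> nat) list \<Rightarrow> 'g word \<Rightarrow>\<^sub>0 complex" where
 "prodl [] = 1"
| "prodl (v # vs) = Ehat v * prodl vs"

fun mono :: "(nat \<times> nat) list \<Rightarrow> (nat \<times> nat) \<Rightarrow>\<^sub>0 nat" where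
 "mono [] = 0"
| "mono (v # vs) = Poly_Mapping.single v 1 + mono vs"

lemma AA_prodl: "AA (prodl vs)" by (induction vs) (auto intro: AA_one AA_mult AA_Ehat)

lemma lookup_mono: "Poly_Mapping.lookup (mono vs) v = count (mset vs) v"
 by (induction vs) (auto simp: lookup_add lookup_single when_def)

lemma ex_mono: "\<exists>vs. mono vs = m"
proof (induction m rule: pm_induct)
 case (2 v c)
 show ?case
 proof (induction c)
  case (Suc c)
  then obtain vs where "mono vs = Poly_Mapping.single v c" by auto
  hence "mono (v # vs) = Poly_Mapping.single v (Suc c)" by (simp add: single_add[symmetric])
  thus ?case by blast
 qed (auto intro: exI[of _ "[]"])
next
 case (3 p q)
 have app: "mono (vs @ ws) = mono vs + mono ws" for vs ws by (induction vs) (auto simp: add.assoc)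
 obtain vs ws where "mono vs = p" "mono ws = q" using 3 by blast
 hence "mono (vs @ ws) = p + q" by (simp add: app)
 thus ?case by blast
qed (auto intro: exI[of _ "[]"])

lemma prodl_move: "prodl (xs @ v # ys) - Ehat v * prodl (xs @ ys) \<in> UU"
proof (induction xs)
 case (Cons x xs)
 have "prodl ((x # xs) @ v # ys) - Ehat v * prodl ((x # xs) @ ys)
   = Ehat x * (prodl (xs @ v # ys) - Ehat v * prodl (xs @ ys)) + (Ehat x * Ehat v - Ehat v * Ehat x) * prodl (xs @ ys)"
  by (simp add: algebra_simps)
 moreover have "Ehat x * (prodl (xs @ v # ys) - Ehat v * prodl (xs @ ys)) \<in> UU"
  by (rule UU_lmult[OF Cons AA_F[OF AA_Ehat]])
 moreover have "(Ehat x * Ehat v - Ehat v * Ehat x) * prodl (xs @ ys) \<in> UU"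
  by (rule UU_rmult[OF cm_AA[OF AA_Ehat AA_Ehat] AA_F[OF AA_prodl]])
 ultimately show ?case by (simp only: UU_add)
qed (simp add: UU_zero)

lemma prodl_perm: "mset xs = mset ys \<Longrightarrow> prodl xs - prodl ys \<in> UU"
proof (induction xs arbitrary: ys)
 case (Cons x xs)
 hence "x \<in> set ys" by (metis list.set_intros(1) set_mset_mset)
 then obtain as bs where ys: "ys = as @ x # bs" by (auto dest: split_list)
 hence "mset xs = mset (as @ bs)" using Cons.prems by simp
 hence "prodl xs - prodl (as @ bs) \<in> UU" by (rule Cons.IH)
 hence "Ehat x * (prodl xs - prodl (as @ bs)) \<in> UU" by (rule UU_lmult) (rule AA_F[OF AA_Ehat])
 hence "Ehat x * prodl xs - Ehat x * prodl (as @ bs) \<in> UU" by (simp add: right_diff_distrib)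
 moreover have "Ehat x * prodl (as @ bs) - prodl ys \<in> UU" unfolding ys by (rule UU_sym[OF prodl_move])
 ultimately show ?case by (auto intro: UU_trans)
qed (simp add: UU_zero)

text \<open>Any order of the factors may be chosen, since by \<open>prodl_perm\<close> a permutation
  changes the product only by an element of \<open>UU\<close>.\<close>

definition L :: "((nat \<times> nat) \<Rightarrow>\<^sub>0 nat) \<Rightarrow> 'g word \<Rightarrow>\<^sub>0 complex" where
 "L m = prodl (SOME vs. mono vs = m)"

lemma L_prodl: "L (mono vs) - prodl vs \<in> UU"
proof -
 define ws where "ws = (SOME ws. mono ws = mono vs)"
 have "mono ws = mono vs" unfolding ws_def by (rule someI) (rule refl)
 hence "count (mset ws) v = count (mset vs) v" for v by (simp only: lookup_mono[symmetric])
 hence "mset ws = mset vs" by (rule multiset_eqI)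
 thus ?thesis unfolding L_def ws_def[symmetric] by (rule prodl_perm)
qed

lemma AA_L: "AA (L m)" by (simp add: L_def AA_prodl)

lemma Ehat_L: "Ehat v * L m - L (Poly_Mapping.single v 1 + m) \<in> UU"
proof -
 obtain vs where vs: "mono vs = m" using ex_mono by blast
 have "L m - prodl vs \<in> UU" using L_prodl[of vs] unfolding vs .
 hence "Ehat v * (L m - prodl vs) \<in> UU" by (rule UU_lmult) (rule AA_F[OF AA_Ehat])
 hence "Ehat v * L m - prodl (v # vs) \<in> UU" by (simp add: right_diff_distrib)
 moreover have "prodl (v # vs) - L (mono (v # vs)) \<in> UU" by (rule UU_sym[OF L_prodl])
 ultimately have "Ehat v * L m - L (mono (v # vs)) \<in> UU" by (rule UU_trans)
 thus ?thesis using vs by simp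
qed

type_synonym mp = "((nat \<times> nat) \<Rightarrow>\<^sub>0 nat) \<Rightarrow>\<^sub>0 complex"

definition Lin :: "mp \<Rightarrow> 'g word \<Rightarrow>\<^sub>0 complex" where
 "Lin q = (\<Sum>m\<in>Poly_Mapping.keys q. scl (Poly_Mapping.lookup q m) * L m)"

lemma Lin_add: "Lin (p + q) = Lin p + Lin q"
 unfolding Lin_def
 by (rule setsum_keys_plus_distrib[where f = "\<lambda>m c. scl c * L m"]) (auto simp: scl_add distrib_right)

lemma Lin_0 [simp]: "Lin 0 = 0" by (simp add: Lin_def)

lemma Lin_single: "Lin (Poly_Mapping.single m c) = scl c * L m"
 by (cases "c = 0") (auto simp: Lin_def)

lemma AA_Lin: "AA (Lin q)" unfolding Lin_def by (intro AA_sum AA_scl AA_L)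

lemma Lin_scl: "Lin (Poly_Mapping.single 0 c * q) = scl c * Lin q"
 by (induction q rule: pm_induct)
  (auto simp: mult_single Lin_single scl_mult mult.assoc[symmetric] distrib_left Lin_add)

text \<open>Left multiplication by u acts on normal forms as multiplication by the polynomial q,
  modulo \<open>UU\<close>. With q' arbitrary this is stable under sums and products, so normal
  forms can be computed letter by letter.\<close>

definition Mp :: "('g word \<Rightarrow>\<^sub>0 complex) \<Rightarrow> mp \<Rightarrow> bool" where
 "Mp u q \<longleftrightarrow> u \<in> F \<and> (\<forall>q'. u * Lin q' - Lin (q * q') \<in> UU)"

definition Tv :: "nat \<times> nat \<Rightarrow> mp" where "Tv v = Poly_Mapping.single (Poly_Mapping.single v 1) 1"

lemma MpD: "Mp u q \<Longrightarrow> u * Lin q' - Lin (q * q') \<in> UU" by (simp add: Mp_def)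

lemma Mp_Ehat: "Mp (Ehat v) (Tv v)"
proof -
 have "Ehat v * Lin q' - Lin (Tv v * q') \<in> UU" for q'
 proof (induction q' rule: pm_induct)
  case (2 m c)
  have "Ehat v * (scl c * L m) - scl c * L (Poly_Mapping.single v 1 + m) = scl c * (Ehat v * L m - L (Poly_Mapping.single v 1 + m))"
   by (simp add: right_diff_distrib mult.assoc[symmetric] scl_comm)
  thus ?case using UU_lmult[OF Ehat_L fr_scalar] by (simp add: Lin_single Tv_def mult_single)
 next
  case (3 p q)
  have "Ehat v * Lin (p + q) - Lin (Tv v * (p + q)) = (Ehat v * Lin p - Lin (Tv v * p)) + (Ehat v * Lin q - Lin (Tv v * q))"
   by (simp add: Lin_add distrib_left)
  thus ?case using 3 by (simp add: UU_add)
 qed (simp add: UU_zero)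
 thus ?thesis by (simp add: Mp_def AA_F AA_Ehat)
qed

lemma Mp_scl: "Mp (scl c) (Poly_Mapping.single 0 c)"
 by (simp add: Mp_def fr_scalar Lin_scl UU_zero)

lemma Mp_add: "Mp u q \<Longrightarrow> Mp v r \<Longrightarrow> Mp (u + v) (q + r)"
proof -
 assume a: "Mp u q" "Mp v r"
 have "(u + v) * Lin q' - Lin ((q + r) * q') = (u * Lin q' - Lin (q * q')) + (v * Lin q' - Lin (r * q'))" for q'
  by (simp add: distrib_right Lin_add)
 thus ?thesis using a by (simp add: Mp_def fr_add UU_add)
qed

lemma Mp_mult: "Mp u q \<Longrightarrow> Mp v r \<Longrightarrow> Mp (u * v) (q * r)"
proof -
 assume a: "Mp u q" "Mp v r"
 have "(u * v) * Lin q' - Lin ((q * r) * q') = u * (v * Lin q' - Lin (r * q')) + (u * Lin (r * q') - Lin (q * (r * q')))" for q'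
  by (simp add: algebra_simps)
 thus ?thesis using a by (simp add: Mp_def fr_mult UU_add UU_lmult)
qed

lemma Mp_cong: "Mp u q \<Longrightarrow> v - u \<in> UU \<Longrightarrow> v \<in> F \<Longrightarrow> Mp v q"
proof -
 assume a: "Mp u q" "v - u \<in> UU" "v \<in> F"
 have e: "v * Lin q' - Lin (q * q') = (v - u) * Lin q' + (u * Lin q' - Lin (q * q'))" for q'
  by (simp add: algebra_simps)
 have "v * Lin q' - Lin (q * q') \<in> UU" for q'
  unfolding e by (rule UU_add[OF UU_rmult[OF a(2) AA_F[OF AA_Lin]] MpD[OF a(1)]])
 thus ?thesis using a(3) by (simp add: Mp_def)
qed

lemma Mp_0: "Mp 0 0" using Mp_scl[of 0] by simp

lemma Mp_sum: "(\<And>k. k \<in> K \<Longrightarrow> Mp (u k) (q k)) \<Longrightarrow> Mp (sum u K) (sum q K)"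
 by (induction K rule: infinite_finite_induct) (auto intro: Mp_0 Mp_add)

lemma Mp_minus: "Mp u q \<Longrightarrow> Mp (- u) (- q)"
proof -
 assume a: "Mp u q"
 have "scl (- 1) * u = - u" "Poly_Mapping.single 0 (- 1) * q = - q" by (simp_all add: single_uminus)
 thus ?thesis using Mp_mult[OF Mp_scl[of "- 1"] a] by simp
qed

lemma Mp_diff: "Mp u q \<Longrightarrow> Mp v r \<Longrightarrow> Mp (u - v) (q - r)"
 using Mp_add[of u q "- v" "- r"] Mp_minus[of v r] by simp

lemma Mp_Eh: "r \<ge> 1 \<Longrightarrow> Mp (Eh j r) (Tv (j, r))"
 using Mp_Ehat[of "(j, r)"] by (simp add: Ehat_def)

definition Pk :: "nat \<Rightarrow> nat \<Rightarrow> mp" where "Pk j k = newtonP (\<lambda>r. Tv (j, r)) k"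

lemma mp_power: "(- 1) ^ k = (Poly_Mapping.single 0 ((- 1) ^ k) :: mp)"
proof (induction k)
 case (Suc k)
 have "(- 1 :: mp) = Poly_Mapping.single 0 (- 1)" by (simp add: single_uminus)
 thus ?case using Suc by (simp add: mult_single)
qed simp

text \<open>The recursion for \<open>Eh\<close> is solved back for its last term k = r, where the
  remaining factor \<open>Eh j 0\<close> is 1. This expresses a power sum by elementary symmetric
  functions in exactly the way \<open>newtonP\<close> does.\<close>

lemma Mp_eta: "Mp (letter (eta j k)) (Pk j k)"
proof (induction k rule: less_induct)
 case (less k)
 show ?case
 proof (cases k)
  case 0
  thus ?thesis using Mp_Ehat[of "(j, 0)"] by (simp add: Ehat_def Pk_def)
 next
  case (Suc r)
  let ?S = "\<Sum>k<r. scl ((- 1) ^ k) * letter (eta j (Suc k)) * Eh j (r - k)"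
  have 1: "scl (of_nat (Suc r)) * Eh j (Suc r) = (\<Sum>k\<le>r. scl ((- 1) ^ k) * letter (eta j (Suc k)) * Eh j (r - k))"
  proof -
   have s: "scl (of_nat (Suc r)) * scl (1 / of_nat (Suc r)) = 1" unfolding scl_mult by (simp del: of_nat_Suc)
   show ?thesis unfolding Eh.simps(2) mult.assoc[of "scl (of_nat (Suc r))" "scl (1 / of_nat (Suc r))", symmetric] s
    by (rule mult_1_left)
  qed
  also have "\<dots> = ?S + scl ((- 1) ^ r) * letter (eta j (Suc r))"
   unfolding lessThan_Suc_atMost[symmetric] sum.lessThan_Suc by simp
  finally have 2: "scl (of_nat (Suc r)) * Eh j (Suc r) - ?S = scl ((- 1) ^ r) * letter (eta j (Suc r))" by simp
  have sq: "(- 1) ^ r * (- 1) ^ r = (1::complex)" by (simp add: power_mult_distrib[symmetric])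
  have 3: "scl ((- 1) ^ r) * (scl (of_nat (Suc r)) * Eh j (Suc r) - ?S) = letter (eta j (Suc r))"
   unfolding 2 mult.assoc[symmetric] scl_mult sq by simp
  have "Mp ?S (\<Sum>k<r. Poly_Mapping.single 0 ((- 1) ^ k) * newtonP (\<lambda>r. Tv (j, r)) (Suc k) * Tv (j, r - k))"
   using less Suc by (intro Mp_sum Mp_mult Mp_scl Mp_Eh) (auto simp: Pk_def)
  hence "Mp (scl ((- 1) ^ r) * (scl (of_nat (Suc r)) * Eh j (Suc r) - ?S))
    (Poly_Mapping.single 0 ((- 1) ^ r) * (Poly_Mapping.single 0 (of_nat (Suc r)) * Tv (j, Suc r) -
     (\<Sum>k<r. Poly_Mapping.single 0 ((- 1) ^ k) * newtonP (\<lambda>r. Tv (j, r)) (Suc k) * Tv (j, r - k))))"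
   by (intro Mp_mult Mp_diff Mp_scl Mp_Eh) auto
  moreover have "Pk j (Suc r) = Poly_Mapping.single 0 ((- 1) ^ r) * (Poly_Mapping.single 0 (of_nat (Suc r)) * Tv (j, Suc r) -
     (\<Sum>k<r. Poly_Mapping.single 0 ((- 1) ^ k) * newtonP (\<lambda>r. Tv (j, r)) (Suc k) * Tv (j, r - k)))"
   unfolding Pk_def newtonP.simps(2)[of _ r] mp_power single_of_nat ..
  ultimately show ?thesis unfolding 3 Suc by simp
 qed
qed

definition theta :: "'g \<Rightarrow> mp" where
 "theta x = (\<Sum>j\<in>{1..n}. \<Sum>k\<in>{k. omega j k x \<noteq> 0}. Poly_Mapping.single 0 (omega j k x) * Pk j k)"

lemma omega_finite: "finite {k. omega j k x \<noteq> 0}"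
proof -
 obtain M where M: "\<forall>k m. \<bar>k\<bar> > M \<longrightarrow> Phi x k m = 0" using Phi_bounded by blast
 have "{k. omega j k x \<noteq> 0} \<subseteq> {..nat \<bar>M\<bar>}"
 proof
  fix k assume "k \<in> {k. omega j k x \<noteq> 0}"
  hence "\<not> \<bar>int k * N\<bar> > M" using M by (auto simp: omega_def)
  moreover have "int k \<le> int k * N" using N3 by (simp add: mult_le_cancel_left1)
  ultimately show "k \<in> {..nat \<bar>M\<bar>}" by auto
 qed
 thus ?thesis by (rule finite_subset) simp
qed

lemma theta_K: "finite K \<Longrightarrow> (\<And>j k. omega j k x \<noteq> 0 \<Longrightarrow> j \<in> {1..n} \<Longrightarrow> k \<in> K) \<Longrightarrow>
  theta x = (\<Sum>j\<in>{1..n}. \<Sum>k\<in>K. Poly_Mapping.single 0 (omega j k x) * Pk j k)"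
 unfolding theta_def by (intro sum.cong refl sum.mono_neutral_left) auto

lemma theta_add: "theta (x + y) = theta x + theta y"
proof -
 let ?K = "(\<Union>j\<in>{1..n}. {k. omega j k x \<noteq> 0}) \<union> (\<Union>j\<in>{1..n}. {k. omega j k y \<noteq> 0})"
 have K: "finite ?K" using omega_finite by auto
 have "theta (x + y) = (\<Sum>j\<in>{1..n}. \<Sum>k\<in>?K. Poly_Mapping.single 0 (omega j k (x + y)) * Pk j k)"
  by (rule theta_K[OF K]) (auto simp: omega_add)
 also have "\<dots> = (\<Sum>j\<in>{1..n}. \<Sum>k\<in>?K. Poly_Mapping.single 0 (omega j k x) * Pk j k)
   + (\<Sum>j\<in>{1..n}. \<Sum>k\<in>?K. Poly_Mapping.single 0 (omega j k y) * Pk j k)"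
  by (simp add: omega_add single_add distrib_right sum.distrib)
 also have "(\<Sum>j\<in>{1..n}. \<Sum>k\<in>?K. Poly_Mapping.single 0 (omega j k x) * Pk j k) = theta x"
  by (rule theta_K[OF K, symmetric]) auto
 also have "(\<Sum>j\<in>{1..n}. \<Sum>k\<in>?K. Poly_Mapping.single 0 (omega j k y) * Pk j k) = theta y"
  by (rule theta_K[OF K, symmetric]) auto
 finally show ?thesis .
qed

lemma theta_sm: "theta (sm c x) = Poly_Mapping.single 0 c * theta x"
proof -
 let ?K = "\<Union>j\<in>{1..n}. {k. omega j k x \<noteq> 0}"
 have K: "finite ?K" using omega_finite by auto
 have "theta (sm c x) = (\<Sum>j\<in>{1..n}. \<Sum>k\<in>?K. Poly_Mapping.single 0 (omega j k (sm c x)) * Pk j k)"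
  by (rule theta_K[OF K]) (auto simp: omega_sm)
 also have "\<dots> = Poly_Mapping.single 0 c * (\<Sum>j\<in>{1..n}. \<Sum>k\<in>?K. Poly_Mapping.single 0 (omega j k x) * Pk j k)"
  by (simp add: omega_sm sum_distrib_left mult.assoc[symmetric] mult_single)
 also have "(\<Sum>j\<in>{1..n}. \<Sum>k\<in>?K. Poly_Mapping.single 0 (omega j k x) * Pk j k) = theta x"
  by (rule theta_K[OF K, symmetric]) auto
 finally show ?thesis .
qed

lemma theta_0: "theta 0 = 0" by (simp add: theta_def)

lemma theta_eta: "1 \<le> j \<Longrightarrow> j \<le> n \<Longrightarrow> theta (eta j k) = Pk j k"
proof -
 assume j: "1 \<le> j" "j \<le> n"
 have "theta (eta j k) = (\<Sum>i\<in>{1..n}. \<Sum>l\<in>{k}. Poly_Mapping.single 0 (omega i l (eta j k)) * Pk i l)"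
  by (rule theta_K) (use j in \<open>auto simp: omega_eta split: if_splits\<close>)
 also have "\<dots> = (\<Sum>i\<in>{1..n}. if i = j then Pk j k else 0)"
  by (rule sum.cong) (use j in \<open>auto simp: omega_eta\<close>)
 finally show ?thesis using j by simp
qed

lemma Mp_letter: "x \<in> HH \<Longrightarrow> Mp (letter x) (theta x)"
proof -
 assume "x \<in> HH"
 let ?X = "{x. x \<in> Cg \<and> Mp (letter x) (theta x)}"
 have z: "0 \<in> ?X" using Mp_cong[OF Mp_0, of "letter 0"] UU_letter_0 UU_F V.subspace_0[OF current_subspace]
  by (simp add: theta_0)
 have "HH \<subseteq> ?X" unfolding HH_def
 proof (rule V.span_minimal)
  show "{eta j k | j k. True} \<subseteq> ?X"
  proof clarify
   fix j k show "eta j k \<in> Cg \<and> Mp (letter (eta j k)) (theta (eta j k))"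
   proof (cases "1 \<le> j \<and> j \<le> n")
    case True thus ?thesis using Mp_eta eta_current by (simp add: theta_eta)
   next
    case False thus ?thesis using z by (simp add: eta_out)
   qed
  qed
  show "V.subspace ?X"
   unfolding V.subspace_def
  proof (intro conjI ballI allI)
   show "0 \<in> ?X" by (rule z)
   fix x y assume xy: "x \<in> ?X" "y \<in> ?X"
   have c: "x + y \<in> Cg" using xy V.subspace_add[OF current_subspace] by blast
   have "Mp (letter (x + y)) (theta x + theta y)"
    by (rule Mp_cong[OF Mp_add UU_letter_add fr_letter[OF c]]) (use xy in auto)
   thus "x + y \<in> ?X" using c by (simp add: theta_add)
  next
   fix c x assume x: "x \<in> ?X"
   have cx: "sm c x \<in> Cg" using x V.subspace_scale[OF current_subspace] by blast
   have "Mp (letter (sm c x)) (Poly_Mapping.single 0 c * theta x)"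
    by (rule Mp_cong[OF Mp_mult[OF Mp_scl] UU_letter_sm fr_letter[OF cx]]) (use x in auto)
   thus "sm c x \<in> ?X" using cx by (simp add: theta_sm)
  qed
 qed
 thus ?thesis using \<open>x \<in> HH\<close> by blast
qed

sublocale mpr: free_rep "\<lambda>c (q::mp). Poly_Mapping.single 0 c * q" "\<lambda>x q. theta x * q"
 by unfold_locales (auto simp: single_add mult_single algebra_simps)

text \<open>The free algebra acts on polynomials, a letter x by multiplication with
  \<open>theta x\<close>. The image of 1 is then multiplicative in p, because the multiplications
  commute with right multiplication.\<close>

definition Theta :: "('g word \<Rightarrow>\<^sub>0 complex) \<Rightarrow> mp" where "Theta p = mpr.act p 1"

lemma wact_theta: "wact (\<lambda>x q. theta x * q) xs v = wact (\<lambda>x q. theta x * q) xs 1 * v"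
 by (induction xs) (auto simp: mult.assoc)

lemma Theta_add: "Theta (p + q) = Theta p + Theta q" by (simp add: Theta_def mpr.act_add)

lemma Theta_1: "Theta 1 = 1" by (simp add: Theta_def)

lemma Theta_scl: "Theta (scl c) = Poly_Mapping.single 0 c" by (simp add: Theta_def mpr.act_scalar)

lemma Theta_letter: "Theta (letter x) = theta x" by (simp add: Theta_def)

lemma Theta_mult: "Theta (p * q) = Theta p * Theta q"
proof -
 have "mpr.act p v = mpr.act p 1 * v" for v
  by (induction p rule: pm_induct) (auto simp: mpr.act_single mpr.act_add distrib_right wact_theta[of _ v] mult.assoc)
 thus ?thesis unfolding Theta_def mpr.act_mult .
qed

lemma Mp_word: "set xs \<subseteq> HH \<Longrightarrow> Mp (Poly_Mapping.single (Word xs) 1) (Theta (Poly_Mapping.single (Word xs) 1))"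
proof (induction xs)
 case Nil
 have "Poly_Mapping.single (Word []) 1 = (1 :: 'g word \<Rightarrow>\<^sub>0 complex)" by (simp add: zero_word_def[symmetric])
 thus ?case using Mp_scl[of 1] Theta_1 by simp
next
 case (Cons x xs)
 have "Poly_Mapping.single (Word (x # xs)) 1 = letter x * Poly_Mapping.single (Word xs) (1::complex)"
  by (simp add: letter_def mult_single plus_word_def)
 thus ?case using Cons by (simp only: Theta_mult Theta_letter) (auto intro!: Mp_mult Mp_letter)
qed

lemma Mp_free: "p \<in> carrier (free_ring HH) \<Longrightarrow> Mp p (Theta p)"
proof -
 assume p: "p \<in> carrier (free_ring HH)"
 have pe: "p = (\<Sum>w\<in>Poly_Mapping.keys p. Poly_Mapping.single w (Poly_Mapping.lookup p w))"
  by (rule poly_mapping_eqI) (simp add: lookup_sum lookup_single when_def in_keys_iff)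
 have "Mp (\<Sum>w\<in>K. Poly_Mapping.single w (Poly_Mapping.lookup p w)) (Theta (\<Sum>w\<in>K. Poly_Mapping.single w (Poly_Mapping.lookup p w)))"
  if "K \<subseteq> Poly_Mapping.keys p" for K
  using that
 proof (induction K rule: infinite_finite_induct)
  case (insert w K)
  have "set (letters w) \<subseteq> HH" using insert.prems p by (auto simp: free_ring_def)
  hence m: "Mp (Poly_Mapping.single w 1) (Theta (Poly_Mapping.single w 1))" using Mp_word[of "letters w"] by simp
  have e: "Poly_Mapping.single w (Poly_Mapping.lookup p w) = scl (Poly_Mapping.lookup p w) * Poly_Mapping.single w 1"
   by (simp add: mult_single)
  have "Mp (Poly_Mapping.single w (Poly_Mapping.lookup p w)) (Theta (Poly_Mapping.single w (Poly_Mapping.lookup p w)))"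
   unfolding e Theta_mult Theta_scl by (intro Mp_mult Mp_scl m)
  thus ?case using insert by (simp add: Theta_add Mp_add)
 qed (use Mp_0 Theta_scl[of 0] in simp_all)
 from this[OF subset_refl] show ?thesis using pe by simp
qed

lemma L_0: "L 0 - 1 \<in> UU" using L_prodl[of "[]"] by simp

text \<open>Spanning by normal forms: apply \<open>Mp\<close> to the normal form of 1. Their
  independence modulo the annihilator is decided by the Fock spaces.\<close>

lemma straighten:
 assumes "p \<in> carrier (free_ring HH)"
 shows "p - Lin (Theta p) \<in> UU"
proof -
 have "p * Lin 1 - Lin (Theta p * 1) \<in> UU" by (rule MpD[OF Mp_free[OF assms]])
 moreover have "Lin 1 = L 0" using Lin_single[of 0 1] by simp
 ultimately have 1: "p * L 0 - Lin (Theta p) \<in> UU" by simp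
 have "p * (L 0 - 1) \<in> UU" by (rule UU_lmult[OF L_0 HH_F[OF assms]])
 hence "p * L 0 - p \<in> UU" by (simp add: right_diff_distrib)
 hence "p - p * L 0 \<in> UU" by (rule UU_sym)
 thus ?thesis using 1 by (rule UU_trans)
qed

end

context A2n2
begin

subsection \<open>Long and short simple roots\<close>

definition Q :: "(nat \<Rightarrow> int) \<Rightarrow> int" where
 "Q c = (\<Sum>i\<in>{1..n}. \<Sum>j\<in>{1..n}. c i * c j * (if i = n then 2 else 1) * A i j)"

lemma root_norm_eq:
 assumes "\<beta> = root_combination G {1..n} (\<lambda>i. of_int (c i))"
 shows "root_norm n G \<beta> = Q c"
 unfolding root_norm_def
proof (rule the_equality[of _ "Q c"])
 show "\<exists>c'. \<beta> = root_combination G {1..n} (\<lambda>i. of_int (c' i)) \<and>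
   Q c = (\<Sum>i\<in>{1..n}. \<Sum>j\<in>{1..n}. c' i * c' j * (if i = n then 2 else 1) * A i j)"
  using assms by (intro exI[of _ c]) (simp add: Q_def)
 fix q assume "\<exists>c. \<beta> = root_combination G {1..n} (\<lambda>i. of_int (c i)) \<and>
   q = (\<Sum>i\<in>{1..n}. \<Sum>j\<in>{1..n}. c i * c j * (if i = n then 2 else 1) * A i j)"
 then obtain c' where c': "\<beta> = root_combination G {1..n} (\<lambda>i. of_int (c' i))" "q = Q c'"
  by (auto simp: Q_def)
 have "c i = c' i" if "i \<in> {1..n}" for i
 proof -
  have "(\<Sum>i\<le>n. (if i = 0 then 0 else of_int (c i - c' i)) * al i h) = 0" for h
  proof -
   have "(\<Sum>i\<le>n. (if i = 0 then 0 else of_int (c i - c' i)) * al i h) =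
     (\<Sum>i\<in>{1..n}. (if i = 0 then 0 else of_int (c i - c' i)) * al i h)"
    by (rule sum.mono_neutral_right) auto
   also have "\<dots> = (\<Sum>i\<in>{1..n}. of_int (c i) * al i h) - (\<Sum>i\<in>{1..n}. of_int (c' i) * al i h)"
    unfolding sum_subtractf[symmetric] by (rule sum.cong) (auto simp: algebra_simps)
   also have "\<dots> = \<beta> h - \<beta> h" unfolding assms c'(1)[symmetric]
    using assms c'(1) by (simp add: root_combination_def fun_eq_iff)
   finally show ?thesis by simp
  qed
  from al_indep[OF this, of i] show ?thesis using that by simp
 qed
 hence "Q c' = Q c" unfolding Q_def by (intro sum.cong refl) auto
 thus "q = Q c" using c' by simp
qed

lemma al_combo: "1 \<le> j \<Longrightarrow> j \<le> n \<Longrightarrow> al j = root_combination G {1..n} (\<lambda>i. of_int (of_bool (i = j)))"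
proof
 fix h assume j: "1 \<le> j" "j \<le> n"
 have "(\<Sum>i\<in>{1..n}. of_int (of_bool (i = j)) * al i h) = (\<Sum>i\<in>{1..n}. if i = j then al j h else 0)"
  by (rule sum.cong) auto
 thus "al j h = root_combination G {1..n} (\<lambda>i. of_int (of_bool (i = j))) h"
  using j by (simp add: root_combination_def)
qed

lemma Q_al: "1 \<le> j \<Longrightarrow> j \<le> n \<Longrightarrow> root_norm n G (al j) = (if j = n then 4 else 2)"
proof -
 assume j: "1 \<le> j" "j \<le> n"
 have "Q (\<lambda>i. of_bool (i = j)) = (\<Sum>i\<in>{1..n}. \<Sum>k\<in>{1..n}. if i = j \<and> k = j then (if i = n then 2 else 1) * A i k else 0)"
  unfolding Q_def by (intro sum.cong refl) auto
 also have "\<dots> = (\<Sum>i\<in>{1..n}. if i = j then (if j = n then 2 else 1) * A j j else 0)"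
  using j by (intro sum.cong refl) (auto simp: sum.delta')
 also have "\<dots> = (if j = n then 2 else 1) * A j j" using j by (simp add: sum.delta)
 also have "\<dots> = (if j = n then 4 else 2)" by (simp add: cartan_matrix_A2n2_def)
 finally show ?thesis using root_norm_eq[OF al_combo[OF j]] by simp
qed

lemma gen_nz: "i \<le> n \<Longrightarrow> gen_e G i \<noteq> 0" "i \<le> n \<Longrightarrow> gen_f G i \<noteq> 0"
proof -
 assume i: "i \<le> n"
 have "cv i \<noteq> 0"
 proof
  assume "cv i = 0"
  hence "al i (cv i) = 0" using i by simp
  thus False using al_cv[OF i i] by (simp add: cartan_matrix_A2n2_def)
 qed
 thus "gen_e G i \<noteq> 0" "gen_f G i \<noteq> 0" using br_ef[OF i i] by auto
qed

lemma e_rs: "i \<le> n \<Longrightarrow> gen_e G i \<in> root_space G (al i)"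
 and f_rs: "i \<le> n \<Longrightarrow> gen_f G i \<in> root_space G (- al i)"
 by (simp_all add: root_space_def br_he br_hf)

lemma al_nz: "i \<le> n \<Longrightarrow> al i \<noteq> 0"
 using h0(2)[of i] by (auto intro!: exI[of _ h0] simp: fun_eq_iff)

lemma al_fin:
 assumes "1 \<le> j" "j \<le> n"
 shows "al j \<in> fin_pos_roots n G"
proof -
 have "al j \<in> fin_roots n G"
  unfolding fin_roots_def roots_def mem_Collect_eq
  using assms al_dual[of j] al_nz[of j] e_rs[of j] gen_nz(1)[of j] e_fin[of j] by (intro conjI bexI[of _ "gen_e G j"]) auto
 moreover have "al j = root_combination G {1..n} (\<lambda>i. of_nat (of_bool (i = j)))"
  using al_combo[OF assms] by (simp add: of_bool_def if_distrib cong: if_cong)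
 ultimately show ?thesis unfolding fin_pos_roots_def by (intro CollectI conjI exI)
qed

lemma card_res:
 assumes "int m < N"
 shows "card {l \<in> {i..<i + int m}. l mod N = r} \<le> 1"
proof -
 have "x = y" if "x \<in> {l \<in> {i..<i + int m}. l mod N = r}" "y \<in> {l \<in> {i..<i + int m}. l mod N = r}" for x y
 proof -
  have "N dvd x - y" using that by (auto simp: mod_eq_dvd_iff[symmetric])
  moreover have "\<bar>x - y\<bar> < N" using that assms by auto
  ultimately show ?thesis using dvd_imp_le_int[of "x - y" N] by auto
 qed
 moreover have "finite {l \<in> {i..<i + int m}. l mod N = r}" by (rule finite_subset[of _ "{i..<i + int m}"]) auto
 ultimately show ?thesis by (simp only: card_le_Suc0_iff_eq One_nat_def) blast
qed

text \<open>A label t < n belongs to two residues modulo N and n to a single one, while a path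
  shorter than a period meets each residue at most once. The weight 2 of n balances this.\<close>

lemma lab_count:
 assumes "int m < N" "1 \<le> t" "t \<le> n"
 shows "int (card {l \<in> {i..<i + int m}. lab l = t}) * (if t = n then 2 else 1) \<le> 2"
proof -
 let ?R = "\<lambda>r. {l \<in> {i..<i + int m}. l mod N = r}"
 have "l mod N = int t \<or> l mod N = 2 * int n - int t" if "lab l = t" for l
 proof (cases l rule: lab_cases)
  case left thus ?thesis using that by simp
 next
  case right
  thus ?thesis using that mod_neg1[of l] by (simp add: N_def)
 qed
 hence sub: "{l \<in> {i..<i + int m}. lab l = t} \<subseteq> ?R (int t) \<union> ?R (2 * int n - int t)" by auto
 have fin: "finite (?R r)" for r by (rule finite_subset[of _ "{i..<i + int m}"]) auto
 have c: "card {l \<in> {i..<i + int m}. lab l = t} \<le> card (?R (int t) \<union> ?R (2 * int n - int t))"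
  by (rule card_mono[OF _ sub]) (rule finite_UnI[OF fin fin])
 show ?thesis
 proof (cases "t = n")
  case True
  hence "?R (int t) \<union> ?R (2 * int n - int t) = ?R (int t)" by auto
  thus ?thesis using c card_res[OF assms(1), of i "int t"] True by simp
 next
  case False
  have "card (?R (int t) \<union> ?R (2 * int n - int t)) \<le> card (?R (int t)) + card (?R (2 * int n - int t))"
   by (rule card_Un_le)
  thus ?thesis using c card_res[OF assms(1), of i "int t"] card_res[OF assms(1), of i "2 * int n - int t"] False by simp
 qed
qed

lemma A_telescope:
 assumes "1 \<le> t" "t \<le> n"
 shows "(\<Sum>l\<in>{i..<i + int m}. A t (lab l)) = (of_bool (lab i = t) - of_bool (lab (i - 1) = t))
  - (of_bool (lab (i + int m) = t) - of_bool (lab (i + int m - 1) = t))"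
proof (induction m)
 case (Suc m)
 have "ka t = 1" using assms by (simp add: ka_def)
 hence "of_int (2 * of_bool (lab (i + int m) = t) - of_bool (lab (i + int m - 1) = t) - of_bool (lab (i + int m + 1) = t))
   = (of_int (A t (lab (i + int m))) :: complex)"
  using cartan_identity[OF assms(2), of "i + int m"]
  by (cases "lab (i + int m) = t"; cases "lab (i + int m - 1) = t"; cases "lab (i + int m + 1) = t") simp_all
 hence a: "A t (lab (i + int m)) = 2 * of_bool (lab (i + int m) = t) - of_bool (lab (i + int m - 1) = t) - of_bool (lab (i + int m + 1) = t)"
  by (simp only: of_int_eq_iff)
 have s: "{i..<i + int (Suc m)} = insert (i + int m) {i..<i + int m}" by auto
 have e: "i + int (Suc m) = i + int m + 1" "i + int m + 1 - 1 = i + int m" by simp_all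
 have "(\<Sum>l\<in>{i..<i + int (Suc m)}. A t (lab l)) = A t (lab (i + int m)) + (\<Sum>l\<in>{i..<i + int m}. A t (lab l))"
  unfolding s by (rule sum.insert) auto
 thus ?case unfolding a Suc.IH e by (simp only: algebra_simps)
qed simp

text \<open>The root is read as a path of steps, c counting its labels. The row sums of the Cartan
  matrix over the path telescope to indicator functions at its ends, so only the labels of the first
  and the last step contribute positively, each at most 2 by \<open>lab_count\<close>.\<close>

lemma Q_bound:
 assumes m: "int m < N" and l: "\<And>l. l \<in> {i..<i + int m} \<Longrightarrow> lab l \<noteq> 0" "m \<ge> 1"
  and e: "e * e = 1"
  and c: "\<And>t. c t = e * int (card {l \<in> {i..<i + int m}. lab l = t})"
 shows "Q c \<le> 4"
proof -
 let ?R = "{i..<i + int m}"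
 define k where "k t = int (card {l \<in> ?R. lab l = t})" for t
 define D where "D t = (if t = n then 2 else 1 :: int)" for t
 have in1n: "lab l \<in> {1..n}" if "l \<in> ?R" for l using l(1)[OF that] lab_le[of l] by auto
 have fib: "(\<Sum>j\<in>{1..n}. k j * A t j) = (\<Sum>l\<in>?R. A t (lab l))" for t
 proof -
  have "(\<Sum>j\<in>{1..n}. \<Sum>l\<in>{l \<in> ?R. lab l = j}. A t (lab l)) = (\<Sum>l\<in>?R. A t (lab l))"
   by (rule sum.group) (use in1n in auto)
  moreover have "(\<Sum>l\<in>{l \<in> ?R. lab l = j}. A t (lab l)) = k j * A t j" for j
  proof -
   have "(\<Sum>l\<in>{l \<in> ?R. lab l = j}. A t (lab l)) = (\<Sum>l\<in>{l \<in> ?R. lab l = j}. A t j)" by (rule sum.cong) auto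
   thus ?thesis unfolding k_def sum_constant .
  qed
  ultimately show ?thesis by (simp only: )
 qed
 have kD: "0 \<le> k t * D t" "t \<in> {1..n} \<Longrightarrow> k t * D t \<le> 2" for t
  using lab_count[OF m, of t i] by (auto simp: k_def D_def)
 let ?f = "\<lambda>t. (of_bool (lab i = t) - of_bool (lab (i - 1) = t))
  - (of_bool (lab (i + int m) = t) - of_bool (lab (i + int m - 1) = t)) :: int"
 have "Q c = (\<Sum>t\<in>{1..n}. k t * D t * (\<Sum>j\<in>{1..n}. k j * A t j))"
 proof -
  have "c s * c j * (if s = n then 2 else 1) * A s j = k s * D s * (k j * A s j)" for s j
  proof -
   have "c s * c j = (e * e) * (k s * k j)" by (simp add: c k_def algebra_simps)
   thus ?thesis by (simp add: e D_def algebra_simps)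
  qed
  thus ?thesis unfolding Q_def sum_distrib_left by (intro sum.cong refl) (simp only: )
 qed
 also have "\<dots> = (\<Sum>t\<in>{1..n}. k t * D t * ?f t)"
  by (intro sum.cong refl) (simp only: fib A_telescope atLeastAtMost_iff)
 \<comment> \<open>The two indicators of the steps just outside the path enter with a negative sign
   and are dropped.\<close>
 also have "\<dots> \<le> (\<Sum>t\<in>{1..n}. (if t = lab i then k t * D t else 0) + (if t = lab (i + int m - 1) then k t * D t else 0))"
 proof (rule sum_mono)
  fix t
  have "?f t \<le> of_bool (lab i = t) + of_bool (lab (i + int m - 1) = t)" by auto
  hence "k t * D t * ?f t \<le> k t * D t * (of_bool (lab i = t) + of_bool (lab (i + int m - 1) = t))"
   by (rule mult_left_mono) (rule kD(1))
  also have "\<dots> = (if t = lab i then k t * D t else 0) + (if t = lab (i + int m - 1) then k t * D t else 0)"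
   by (auto simp: distrib_left)
  finally show "k t * D t * ?f t \<le> (if t = lab i then k t * D t else 0) + (if t = lab (i + int m - 1) then k t * D t else 0)" .
 qed
 also have "\<dots> = k (lab i) * D (lab i) + k (lab (i + int m - 1)) * D (lab (i + int m - 1))"
  using in1n[of i] in1n[of "i + int m - 1"] l(2) by (simp add: sum.distrib)
 also have "\<dots> \<le> 2 + 2"
  by (intro add_mono kD(2) in1n) (use l(2) in auto)
 finally show ?thesis by simp
qed

text \<open>A nonzero matrix entry of a root vector writes the root as plus or minus the sum over a
  path of steps. As the root vanishes on \<open>sc\<close>, that path avoids the label 0. The bound
  4 is attained at \<open>\<alpha>\<^sub>n\<close>, which is therefore long.\<close>

lemma fin_root_norm:
 assumes "\<beta> \<in> fin_roots n G"
 shows "root_norm n G \<beta> \<le> 4"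
proof -
 obtain x where x: "x \<in> fin_algebra n G" "x \<noteq> 0" "x \<in> root_space G \<beta>" and b: "\<beta> \<in> roots G"
  using assms by (auto simp: fin_roots_def)
 have "lie_subalgebra G {x. br sc x = 0}"
  unfolding lie_subalgebra_def by (auto simp: V.subspace_def br_add_r br_sm_r jac[of sc])
 moreover have "gen_e G i \<in> {x. br sc x = 0} \<and> gen_f G i \<in> {x. br sc x = 0}" if "i \<in> {1..n}" for i
  using that sc by (auto simp: br_he br_hf)
 ultimately have "fin_algebra n G \<subseteq> {x. br sc x = 0}" unfolding fin_algebra_def lie_generated_def by blast
 hence "sm (\<beta> sc) x = 0" using x(1) rsD[OF x(3) sc(1)] by auto
 hence bsc: "\<beta> sc = 0" using x(2) by simp
 have bd: "\<beta> h = 0" if "h \<notin> H" for h using b that by (simp add: roots_def dual_def)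
 have "\<exists>h\<in>H. \<beta> h \<noteq> 0"
 proof (rule ccontr)
  assume "\<not> ?thesis"
  hence "\<beta> = 0" using bd by (auto simp: fun_eq_iff)
  thus False using b by (simp add: roots_def)
 qed
 then obtain h where h: "h \<in> H" "\<beta> h \<noteq> 0" by blast
 have "\<exists>k m. Phi x k m \<noteq> 0" using rs_inj[OF x(3) _ h] x(2) by blast
 then obtain k m where km: "Phi x k m \<noteq> 0" by blast
 have ent: "\<beta> h = pih h m - pih h (m + k)" if "h \<in> H" for h by (rule rs_Phi[OF x(3) that km])
 have k0: "k \<noteq> 0" using root_Phi0[OF b x(3)] km by metis
 obtain i l and e :: int where iel: "e = 1 \<or> e = - 1" "l \<ge> 1"
  "\<And>h. h \<in> H \<Longrightarrow> \<beta> h = of_int e * (pih h i - pih h (i + int l))"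
 proof (cases "k > 0")
  case True
  show ?thesis by (rule that[of 1 "nat k" m]) (use True ent in auto)
 next
  case False
  show ?thesis by (rule that[of "- 1" "nat (- k)" "m + k"]) (use False k0 ent in auto)
 qed
 let ?R = "{i..<i + int l}"
 have lab0: "lab t \<noteq> 0" if "t \<in> ?R" for t
 proof (rule sc_entry[OF _ that])
  show "pih sc i = pih sc (i + int l)" using iel(3)[OF sc(1)] bsc iel(1) by auto
 qed
 \<comment> \<open>A path of a full period would start some step at a multiple of N, and that step
   has label 0.\<close>
 have lN: "int l < N"
 proof (rule ccontr)
  assume a: "\<not> ?thesis"
  have "(- i) mod N < N" "0 \<le> (- i) mod N" using mod_bounds by auto
  hence "i + (- i) mod N \<in> ?R" using a by auto
  moreover have "N dvd i + (- i) mod N" by (simp add: mod_eq_0_iff_dvd[symmetric] mod_add_right_eq)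
  ultimately show False using lab0 lab0_iff by blast
 qed
 define c where "c t = e * int (card {t' \<in> ?R. lab t' = t})" for t
 have in1n: "lab t \<in> {1..n}" if "t \<in> ?R" for t using lab0[OF that] lab_le[of t] by auto
 have "\<beta> h = root_combination G {1..n} (\<lambda>i. of_int (c i)) h" for h
 proof (cases "h \<in> H")
  case True
  have "(\<Sum>t\<in>{1..n}. \<Sum>t'\<in>{t' \<in> ?R. lab t' = t}. al (lab t') h) = (\<Sum>t'\<in>?R. al (lab t') h)"
   by (rule sum.group) (use in1n in auto)
  moreover have "(\<Sum>t'\<in>{t' \<in> ?R. lab t' = t}. al (lab t') h) = of_nat (card {t' \<in> ?R. lab t' = t}) * al t h" for t
  proof -
   have "(\<Sum>t'\<in>{t' \<in> ?R. lab t' = t}. al (lab t') h) = (\<Sum>t'\<in>{t' \<in> ?R. lab t' = t}. al t h)" by (rule sum.cong) auto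
   thus ?thesis unfolding sum_constant .
  qed
  ultimately have "(\<Sum>t\<in>{1..n}. of_nat (card {t' \<in> ?R. lab t' = t}) * al t h) = pih h i - pih h (i + int l)"
   by (simp add: pih_diff_sum)
  thus ?thesis using iel(3)[OF True]
   by (simp add: root_combination_def c_def sum_distrib_left[symmetric] mult.assoc)
 next
  case False
  thus ?thesis using bd root_combo_in_dual[of "{1..n}"] by (simp add: dual_def)
 qed
 hence "root_norm n G \<beta> = Q c" by (intro root_norm_eq ext)
 also have "\<dots> \<le> 4" by (rule Q_bound[OF lN lab0 iel(2)]) (use iel(1) c_def in auto)
 finally show ?thesis .
qed

lemma al_n_long: "al n \<in> long_roots n G"
 using al_fin[of n] n1 fin_root_norm Q_al[of n] by (auto simp: long_roots_def fin_pos_roots_def)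

lemma al_short: "1 \<le> j \<Longrightarrow> j < n \<Longrightarrow> al j \<in> short_roots n G"
proof -
 assume j: "1 \<le> j" "j < n"
 have "al j \<in> fin_roots n G" "al n \<in> fin_roots n G" using al_fin[of j] al_fin[of n] j by (auto simp: fin_pos_roots_def)
 moreover have "\<not> root_norm n G (al n) \<le> root_norm n G (al j)" using j Q_al[of j] Q_al[of n] by simp
 ultimately show ?thesis unfolding short_roots_def long_roots_def by blast
qed

lemma n_plus_rs: "\<beta> \<in> real_roots_pos n G \<Longrightarrow> x \<in> root_space G \<beta> \<Longrightarrow> x \<in> current_n_plus n G"
 unfolding current_n_plus_def sum_of_root_spaces_def by (intro V.span_base) blast

lemma rs_combo_current:
 assumes "x \<in> root_space G \<beta>" "\<And>h. \<beta> h = root_combination G {..n} (\<lambda>i. of_nat (c i)) h" "c 0 \<ge> 1"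
 shows "x \<in> Cg"
proof -
 have "\<beta> = root_combination G {..n} (\<lambda>i. of_nat (c i))" using assms(2) by (rule ext)
 moreover have "(\<Sum>i\<le>n. c i) \<ge> 1" using assms(3) member_le_sum[of 0 "{..n}" c] by simp
 ultimately have "x \<in> sum_of_root_spaces G (positive_roots n G)" using assms(1) rs_positive by simp
 thus ?thesis unfolding current_algebra_def by (intro V.span_base) blast
qed

lemma combo_shift:
 assumes "1 \<le> j" "j \<le> n"
 shows "root_combination G {..n} (\<lambda>i. a * (if i = n then 1 else 2) + (if i = j then e else 0)) h = a * delta n G h + e * al j h"
proof -
 have "(\<Sum>i\<le>n. (if i = j then e else 0) * al i h) = (\<Sum>i\<le>n. if i = j then e * al j h else 0)" by (rule sum.cong) auto
 thus ?thesis using assms(2)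
  by (simp add: root_combination_def delta_def distrib_right sum.distrib sum_distrib_left mult.assoc)
qed

lemma al_rs_current: "x \<in> root_space G (al j) \<Longrightarrow> 1 \<le> j \<Longrightarrow> j \<le> n \<Longrightarrow> x \<in> Cg"
proof -
 assume x: "x \<in> root_space G (al j)" "1 \<le> j" "j \<le> n"
 have "br h0 x = sm (of_int 1) x" using rsD[OF x(1) h0(1)] h0(2) x(3) by simp
 from eigen_T(1)[OF this] have "P 1 1 x (Phi x 1)" by (simp add: T_def)
 thus ?thesis by (rule P_current)
qed

lemma neg_al_rs_FP: "x \<in> root_space G (- al j) \<Longrightarrow> 1 \<le> j \<Longrightarrow> j \<le> n \<Longrightarrow> FP (- 1) 1 x"
proof -
 assume x: "x \<in> root_space G (- al j)" "1 \<le> j" "j \<le> n"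
 have "br h0 x = sm (of_int (- 1)) x" using rsD[OF x(1) h0(1)] h0(2) x(3) by simp
 from eigen_T(1)[OF this] have "P (- 1) 1 x (Phi x (- 1))" by (simp add: T_def)
 thus ?thesis by (rule P_FP) (use rsD[OF x(1) sc(1)] sc(3) x in auto)
qed

lemma fin_cartan_HH: "h \<in> fin_cartan n G \<Longrightarrow> h \<in> HH"
proof -
 have "fin_cartan n G \<subseteq> HH" unfolding fin_cartan_def
 proof (rule V.span_minimal[OF _ HH_subspace])
  show "cv ` {1..n} \<subseteq> HH" using eta_HH[of _ 0] by (auto simp: eta_0[symmetric])
 qed
 thus "h \<in> fin_cartan n G \<Longrightarrow> h \<in> HH" by blast
qed

lemma eta_br_rs:
 assumes "x \<in> root_space G (\<lambda>h. f h + of_nat k * delta n G h)"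
 shows "\<exists>l. br (eta j i) x \<in> root_space G (\<lambda>h. f h + of_nat l * delta n G h)"
proof (cases "1 \<le> j \<and> j \<le> n")
 case True
 show ?thesis
 proof (cases "i = 0")
  case i: True
  have "br (eta j i) x = sm (f (cv j) + of_nat k * delta n G (cv j)) x"
   using True rsD[OF assms cv_H] i by (simp add: eta_0)
  thus ?thesis using rs_sm[OF assms] by (intro exI[of _ k]) simp
 next
  case False
  have "br (eta j i) x \<in> root_space G (\<lambda>h. f h + of_nat (i + k) * delta n G h)"
   by (rule rs_br[OF eta_rs assms]) (use False in \<open>auto simp: algebra_simps\<close>)
  thus ?thesis by blast
 qed
next
 case False
 thus ?thesis using rs_zero by (auto simp: eta_out)
qed

subsection \<open>Harish-Chandra projection in rank one\<close>

text \<open>The left ideal generated by Cn+, lifted to the free ring; \<open>UU\<close> is included,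
  so congruences in the enveloping algebra become equalities up to \<open>J0\<close>.\<close>

inductive J0 :: "('g word \<Rightarrow>\<^sub>0 complex) \<Rightarrow> bool" where
 J0_UU: "p \<in> UU \<Longrightarrow> J0 p"
| J0_pos: "a \<in> F \<Longrightarrow> x \<in> current_n_plus n G \<Longrightarrow> x \<in> Cg \<Longrightarrow> J0 (a * letter x)"
| J0_add: "J0 p \<Longrightarrow> J0 q \<Longrightarrow> J0 (p + q)"

lemma J0_F: "J0 p \<Longrightarrow> p \<in> F"
 by (induction rule: J0.induct) (auto intro: UU_F fr_mult fr_letter fr_add)

lemma J0_lmult: "J0 p \<Longrightarrow> a \<in> F \<Longrightarrow> J0 (a * p)"
proof (induction rule: J0.induct)
 case (J0_pos b x)
 thus ?case using J0.J0_pos[of "a * b" x] by (simp add: fr_mult mult.assoc)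
qed (auto intro: J0_UU J0_add UU_lmult simp: distrib_left)

lemma J0_zero: "J0 0" by (rule J0_UU[OF UU_zero])

end

text \<open>The pattern common to both kinds of simple roots: bracketing with \<open>Pos\<close>
  leads from \<open>Neg2\<close> to \<open>Neg1\<close>, from there to \<open>HH\<close>, and from
  \<open>HH\<close> back to \<open>Pos\<close>. \<open>Neg2\<close> holds the negatives of doubled
  roots, which occur only for the long simple root and stay empty otherwise.\<close>

locale rank_one = A2n2 G n for G :: "('g::ab_group_add) kac_moody" and n +
 fixes Pos Neg1 Neg2 :: "'g set"
 assumes Pos: "x \<in> Pos \<Longrightarrow> x \<in> current_algebra n G" "x \<in> Pos \<Longrightarrow> x \<in> current_n_plus n G"
  and Neg1: "y \<in> Neg1 \<Longrightarrow> y \<in> current_algebra n G" and Neg2: "y \<in> Neg2 \<Longrightarrow> y \<in> current_algebra n G"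
  and Pos_eta: "x \<in> Pos \<Longrightarrow> br x (eta j k) \<in> Pos"
  and Neg1_eta: "y \<in> Neg1 \<Longrightarrow> br (eta j k) y \<in> Neg1" and Neg2_eta: "y \<in> Neg2 \<Longrightarrow> br (eta j k) y \<in> Neg2"
  and Pos_Neg1: "x \<in> Pos \<Longrightarrow> y \<in> Neg1 \<Longrightarrow> br x y \<in> HH"
  and Pos_Neg2: "x \<in> Pos \<Longrightarrow> y \<in> Neg2 \<Longrightarrow> br x y \<in> Neg1"
begin

text \<open>Negative letters of total depth d in front of a polynomial in \<open>eta\<close>, modulo
  the left ideal; a letter of \<open>Neg2\<close> has depth 2. The left ideal belongs to every
  depth.\<close>

inductive W :: "nat \<Rightarrow> ('g word \<Rightarrow>\<^sub>0 complex) \<Rightarrow> bool" where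
 W_AA: "AA u \<Longrightarrow> W 0 u"
| W_J: "J0 u \<Longrightarrow> W d u"
| W_neg1: "W d u \<Longrightarrow> y \<in> Neg1 \<Longrightarrow> W (Suc d) (letter y * u)"
| W_neg2: "W d u \<Longrightarrow> y \<in> Neg2 \<Longrightarrow> W (Suc (Suc d)) (letter y * u)"
| W_add: "W d u \<Longrightarrow> W d v \<Longrightarrow> W d (u + v)"
| W_scl: "W d u \<Longrightarrow> W d (scl c * u)"

lemma W_F: "W d u \<Longrightarrow> u \<in> F"
 by (induction rule: W.induct) (auto intro: AA_F J0_F fr_mult fr_letter fr_add fr_scalar Neg1 Neg2)

lemma W_cong: "W d u \<Longrightarrow> v - u \<in> UU \<Longrightarrow> W d v"
 using W_add[of d u "v - u"] W_J[OF J0_UU] by simp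

lemma commute_cong:
 assumes "x \<in> Cg" "y \<in> Cg" "u \<in> F"
 shows "letter x * (letter y * u) - (letter y * (letter x * u) + letter (br x y) * u) \<in> UU"
proof -
 have "letter x * (letter y * u) - (letter y * (letter x * u) + letter (br x y) * u)
   = (letter x * letter y - letter y * letter x - letter (br x y)) * u"
  by (simp add: algebra_simps)
 thus ?thesis using UU_rmult[OF UU_letter_br[OF assms(1,2)] assms(3)] by simp
qed

lemma W_eta: "W d u \<Longrightarrow> W d (letter (eta j k) * u)"
proof (induction rule: W.induct)
 case (W_AA u) thus ?case by (intro W.W_AA AA_eta)
next
 case (W_J u d) thus ?case by (intro W.W_J J0_lmult fr_letter eta_current)
next
 case (W_neg1 d u y)
 have "W (Suc d) (letter y * (letter (eta j k) * u) + letter (br (eta j k) y) * u)"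
  by (intro W_add W.W_neg1 W_neg1 Neg1_eta)
 thus ?case by (rule W_cong) (rule commute_cong[OF eta_current Neg1[OF W_neg1.hyps(2)] W_F[OF W_neg1.hyps(1)]])
next
 case (W_neg2 d u y)
 have "W (Suc (Suc d)) (letter y * (letter (eta j k) * u) + letter (br (eta j k) y) * u)"
  by (intro W_add W.W_neg2 W_neg2 Neg2_eta)
 thus ?case by (rule W_cong) (rule commute_cong[OF eta_current Neg2[OF W_neg2.hyps(2)] W_F[OF W_neg2.hyps(1)]])
next
 case (W_add d u v) thus ?case by (simp add: distrib_left W.W_add)
next
 case (W_scl d u c)
 have "letter (eta j k) * (scl c * u) = scl c * (letter (eta j k) * u)"
  by (simp only: mult.assoc[symmetric] scl_comm)
 thus ?case using W.W_scl[OF W_scl.IH] by simp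
qed

lemma W_HH:
 assumes "x \<in> HH" "W d u"
 shows "W d (letter x * u)"
proof -
 let ?X = "{x. x \<in> Cg \<and> W d (letter x * u)}"
 have uF: "u \<in> F" using assms(2) by (rule W_F)
 have "HH \<subseteq> ?X" unfolding HH_def
 proof (rule V.span_minimal)
  show "{eta j k | j k. True} \<subseteq> ?X" using W_eta[OF assms(2)] eta_current by blast
  show "V.subspace ?X" unfolding V.subspace_def
  proof (intro conjI ballI allI)
   show "0 \<in> ?X" using W_J[OF J0_UU[OF UU_rmult[OF UU_letter_0 uF]]] V.subspace_0[OF current_subspace] by simp
   fix x y assume xy: "x \<in> ?X" "y \<in> ?X"
   have c: "x + y \<in> Cg" using xy V.subspace_add[OF current_subspace] by blast
   have "(letter (x + y) - (letter x + letter y)) * u \<in> UU"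
    using xy by (intro UU_rmult UU_letter_add uF) auto
   hence "letter (x + y) * u - (letter x * u + letter y * u) \<in> UU" by (simp add: algebra_simps)
   moreover have "W d (letter x * u + letter y * u)" using xy by (intro W_add) auto
   ultimately show "x + y \<in> ?X" using c W_cong by blast
  next
   fix c x assume x: "x \<in> ?X"
   have cx: "sm c x \<in> Cg" using x V.subspace_scale[OF current_subspace] by blast
   have "(letter (sm c x) - scl c * letter x) * u \<in> UU"
    using x by (intro UU_rmult UU_letter_sm uF) auto
   hence "letter (sm c x) * u - scl c * (letter x * u) \<in> UU" by (simp add: left_diff_distrib mult.assoc)
   moreover have "W d (scl c * (letter x * u))" using x by (intro W_scl) auto
   ultimately show "sm c x \<in> ?X" using cx W_cong by blast
  qed
 qed
 thus ?thesis using assms(1) by blast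
qed

lemma J0_cong: "J0 u \<Longrightarrow> v - u \<in> UU \<Longrightarrow> J0 v"
 using J0_add[of u "v - u"] J0_UU[of "v - u"] by simp

lemma AA_pos: "AA u \<Longrightarrow> x \<in> Pos \<Longrightarrow> J0 (letter x * u)"
proof (induction arbitrary: x rule: AA.induct)
 case AA_one
 thus ?case using J0_pos[OF fr_one Pos(2) Pos(1)] by simp
next
 case (AA_eta u j k)
 have "J0 (letter (eta j k) * (letter x * u) + letter (br x (eta j k)) * u)"
  by (intro J0_add J0_lmult AA_eta Pos_eta fr_letter eta_current)
 thus ?case by (rule J0_cong) (rule commute_cong[OF Pos(1)[OF AA_eta.prems] eta_current AA_F[OF AA_eta.hyps]])
next
 case (AA_add u v) thus ?case by (simp add: distrib_left J0_add)
next
 case (AA_scl u c)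
 have "letter x * (scl c * u) = scl c * (letter x * u)"
  by (simp only: mult.assoc[symmetric] scl_comm)
 thus ?case using J0_lmult[OF AA_scl.IH[OF AA_scl.prems] fr_scalar] by simp
qed

text \<open>The letter x is moved to the right. Each commutator replaces a negative letter by one of
  depth one less, and when x reaches the polynomial in \<open>eta\<close>, \<open>AA_pos\<close>
  puts the result into the left ideal.\<close>

lemma W_pos: "W d u \<Longrightarrow> x \<in> Pos \<Longrightarrow> (d = 0 \<longrightarrow> J0 (letter x * u)) \<and> (d \<noteq> 0 \<longrightarrow> W (d - 1) (letter x * u))"
proof (induction arbitrary: x rule: W.induct)
 case (W_AA u) thus ?case by (simp add: AA_pos)
next
 case (W_J u d)
 have "J0 (letter x * u)" using W_J by (intro J0_lmult fr_letter Pos)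
 thus ?case by (simp add: W.W_J)
next
 case (W_neg1 d u y)
 have yF: "letter y \<in> F" using W_neg1.hyps by (intro fr_letter Neg1)
 have 1: "W d (letter y * (letter x * u))"
 proof (cases "d = 0")
  case True
  hence "J0 (letter x * u)" using W_neg1.IH[OF W_neg1.prems] by simp
  thus ?thesis by (rule W.W_J[OF J0_lmult[OF _ yF]])
 next
  case False
  hence "W (Suc (d - 1)) (letter y * (letter x * u))"
   using W_neg1.IH[OF W_neg1.prems] W_neg1.hyps by (intro W.W_neg1) auto
  thus ?thesis using False by simp
 qed
 have "W d (letter (br x y) * u)" using W_neg1 by (intro W_HH Pos_Neg1)
 hence "W d (letter y * (letter x * u) + letter (br x y) * u)" using 1 by (intro W.W_add)
 hence "W d (letter x * (letter y * u))"
  by (rule W_cong) (rule commute_cong[OF Pos(1)[OF W_neg1.prems] Neg1[OF W_neg1.hyps(2)] W_F[OF W_neg1.hyps(1)]])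
 thus ?case by simp
next
 case (W_neg2 d u y)
 have yF: "letter y \<in> F" using W_neg2.hyps by (intro fr_letter Neg2)
 have 1: "W (Suc d) (letter y * (letter x * u))"
 proof (cases "d = 0")
  case True
  hence "J0 (letter x * u)" using W_neg2.IH[OF W_neg2.prems] by simp
  thus ?thesis by (rule W.W_J[OF J0_lmult[OF _ yF]])
 next
  case False
  hence "W (Suc (Suc (d - 1))) (letter y * (letter x * u))"
   using W_neg2.IH[OF W_neg2.prems] W_neg2.hyps by (intro W.W_neg2) auto
  thus ?thesis using False by simp
 qed
 have "W (Suc d) (letter (br x y) * u)" using W_neg2 by (intro W.W_neg1 Pos_Neg2)
 hence "W (Suc d) (letter y * (letter x * u) + letter (br x y) * u)" using 1 by (intro W.W_add)
 hence "W (Suc d) (letter x * (letter y * u))"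
  by (rule W_cong) (rule commute_cong[OF Pos(1)[OF W_neg2.prems] Neg2[OF W_neg2.hyps(2)] W_F[OF W_neg2.hyps(1)]])
 thus ?case by simp
next
 case (W_add d u v)
 thus ?case by (cases "d = 0") (simp_all add: distrib_left J0_add W.W_add)
next
 case (W_scl d u c)
 have "letter x * (scl c * u) = scl c * (letter x * u)"
  by (simp only: mult.assoc[symmetric] scl_comm)
 thus ?case using W_scl.IH[OF W_scl.prems] by (cases "d = 0") (simp_all add: J0_lmult fr_scalar W.W_scl)
qed

lemma W_0: "W d u \<Longrightarrow> d = 0 \<Longrightarrow> \<exists>a. AA a \<and> J0 (u - a)"
proof (induction rule: W.induct)
 case (W_AA u) thus ?case using J0_zero by (intro exI[of _ u]) simp
next
 case (W_J u d) thus ?case using AA_zero by (intro exI[of _ 0]) simp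
next
 case (W_add d u v)
 then obtain a a' where a: "AA a" "J0 (u - a)" "AA a'" "J0 (v - a')" by blast
 have "u + v - (a + a') = (u - a) + (v - a')" by simp
 thus ?case using J0_add[OF a(2,4)] AA_add[OF a(1,3)] by (intro exI[of _ "a + a'"]) (simp add: algebra_simps)
next
 case (W_scl d u c)
 then obtain a where a: "AA a" "J0 (u - a)" by blast
 have "scl c * u - scl c * a = scl c * (u - a)" by (simp add: right_diff_distrib)
 thus ?case using J0_lmult[OF a(2) fr_scalar, of c] AA_scl[OF a(1), of c] by (intro exI[of _ "scl c * a"]) simp
qed auto

lemma W_pow_pos: "W d u \<Longrightarrow> x \<in> Pos \<Longrightarrow> m \<le> d \<Longrightarrow> W (d - m) (letter x ^ m * u)"
proof (induction m)
 case (Suc m)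
 have "W (d - m) (letter x ^ m * u)" using Suc by simp
 from W_pos[OF this Suc.prems(2)] have "W (d - m - 1) (letter x * (letter x ^ m * u))" using Suc.prems by simp
 thus ?case by (simp add: mult.assoc)
qed simp

lemma W_pow1: "y \<in> Neg1 \<Longrightarrow> W r (letter y ^ r)"
proof (induction r)
 case (Suc r) thus ?case using W_neg1[of r "letter y ^ r" y] by simp
qed (simp add: W_AA AA_one)

lemma W_pow2: "y \<in> Neg2 \<Longrightarrow> W (2 * r) (letter y ^ r)"
proof (induction r)
 case (Suc r) thus ?case using W_neg2[of "2 * r" "letter y ^ r" y] by simp
qed (simp add: W_AA AA_one)

lemma W_Lin: "W 0 u \<Longrightarrow> \<exists>p. AA p \<and> J0 (u - Lin (Theta p))"
proof -
 assume "W 0 u"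
 then obtain a where a: "AA a" "J0 (u - a)" using W_0 by blast
 have "J0 (a - Lin (Theta a))" by (rule J0_UU[OF straighten[OF AA_HH[OF a(1)]]])
 from J0_add[OF a(2) this] show ?thesis using a(1) by auto
qed

end

section \<open>The rank one subalgebras of the simple roots\<close>

context A2n2
begin

definition shiftfam :: "('g \<Rightarrow> complex) \<Rightarrow> 'g set" where
 "shiftfam f = (\<Union>k. root_space G (\<lambda>h. f h + of_nat k * delta n G h))"

lemma shiftfamI: "x \<in> root_space G (\<lambda>h. f h + of_nat k * delta n G h) \<Longrightarrow> x \<in> shiftfam f"
 by (auto simp: shiftfam_def)

lemma shiftfam_eta:
 assumes "x \<in> shiftfam f"
 shows "br (eta j i) x \<in> shiftfam f" "br x (eta j i) \<in> shiftfam f"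
proof -
 obtain k where k: "x \<in> root_space G (\<lambda>h. f h + of_nat k * delta n G h)" using assms by (auto simp: shiftfam_def)
 obtain l where l: "br (eta j i) x \<in> root_space G (\<lambda>h. f h + of_nat l * delta n G h)" using eta_br_rs[OF k] by blast
 thus "br (eta j i) x \<in> shiftfam f" by (rule shiftfamI)
 have "br x (eta j i) = sm (- 1) (br (eta j i) x)" using br_anti[of x "eta j i"] by simp
 thus "br x (eta j i) \<in> shiftfam f" using shiftfamI[OF rs_sm[OF l, of "- 1"]] by simp
qed

lemma shift_current:
 assumes "1 \<le> j" "j \<le> n" "e = 1 \<or> e = - 1" "k \<ge> 1" "x \<in> root_space G (\<lambda>h. e * al j h + of_nat k * delta n G h)"
 shows "x \<in> Cg"
proof -
 \<comment> \<open>The coefficients of the root in terms of the simple roots. With a minus sign the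
   one at j is still a natural number because k >= 1.\<close>
 define c where "c i = (if i = j then (if e = 1 then k * (if i = n then 1 else 2) + 1 else k * (if i = n then 1 else 2) - 1)
  else k * (if i = n then 1 else 2))" for i
 have c: "(of_nat (c i) :: complex) = of_nat k * (if i = n then 1 else 2) + (if i = j then e else 0)" for i
 proof -
  have "k * (if i = n then 1 else 2) \<ge> 1" using assms(4) by auto
  hence "(of_nat (k * (if i = n then 1 else 2) - 1) :: complex) = of_nat k * (if i = n then 1 else 2) - 1"
   by (subst of_nat_diff) auto
  thus ?thesis using assms(3) by (auto simp: c_def)
 qed
 show ?thesis
 proof (rule rs_combo_current[OF assms(5)])
  fix h show "e * al j h + of_nat k * delta n G h = root_combination G {..n} (\<lambda>i. of_nat (c i)) h"
   unfolding c combo_shift[OF assms(1,2)] by simp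
  show "c 0 \<ge> 1" using assms n1 by (simp add: c_def)
 qed
qed

lemma half_shift_current:
 assumes "e = 1 \<or> e = - 1" "x \<in> root_space G (\<lambda>h. (e * al n h + delta n G h) / 2 + of_nat k * delta n G h)"
 shows "x \<in> Cg"
proof -
 \<comment> \<open>Halving is harmless: the coefficients of \<delta> other than that at n are 2, and
   at n the halves of \<open>\<alpha>\<^sub>n\<close> and \<delta> combine to 1 or 0.\<close>
 define c where "c i = (if i = n then (if e = 1 then k + 1 else k) else 2 * k + 1)" for i
 have c: "(of_nat (c i) :: complex) = (of_nat k + 1 / 2) * (if i = n then 1 else 2) + (if i = n then e / 2 else 0)" for i
  using assms(1) by (auto simp: c_def field_simps)
 show ?thesis
 proof (rule rs_combo_current[OF assms(2)])
  fix h show "(e * al n h + delta n G h) / 2 + of_nat k * delta n G h = root_combination G {..n} (\<lambda>i. of_nat (c i)) h"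
   unfolding c combo_shift[OF n1 order_refl] by (simp add: field_simps)
  show "c 0 \<ge> 1" using n1 by (simp add: c_def)
 qed
qed

lemma al_shiftfam_current:
 assumes "1 \<le> j" "j \<le> n"
 shows "x \<in> shiftfam (al j) \<Longrightarrow> x \<in> Cg" "x \<in> shiftfam (\<lambda>h. - al j h) \<Longrightarrow> x \<in> Cg"
proof -
 assume "x \<in> shiftfam (al j)"
 then obtain k where k: "x \<in> root_space G (\<lambda>h. al j h + of_nat k * delta n G h)" by (auto simp: shiftfam_def)
 show "x \<in> Cg"
 proof (cases "k = 0")
  case True thus ?thesis using al_rs_current[OF _ assms] k by simp
 next
  case False thus ?thesis using shift_current[OF assms, of 1 k x] k by simp
 qed
next
 assume "x \<in> shiftfam (\<lambda>h. - al j h)"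
 then obtain k where k: "x \<in> root_space G (\<lambda>h. - al j h + of_nat k * delta n G h)" by (auto simp: shiftfam_def)
 show "x \<in> Cg"
 proof (cases "k = 0")
  case True
  have "(\<lambda>h. - al j h) = - al j" by (simp add: fun_eq_iff)
  hence "x \<in> root_space G (- al j)" using k True by simp
  thus ?thesis using FP_current[OF neg_al_rs_FP[OF _ assms]] by blast
 next
  case False thus ?thesis using shift_current[OF assms, of "- 1" k x] k by simp
 qed
qed

lemma f_shiftfam: "1 \<le> j \<Longrightarrow> j \<le> n \<Longrightarrow> gen_f G j \<in> shiftfam (\<lambda>h. - al j h)"
proof (rule shiftfamI[of _ _ 0])
 assume "1 \<le> j" "j \<le> n"
 moreover have "(\<lambda>h. - al j h + of_nat 0 * delta n G h) = - al j" by (simp add: fun_eq_iff)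
 ultimately show "gen_f G j \<in> root_space G (\<lambda>h. - al j h + of_nat 0 * delta n G h)" using f_rs[of j] by simp
qed

lemma rs_br_zero:
 assumes "1 \<le> j" "j \<le> n" "x \<in> root_space G (al j)" "y \<in> root_space G (- al j)"
 shows "br x y \<in> fin_cartan n G"
proof -
 have x: "br h0 x = sm (of_int 1) x" using rsD[OF assms(3) h0(1)] h0(2) assms(2) by simp
 have y: "br h0 y = sm (of_int (- 1)) y" using rsD[OF assms(4) h0(1)] h0(2) assms(2) by simp
 from eigen_T(1)[OF x] have "P 1 1 x (Phi x 1)" by (simp add: T_def)
 hence "FP 1 1 x" by (rule P_FP) (use rsD[OF assms(3) sc(1)] sc(3) assms in auto)
 moreover have "T (- int 1) y (Phi y (- 1))" using eigen_T(1)[OF y] by simp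
 ultimately show ?thesis by (rule FP_low)
qed

text \<open>For j < n every \<open>\<alpha>\<^sub>j + k \<delta>\<close> is a root of Cn+, so there
  is no depth 2. Y has the root \<open>\<alpha>\<^sub>j + \<delta>\<close> and depth is consumed
  letter by letter: r letters Y against r letters f.\<close>

lemma rank_one_short:
 assumes j: "1 \<le> j" "j < n"
 shows "\<exists>Y. Y \<in> Cg \<and> T (N + 1) Y (Xc (int j) (N + int j + 1)) \<and>
  (\<forall>r. \<exists>p. AA p \<and> J0 (letter Y ^ r * letter (gen_f G j) ^ r - Lin (Theta p)))"
proof -
 have jn: "j \<le> n" using j by simp
 interpret r: rank_one G n "shiftfam (al j)" "shiftfam (\<lambda>h. - al j h)" "{}"
 proof unfold_locales
  fix x assume "x \<in> shiftfam (al j)"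
  then obtain k where k: "x \<in> root_space G (\<lambda>h. al j h + of_nat k * delta n G h)" by (auto simp: shiftfam_def)
  have "(\<lambda>h. al j h + of_nat k * delta n G h) \<in> real_roots_pos n G"
  proof (cases "k = 0")
   case True thus ?thesis using al_fin[OF j(1) jn] by (simp add: real_roots_pos_def)
  next
   case False
   hence "k \<ge> 1" by simp
   thus ?thesis using al_fin[OF j(1) jn] al_short[OF j] unfolding real_roots_pos_def by blast
  qed
  thus "x \<in> current_n_plus n G" using k by (rule n_plus_rs)
 next
  fix x y assume "x \<in> shiftfam (al j)" "y \<in> shiftfam (\<lambda>h. - al j h)"
  then obtain k l where k: "x \<in> root_space G (\<lambda>h. al j h + of_nat k * delta n G h)"
   and l: "y \<in> root_space G (\<lambda>h. - al j h + of_nat l * delta n G h)" by (auto simp: shiftfam_def)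
  show "br x y \<in> HH"
  proof (cases "k + l = 0")
   case True
   have "(\<lambda>h. - al j h) = - al j" by (simp add: fun_eq_iff)
   thus ?thesis using rs_br_zero[OF j(1) jn, of x y] k l True by (intro fin_cartan_HH) simp
  next
   case False
   have "br x y \<in> root_space G (\<lambda>h. of_nat (k + l) * delta n G h)"
    by (rule rs_br[OF k l]) (simp add: algebra_simps)
   thus ?thesis by (rule imaginary_HH) (use False in linarith)
  qed
 qed (use al_shiftfam_current[OF j(1) jn] shiftfam_eta in auto)
 have "int j + 1 \<le> 2 * int n" using j by simp
 then obtain Y where "T (N + (int j + 1) - int j) Y (Xc (int j) (N + (int j + 1)))"
  using hasX_Nl[of "int j" "int j + 1"] j by auto
 hence Y: "T (N + 1) Y (Xc (int j) (N + int j + 1))" by (simp add: add.assoc)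
 have "Y \<in> root_space G (\<lambda>h. al j h + of_nat 1 * delta n G h)"
 proof (rule rs_I[OF Y])
  fix h m assume c: "Xc (int j) (N + int j + 1) m \<noteq> 0"
  have "lab m = j"
  proof (cases "N dvd m - int j")
   case True thus ?thesis using lab_cong[OF True] lab_self[OF jn] by simp
  next
   case False
   hence "N dvd m + (N + int j + 1)" using c by (auto simp: Xc_def)
   hence "N dvd (m + int j + 1) + N" by (simp add: algebra_simps)
   hence "N dvd m + int j + 1" by (simp only: dvd_shift)
   hence "N dvd m - (- 1 - int j)" by (simp add: algebra_simps)
   from lab_cong[OF this] show ?thesis using lab_refl[of "int j"] lab_self[OF jn] by simp
  qed
  moreover have "m + (N + 1) = m + 1 + N" by simp
  ultimately show "al j h + of_nat 1 * delta n G h = pih h m - pih h (m + (N + 1))"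
   using pih_step[of h m] pih_period[of h "m + 1"] by (simp only: delta_pih) (simp add: algebra_simps)
 qed (use N3 in simp)
 hence YP: "Y \<in> shiftfam (al j)" by (rule shiftfamI)
 have "\<exists>p. AA p \<and> J0 (letter Y ^ r * letter (gen_f G j) ^ r - Lin (Theta p))" for r
  using r.W_Lin[of "letter Y ^ r * letter (gen_f G j) ^ r"]
   r.W_pow_pos[OF r.W_pow1[OF f_shiftfam[OF j(1) jn], of r] YP, of r] by simp
 thus ?thesis using Y r.Pos(1)[OF YP] by blast
qed

lemma pih_n: "2 * pih h (int n) = al n h - delta n G h" "pih h N = - delta n G h"
proof -
 have "pih h (int n) - pih h (- int n + N) = al n h"
  using pih_step[of h "int n"] lab_self[of n] by (simp add: N_def)
 thus "2 * pih h (int n) = al n h - delta n G h"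
  using pih_period[of h "- int n"] pih_neg[of h "int n"] by (simp add: delta_pih algebra_simps)
qed (simp add: delta_pih)

text \<open>\<open>\<alpha>\<^sub>n + \<delta>\<close> is not among the roots of Cn+, so Y is taken
  with half of it. Then f has depth 2, the negatives of the half roots have depth 1, and 2r letters
  Y are balanced by r letters f.\<close>

lemma rank_one_long:
 shows "\<exists>Y. Y \<in> Cg \<and> T (N - int n) Y (Xc (int n) N) \<and>
  (\<forall>r. \<exists>p. AA p \<and> J0 (letter Y ^ (2 * r) * letter (gen_f G n) ^ r - Lin (Theta p)))"
proof -
 let ?P = "shiftfam (\<lambda>h. (1 * al n h + delta n G h) / 2)" and ?N = "shiftfam (\<lambda>h. (- 1 * al n h + delta n G h) / 2)"
 interpret r: rank_one G n ?P ?N "shiftfam (\<lambda>h. - al n h)"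
 proof unfold_locales
  fix x assume "x \<in> ?P"
  then obtain k where k: "x \<in> root_space G (\<lambda>h. (1 * al n h + delta n G h) / 2 + of_nat k * delta n G h)" by (auto simp: shiftfam_def)
  show "x \<in> Cg" by (rule half_shift_current[OF _ k]) simp
  have e: "(\<lambda>h. (1 * al n h + delta n G h) / 2 + of_nat k * delta n G h) = (\<lambda>h. (al n h + (2 * of_nat k + 1) * delta n G h) / 2)"
   by (simp add: fun_eq_iff field_simps)
  have "al n \<in> long_roots n G \<inter> fin_pos_roots n G" using al_fin[OF n1 order_refl] al_n_long by blast
  hence "(\<lambda>h. (al n h + (2 * of_nat k + 1) * delta n G h) / 2) \<in> real_roots_pos n G"
   unfolding real_roots_pos_def by blast
  thus "x \<in> current_n_plus n G" using k unfolding e by (rule n_plus_rs)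
 next
  fix y assume "y \<in> ?N"
  then obtain k where k: "y \<in> root_space G (\<lambda>h. (- 1 * al n h + delta n G h) / 2 + of_nat k * delta n G h)" by (auto simp: shiftfam_def)
  show "y \<in> Cg" by (rule half_shift_current[OF _ k]) simp
 next
  fix x y assume "x \<in> ?P" "y \<in> ?N"
  then obtain k l where k: "x \<in> root_space G (\<lambda>h. (1 * al n h + delta n G h) / 2 + of_nat k * delta n G h)"
   and l: "y \<in> root_space G (\<lambda>h. (- 1 * al n h + delta n G h) / 2 + of_nat l * delta n G h)" by (auto simp: shiftfam_def)
  have "br x y \<in> root_space G (\<lambda>h. of_nat (k + l + 1) * delta n G h)"
   by (rule rs_br[OF k l]) (simp add: field_simps)
  thus "br x y \<in> HH" by (rule imaginary_HH) simp
 next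
  fix x y assume "x \<in> ?P" "y \<in> shiftfam (\<lambda>h. - al n h)"
  then obtain k l where k: "x \<in> root_space G (\<lambda>h. (1 * al n h + delta n G h) / 2 + of_nat k * delta n G h)"
   and l: "y \<in> root_space G (\<lambda>h. - al n h + of_nat l * delta n G h)" by (auto simp: shiftfam_def)
  have "br x y \<in> root_space G (\<lambda>h. (- 1 * al n h + delta n G h) / 2 + of_nat (k + l) * delta n G h)"
   by (rule rs_br[OF k l]) (simp add: field_simps)
  thus "br x y \<in> ?N" by (rule shiftfamI)
 qed (use al_shiftfam_current(2)[OF n1 order_refl] shiftfam_eta in blast)+
 obtain Y where Y: "T (N - int n) Y (Xc (int n) N)" using hasX_N[of "int n"] n1 by auto
 have "Y \<in> root_space G (\<lambda>h. (1 * al n h + delta n G h) / 2 + of_nat 0 * delta n G h)"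
 proof (rule rs_I[OF Y])
  fix h m assume c: "Xc (int n) N m \<noteq> 0"
  have "N dvd m - int n \<or> N dvd m"
  proof (cases "N dvd m - int n")
   case False
   hence "N dvd m + N" using c by (auto simp: Xc_def)
   thus ?thesis by (simp only: dvd_shift simp_thms)
  qed simp
  then obtain z where "m = int n + z * N \<or> m = 0 + z * N"
  proof
   assume "N dvd m - int n"
   then obtain z where "m - int n = N * z" by (rule dvdE)
   hence "m = int n + z * N" by (simp add: algebra_simps)
   thus ?thesis using that[of z] by simp
  next
   assume "N dvd m"
   then obtain z where "m = N * z" by (rule dvdE)
   thus ?thesis using that[of z] by (simp add: mult.commute)
  qed
  moreover have p: "pih h (a + z * N) - pih h (a + z * N + (N - int n)) = pih h a - pih h (a + (N - int n))" for a
   using pih_period_mult[of h a z] pih_period_mult[of h "a + (N - int n)" z] by (simp add: add_ac)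
  moreover have "pih h (int n) - pih h (int n + (N - int n)) = (al n h + delta n G h) / 2"
   using pih_n[of h] by (simp add: field_simps)
  moreover have "pih h 0 - pih h (0 + (N - int n)) = (al n h + delta n G h) / 2"
  proof -
   have "2 * pih h (0 + (N - int n)) = - (al n h + delta n G h)"
   proof -
    have "0 + (N - int n) = - int n + N" by simp
    hence "pih h (0 + (N - int n)) = - pih h (int n) - delta n G h"
     using pih_period[of h "- int n"] pih_neg[of h "int n"] pih_n(2)[of h] by (simp only: ) simp
    hence "2 * pih h (0 + (N - int n)) = - (2 * pih h (int n)) - 2 * delta n G h" by (simp only: ) simp
    thus ?thesis unfolding pih_n(1) by (simp only: ) simp
   qed
   moreover have "0 - x = a / 2" if "2 * x = - a" for x a :: complex
   proof -
    have "a = - (2 * x)" using that by simp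
    thus ?thesis by simp
   qed
   ultimately show ?thesis unfolding pih_0 by blast
  qed
  ultimately have "pih h m - pih h (m + (N - int n)) = (al n h + delta n G h) / 2" by metis
  thus "(1 * al n h + delta n G h) / 2 + of_nat 0 * delta n G h = pih h m - pih h (m + (N - int n))" by simp
 qed (simp add: N_def)
 hence YP: "Y \<in> ?P" by (rule shiftfamI)
 have "\<exists>p. AA p \<and> J0 (letter Y ^ (2 * r) * letter (gen_f G n) ^ r - Lin (Theta p))" for r
  using r.W_Lin[of "letter Y ^ (2 * r) * letter (gen_f G n) ^ r"]
   r.W_pow_pos[OF r.W_pow2[OF f_shiftfam[OF n1 order_refl], of r] YP, of "2 * r"] by simp
 thus ?thesis using Y r.Pos(1)[OF YP] by blast
qed

end

text \<open>Index \<open>(j, 0)\<close> counts the sites of type \<open>j\<close>; index \<open>(j, r)\<close> is an elementary symmetric function of their parameters.\<close>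

definition site_tau :: "nat set \<Rightarrow> (nat \<Rightarrow> nat) \<Rightarrow> (nat \<Rightarrow> complex) \<Rightarrow> nat \<times> nat \<Rightarrow> complex" where
 "site_tau Sg J b v = (if snd v = 0 then of_nat (card {s\<in>Sg. J s = fst v}) else esym b {s\<in>Sg. J s = fst v} (snd v))"

text \<open>The number of orders in which 2r + q moves bring back r sites that are two moves, and q
  sites that are one move, away from the ground state.\<close>

function cc :: "nat \<Rightarrow> nat \<Rightarrow> nat" where
 "cc r q = (if r = 0 \<and> q = 0 then 1 else (if r = 0 then 0 else r * cc (r - 1) (Suc q)) + (if q = 0 then 0 else q * cc r (q - 1)))"
 by auto
termination by (relation "measure (\<lambda>(r, q). 2 * r + q)") auto

declare cc.simps [simp del]

lemma cc_pos: "cc r q > 0"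
proof (induction r q rule: cc.induct)
 case (1 r q)
 show ?case
 proof (cases "r = 0")
  case True thus ?thesis using 1 by (subst cc.simps) auto
 next
  case False thus ?thesis using 1(1) by (subst cc.simps) auto
 qed
qed

lemma (in free_rep) act_sum: "act (sum p K) v = (\<Sum>k\<in>K. act (p k) v)"
 by (induction K rule: infinite_finite_induct) (auto simp: act_add)

section \<open>Normal forms acting on the vacuum\<close>

context fock_data
begin

lemma mat_T: "T k x c \<Longrightarrow> mat (b s) x p q = c p * qv (b s) q (p + k)"
 by (simp add: mat_def opx_T)

lemma eta_T': "1 \<le> j \<Longrightarrow> j \<le> n \<Longrightarrow> T (int k * N) (eta j k) (Phi (eta j k) (int k * N))"
proof (cases "k = 0")
 case True
 assume j: "1 \<le> j" "j \<le> n"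
 thus ?thesis using True cv_H[of j] by (auto simp: T_def eta_0 Phi_H fun_eq_iff)
next
 case False
 assume j: "1 \<le> j" "j \<le> n"
 have e: "T (int k * N) (eta j k) (etac j k)" using eta_T j False by simp
 hence "Phi (eta j k) (int k * N) = etac j k" by (auto simp: Phi_T)
 thus ?thesis using e by simp
qed

lemma act_eta: "fr.act (letter (eta j k)) v0 = sF (\<Sum>s\<in>{s\<in>Sg. J s = j}. b s ^ k) v0"
proof (cases "1 \<le> j \<and> j \<le> n")
 case True
 hence T: "T (int k * N) (eta j k) (Phi (eta j k) (int k * N))" using eta_T' by simp
 have "rho (eta j k) v0 = sF (chi (eta j k)) v0"
 proof (rule rho_diag)
  fix l m assume nz: "Phi (eta j k) l m \<noteq> 0"
  have "l = int k * N"
  proof (rule ccontr)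
   assume "l \<noteq> int k * N"
   hence "Phi (eta j k) l m = 0" by (subst Phi_T[OF T]) simp
   thus False using nz by simp
  qed
  thus "N dvd l" by simp
 qed
 moreover have "chi (eta j k) = (\<Sum>s\<in>Sg. if J s = j then b s ^ k else 0)"
  unfolding chi_def
 proof (rule sum.cong[OF refl])
  fix s assume s: "s \<in> Sg"
  have "mat (b s) (eta j k) p p = Phi (eta j k) (int k * N) p * b s ^ k" for p
   using mat_T[OF T, of s p p] N3 by (simp add: qv_def)
  hence "(\<Sum>p\<in>{1..int (J s)}. mat (b s) (eta j k) p p) = omega (J s) k (eta j k) * b s ^ k"
   by (simp add: omega_def sum_distrib_right)
  thus "(\<Sum>p\<in>{1..int (J s)}. mat (b s) (eta j k) p p) = (if J s = j then b s ^ k else 0)"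
   using omega_eta[of j "J s" k k] J[OF s] True by auto
 qed
 moreover have "(\<Sum>s\<in>Sg. if J s = j then b s ^ k else 0) = (\<Sum>s\<in>{s\<in>Sg. J s = j}. b s ^ k)"
  using finSg by (simp add: sum.inter_filter)
 ultimately show ?thesis by simp
next
 case False
 hence e: "{s\<in>Sg. J s = j} = {}" using J by auto
 show ?thesis unfolding e using False by (simp add: eta_out rho_0 sF_def fun_eq_iff)
qed

abbreviation tau where "tau \<equiv> site_tau Sg J b"

lemma sF_sF: "sF c (sF d f) = sF (c * d) f" by (simp add: sF_def mult.assoc)

lemma act_Eh: "fr.act (Eh j r) v0 = sF (esym b {s\<in>Sg. J s = j} r) v0"
proof (induction r rule: less_induct)
 case (less r)
 let ?S = "{s\<in>Sg. J s = j}"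
 have fin: "finite ?S" using finSg by simp
 show ?case
 proof (cases r)
  case 0 thus ?thesis by (simp add: esym_0[OF fin])
 next
  case (Suc q)
  have "fr.act (Eh j r) v0 = sF (1 / of_nat (Suc q)) (\<Sum>k\<le>q. sF ((- 1) ^ k * (\<Sum>s\<in>?S. b s ^ Suc k) * esym b ?S (q - k)) v0)"
  proof -
   have "fr.act (scl ((- 1) ^ k) * letter (eta j (Suc k)) * Eh j (q - k)) v0
     = sF ((- 1) ^ k * (\<Sum>s\<in>?S. b s ^ Suc k) * esym b ?S (q - k)) v0" for k
   proof -
    have "fr.act (Eh j (q - k)) v0 = sF (esym b ?S (q - k)) v0" by (rule less) (simp add: Suc)
    thus ?thesis unfolding fr.act_mult fr.act_scalar by (simp only: fr.act_v_s act_eta sF_sF mult_ac)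
   qed
   thus ?thesis unfolding Suc Eh.simps(2) fr.act_mult[of "scl (1 / of_nat (Suc q))"] fr.act_scalar fr.act_sum by simp
  qed
  also have "\<dots> = sF (1 / of_nat (Suc q) * (\<Sum>k\<le>q. (- 1) ^ k * (\<Sum>s\<in>?S. b s ^ Suc k) * esym b ?S (q - k))) v0"
   unfolding fr.scale_sum_left[symmetric] sF_sF ..
  also have "(\<Sum>k\<le>q. (- 1) ^ k * (\<Sum>s\<in>?S. b s ^ Suc k) * esym b ?S (q - k)) = of_nat (Suc q) * esym b ?S (Suc q)"
   by (rule newton_identity[OF fin, symmetric])
  finally show ?thesis unfolding Suc by (simp del: of_nat_Suc)
 qed
qed

lemma act_Ehat: "fr.act (Ehat v) v0 = sF (tau v) v0"
proof (cases "snd v = 0")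
 case True
 thus ?thesis using act_eta[of "fst v" 0] by (simp add: Ehat_def site_tau_def)
next
 case False
 thus ?thesis using act_Eh[of "fst v" "snd v"] by (simp add: Ehat_def site_tau_def)
qed

lemma act_prodl: "fr.act (prodl vs) v0 = sF (mon tau (mono vs)) v0"
 by (induction vs) (simp_all add: fr.act_mult fr.act_v_s act_Ehat sF_sF mon_add mult.commute)

lemma act_L: "fr.act (L m) v0 = sF (mon tau m) v0"
 unfolding L_def act_prodl someI_ex[OF ex_mono[of m]] ..

lemma act_Lin: "fr.act (Lin q) v0 = sF (ev.psubst tau q) v0"
proof (induction q rule: pm_induct)
 case 1 thus ?case by (simp only: Lin_0 fr.act_0 ev.psubst_0 fr.scale_zero_left)
next
 case (2 m c) thus ?case by (simp add: Lin_single fr.act_mult fr.act_scalar act_L sF_sF)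
next
 case (3 p q) thus ?case by (simp add: Lin_add fr.act_add ev.psubst_add fr.scale_left_distrib)
qed

lemma act_congr: "p - q \<in> UU \<Longrightarrow> fr.act p v = fr.act q v"
 using act_uea[of "p - q" v] by (simp add: fr.act_diff)

lemma act_J0: "J0 p \<Longrightarrow> fr.act p v0 = 0"
 by (induction rule: J0.induct) (simp_all add: act_uea fr.act_mult fr.act_add act_n_plus del: fr.act_letter)

lemma sum_at: "(\<Sum>k\<in>K. u k) U = (\<Sum>k\<in>K. (u k U :: complex))"
 by (induction K rule: infinite_finite_induct) auto

lemma sF_cancel: "sF c v0 = sF d v0 \<Longrightarrow> c = d"
 using v0_nz by (auto simp: sF_def dest: fun_cong[of _ _ S0])

subsection \<open>Excitations of the vacuum\<close>

text \<open>The configuration in which, at each site s, the particles below the top one rest in 1,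
  ..., J s - 1 and the top particle sits at \<open>st s\<close>.\<close>

definition St :: "(nat \<Rightarrow> int) \<Rightarrow> (nat \<times> int) set" where
 "St st = Sigma Sg (\<lambda>s. insert (st s) {1..int (J s) - 1})"

definition vst :: "(nat \<Rightarrow> int) \<Rightarrow> (nat \<times> int) set \<Rightarrow> complex" where "vst st = fk.vac (St st)"

lemma vst_ground: "v0 = vst (\<lambda>s. int (J s))"
proof -
 have "insert (int (J s)) {1..int (J s) - 1} = {1..int (J s)}" if "s \<in> Sg" for s using J[OF that] by auto
 hence "S0 = St (\<lambda>s. int (J s))" unfolding S0_def St_def by (intro Sigma_cong) auto
 thus ?thesis by (simp add: v0_def vst_def)
qed

text \<open>An operator that can only move the top particle of each site, and only to the position \<open>t s\<close>.\<close>

lemma rho_top: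
 assumes st: "\<And>s. s \<in> Sg \<Longrightarrow> int (J s) \<le> st s \<and> st s \<le> N" and t: "\<And>s. s \<in> Sg \<Longrightarrow> int (J s) \<le> t s \<and> t s \<le> N"
  and low: "\<And>s p q. s \<in> Sg \<Longrightarrow> 1 \<le> p \<Longrightarrow> p \<le> N \<Longrightarrow> 1 \<le> q \<Longrightarrow> q < int (J s) \<Longrightarrow> mat (b s) x p q \<noteq> 0
    \<Longrightarrow> p \<noteq> q \<and> (p < int (J s) \<or> p = st s)"
  and top: "\<And>s p. s \<in> Sg \<Longrightarrow> 1 \<le> p \<Longrightarrow> p \<le> N \<Longrightarrow> mat (b s) x p (st s) \<noteq> 0 \<Longrightarrow> p \<noteq> st s \<and> (p < int (J s) \<or> p = t s)"
 shows "rho x (vst st) = (\<Sum>s\<in>Sg. sF (mat (b s) x (t s) (st s)) (vst (st(s := t s))))"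
proof
 fix U
 let ?g = "\<lambda>(a, c). M x a c * fk.cr a (fk.an c (vst st)) U"
 let ?e = "\<lambda>s. ((s, t s), (s, st s))"
 have inI: "(s, t s) \<in> I" "(s, st s) \<in> I" if "s \<in> Sg" for s
  using st[OF that] t[OF that] J[OF that] that by (auto simp: I_def)
 have "rho x (vst st) U = sum ?g (I \<times> I)" by (simp add: rho_def fk.bil_def sum.cartesian_product)
 also have "\<dots> = sum ?g (?e ` Sg)"
 proof (rule sum.mono_neutral_right)
  show "\<forall>z\<in>I \<times> I - ?e ` Sg. ?g z = 0"
  proof
   fix z assume z: "z \<in> I \<times> I - ?e ` Sg"
   obtain s p s' q where zz: "z = ((s, p), (s', q))" by (metis surj_pair)
   have I: "s \<in> Sg" "s' \<in> Sg" "1 \<le> p" "p \<le> N" "1 \<le> q" "q \<le> N" and ne: "z \<noteq> ?e s" using z by (auto simp: zz I_def)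
   show "?g z = 0"
   proof (cases "s = s' \<and> mat (b s) x p q \<noteq> 0")
    case False thus ?thesis by (auto simp: zz M_def)
   next
    case True
    have "fk.cr (s, p) (fk.an (s', q) (fk.vac (St st))) U = 0"
    proof (rule fk.hop_zero)
     show "(s', q) \<notin> St st \<or> (s, p) \<in> St st \<and> (s, p) \<noteq> (s', q)"
      using low[of s p q] top[of s p] True I ne by (auto simp: St_def zz)
    qed
    thus ?thesis by (simp add: zz vst_def)
   qed
  qed
 qed (use fk.fin inI in auto)
 also have "\<dots> = (\<Sum>s\<in>Sg. ?g (?e s))" by (subst sum.reindex) (auto simp: inj_on_def)
 also have "\<dots> = (\<Sum>s\<in>Sg. sF (mat (b s) x (t s) (st s)) (vst (st(s := t s))) U)"
 proof (rule sum.cong[OF refl])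
  fix s assume s: "s \<in> Sg"
  show "?g (?e s) = sF (mat (b s) x (t s) (st s)) (vst (st(s := t s))) U"
  proof (cases "mat (b s) x (t s) (st s) = 0")
   case True thus ?thesis by (simp add: M_def sF_def)
  next
   case False
   have ts: "t s \<noteq> st s" using top[OF s _ _ False] t[OF s] J[OF s] by auto
   have "fk.cr (s, t s) (fk.an (s, st s) (fk.vac (St st))) = fk.vac (insert (s, t s) (St st - {(s, st s)}))"
   proof (rule fk.hop[OF inI[OF s]])
    show "(s, st s) \<in> St st" "(s, t s) \<notin> St st" using s ts t[OF s] by (auto simp: St_def)
    fix z assume z: "z \<in> St st" "z \<noteq> (s, st s)"
    obtain s' p where zz: "z = (s', p)" by (cases z)
    show "z < (s, t s) \<longleftrightarrow> z < (s, st s)"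
     using z st[OF s] t[OF s] by (auto simp: St_def zz)
   qed
   moreover have "insert (s, t s) (St st - {(s, st s)}) = St (st(s := t s))"
    using s st[OF s] ts by (auto simp: St_def split: if_splits)
   ultimately show ?thesis by (simp add: M_def sF_def vst_def)
  qed
 qed
 finally show "rho x (vst st) U = (\<Sum>s\<in>Sg. sF (mat (b s) x (t s) (st s)) (vst (st(s := t s)))) U"
  by (simp add: sum_at)
qed

abbreviation Sj where "Sj j \<equiv> {s\<in>Sg. J s = j}"

text \<open>Sites in \<open>R\<close> are excited to \<open>j + 1\<close>, those in \<open>K\<close> to \<open>N\<close>.\<close>

definition exc :: "nat \<Rightarrow> nat set \<Rightarrow> nat set \<Rightarrow> nat \<Rightarrow> int" where
 "exc j R K s = (if s \<in> R then int j + 1 else if s \<in> K then N else int (J s))"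

lemma exc_bounds: "s \<in> Sg \<Longrightarrow> R \<subseteq> Sj j \<Longrightarrow> int (J s) \<le> exc j R K s \<and> exc j R K s \<le> N"
 using J[of s] n1 by (auto simp: exc_def N_def)

lemma T_F: "1 \<le> j \<Longrightarrow> j \<le> n \<Longrightarrow> T (- 1) (gen_f G j) (\<lambda>m. of_bool (lab (m - 1) = j))"
proof -
 assume j: "1 \<le> j" "j \<le> n"
 have "P (- 1) 1 (g (- 1) j) (cg (- 1) j)" by (rule P_gen) (use j in simp)
 moreover have "cg (- 1) j = (\<lambda>m. of_bool (lab (m - 1) = j))" using j by (auto simp: cg_def ka_def fun_eq_iff)
 moreover have "g (- 1) j = gen_f G j" by (simp add: g_def)
 ultimately show ?thesis by (simp add: T_def)
qed

lemma small_dvd: "\<bar>a\<bar> < N \<Longrightarrow> N dvd a \<longleftrightarrow> a = 0"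
 using dvd_imp_le_int[of a N] by auto

lemma mat_F:
 assumes "1 \<le> j" "j \<le> n" "1 \<le> p" "p \<le> N" "1 \<le> q" "q \<le> N"
 shows "mat (b s) (gen_f G j) p q = of_bool (p = q + 1 \<and> lab q = j)"
proof (cases "N dvd p - 1 - q")
 case True
 have l: "lab (p - 1) = lab q" by (rule lab_cong) (use True in \<open>simp add: algebra_simps\<close>)
 have "p - 1 - q = 0 \<or> p - 1 - q = - N"
 proof (cases "\<bar>p - 1 - q\<bar> < N")
  case False thus ?thesis using assms by auto
 qed (use True small_dvd in auto)
 thus ?thesis
 proof
  assume "p - 1 - q = 0"
  thus ?thesis using mat_T[OF T_F[OF assms(1,2)], of s p q] by (simp add: qv_def)
 next
  \<comment> \<open>Wrapping around from N to 1 is a step of label 0, which differs from j.\<close>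
  assume a: "p - 1 - q = - N"
  hence "q = N" "p \<noteq> q + 1" using assms by auto
  moreover have "lab N = 0" using lab_shift(1)[of 0] lab_self[of 0] by simp
  ultimately show ?thesis using mat_T[OF T_F[OF assms(1,2)], of s p q] l assms by simp
 qed
next
 case False
 hence "p \<noteq> q + 1" by auto
 thus ?thesis using mat_T[OF T_F[OF assms(1,2)], of s p q] False by (simp add: qv_def)
qed

lemma lab_small: "0 \<le> q \<Longrightarrow> q \<le> int n \<Longrightarrow> lab q = nat q" using lab_self[of "nat q"] by simp

lemma lab_j1: "1 \<le> j \<Longrightarrow> j \<le> n \<Longrightarrow> lab (int j + 1) \<noteq> j"
proof -
 assume j: "1 \<le> j" "j \<le> n"
 show ?thesis
 proof (cases "j = n")
  case True
  have "lab (int j + 1) = lab (- 1 - (int j + 1))" by (rule lab_refl[symmetric])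
  also have "\<dots> = lab (- 1 - (int j + 1) + N)" by simp
  also have "- 1 - (int j + 1) + N = int (n - 1)" using True n1 by (simp add: N_def)
  also have "lab (int (n - 1)) = n - 1" by (rule lab_self) simp
  finally show ?thesis using True n1 by simp
 next
  case False thus ?thesis using lab_small[of "int j + 1"] j by simp
 qed
qed

text \<open>Only an unexcited site of type j can move. At a larger type the target j + 1 is
  occupied, at a smaller type j is empty, and by \<open>lab_j1\<close> a particle already at j + 1
  does not move again.\<close>

lemma F_vs:
 assumes j: "1 \<le> j" "j \<le> n" and R: "R \<subseteq> Sj j"
 shows "rho (gen_f G j) (vst (exc j R {})) = (\<Sum>s\<in>Sj j - R. vst (exc j (insert s R) {}))"
proof -
 let ?t = "\<lambda>s. if J s = j then int j + 1 else int (J s)"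
 have tb: "int (J s) \<le> ?t s \<and> ?t s \<le> N" if "s \<in> Sg" for s using J[OF that] j by (auto simp: N_def)
 have m: "mat (b s) (gen_f G j) (?t s) (exc j R {} s) = of_bool (s \<in> Sj j - R)" if s: "s \<in> Sg" for s
 proof -
  have "mat (b s) (gen_f G j) (?t s) (exc j R {} s) = of_bool (?t s = exc j R {} s + 1 \<and> lab (exc j R {} s) = j)"
   using exc_bounds[OF s R, of "{}"] tb[OF s] J[OF s] by (intro mat_F j) auto
  thus ?thesis using s R lab_self[OF j(2)] lab_j1[OF j] by (auto simp: exc_def)
 qed
 have "rho (gen_f G j) (vst (exc j R {})) = (\<Sum>s\<in>Sg. sF (mat (b s) (gen_f G j) (?t s) (exc j R {} s)) (vst ((exc j R {})(s := ?t s))))"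
 proof (rule rho_top[OF _ tb])
  fix s p q assume a: "s \<in> Sg" "1 \<le> p" "p \<le> N" "1 \<le> q" "q < int (J s)" "mat (b s) (gen_f G j) p q \<noteq> 0"
  have qN: "q \<le> int n" "q \<le> N" using a J[OF a(1)] by (auto simp: N_def)
  have pq: "p = q + 1" "lab q = j" using a(6) mat_F[OF j a(2-4) qN(2)] by (auto split: if_splits)
  hence "q = int j" using lab_small[of q] a qN by auto
  thus "p \<noteq> q \<and> (p < int (J s) \<or> p = exc j R {} s)" using pq a R by (auto simp: exc_def)
 next
  fix s p assume a: "s \<in> Sg" "1 \<le> p" "p \<le> N" "mat (b s) (gen_f G j) p (exc j R {} s) \<noteq> 0"
  have qN: "1 \<le> exc j R {} s" "exc j R {} s \<le> N" using exc_bounds[OF a(1) R, of "{}"] J[OF a(1)] by auto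
  have pq: "p = exc j R {} s + 1" "lab (exc j R {} s) = j" using a(4) mat_F[OF j a(2,3) qN] by (auto split: if_splits)
  have "J s = j \<and> s \<notin> R"
   using pq(2) lab_j1[OF j] lab_self[of "J s"] J[OF a(1)] R by (auto simp: exc_def split: if_splits)
  thus "p \<noteq> exc j R {} s \<and> (p < int (J s) \<or> p = ?t s)" using pq by (auto simp: exc_def)
 qed (use exc_bounds[OF _ R] in auto)
 also have "\<dots> = (\<Sum>s\<in>Sg. if s \<in> Sj j - R then vst (exc j (insert s R) {}) else 0)"
 proof (rule sum.cong[OF refl])
  fix s assume s: "s \<in> Sg"
  have e: "(exc j R {})(s := ?t s) = exc j (insert s R) {}" if "s \<in> Sj j - R" using that by (auto simp: exc_def fun_eq_iff)
  thus "sF (mat (b s) (gen_f G j) (?t s) (exc j R {} s)) (vst ((exc j R {})(s := ?t s))) =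
   (if s \<in> Sj j - R then vst (exc j (insert s R) {}) else 0)"
  proof (cases "s \<in> Sj j - R")
   case True
   show ?thesis unfolding m[OF s] e[OF True] using True by (simp add: sF_def)
  next
   case False
   show ?thesis unfolding m[OF s] unfolding if_not_P[OF False] using False by (simp add: sF_def fun_eq_iff)
  qed
 qed
 also have "\<dots> = (\<Sum>s\<in>Sj j - R. vst (exc j (insert s R) {}))"
  using finSg by (subst sum.inter_filter[symmetric]) (auto intro: sum.cong)
 finally show ?thesis .
qed

text \<open>A set of size r + 1 is reached from r + 1 of its subsets, one for each last element,
  which builds up the factorial.\<close>

lemma pow_subsets:
 fixes S :: "nat set"
 assumes step: "\<And>R. R \<subseteq> S \<Longrightarrow> f (h R) = (\<Sum>s\<in>S - R. h (insert s R))" and S: "finite S"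
  and lin: "\<And>(K :: nat set set) c u. f (sF c (sum u K)) = sF c (\<Sum>k\<in>K. f (u k))"
 shows "(f ^^ r) (h {}) = sF (of_nat (fact r)) (\<Sum>R\<in>{R. R \<subseteq> S \<and> card R = r}. h R)"
proof (induction r)
 case 0
 have "{R. R \<subseteq> S \<and> card R = 0} = {{}}" using S by (auto dest: finite_subset)
 thus ?case by (simp add: sF_def)
next
 case (Suc r)
 let ?A = "{R. R \<subseteq> S \<and> card R = r}" and ?B = "{R. R \<subseteq> S \<and> card R = Suc r}"
 have fin: "finite R" if "R \<subseteq> S" for R using S that by (rule rev_finite_subset)
 have fAB: "finite ?A" "finite ?B" using S by (auto intro: finite_subset[of _ "Pow S"])
 have "(\<Sum>R\<in>?A. \<Sum>s\<in>S - R. h (insert s R)) = (\<Sum>(R, s)\<in>Sigma ?A (\<lambda>R. S - R). h (insert s R))"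
  by (rule sum.Sigma) (use fAB S in auto)
 also have "\<dots> = (\<Sum>(R, s)\<in>Sigma ?B (\<lambda>R. R). h R)"
  by (rule sum.reindex_bij_witness[where i = "\<lambda>(R, s). (R - {s}, s)" and j = "\<lambda>(R, s). (insert s R, s)"])
    (auto simp: fin card_Diff_singleton insert_absorb)
 also have "\<dots> = (\<Sum>R\<in>?B. \<Sum>s\<in>R. h R)"
  by (rule sum.Sigma[symmetric]) (use fAB fin in auto)
 also have "\<dots> = (\<Sum>R\<in>?B. sF (of_nat (Suc r)) (h R))"
 proof (rule sum.cong[OF refl])
  fix R assume "R \<in> ?B"
  have "(\<Sum>s\<in>R. h R) = sF (of_nat (card R)) (h R)"
   using fr.scale_sum_left[of "\<lambda>_. 1" R "h R"] by simp
  thus "(\<Sum>s\<in>R. h R) = sF (of_nat (Suc r)) (h R)" using \<open>R \<in> ?B\<close> by simp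
 qed
 also have "\<dots> = sF (of_nat (Suc r)) (\<Sum>R\<in>?B. h R)" by (rule fr.scale_sum_right[symmetric])
 finally have e: "(\<Sum>R\<in>?A. \<Sum>s\<in>S - R. h (insert s R)) = sF (of_nat (Suc r)) (\<Sum>R\<in>?B. h R)" .
 have "(f ^^ Suc r) (h {}) = sF (of_nat (fact r)) (\<Sum>R\<in>?A. f (h R))" by (simp add: Suc lin)
 also have "(\<Sum>R\<in>?A. f (h R)) = (\<Sum>R\<in>?A. \<Sum>s\<in>S - R. h (insert s R))" by (rule sum.cong) (auto simp: step)
 finally show ?case unfolding e sF_sF by (simp add: algebra_simps)
qed

lemma rho_sum: "rho x (sF c (sum u K)) = sF c (\<Sum>k\<in>K. rho x (u k))"
 using fr.act_v_sum[of "letter x" u K] by (simp add: rho_f_s)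

lemma F_pow:
 assumes "1 \<le> j" "j \<le> n"
 shows "(rho (gen_f G j) ^^ r) v0 = sF (of_nat (fact r)) (\<Sum>R\<in>{R. R \<subseteq> Sj j \<and> card R = r}. vst (exc j R {}))"
proof -
 have "exc j {} {} = (\<lambda>s. int (J s))" by (simp add: exc_def fun_eq_iff)
 hence "vst (exc j {} {}) = v0" unfolding vst_ground by simp
 thus ?thesis using pow_subsets[of "Sj j" "rho (gen_f G j)" "\<lambda>R. vst (exc j R {})" r, OF F_vs[OF assms] _ rho_sum] finSg by simp
qed

lemma pow_act: "(rho x ^^ m) v = fr.act (letter x ^ m) v"
proof -
 have "fr.act (letter x) = rho x" by (rule ext) simp
 thus ?thesis by (simp add: fr.act_power)
qed

lemma rho_pow_sum: "(rho x ^^ m) (sum u K) = (\<Sum>k\<in>K. (rho x ^^ m) (u k))"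
 and rho_pow_s: "(rho x ^^ m) (sF c f) = sF c ((rho x ^^ m) f)"
 and rho_pow_add: "(rho x ^^ m) (f + f') = (rho x ^^ m) f + (rho x ^^ m) f'"
 unfolding pow_act by (rule fr.act_v_sum, rule fr.act_v_s, rule fr.act_v_add)

text \<open>Y has the entry (j, N + j + 1), and reducing the column by a period gives the factor
  \<open>b s\<close>. The mirror entry joins positions above n, which are empty in the states
  \<open>exc j R {}\<close>.\<close>

lemma mat_short:
 assumes j: "1 \<le> j" "j < n" and Y: "T (N + 1) Y (Xc (int j) (N + int j + 1))"
 shows "mat (b s) Y (int j) (int j + 1) = b s"
  and "1 \<le> p \<Longrightarrow> p \<le> N \<Longrightarrow> 1 \<le> q \<Longrightarrow> q \<le> N \<Longrightarrow> mat (b s) Y p q \<noteq> 0 \<Longrightarrow>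
   p = int j \<and> q = int j + 1 \<or> p = N - int j - 1 \<and> q = N - int j"
proof -
 have "\<not> N dvd 2 * int j + 1" using ndvd(1)[of "2 * int j + 1"] j by (simp add: N_def)
 moreover have "int j + (N + int j + 1) = (2 * int j + 1) + N" by simp
 ultimately have "Xc (int j) (N + int j + 1) (int j) = 1" unfolding Xc_def by (simp only: dvd_shift) simp
 moreover have "qv (b s) (int j + 1) (int j + (N + 1)) = b s" using N3 by (simp add: qv_def)
 ultimately show "mat (b s) Y (int j) (int j + 1) = b s" using mat_T[OF Y, of s "int j" "int j + 1"] by simp
next
 assume p: "1 \<le> p" "p \<le> N" and q: "1 \<le> q" "q \<le> N" and nz: "mat (b s) Y p q \<noteq> 0"
 have "N dvd p - int j \<or> N dvd p + (N + int j + 1)" using nz mat_T[OF Y, of s p q] by (auto simp: Xc_def)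
 moreover have "p + (N + int j + 1) = (p + int j + 1 - N) + 2 * N" by simp
 ultimately have "N dvd p - int j \<or> N dvd p + int j + 1 - N" by (simp only: dvd_shift)
 hence pe: "p = int j \<or> p = N - int j - 1"
  using small_dvd[of "p - int j"] small_dvd[of "p + int j + 1 - N"] p j by (auto simp: N_def)
 have "N dvd p + (N + 1) - q" using nz mat_T[OF Y, of s p q] by (auto simp: qv_def split: if_splits)
 moreover have "p + (N + 1) - q = (p + 1 - q) + N" by simp
 ultimately have "N dvd p + 1 - q" by (simp only: dvd_shift)
 hence "q = p + 1" using small_dvd[of "p + 1 - q"] p q pe j by (auto simp: N_def)
 thus "p = int j \<and> q = int j + 1 \<or> p = N - int j - 1 \<and> q = N - int j" using pe by auto
qed

lemma Y_short:
 assumes j: "1 \<le> j" "j < n" and Y: "T (N + 1) Y (Xc (int j) (N + int j + 1))" and R: "R \<subseteq> Sj j"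
 shows "rho Y (vst (exc j R {})) = (\<Sum>s\<in>R. sF (b s) (vst (exc j (R - {s}) {})))"
proof -
 note nz = mat_short(2)[OF j Y]
 let ?t = "\<lambda>s. int (J s)"
 have JN: "1 \<le> int (J s)" "int (J s) \<le> int n" "int (J s) \<le> N" if "s \<in> Sg" for s using J[OF that] by (auto simp: N_def)
 have m: "mat (b s) Y (?t s) (exc j R {} s) = (if s \<in> R then b s else 0)" if s: "s \<in> Sg" for s
 proof (cases "s \<in> R")
  case True
  hence "J s = j" using R by auto
  thus ?thesis using True mat_short(1)[OF j Y, of s] by (simp add: exc_def)
 next
  case False
  have "mat (b s) Y (?t s) (?t s) = 0"
  proof (rule ccontr)
   assume "mat (b s) Y (?t s) (?t s) \<noteq> 0"
   from nz[OF _ _ _ _ this] show False using JN[OF s] by auto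
  qed
  thus ?thesis using False by (simp add: exc_def)
 qed
 have "rho Y (vst (exc j R {})) = (\<Sum>s\<in>Sg. sF (mat (b s) Y (?t s) (exc j R {} s)) (vst ((exc j R {})(s := ?t s))))"
 proof (rule rho_top)
  fix s p q assume a: "s \<in> Sg" "1 \<le> p" "p \<le> N" "1 \<le> q" "q < int (J s)" "mat (b s) Y p q \<noteq> 0"
  show "p \<noteq> q \<and> (p < int (J s) \<or> p = exc j R {} s)"
   using nz[OF a(2-4) _ a(6)] a JN[OF a(1)] j by (auto simp: N_def)
 next
  fix s p assume a: "s \<in> Sg" "1 \<le> p" "p \<le> N" "mat (b s) Y p (exc j R {} s) \<noteq> 0"
  have q: "1 \<le> exc j R {} s" "exc j R {} s \<le> N" using exc_bounds[OF a(1) R, of "{}"] JN[OF a(1)] by auto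
  show "p \<noteq> exc j R {} s \<and> (p < int (J s) \<or> p = ?t s)"
   using nz[OF a(2,3) q a(4)] R JN[OF a(1)] j by (auto simp: exc_def N_def split: if_splits)
 qed (use exc_bounds[OF _ R] JN in auto)
 also have "\<dots> = (\<Sum>s\<in>Sg. if s \<in> R then sF (b s) (vst (exc j (R - {s}) {})) else 0)"
 proof (rule sum.cong[OF refl])
  fix s assume s: "s \<in> Sg"
  have e: "(exc j R {})(s := ?t s) = exc j (R - {s}) {}" if "s \<in> R" using that by (auto simp: exc_def fun_eq_iff)
  thus "sF (mat (b s) Y (?t s) (exc j R {} s)) (vst ((exc j R {})(s := ?t s))) =
   (if s \<in> R then sF (b s) (vst (exc j (R - {s}) {})) else 0)"
  proof (cases "s \<in> R")
   case True
   show ?thesis unfolding m[OF s] e[OF True] using True by simp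
  next
   case False
   show ?thesis unfolding m[OF s] unfolding if_not_P[OF False] by (simp add: sF_def fun_eq_iff)
  qed
 qed
 also have "\<dots> = (\<Sum>s\<in>R. sF (b s) (vst (exc j (R - {s}) {})))"
  by (rule sum.mono_neutral_cong_right) (use finSg R in auto)
 finally show ?thesis .
qed

lemma Y_short_pow:
 assumes j: "1 \<le> j" "j < n" and Y: "T (N + 1) Y (Xc (int j) (N + int j + 1))"
 shows "R \<subseteq> Sj j \<Longrightarrow> card R = r \<Longrightarrow> (rho Y ^^ r) (vst (exc j R {})) = sF (of_nat (fact r) * (\<Prod>s\<in>R. b s)) v0"
proof (induction r arbitrary: R)
 case 0
 hence "R = {}" using finSg by (auto dest: finite_subset)
 thus ?case unfolding vst_ground by (simp add: exc_def sF_def)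
next
 case (Suc r)
 have fR: "finite R" using Suc.prems finSg by (auto dest: finite_subset)
 have "(rho Y ^^ Suc r) (vst (exc j R {})) = (\<Sum>s\<in>R. sF (b s) ((rho Y ^^ r) (vst (exc j (R - {s}) {}))))"
  unfolding funpow_Suc_right o_def Y_short[OF j Y Suc.prems(1)] rho_pow_sum rho_pow_s ..
 also have "\<dots> = (\<Sum>s\<in>R. sF (of_nat (fact r) * (\<Prod>s\<in>R. b s)) v0)"
 proof (rule sum.cong[OF refl])
  fix s assume s: "s \<in> R"
  have "R - {s} \<subseteq> Sj j" "card (R - {s}) = r" using Suc.prems fR s by auto
  note ih = Suc.IH[OF this]
  have "b s * (\<Prod>s\<in>R - {s}. b s) = (\<Prod>s\<in>R. b s)" by (rule prod.remove[OF fR s, symmetric])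
  hence "b s * (of_nat (fact r) * (\<Prod>s\<in>R - {s}. b s)) = of_nat (fact r) * (\<Prod>s\<in>R. b s)"
   by (subst mult.left_commute) (simp only: )
  thus "sF (b s) ((rho Y ^^ r) (vst (exc j (R - {s}) {}))) = sF (of_nat (fact r) * (\<Prod>s\<in>R. b s)) v0"
   unfolding ih sF_sF by simp
 qed
 also have "\<dots> = sF (of_nat (Suc r) * (of_nat (fact r) * (\<Prod>s\<in>R. b s))) v0"
  unfolding fr.scale_sum_left[symmetric] sum_constant Suc.prems(2) ..
 also have "of_nat (Suc r) * (of_nat (fact r) * (\<Prod>s\<in>R. b s)) = of_nat (fact (Suc r)) * (\<Prod>s\<in>R. b s)" by (simp add: algebra_simps)
 finally show ?case .
qed

text \<open>One factorial counts the orders in which r sites are excited by f, the other those in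
  which Y brings them back; each returning site contributes its parameter.\<close>

lemma eval_short:
 assumes j: "1 \<le> j" "j < n" and Y: "T (N + 1) Y (Xc (int j) (N + int j + 1))"
 shows "fr.act (letter Y ^ r * letter (gen_f G j) ^ r) v0 = sF (of_nat (fact r * fact r) * esym b (Sj j) r) v0"
proof -
 let ?A = "{R. R \<subseteq> Sj j \<and> card R = r}"
 have "fr.act (letter Y ^ r * letter (gen_f G j) ^ r) v0 = (rho Y ^^ r) ((rho (gen_f G j) ^^ r) v0)"
  by (simp only: fr.act_mult pow_act)
 also have "\<dots> = sF (of_nat (fact r)) (\<Sum>R\<in>?A. (rho Y ^^ r) (vst (exc j R {})))"
  using F_pow[of j r] j by (simp add: rho_pow_s rho_pow_sum)
 also have "(\<Sum>R\<in>?A. (rho Y ^^ r) (vst (exc j R {}))) = (\<Sum>R\<in>?A. sF (of_nat (fact r) * (\<Prod>s\<in>R. b s)) v0)"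
  by (rule sum.cong) (auto simp: Y_short_pow[OF j Y])
 also have "\<dots> = sF (of_nat (fact r) * esym b (Sj j) r) v0"
  unfolding fr.scale_sum_left[symmetric] sum_distrib_left[symmetric] using esym_subsets[of "Sj j" b r] finSg by simp
 finally show ?thesis by (simp add: sF_sF mult.assoc)
qed

text \<open>A particle at n + 1 returns to n in two moves, through position N. The entry (n, N)
  performs the second move with factor 1; its mirror image, reduced by a period, performs the first
  and supplies the parameter and a sign.\<close>

lemma mat_long:
 assumes Y: "T (N - int n) Y (Xc (int n) N)"
 shows "mat (b s) Y (int n) N = 1" "mat (b s) Y N (int n + 1) = sg (int n) * b s"
  and "1 \<le> p \<Longrightarrow> p \<le> N \<Longrightarrow> 1 \<le> q \<Longrightarrow> q \<le> N \<Longrightarrow> mat (b s) Y p q \<noteq> 0 \<Longrightarrow>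
   p = int n \<and> q = N \<or> p = N \<and> q = int n + 1"
proof -
 have nd: "\<not> N dvd int n" using ndvd(1)[of "int n"] n1 by (simp add: N_def)
 have "Xc (int n) N (int n) = 1" using nd unfolding Xc_def dvd_shift by simp
 moreover have "qv (b s) N (int n + (N - int n)) = 1" by (simp add: qv_def)
 ultimately show "mat (b s) Y (int n) N = 1" using mat_T[OF Y, of s "int n" N] by simp
 have "\<not> N dvd N - int n" using ndvd(1)[of "N - int n"] n1 by (simp add: N_def)
 hence "Xc (int n) N N = sg (int n)" unfolding Xc_def by (simp add: sg_add sg_N)
 moreover have "qv (b s) (int n + 1) (N + (N - int n)) = b s"
 proof -
  have e: "N + (N - int n) - (int n + 1) = N" by (simp add: N_def)
  show ?thesis unfolding qv_def e using N3 by simp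
 qed
 ultimately show "mat (b s) Y N (int n + 1) = sg (int n) * b s" using mat_T[OF Y, of s N "int n + 1"] by simp
 assume p: "1 \<le> p" "p \<le> N" and q: "1 \<le> q" "q \<le> N" and nz: "mat (b s) Y p q \<noteq> 0"
 have "N dvd p - int n \<or> N dvd p + N" using nz mat_T[OF Y, of s p q] by (auto simp: Xc_def)
 moreover have "p + N = (p - N) + 2 * N" by simp
 ultimately have "N dvd p - int n \<or> N dvd p - N" by (simp only: dvd_shift)
 hence pe: "p = int n \<or> p = N" using small_dvd[of "p - int n"] small_dvd[of "p - N"] p n1 by (auto simp: N_def)
 have d: "N dvd p + (N - int n) - q" using nz mat_T[OF Y, of s p q] by (auto simp: qv_def split: if_splits)
 show "p = int n \<and> q = N \<or> p = N \<and> q = int n + 1"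
 proof (cases "p = int n")
  case True
  hence "N dvd N - q" using d by simp
  thus ?thesis using small_dvd[of "N - q"] q True by auto
 next
  case False
  hence pN: "p = N" using pe by simp
  have "N + (N - int n) - q = (int n + 1 - q) + N" by (simp add: N_def)
  hence "N dvd int n + 1 - q" using d unfolding pN by (simp only: dvd_shift)
  thus ?thesis using small_dvd[of "int n + 1 - q"] q pN n1 by (auto simp: N_def)
 qed
qed

lemma Y_long:
 assumes Y: "T (N - int n) Y (Xc (int n) N)" and R: "R \<subseteq> Sj n" and K: "K \<subseteq> Sj n" "R \<inter> K = {}"
 shows "rho Y (vst (exc n R K)) = (\<Sum>s\<in>R. sF (sg (int n) * b s) (vst (exc n (R - {s}) (insert s K))))
   + (\<Sum>s\<in>K. vst (exc n R (K - {s})))"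
proof -
 note nz = mat_long(3)[OF Y]
 let ?t = "\<lambda>s. if s \<in> R then N else int (J s)"
 have JN: "1 \<le> int (J s)" "int (J s) \<le> int n" "int (J s) \<le> N" if "s \<in> Sg" for s using J[OF that] by (auto simp: N_def)
 have m: "mat (b s) Y (?t s) (exc n R K s) = (if s \<in> R then sg (int n) * b s else if s \<in> K then 1 else 0)" if s: "s \<in> Sg" for s
 proof (cases "s \<in> R \<or> s \<in> K")
  case True
  thus ?thesis using K R mat_long(1,2)[OF Y, of s] by (auto simp: exc_def)
 next
  case False
  have "mat (b s) Y (int (J s)) (int (J s)) = 0"
  proof (rule ccontr)
   assume "mat (b s) Y (int (J s)) (int (J s)) \<noteq> 0"
   from nz[OF _ _ _ _ this] show False using JN[OF s] by (auto simp: N_def)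
  qed
  thus ?thesis using False by (simp add: exc_def)
 qed
 have "rho Y (vst (exc n R K)) = (\<Sum>s\<in>Sg. sF (mat (b s) Y (?t s) (exc n R K s)) (vst ((exc n R K)(s := ?t s))))"
 proof (rule rho_top)
  fix s p q assume a: "s \<in> Sg" "1 \<le> p" "p \<le> N" "1 \<le> q" "q < int (J s)" "mat (b s) Y p q \<noteq> 0"
  show "p \<noteq> q \<and> (p < int (J s) \<or> p = exc n R K s)"
   using nz[OF a(2-4) _ a(6)] a JN[OF a(1)] by (auto simp: N_def)
 next
  fix s p assume a: "s \<in> Sg" "1 \<le> p" "p \<le> N" "mat (b s) Y p (exc n R K s) \<noteq> 0"
  have q: "1 \<le> exc n R K s" "exc n R K s \<le> N" using exc_bounds[OF a(1) R, of K] JN[OF a(1)] by auto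
  show "p \<noteq> exc n R K s \<and> (p < int (J s) \<or> p = ?t s)"
   using nz[OF a(2,3) q a(4)] R K JN[OF a(1)] n1 by (auto simp: exc_def N_def split: if_splits)
 qed (use exc_bounds[OF _ R] JN in auto)
 also have "\<dots> = (\<Sum>s\<in>Sg. (if s \<in> R then sF (sg (int n) * b s) (vst (exc n (R - {s}) (insert s K))) else 0)
   + (if s \<in> K then vst (exc n R (K - {s})) else 0))"
 proof (rule sum.cong[OF refl])
  fix s assume s: "s \<in> Sg"
  have e1: "(exc n R K)(s := ?t s) = exc n (R - {s}) (insert s K)" if "s \<in> R" using that by (auto simp: exc_def fun_eq_iff)
  have e2: "(exc n R K)(s := ?t s) = exc n R (K - {s})" if "s \<in> K" using that K by (auto simp: exc_def fun_eq_iff)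
  show "sF (mat (b s) Y (?t s) (exc n R K s)) (vst ((exc n R K)(s := ?t s))) =
   (if s \<in> R then sF (sg (int n) * b s) (vst (exc n (R - {s}) (insert s K))) else 0) + (if s \<in> K then vst (exc n R (K - {s})) else 0)"
  proof (cases "s \<in> R")
   case True
   hence nK: "s \<notin> K" using K by auto
   show ?thesis unfolding m[OF s] e1[OF True] unfolding if_P[OF True] if_not_P[OF nK] by simp
  next
   case False
   show ?thesis
   proof (cases "s \<in> K")
    case True
    show ?thesis unfolding m[OF s] e2[OF True] unfolding if_P[OF True] if_not_P[OF False] by (simp add: sF_def)
   next
    case nK: False
    show ?thesis unfolding m[OF s] unfolding if_not_P[OF nK] if_not_P[OF False] by (simp add: sF_def fun_eq_iff)
   qed
  qed
 qed
 also have "\<dots> = (\<Sum>s\<in>Sg. if s \<in> R then sF (sg (int n) * b s) (vst (exc n (R - {s}) (insert s K))) else 0)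
   + (\<Sum>s\<in>Sg. if s \<in> K then vst (exc n R (K - {s})) else 0)" by (rule sum.distrib)
 also have "(\<Sum>s\<in>Sg. if s \<in> R then sF (sg (int n) * b s) (vst (exc n (R - {s}) (insert s K))) else 0) =
   (\<Sum>s\<in>R. sF (sg (int n) * b s) (vst (exc n (R - {s}) (insert s K))))"
  by (rule sum.mono_neutral_cong_right) (use finSg R in auto)
 also have "(\<Sum>s\<in>Sg. if s \<in> K then vst (exc n R (K - {s})) else 0) = (\<Sum>s\<in>K. vst (exc n R (K - {s})))"
  by (rule sum.mono_neutral_cong_right) (use finSg K in auto)
 finally show ?thesis .
qed

lemma Y_long_pow:
 assumes Y: "T (N - int n) Y (Xc (int n) N)"
 shows "R \<subseteq> Sj n \<Longrightarrow> K \<subseteq> Sj n \<Longrightarrow> R \<inter> K = {} \<Longrightarrow> 2 * card R + card K = d \<Longrightarrow>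
  (rho Y ^^ d) (vst (exc n R K)) = sF (of_nat (cc (card R) (card K)) * (\<Prod>s\<in>R. sg (int n) * b s)) v0"
proof (induction d arbitrary: R K)
 case 0
 hence "R = {}" "K = {}" using finSg by (auto dest: finite_subset)
 thus ?case unfolding vst_ground by (simp add: exc_def sF_def cc.simps[of 0 0])
next
 case (Suc d)
 let ?P = "\<Prod>s\<in>R. sg (int n) * b s" and ?r = "card R" and ?q = "card K"
 have fin: "finite R" "finite K" using Suc.prems finSg by (auto dest: finite_subset)
 have "(rho Y ^^ Suc d) (vst (exc n R K)) = (\<Sum>s\<in>R. sF (sg (int n) * b s) ((rho Y ^^ d) (vst (exc n (R - {s}) (insert s K)))))
   + (\<Sum>s\<in>K. (rho Y ^^ d) (vst (exc n R (K - {s}))))"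
  unfolding funpow_Suc_right o_def Y_long[OF Y Suc.prems(1-3)] rho_pow_add rho_pow_sum rho_pow_s ..
 also have "(\<Sum>s\<in>R. sF (sg (int n) * b s) ((rho Y ^^ d) (vst (exc n (R - {s}) (insert s K))))) =
   (\<Sum>s\<in>R. sF (of_nat (cc (?r - 1) (Suc ?q)) * ?P) v0)"
 proof (rule sum.cong[OF refl])
  fix s assume s: "s \<in> R"
  have sK: "s \<notin> K" using s Suc.prems by auto
  have c: "card (R - {s}) = ?r - 1" "card (insert s K) = Suc ?q" "?r \<ge> 1" using s sK fin by (auto simp: Suc_le_eq card_gt_0_iff)
  have "R - {s} \<subseteq> Sj n" "insert s K \<subseteq> Sj n" "(R - {s}) \<inter> insert s K = {}" "2 * card (R - {s}) + card (insert s K) = d"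
   using Suc.prems s sK c by auto
  note ih = Suc.IH[OF this]
  have "(sg (int n) * b s) * (\<Prod>s\<in>R - {s}. sg (int n) * b s) = ?P" by (rule prod.remove[OF fin(1) s, symmetric])
  hence "(sg (int n) * b s) * (of_nat (cc (?r - 1) (Suc ?q)) * (\<Prod>s\<in>R - {s}. sg (int n) * b s)) = of_nat (cc (?r - 1) (Suc ?q)) * ?P"
   by (subst mult.left_commute) (simp only: )
  thus "sF (sg (int n) * b s) ((rho Y ^^ d) (vst (exc n (R - {s}) (insert s K)))) = sF (of_nat (cc (?r - 1) (Suc ?q)) * ?P) v0"
   unfolding ih sF_sF c(1,2) by simp
 qed
 also have "\<dots> = sF (of_nat ?r * (of_nat (cc (?r - 1) (Suc ?q)) * ?P)) v0"
  unfolding fr.scale_sum_left[symmetric] sum_constant ..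
 also have "(\<Sum>s\<in>K. (rho Y ^^ d) (vst (exc n R (K - {s})))) = (\<Sum>s\<in>K. sF (of_nat (cc ?r (?q - 1)) * ?P) v0)"
 proof (rule sum.cong[OF refl])
  fix s assume s: "s \<in> K"
  have c: "card (K - {s}) = ?q - 1" "?q \<ge> 1" using s fin by (auto simp: Suc_le_eq card_gt_0_iff)
  have "R \<subseteq> Sj n" "K - {s} \<subseteq> Sj n" "R \<inter> (K - {s}) = {}" "2 * card R + card (K - {s}) = d"
   using Suc.prems s c by auto
  from Suc.IH[OF this] show "(rho Y ^^ d) (vst (exc n R (K - {s}))) = sF (of_nat (cc ?r (?q - 1)) * ?P) v0"
   unfolding c(1) .
 qed
 also have "\<dots> = sF (of_nat ?q * (of_nat (cc ?r (?q - 1)) * ?P)) v0"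
  unfolding fr.scale_sum_left[symmetric] sum_constant ..
 finally have "(rho Y ^^ Suc d) (vst (exc n R K)) =
   sF (of_nat ?r * (of_nat (cc (?r - 1) (Suc ?q)) * ?P) + of_nat ?q * (of_nat (cc ?r (?q - 1)) * ?P)) v0"
  by (simp only: fr.scale_left_distrib)
 moreover have "of_nat ?r * (of_nat (cc (?r - 1) (Suc ?q)) * ?P) + of_nat ?q * (of_nat (cc ?r (?q - 1)) * ?P) = of_nat (cc ?r ?q) * ?P"
 proof -
  have "cc ?r ?q = ?r * cc (?r - 1) (Suc ?q) + ?q * cc ?r (?q - 1)"
   using Suc.prems(4) by (subst cc.simps) auto
  thus ?thesis by (simp add: algebra_simps)
 qed
 ultimately show ?case by simp
qed

text \<open>The factorial counts the orders of exciting r sites, and \<open>cc r 0\<close> those of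
  the 2r moves back, in which the moves of different sites may interleave. The sign comes from the
  first move of each site.\<close>

lemma eval_long:
 assumes Y: "T (N - int n) Y (Xc (int n) N)"
 shows "fr.act (letter Y ^ (2 * r) * letter (gen_f G n) ^ r) v0 = sF (of_nat (fact r * cc r 0) * sg (int n) ^ r * esym b (Sj n) r) v0"
proof -
 let ?A = "{R. R \<subseteq> Sj n \<and> card R = r}"
 have "fr.act (letter Y ^ (2 * r) * letter (gen_f G n) ^ r) v0 = (rho Y ^^ (2 * r)) ((rho (gen_f G n) ^^ r) v0)"
  by (simp only: fr.act_mult pow_act)
 also have "\<dots> = sF (of_nat (fact r)) (\<Sum>R\<in>?A. (rho Y ^^ (2 * r)) (vst (exc n R {})))"
  using F_pow[of n r] n1 by (simp add: rho_pow_s rho_pow_sum)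
 also have "(\<Sum>R\<in>?A. (rho Y ^^ (2 * r)) (vst (exc n R {}))) = (\<Sum>R\<in>?A. sF (of_nat (cc r 0) * sg (int n) ^ r * (\<Prod>s\<in>R. b s)) v0)"
 proof (rule sum.cong[OF refl])
  fix R assume R: "R \<in> ?A"
  have "(rho Y ^^ (2 * r)) (vst (exc n R {})) = sF (of_nat (cc (card R) (card ({} :: nat set))) * (\<Prod>s\<in>R. sg (int n) * b s)) v0"
   by (rule Y_long_pow[OF Y]) (use R in auto)
  also have "(\<Prod>s\<in>R. sg (int n) * b s) = sg (int n) ^ r * (\<Prod>s\<in>R. b s)" using R by (simp add: prod.distrib)
  finally show "(rho Y ^^ (2 * r)) (vst (exc n R {})) = sF (of_nat (cc r 0) * sg (int n) ^ r * (\<Prod>s\<in>R. b s)) v0"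
   using R by (simp add: mult.assoc)
 qed
 also have "\<dots> = sF (of_nat (cc r 0) * sg (int n) ^ r * esym b (Sj n) r) v0"
  unfolding fr.scale_sum_left[symmetric] sum_distrib_left[symmetric] using esym_subsets[of "Sj n" b r] finSg by simp
 finally show ?thesis by (simp add: sF_sF mult.assoc)
qed

end

subsection \<open>Support and degree of polynomials\<close>

definition over :: "'v set \<Rightarrow> (('v \<Rightarrow>\<^sub>0 nat) \<Rightarrow>\<^sub>0 complex) \<Rightarrow> bool" where
 "over X q \<longleftrightarrow> (\<forall>m\<in>Poly_Mapping.keys q. Poly_Mapping.keys m \<subseteq> X)"

definition wdeg :: "(('v \<Rightarrow> nat)) \<Rightarrow> ('v \<Rightarrow>\<^sub>0 nat) \<Rightarrow> nat" where
 "wdeg w m = (\<Sum>v\<in>Poly_Mapping.keys m. Poly_Mapping.lookup m v * w v)"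

definition homp :: "('v \<Rightarrow> nat) \<Rightarrow> nat \<Rightarrow> (('v \<Rightarrow>\<^sub>0 nat) \<Rightarrow>\<^sub>0 complex) \<Rightarrow> bool" where
 "homp w d q \<longleftrightarrow> (\<forall>m\<in>Poly_Mapping.keys q. wdeg w m = d)"

lemma wdeg_superset: "finite K \<Longrightarrow> Poly_Mapping.keys m \<subseteq> K \<Longrightarrow> wdeg w m = (\<Sum>v\<in>K. Poly_Mapping.lookup m v * w v)"
 unfolding wdeg_def by (rule sum.mono_neutral_left) (auto simp: in_keys_iff)

lemma wdeg_add: "wdeg w (m + m') = wdeg w m + wdeg w m'"
proof -
 let ?K = "Poly_Mapping.keys m \<union> Poly_Mapping.keys m'"
 have "wdeg w (m + m') = (\<Sum>v\<in>?K. Poly_Mapping.lookup (m + m') v * w v)"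
  by (rule wdeg_superset) (use Poly_Mapping.keys_add[of m m'] in auto)
 also have "\<dots> = (\<Sum>v\<in>?K. Poly_Mapping.lookup m v * w v) + (\<Sum>v\<in>?K. Poly_Mapping.lookup m' v * w v)"
  by (simp add: lookup_add distrib_right sum.distrib)
 also have "(\<Sum>v\<in>?K. Poly_Mapping.lookup m v * w v) = wdeg w m" by (rule wdeg_superset[symmetric]) auto
 also have "(\<Sum>v\<in>?K. Poly_Mapping.lookup m' v * w v) = wdeg w m'" by (rule wdeg_superset[symmetric]) auto
 finally show ?thesis .
qed

lemma over_0 [simp]: "over X 0" by (simp add: over_def)
lemma over_scalar [simp]: "over X (Poly_Mapping.single 0 c)" by (simp add: over_def)
lemma over_1 [simp]: "over X 1" by (simp add: over_def)
lemma over_add: "over X p \<Longrightarrow> over X q \<Longrightarrow> over X (p + q)"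
 using Poly_Mapping.keys_add[of p q] by (auto simp: over_def dest!: subsetD[of "Poly_Mapping.keys (p + q)"])
lemma over_minus: "over X p \<Longrightarrow> over X (- p)" by (simp add: over_def)
lemma over_diff: "over X p \<Longrightarrow> over X q \<Longrightarrow> over X (p - q)"
 using over_add[of X p "- q"] over_minus[of X q] by simp
lemma over_mult:
 assumes "over X p" "over X q"
 shows "over X (p * q)"
 unfolding over_def
proof
 fix m assume "m \<in> Poly_Mapping.keys (p * q)"
 then obtain a b where ab: "m = a + b" "a \<in> Poly_Mapping.keys p" "b \<in> Poly_Mapping.keys q"
  using Poly_Mapping.keys_mult[of p q] by auto
 have "Poly_Mapping.keys m \<subseteq> Poly_Mapping.keys a \<union> Poly_Mapping.keys b" unfolding ab(1) by (rule Poly_Mapping.keys_add)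
 thus "Poly_Mapping.keys m \<subseteq> X" using assms ab unfolding over_def by blast
qed
lemma over_sum: "(\<And>k. k \<in> K \<Longrightarrow> over X (f k)) \<Longrightarrow> over X (sum f K)"
 by (induction K rule: infinite_finite_induct) (auto intro: over_add)
lemma over_mono: "over X p \<Longrightarrow> X \<subseteq> Y \<Longrightarrow> over Y p" unfolding over_def by blast

lemma homp_0 [simp]: "homp w d 0" by (simp add: homp_def)
lemma homp_scalar [simp]: "homp w 0 (Poly_Mapping.single 0 c)" by (simp add: homp_def wdeg_def)
lemma homp_add: "homp w d p \<Longrightarrow> homp w d q \<Longrightarrow> homp w d (p + q)"
 using Poly_Mapping.keys_add[of p q] by (auto simp: homp_def dest!: subsetD[of "Poly_Mapping.keys (p + q)"])
lemma homp_minus: "homp w d p \<Longrightarrow> homp w d (- p)" by (simp add: homp_def)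
lemma homp_diff: "homp w d p \<Longrightarrow> homp w d q \<Longrightarrow> homp w d (p - q)"
 using homp_add[of w d p "- q"] homp_minus[of w d q] by simp
lemma homp_mult:
 assumes "homp w d p" "homp w e q"
 shows "homp w (d + e) (p * q)"
 unfolding homp_def
proof
 fix m assume "m \<in> Poly_Mapping.keys (p * q)"
 then obtain a b where ab: "m = a + b" "a \<in> Poly_Mapping.keys p" "b \<in> Poly_Mapping.keys q"
  using Poly_Mapping.keys_mult[of p q] by auto
 thus "wdeg w m = d + e" using assms by (simp add: homp_def wdeg_add)
qed
lemma homp_sum: "(\<And>k. k \<in> K \<Longrightarrow> homp w d (f k)) \<Longrightarrow> homp w d (sum f K)"
 by (induction K rule: infinite_finite_induct) (auto intro: homp_add)

lemma psubst_over: "over X q \<Longrightarrow> (\<And>v. v \<in> X \<Longrightarrow> \<tau> v = \<tau>' v) \<Longrightarrow> ev.psubst \<tau> q = ev.psubst \<tau>' q"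
proof -
 assume a: "over X q" "\<And>v. v \<in> X \<Longrightarrow> \<tau> v = \<tau>' v"
 have "mon \<tau> m = mon \<tau>' m" if "m \<in> Poly_Mapping.keys q" for m
  unfolding mon_def
 proof (rule prod.cong[OF refl])
  fix v assume "v \<in> Poly_Mapping.keys m"
  hence "v \<in> X" using a(1) that by (auto simp: over_def)
  thus "\<tau> v ^ Poly_Mapping.lookup m v = \<tau>' v ^ Poly_Mapping.lookup m v" using a(2)[of v] by simp
 qed
 thus ?thesis unfolding ev.psubst_def by (intro sum.cong refl) simp
qed

lemma esym_image: "inj_on h S \<Longrightarrow> esym b (h ` S) r = esym (\<lambda>i. b (h i)) S r"
 unfolding esym_def by (simp add: prod.reindex)

abbreviation (input) ww :: "nat \<times> nat \<Rightarrow> nat" where "ww \<equiv> \<lambda>(i, r). 2 * r"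

context A2n2
begin

lemma over_Tv: "v \<in> X \<Longrightarrow> over X (Tv v)" by (simp add: over_def Tv_def)

lemma homp_Tv: "homp ww (2 * r) (Tv (j, r))" by (simp add: homp_def Tv_def wdeg_def)

lemma sign_mp: "over X ((- 1) ^ k :: mp)" "homp w 0 ((- 1) ^ k :: mp)"
 unfolding mp_power by simp_all

lemma of_nat_mp: "over X (of_nat k :: mp)" "homp w 0 (of_nat k :: mp)"
 using over_scalar[of X "of_nat k"] homp_scalar[of w "of_nat k"] by (simp_all only: single_of_nat)

text \<open>In positive degree \<open>newtonP\<close> never reaches \<open>e 0\<close>, so the
  variable (j, 0) of the coroot is absent.\<close>

lemma over_Pk: "over ({j} \<times> {1..}) (Pk j (Suc k))"
 unfolding Pk_def
proof (induction k rule: less_induct)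
 case (less k)
 show ?case unfolding newtonP.simps(2)[of _ k]
  by (intro over_mult over_diff over_sum sign_mp of_nat_mp over_Tv less) auto
qed

lemma homp_Pk: "homp ww (2 * k) (Pk j k)"
 unfolding Pk_def
proof (induction k rule: less_induct)
 case (less k)
 show ?case
 proof (cases k)
  case 0 thus ?thesis using homp_Tv[of 0 j] by simp
 next
  case (Suc r)
  have 1: "homp ww (0 + 2 * Suc r) (of_nat (Suc r) * Tv (j, Suc r))" by (intro homp_mult of_nat_mp homp_Tv)
  have "homp ww (0 + 2 * Suc i + 2 * (r - i)) ((- 1) ^ i * newtonP (\<lambda>r. Tv (j, r)) (Suc i) * Tv (j, r - i))" if "i < r" for i
   by (intro homp_mult sign_mp less homp_Tv) (use Suc that in simp)
  hence 2: "homp ww (2 * Suc r) ((- 1) ^ i * newtonP (\<lambda>r. Tv (j, r)) (Suc i) * Tv (j, r - i))" if "i < r" for i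
  proof -
   have "0 + 2 * Suc i + 2 * (r - i) = 2 * Suc r" using that by simp
   thus ?thesis using \<open>\<And>i. i < r \<Longrightarrow> homp ww (0 + 2 * Suc i + 2 * (r - i)) _\<close>[OF that] by (simp only: )
  qed
  have "homp ww (0 + 2 * Suc r) (newtonP (\<lambda>r. Tv (j, r)) (Suc r))"
   unfolding newtonP.simps(2)[of _ r] by (rule homp_mult[OF sign_mp(2)], rule homp_diff, use 1 in simp, rule homp_sum, rule 2, simp)
  thus ?thesis using Suc by simp
 qed
qed

lemma over_theta: "over ({1..n} \<times> UNIV) (theta x)"
 unfolding theta_def
proof (intro over_sum over_mult over_scalar)
 fix j k assume j: "j \<in> {1..n}"
 hence sub: "{j} \<times> {1..} \<subseteq> {1..n} \<times> (UNIV :: nat set)" by auto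
 show "over ({1..n} \<times> UNIV) (Pk j k)"
 proof (cases k)
  case 0 thus ?thesis using over_Tv[of "(j, 0)" "{1..n} \<times> UNIV"] j by (simp add: Pk_def)
 next
  case (Suc r) thus ?thesis using over_mono[OF over_Pk[of j r] sub] by simp
 qed
qed

lemma over_theta_plus: "x \<in> current_h_plus n G \<Longrightarrow> over ({1..n} \<times> {1..}) (theta x)"
 unfolding theta_def
proof (intro over_sum over_mult over_scalar)
 fix j k assume x: "x \<in> current_h_plus n G" "j \<in> {1..n}" "k \<in> {k. omega j k x \<noteq> 0}"
 have k: "k \<noteq> 0"
 proof
  assume "k = 0"
  hence "omega j k x = 0" using h_plus_Phi0[OF x(1)] by (simp add: omega_def)
  thus False using x(3) by simp
 qed
 have sub: "{j} \<times> {1..} \<subseteq> {1..n} \<times> {1 :: nat..}" using x(2) by auto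
 show "over ({1..n} \<times> {1..}) (Pk j k)"
  using over_mono[OF over_Pk[of j "k - 1"] sub] k by simp
qed

lemma over_Theta:
 assumes "p \<in> carrier (free_ring S)" "\<And>x. x \<in> S \<Longrightarrow> over X (theta x)"
 shows "over X (Theta p)"
proof -
 have "over X (wact (\<lambda>x q. theta x * q) xs 1)" if "set xs \<subseteq> S" for xs
  using that by (induction xs) (auto intro: over_mult assms(2))
 thus ?thesis using assms(1) unfolding Theta_def mpr.act_def free_ring_def
  by (intro over_sum over_mult over_scalar) auto
qed

lemma Mp_prodl: "Mp (prodl vs) (Poly_Mapping.single (mono vs) 1)"
proof (induction vs)
 case Nil thus ?case using Mp_scl[of 1] by simp
next
 case (Cons v vs)
 have "Tv v * Poly_Mapping.single (mono vs) 1 = Poly_Mapping.single (mono (v # vs)) 1"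
  by (simp add: Tv_def mult_single)
 thus ?case using Mp_mult[OF Mp_Ehat[of v] Cons] by (simp only: prodl.simps)
qed

lemma Mp_L: "Mp (L m) (Poly_Mapping.single m 1)"
 using Mp_prodl[of "SOME vs. mono vs = m"] unfolding L_def someI_ex[OF ex_mono[of m]] .

lemma Mp_Lin: "Mp (Lin q) q"
proof (induction q rule: pm_induct)
 case 1 thus ?case by (simp add: Mp_0)
next
 case (2 m c)
 have "Poly_Mapping.single 0 c * Poly_Mapping.single m 1 = Poly_Mapping.single m c" by (simp add: mult_single)
 thus ?case using Mp_mult[OF Mp_scl[of c] Mp_L[of m]] by (simp add: Lin_single)
next
 case (3 p q) thus ?case by (simp add: Lin_add Mp_add)
qed

lemma HH_commute:
 assumes "p \<in> carrier (free_ring HH)" "q \<in> carrier (free_ring HH)"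
 shows "p * q - q * p \<in> UU"
proof -
 have a: "p * q - Lin (Theta p * Theta q) \<in> UU" if "p \<in> carrier (free_ring HH)" "q \<in> carrier (free_ring HH)" for p q
 proof -
  have "p * (q - Lin (Theta q)) \<in> UU" by (intro UU_lmult straighten HH_F that)
  hence "p * q - p * Lin (Theta q) \<in> UU" by (simp add: right_diff_distrib)
  thus ?thesis using MpD[OF Mp_free[OF that(1)]] by (rule UU_trans)
 qed
 have "Lin (Theta p * Theta q) - q * p \<in> UU" using UU_sym[OF a[OF assms(2,1)]] by (simp add: mult.commute)
 thus ?thesis by (rule UU_trans[OF a[OF assms]])
qed

subsection \<open>Fock spaces with prescribed sites\<close>

text \<open>The i-th site of type j is coded by the pair (j, i), and the parameters of each type
  come from \<open>esym_surj\<close>. The top value must be nonzero because it is the product of the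
  parameters, which are invertible.\<close>

lemma sites_exist:
 fixes Mm :: "nat \<Rightarrow> nat" and t :: "nat \<Rightarrow> nat \<Rightarrow> complex"
 assumes "\<And>j. j \<in> {1..n} \<Longrightarrow> Mm j \<ge> 1 \<Longrightarrow> t j (Mm j) \<noteq> 0"
 obtains Sg J b where "fock_data G n Sg J b" "\<And>j. j \<in> {1..n} \<Longrightarrow> card {s\<in>Sg. J s = j} = Mm j"
  "\<And>j r. j \<in> {1..n} \<Longrightarrow> 1 \<le> r \<Longrightarrow> r \<le> Mm j \<Longrightarrow> esym b {s\<in>Sg. J s = j} r = t j r"
proof -
 have "\<forall>j\<in>{1..n}. \<exists>b. (\<forall>s<Mm j. b s \<noteq> 0) \<and> (\<forall>r. 1 \<le> r \<longrightarrow> r \<le> Mm j \<longrightarrow> esym b {..<Mm j} r = t j r)"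
  using esym_surj assms by blast
 then obtain bb where bb: "\<And>j s. j \<in> {1..n} \<Longrightarrow> s < Mm j \<Longrightarrow> bb j s \<noteq> 0"
  "\<And>j r. j \<in> {1..n} \<Longrightarrow> 1 \<le> r \<Longrightarrow> r \<le> Mm j \<Longrightarrow> esym (bb j) {..<Mm j} r = t j r"
  unfolding bchoice_iff by blast
 define Sg where "Sg = prod_encode ` (SIGMA j:{1..n}. {..<Mm j})"
 define J where "J s = fst (prod_decode s)" for s
 define b where "b s = bb (fst (prod_decode s)) (snd (prod_decode s))" for s
 have Sj: "{s\<in>Sg. J s = j} = (\<lambda>i. prod_encode (j, i)) ` {..<Mm j}" if "j \<in> {1..n}" for j
  using that by (auto simp: Sg_def J_def)
 have inj: "inj_on (\<lambda>i. prod_encode (j, i)) {..<Mm j}" for j by (auto simp: inj_on_def)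
 show ?thesis
 proof (rule that[of Sg J b])
  show "fock_data G n Sg J b"
   by (intro fock_data.intro fock_data_axioms.intro A2n2_axioms) (use bb(1) in \<open>auto simp: Sg_def J_def b_def\<close>)
  fix j assume j: "j \<in> {1..n}"
  show "card {s\<in>Sg. J s = j} = Mm j" unfolding Sj[OF j] card_image[OF inj] by simp
  fix r assume r: "1 \<le> r" "r \<le> Mm j"
  show "esym b {s\<in>Sg. J s = j} r = t j r"
   unfolding Sj[OF j] esym_image[OF inj] using bb(2)[OF j r] by (simp add: b_def)
 qed
qed

text \<open>The number of sites is itself the coordinate (j, 0) and runs through the integers above
  m0. With more than m0 sites the elementary symmetric functions up to m0 can take any values, and
  the higher ones are filled with 1 to keep the top one nonzero.\<close>

lemma grid_all:
 assumes q: "over ({1..n} \<times> UNIV) q" and ev: "\<And>Sg J b. fock_data G n Sg J b \<Longrightarrow> ev.psubst (site_tau Sg J b) q = 0"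
 shows "q = 0"
proof -
 have "finite (\<Union>m\<in>Poly_Mapping.keys q. snd ` Poly_Mapping.keys m)" by simp
 then obtain m0 where m0: "\<And>m v. m \<in> Poly_Mapping.keys q \<Longrightarrow> v \<in> Poly_Mapping.keys m \<Longrightarrow> snd v \<le> m0"
  unfolding finite_nat_set_iff_bounded_le by blast
 let ?V = "{1..n} \<times> {..m0}"
 let ?B = "\<lambda>v :: nat \<times> nat. if snd v = 0 then of_nat ` {m0 + 1..} else UNIV :: complex set"
 have V: "over ?V q" using q m0 unfolding over_def by fastforce
 show ?thesis
 proof (rule poly_vanishes_on_grid[of ?V q ?B])
  fix v :: "nat \<times> nat" show "infinite (?B v)"
   using infinite_UNIV_char_0[where ?'a = complex] by (auto simp: finite_image_iff inj_on_def infinite_Ici)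
 next
  fix \<tau> :: "nat \<times> nat \<Rightarrow> complex" assume \<tau>: "\<And>v. v \<in> ?V \<Longrightarrow> \<tau> v \<in> ?B v"
  have "\<forall>j\<in>{1..n}. \<exists>k. k \<ge> m0 + 1 \<and> \<tau> (j, 0) = of_nat k"
  proof
   fix j assume "j \<in> {1..n}"
   hence "\<tau> (j, 0) \<in> of_nat ` {m0 + 1..}" using \<tau>[of "(j, 0)"] by simp
   thus "\<exists>k. k \<ge> m0 + 1 \<and> \<tau> (j, 0) = of_nat k" by auto
  qed
  then obtain Mm where Mm: "\<And>j. j \<in> {1..n} \<Longrightarrow> Mm j \<ge> m0 + 1 \<and> \<tau> (j, 0) = of_nat (Mm j)"
   unfolding bchoice_iff by blast
  obtain Sg J b where fd: "fock_data G n Sg J b" "\<And>j. j \<in> {1..n} \<Longrightarrow> card {s\<in>Sg. J s = j} = Mm j"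
   "\<And>j r. j \<in> {1..n} \<Longrightarrow> 1 \<le> r \<Longrightarrow> r \<le> Mm j \<Longrightarrow> esym b {s\<in>Sg. J s = j} r = (if r \<le> m0 then \<tau> (j, r) else 1)"
   by (rule sites_exist[of Mm "\<lambda>j r. if r \<le> m0 then \<tau> (j, r) else 1"]) (use Mm in fastforce)+
  have "\<tau> v = site_tau Sg J b v" if "v \<in> ?V" for v
  proof -
   obtain j r where v: "v = (j, r)" by (cases v)
   have j: "j \<in> {1..n}" "r \<le> m0" using that by (auto simp: v)
   show ?thesis
   proof (cases "r = 0")
    case True thus ?thesis using fd(2)[OF j(1)] Mm[OF j(1)] by (simp add: site_tau_def v)
   next
    case False
    have "esym b {s\<in>Sg. J s = j} r = (if r \<le> m0 then \<tau> (j, r) else 1)"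
     by (rule fd(3)) (use j Mm[OF j(1)] False in auto)
    thus ?thesis using False j by (simp add: site_tau_def v)
   qed
  qed
  hence "ev.psubst \<tau> q = ev.psubst (site_tau Sg J b) q" by (rule psubst_over[OF V])
  thus "ev.psubst \<tau> q = 0" using ev[OF fd(1)] by simp
 qed (use V in \<open>auto simp: over_def\<close>)
qed

text \<open>With the numbers of sites fixed, the coordinates range over nonzero values: still an
  infinite set for each, and the top coordinate is allowed by \<open>sites_exist\<close>.\<close>

lemma grid_fixed:
 assumes q: "over {(j, r). 1 \<le> j \<and> j \<le> n \<and> 1 \<le> r \<and> r \<le> Mm j} q"
  and ev: "\<And>Sg J b. fock_data G n Sg J b \<Longrightarrow> (\<And>j. j \<in> {1..n} \<Longrightarrow> card {s\<in>Sg. J s = j} = Mm j) \<Longrightarrow> ev.psubst (site_tau Sg J b) q = 0"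
 shows "q = 0"
proof -
 let ?V = "{(j, r). 1 \<le> j \<and> j \<le> n \<and> 1 \<le> r \<and> r \<le> Mm j}"
 have "?V = Sigma {1..n} (\<lambda>j. {1..Mm j})" by auto
 hence fin: "finite ?V" by simp
 show ?thesis
 proof (rule poly_vanishes_on_grid[of ?V q "\<lambda>_. UNIV - {0}"])
  show "infinite (UNIV - {0 :: complex})" using infinite_UNIV_char_0[where ?'a = complex] by simp
 next
  fix \<tau> :: "nat \<times> nat \<Rightarrow> complex" assume \<tau>: "\<And>v. v \<in> ?V \<Longrightarrow> \<tau> v \<in> UNIV - {0}"
  obtain Sg J b where fd: "fock_data G n Sg J b" "\<And>j. j \<in> {1..n} \<Longrightarrow> card {s\<in>Sg. J s = j} = Mm j"
   "\<And>j r. j \<in> {1..n} \<Longrightarrow> 1 \<le> r \<Longrightarrow> r \<le> Mm j \<Longrightarrow> esym b {s\<in>Sg. J s = j} r = \<tau> (j, r)"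
   by (rule sites_exist[of Mm "\<lambda>j r. \<tau> (j, r)"]) (use \<tau> in fastforce)+
  have "\<tau> v = site_tau Sg J b v" if "v \<in> ?V" for v
   using that fd(3) by (cases v) (auto simp: site_tau_def)
  hence "ev.psubst \<tau> q = ev.psubst (site_tau Sg J b) q" by (rule psubst_over[OF q])
  thus "ev.psubst \<tau> q = 0" using ev[OF fd(1,2)] by simp
 qed (use q fin in \<open>auto simp: over_def\<close>)
qed

end

lemma (in fock_data) J0_eval:
 assumes "J0 (E - Lin q)" "fr.act E v0 = sF c v0"
 shows "ev.psubst tau q = c"
proof -
 have "fr.act E v0 = fr.act (Lin q) v0"
  using act_J0[OF assms(1)] unfolding fr.act_diff by simp
 thus ?thesis unfolding assms(2) act_Lin by (rule sF_cancel[symmetric])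
qed

context A2n2
begin

lemma Ehat_from_eval:
 assumes jr: "1 \<le> j" "j \<le> n" "r \<ge> 1" and p: "AA p" "J0 (E - Lin (Theta p))" and C: "C \<noteq> 0"
  and ev: "\<And>Sg J b. fock_data G n Sg J b \<Longrightarrow> ev.psubst (site_tau Sg J b) (Theta p) = C * esym b {s\<in>Sg. J s = j} r"
 shows "J0 (Ehat (j, r) - scl (1 / C) * E)"
proof -
 let ?v = "(j, r)"
 have "Theta p - Poly_Mapping.single 0 C * Tv ?v = 0"
 proof (rule grid_all)
  show "over ({1..n} \<times> UNIV) (Theta p - Poly_Mapping.single 0 C * Tv ?v)"
   by (intro over_diff over_mult over_scalar over_Tv over_Theta[OF AA_HH[OF p(1)]] over_theta) (use jr in simp)
  fix Sg J b assume fd: "fock_data G n Sg J b"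
  have "ev.psubst (site_tau Sg J b) (Poly_Mapping.single 0 C * Tv ?v) = C * esym b {s\<in>Sg. J s = j} r"
   using jr by (simp add: ev.psubst_mult Tv_def site_tau_def)
  thus "ev.psubst (site_tau Sg J b) (Theta p - Poly_Mapping.single 0 C * Tv ?v) = 0"
   using ev[OF fd] by (simp add: ev.psubst_diff)
 qed
 hence "Lin (Theta p) = scl C * L (Poly_Mapping.single ?v 1)"
  using Lin_scl[of C "Tv ?v"] by (simp add: Tv_def Lin_single)
 hence "J0 (scl (- (1 / C)) * (E - scl C * L (Poly_Mapping.single ?v 1)))" using J0_lmult[OF p(2) fr_scalar] by simp
 moreover have "scl (- (1 / C)) * (E - scl C * L (Poly_Mapping.single ?v 1)) = L (Poly_Mapping.single ?v 1) - scl (1 / C) * E"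
  using C by (simp add: right_diff_distrib mult.assoc[symmetric] scl_mult single_uminus)
 ultimately have 1: "J0 (L (Poly_Mapping.single ?v 1) - scl (1 / C) * E)" by simp
 have e: "mono [?v] = Poly_Mapping.single ?v 1" "prodl [?v] = Ehat ?v"
  unfolding mono.simps prodl.simps by (rule add_0_right, rule mult_1_right)
 have "L (Poly_Mapping.single ?v 1) - Ehat ?v \<in> UU" using L_prodl[of "[?v]"] unfolding e .
 hence "J0 (Ehat ?v - L (Poly_Mapping.single ?v 1))" by (rule J0_UU[OF UU_sym])
 moreover have "u - v + (v - w) = u - w" for u v w :: "'g word \<Rightarrow>\<^sub>0 complex" by simp
 ultimately show ?thesis using J0_add[OF _ 1, of "Ehat ?v - L (Poly_Mapping.single ?v 1)"] by (simp only: )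
qed

lemma Ehat_rank_one:
 assumes j: "1 \<le> j" "j \<le> n" and r: "r \<ge> 1"
 shows "\<exists>y\<in>F. J0 (Ehat (j, r) - y * letter (gen_f G j) ^ r)"
proof (cases "j < n")
 case True
 from rank_one_short[OF j(1) True] obtain Y where Y0: "Y \<in> Cg \<and> T (N + 1) Y (Xc (int j) (N + int j + 1)) \<and>
  (\<forall>r. \<exists>p. AA p \<and> J0 (letter Y ^ r * letter (gen_f G j) ^ r - Lin (Theta p)))" by (rule exE)
 note Y = Y0[THEN conjunct1] Y0[THEN conjunct2, THEN conjunct1] Y0[THEN conjunct2, THEN conjunct2, THEN spec]
 from Y(3)[of r] obtain p where p: "AA p" "J0 (letter Y ^ r * letter (gen_f G j) ^ r - Lin (Theta p))" by (elim exE conjE)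
 let ?C = "of_nat (fact r * fact r) :: complex"
 have "J0 (Ehat (j, r) - scl (1 / ?C) * (letter Y ^ r * letter (gen_f G j) ^ r))"
 proof (rule Ehat_from_eval[OF j r p])
  fix Sg J b assume fd: "fock_data G n Sg J b"
  show "ev.psubst (site_tau Sg J b) (Theta p) = ?C * esym b {s\<in>Sg. J s = j} r"
   by (rule fock_data.J0_eval[OF fd p(2) fock_data.eval_short[OF fd j(1) True Y(2)]])
 qed simp
 hence "J0 (Ehat (j, r) - (scl (1 / ?C) * letter Y ^ r) * letter (gen_f G j) ^ r)" by (simp only: mult.assoc)
 moreover have "scl (1 / ?C) * letter Y ^ r \<in> F" by (intro fr_mult fr_scalar fr_power fr_letter Y(1))
 ultimately show ?thesis by (rule bexI)
next
 case False
 hence jn: "j = n" using j by simp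
 from rank_one_long obtain Y where Y0: "Y \<in> Cg \<and> T (N - int n) Y (Xc (int n) N) \<and>
  (\<forall>r. \<exists>p. AA p \<and> J0 (letter Y ^ (2 * r) * letter (gen_f G n) ^ r - Lin (Theta p)))" by (rule exE)
 note Y = Y0[THEN conjunct1] Y0[THEN conjunct2, THEN conjunct1] Y0[THEN conjunct2, THEN conjunct2, THEN spec]
 from Y(3)[of r] obtain p where p: "AA p" "J0 (letter Y ^ (2 * r) * letter (gen_f G n) ^ r - Lin (Theta p))" by (elim exE conjE)
 let ?C = "of_nat (fact r * cc r 0) * sg (int n) ^ r :: complex"
 have "J0 (Ehat (n, r) - scl (1 / ?C) * (letter Y ^ (2 * r) * letter (gen_f G n) ^ r))"
 proof (rule Ehat_from_eval[OF n1 order_refl r p])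
  fix Sg J b assume fd: "fock_data G n Sg J b"
  show "ev.psubst (site_tau Sg J b) (Theta p) = ?C * esym b {s\<in>Sg. J s = n} r"
   by (rule fock_data.J0_eval[OF fd p(2) fock_data.eval_long[OF fd Y(2)]])
 qed (use cc_pos[of r 0] in \<open>simp add: sg_def\<close>)
 hence "J0 (Ehat (n, r) - (scl (1 / ?C) * letter Y ^ (2 * r)) * letter (gen_f G n) ^ r)" by (simp only: mult.assoc)
 moreover have "scl (1 / ?C) * letter Y ^ (2 * r) \<in> F" by (intro fr_mult fr_scalar fr_power fr_letter Y(1))
 ultimately show ?thesis unfolding jn by (rule bexI)
qed

subsection \<open>Gradings and root vectors\<close>

lemma delta_at: "delta n G sc = 2"
proof -
 have "delta n G sc = (\<Sum>i\<le>n. if i = 0 then 2 else 0)" unfolding delta_def root_combination_def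
  by (rule sum.cong) (use sc n1 in auto)
 thus ?thesis by simp
qed

lemma component_sc: "x \<in> current_component n G l \<Longrightarrow> br sc x = sm (of_nat l) x"
proof -
 have "current_component n G l \<subseteq> {x. br sc x = sm (of_nat l) x}" unfolding current_component_def
 proof (rule V.span_minimal)
  show sub: "V.subspace {x. br sc x = sm (of_nat l) x}"
   by (auto simp: V.subspace_def br_add_r br_sm_r V.scale_right_distrib V.scale_scale mult.commute)
  have "sum_of_root_spaces G {\<beta> \<in> positive_roots n G \<union> fin_neg_roots n G. \<beta> (scaling_element n G) = of_nat l} \<subseteq> {x. br sc x = sm (of_nat l) x}"
  proof (rule sum_of_root_spaces_minimal[OF _ sub], rule subsetI)
   fix \<beta> x assume "\<beta> \<in> {\<beta> \<in> positive_roots n G \<union> fin_neg_roots n G. \<beta> (scaling_element n G) = of_nat l}" "x \<in> root_space G \<beta>"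
   thus "x \<in> {x. br sc x = sm (of_nat l) x}" using rsD[OF _ sc(1), of x \<beta>] by (simp add: sc_def)
  qed
  moreover have "fin_cartan n G \<subseteq> {x. br sc x = sm (of_nat 0) x}"
   using fin_cartan_H HH0 sc(1) by auto
  moreover have "br sc 0 = 0" using br_sm_r[of sc 0 0] by simp
  ultimately show "(if l = 0 then fin_cartan n G else {0}) \<union> sum_of_root_spaces G
   {\<beta> \<in> positive_roots n G \<union> fin_neg_roots n G. \<beta> (scaling_element n G) = of_nat l} \<subseteq> {x. br sc x = sm (of_nat l) x}"
   by (cases "l = 0") auto
 qed
 thus "x \<in> current_component n G l \<Longrightarrow> br sc x = sm (of_nat l) x" by blast
qed

lemma homp_theta: "x \<in> current_component n G l \<Longrightarrow> homp ww l (theta x)"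
 unfolding theta_def
proof (rule homp_sum, rule homp_sum)
 fix j k assume x: "x \<in> current_component n G l" and k: "k \<in> {k. omega j k x \<noteq> 0}"
 have "\<exists>a. Phi x (int k * N) a \<noteq> 0"
 proof (rule ccontr)
  assume "\<not> ?thesis"
  thus False using k by (simp add: omega_def)
 qed
 then obtain a where a: "Phi x (int k * N) a \<noteq> 0" by blast
 have "of_nat l * Phi x (int k * N) a = Phi (br sc x) (int k * N) a" by (simp add: component_sc[OF x] Phi_sm)
 also have "\<dots> = (of_nat k * 2) * Phi x (int k * N) a" by (simp only: Phi_h[OF sc(1)] pih_shift delta_at)
 finally have "(of_nat l :: complex) = of_nat k * 2" using a by simp
 hence "(of_nat l :: complex) = of_nat (2 * k)" by (simp add: mult.commute)
 hence "l = 0 + 2 * k" by (simp only: of_nat_eq_iff add_0)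
 moreover have "homp ww (0 + 2 * k) (Poly_Mapping.single 0 (omega j k x) * Pk j k)" by (intro homp_mult homp_scalar homp_Pk)
 ultimately show "homp ww l (Poly_Mapping.single 0 (omega j k x) * Pk j k)" by simp
qed

lemma eta_component: "k \<ge> 1 \<Longrightarrow> eta j k \<in> current_h_plus n G" "k \<ge> 1 \<Longrightarrow> eta j k \<in> current_component n G (2 * k)"
proof -
 assume k: "k \<ge> 1"
 show "eta j k \<in> current_h_plus n G" unfolding current_h_plus_def sum_of_root_spaces_def
  by (rule V.span_base) (use eta_rs[OF k] k in blast)
 show "eta j k \<in> current_component n G (2 * k)"
 proof (cases "eta j k = 0")
  case True thus ?thesis by (simp add: current_component_def V.span_zero)
 next
  case False
  have e: "(\<lambda>h. of_nat k * delta n G h) = root_combination G {..n} (\<lambda>i. of_nat (k * (if i = n then 1 else 2)))"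
   by (auto simp: delta_def root_combination_def sum_distrib_left mult.assoc intro!: ext sum.cong)
  have "(\<lambda>h. of_nat k * delta n G h) \<in> roots G" unfolding roots_def
  proof (intro CollectI conjI)
   show "(\<lambda>h. of_nat k * delta n G h) \<in> dual G H" unfolding e by (rule root_combo_in_dual) simp
   have "of_nat k * delta n G sc \<noteq> 0" using k by (simp add: delta_at)
   thus "(\<lambda>h. of_nat k * delta n G h) \<noteq> 0" by (auto simp: fun_eq_iff)
   show "\<exists>x\<in>root_space G (\<lambda>h. of_nat k * delta n G h). x \<noteq> 0" using eta_rs[OF k] False by blast
  qed
  hence "(\<lambda>h. of_nat k * delta n G h) \<in> positive_roots n G" unfolding positive_roots_def
   by (intro CollectI conjI exI) (assumption, rule e)
  moreover have "of_nat k * delta n G (scaling_element n G) = of_nat (2 * k)" using delta_at by (simp add: sc_def)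
  ultimately have mem: "(\<lambda>h. of_nat k * delta n G h) \<in> {\<beta> \<in> positive_roots n G \<union> fin_neg_roots n G. \<beta> (scaling_element n G) = of_nat (2 * k)}" by simp
  have "eta j k \<in> sum_of_root_spaces G {\<beta> \<in> positive_roots n G \<union> fin_neg_roots n G. \<beta> (scaling_element n G) = of_nat (2 * k)}"
   unfolding sum_of_root_spaces_def by (rule V.span_base, rule UN_I[OF mem], rule eta_rs[OF k])
  thus ?thesis unfolding current_component_def by (intro V.span_base) blast
 qed
qed

text \<open>A nonzero entry of x makes the value of \<beta> on \<open>h0\<close> an integer, the
  height. So positivity alone puts x into the positive part, and this covers the halved roots as
  well.\<close>

lemma rs_real_current:
 assumes "x \<in> root_space G \<beta>" "\<beta> h0 = of_real r" "r > 0"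
 shows "x \<in> Cg"
proof (cases "\<forall>k m. Phi x k m = 0")
 case True
 have "\<beta> h0 \<noteq> 0" using assms by simp
 hence "x = 0" using rs_inj[OF assms(1) _ h0(1)] True by blast
 thus ?thesis using V.subspace_0[OF current_subspace] by simp
next
 case False
 then obtain k m where km: "Phi x k m \<noteq> 0" by blast
 have b: "\<beta> h0 = of_int k" using rs_Phi[OF assms(1) h0(1) km] by (simp add: pih_h0)
 hence "complex_of_real (of_int k) = of_real r" using assms(2) by simp
 hence "real_of_int k = r" by (simp only: of_real_eq_iff)
 hence k: "k > 0" using assms(3) by simp
 have "br h0 x = sm (of_int k) x" using rsD[OF assms(1) h0(1)] b by simp
 from eigen_T(1)[OF this] have "P 1 (nat k) x (Phi x k)" using k by (simp add: T_def)
 thus ?thesis by (rule P_current)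
qed

lemma n_plus_current: "x \<in> current_n_plus n G \<Longrightarrow> x \<in> Cg"
proof -
 have "current_n_plus n G \<subseteq> Cg" unfolding current_n_plus_def
 proof (rule sum_of_root_spaces_minimal[OF _ current_subspace], rule subsetI)
  fix \<beta> x assume b: "\<beta> \<in> real_roots_pos n G" and x: "x \<in> root_space G \<beta>"
  have al: "\<exists>r::nat. r \<ge> 1 \<and> \<alpha> h0 = of_nat r" if "\<alpha> \<in> fin_pos_roots n G" for \<alpha>
   by (rule fin_combo[OF that]) blast
  consider "\<beta> \<in> fin_pos_roots n G" | \<alpha> k where "\<alpha> \<in> fin_pos_roots n G" "\<beta> = (\<lambda>h. \<alpha> h + of_nat k * delta n G h)"
   | \<alpha> k where "\<alpha> \<in> fin_pos_roots n G" "\<beta> = (\<lambda>h. \<alpha> h + 2 * of_nat k * delta n G h)"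
   | \<alpha> k where "\<alpha> \<in> fin_pos_roots n G" "\<beta> = (\<lambda>h. (\<alpha> h + (2 * of_nat k + 1) * delta n G h) / 2)"
   using b unfolding real_roots_pos_def by blast
  hence "\<exists>r::real. r > 0 \<and> \<beta> h0 = of_real r"
  proof cases
   case 1
   obtain r :: nat where "r \<ge> 1" "\<beta> h0 = of_nat r" using al[OF 1] by blast
   thus ?thesis by (intro exI[of _ "real r"]) simp
  next
   case (2 \<alpha> k)
   obtain r :: nat where "r \<ge> 1" "\<alpha> h0 = of_nat r" using al[OF 2(1)] by blast
   thus ?thesis using N3 by (intro exI[of _ "real r + real k * of_int N"]) (simp add: 2(2) delta_h0 add_pos_nonneg)
  next
   case (3 \<alpha> k)
   obtain r :: nat where "r \<ge> 1" "\<alpha> h0 = of_nat r" using al[OF 3(1)] by blast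
   thus ?thesis using N3 by (intro exI[of _ "real r + 2 * real k * of_int N"]) (simp add: 3(2) delta_h0 add_pos_nonneg)
  next
   case (4 \<alpha> k)
   obtain r :: nat where "r \<ge> 1" "\<alpha> h0 = of_nat r" using al[OF 4(1)] by blast
   thus ?thesis using N3 by (intro exI[of _ "(real r + (2 * real k + 1) * of_int N) / 2"]) (simp add: 4(2) delta_h0 add_pos_nonneg)
  qed
  thus "x \<in> Cg" using rs_real_current[OF x] by blast
 qed
 thus "x \<in> current_n_plus n G \<Longrightarrow> x \<in> Cg" by blast
qed

lemma fin_neg_current:
 assumes "\<alpha> \<in> fin_pos_roots n G" "x \<in> root_space G (- \<alpha>)"
 shows "x \<in> Cg"
proof (rule fin_combo[OF assms(1)])
 fix c k assume k: "k \<ge> 1" "\<alpha> h0 = of_nat k" "\<alpha> sc = 0"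
 have "br h0 x = sm (of_int (- int k)) x" using rsD[OF assms(2) h0(1)] k by simp
 from eigen_T(1)[OF this] have "P (- 1) k x (Phi x (- int k))" using k(1) by (simp add: T_def)
 moreover have "br sc x = 0" using rsD[OF assms(2) sc(1)] k by simp
 ultimately have "FP (- 1) k x" by (intro P_FP) auto
 thus "x \<in> Cg" by (rule FP_current)
qed

text \<open>\<open>coroot\<close> is characterised through root spaces and has to be matched with
  the given simple coroot: x has height 1, so its bracket with \<open>f\<^sub>j\<close> is a
  multiple of the simple coroot, and the value 2 fixes the multiple.\<close>

lemma coroot_al: "1 \<le> j \<Longrightarrow> j \<le> n \<Longrightarrow> coroot G (al j) = cv j"
proof -
 assume j: "1 \<le> j" "j \<le> n"
 obtain x h where x: "x \<in> root_space G (al j)" "br x (gen_f G j) = h" "al j h \<noteq> 0" "coroot G (al j) = sm (2 / al j h) h"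
  using coroot_fin[OF al_fin[OF j] f_rs[OF j(2)] gen_nz(2)[OF j(2)]] by blast
 have "br h0 x = sm (of_int 1) x" using rsD[OF x(1) h0(1)] h0(2) j by simp
 from eigen_T(1)[OF this] have "P 1 1 x (Phi x 1)" by (simp add: T_def)
 then obtain a where a: "x = (\<Sum>i\<le>n. sm (a i) (g 1 i))" using P1_lin[of 1 1 x "Phi x 1"] by blast
 have s: "br (\<Sum>i\<in>K. sm (a i) (g 1 i)) (gen_f G j) = (\<Sum>i\<in>K. sm (a i) (br (g 1 i) (gen_f G j)))" if "finite K" for K
  using that by (induction K rule: finite_induct) (use br_sm_l[of 0 0] in \<open>simp_all add: br_add_l br_sm_l\<close>)
 have "h = (\<Sum>i\<le>n. sm (a i) (br (g 1 i) (gen_f G j)))" using x(2) s[of "{..n}"] by (simp only: a finite_atMost)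
 also have "\<dots> = (\<Sum>i\<le>n. if i = j then sm (a j) (cv j) else 0)"
  by (rule sum.cong) (use br_ef[of _ j] j in \<open>auto simp: g_def\<close>)
 finally have h: "h = sm (a j) (cv j)" using j by simp
 have "al j h = 2 * a j" unfolding h al_sm[OF j(2) cv_H[OF j(2)]]
  using al_cv[OF j(2) j(2)] by (simp add: cartan_matrix_A2n2_def)
 thus ?thesis using x(3) unfolding x(4) h by simp
qed

end

subsection \<open>Quotient rings with extra fields\<close>

lemma ext_ops [simp]: "carrier (ring.extend R x) = carrier R" "monoid.mult (ring.extend R x) = monoid.mult R" "monoid.one (ring.extend R x) = monoid.one R"
 "ring.zero (ring.extend R x) = ring.zero R" "ring.add (ring.extend R x) = ring.add R"
 by (simp_all add: ring.defs)

lemma ext_fields [simp]: "scalar (ring.extend R (graded_algebra.fields s c)) = s" "component (ring.extend R (graded_algebra.fields s c)) = c"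
 by (simp_all add: ring.defs graded_algebra.defs)

lemma ring_ext:
 assumes "ring R"
 shows "ring (ring.extend R x)"
proof -
 interpret R: ring R by fact
 show ?thesis
 proof (rule ringI)
  show "abelian_group (ring.extend R x)"
  proof (rule abelian_groupI)
   fix a assume "a \<in> carrier (ring.extend R x)"
   thus "\<exists>y\<in>carrier (ring.extend R x). y \<oplus>\<^bsub>ring.extend R x\<^esub> a = \<zero>\<^bsub>ring.extend R x\<^esub>"
    by (intro bexI[of _ "\<ominus>\<^bsub>R\<^esub> a"]) (auto simp: R.l_neg)
  qed (auto simp: R.a_ac)
  show "Group.monoid (ring.extend R x)" by (rule monoidI) (auto simp: R.m_assoc)
 qed (auto simp: R.l_distr R.r_distr)
qed

lemma quot_ops:
 "carrier (R Quot I) = (\<lambda>p. I +>\<^bsub>R\<^esub> p) ` carrier R" "\<zero>\<^bsub>R Quot I\<^esub> = I" "\<one>\<^bsub>R Quot I\<^esub> = I +>\<^bsub>R\<^esub> \<one>\<^bsub>R\<^esub>"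
 by (auto simp: FactRing_def A_RCOSETS_def' )

lemma quot_add: "ideal I R \<Longrightarrow> p \<in> carrier R \<Longrightarrow> q \<in> carrier R \<Longrightarrow> ring.add (R Quot I) (I +>\<^bsub>R\<^esub> p) (I +>\<^bsub>R\<^esub> q) = I +>\<^bsub>R\<^esub> (p \<oplus>\<^bsub>R\<^esub> q)"
 by (simp add: FactRing_def ideal.a_rcos_sum)

lemma quot_mult: "ideal I R \<Longrightarrow> p \<in> carrier R \<Longrightarrow> q \<in> carrier R \<Longrightarrow> monoid.mult (R Quot I) (I +>\<^bsub>R\<^esub> p) (I +>\<^bsub>R\<^esub> q) = I +>\<^bsub>R\<^esub> (p \<otimes>\<^bsub>R\<^esub> q)"
 by (simp add: FactRing_def ideal.rcoset_mult_add)

lemma quot_eq: "ideal I R \<Longrightarrow> p \<in> carrier R \<Longrightarrow> q \<in> carrier R \<Longrightarrow> (I +>\<^bsub>R\<^esub> p = I +>\<^bsub>R\<^esub> q) \<longleftrightarrow> p \<ominus>\<^bsub>R\<^esub> q \<in> I"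
proof -
 assume a: "ideal I R" "p \<in> carrier R" "q \<in> carrier R"
 show ?thesis using ring.quotient_eq_iff_same_a_r_cos[OF ideal.axioms(2)[OF a(1)] a] by (simp only: )
qed

lemma free_minus: "p \<in> carrier (free_ring S) \<Longrightarrow> q \<in> carrier (free_ring S) \<Longrightarrow> p \<ominus>\<^bsub>free_ring S\<^esub> q = p - q"
 by (simp add: a_minus_def fr_uminus fr_ops)

lemma subgroup_of_ring:
 assumes "ring R" "H \<subseteq> carrier R" "\<zero>\<^bsub>R\<^esub> \<in> H" "\<And>x y. x \<in> H \<Longrightarrow> y \<in> H \<Longrightarrow> x \<oplus>\<^bsub>R\<^esub> y \<in> H" "\<And>x. x \<in> H \<Longrightarrow> \<ominus>\<^bsub>R\<^esub> x \<in> H"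
 shows "additive_subgroup H R"
 by (rule additive_subgroup.intro, rule subgroup.intro) (use assms in \<open>auto simp: a_inv_def[symmetric]\<close>)

context A2n2
begin

abbreviation co where "co p \<equiv> UU +>\<^bsub>free_ring Cg\<^esub> p"
abbreviation U where "U \<equiv> current_uea n G"

lemma U_ring: "ring U"
 unfolding current_uea_def uea_def by (rule ring_ext, rule ideal.quotient_is_ring, rule UU_ideal)

lemma U_carrier: "carrier U = co ` F" "\<zero>\<^bsub>U\<^esub> = UU" "\<one>\<^bsub>U\<^esub> = co 1" "scalar U c = co (scl c)"
 by (simp_all add: current_uea_def uea_def quot_ops fr_ops)

lemma co_add: "p \<in> F \<Longrightarrow> q \<in> F \<Longrightarrow> co p \<oplus>\<^bsub>U\<^esub> co q = co (p + q)"
 and co_mult: "p \<in> F \<Longrightarrow> q \<in> F \<Longrightarrow> co p \<otimes>\<^bsub>U\<^esub> co q = co (p * q)"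
 using quot_add[OF UU_ideal, of p q] quot_mult[OF UU_ideal, of p q]
 by (simp_all add: current_uea_def uea_def fr_ops)

lemma co_eq: "p \<in> F \<Longrightarrow> q \<in> F \<Longrightarrow> co p = co q \<longleftrightarrow> p - q \<in> UU"
 using quot_eq[OF UU_ideal, of p q] by (simp add: free_minus)

lemma co_0: "co 0 = \<zero>\<^bsub>U\<^esub>"
 unfolding U_carrier(2) by (rule ring.a_rcos_zero[OF ring_free_ring UU_ideal UU_zero])

lemma co_neg: "p \<in> F \<Longrightarrow> \<ominus>\<^bsub>U\<^esub> co p = co (- p)"
proof -
 assume p: "p \<in> F"
 interpret R: ring U by (rule U_ring)
 have "co (- p) \<oplus>\<^bsub>U\<^esub> co p = \<zero>\<^bsub>U\<^esub>" using co_add[OF fr_minus[OF p] p] co_0 by simp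
 thus ?thesis using p fr_minus[OF p] by (intro R.minus_equality) (auto simp: U_carrier)
qed

lemma co_pow: "p \<in> F \<Longrightarrow> co p [^]\<^bsub>U\<^esub> (k::nat) = co (p ^ k)"
proof (induction k)
 case 0
 interpret R: ring U by (rule U_ring)
 show ?case by (simp add: U_carrier)
next
 case (Suc k)
 interpret R: ring U by (rule U_ring)
 show ?case using Suc co_mult[OF fr_power[OF Suc.prems] Suc.prems, of k] by (simp add: power_commutes)
qed

end

subsection \<open>The annihilator of the vacuum\<close>

context fock_data
begin

definition Ann where "Ann = co ` {p\<in>F. fr.act p v0 = 0}"

lemma AnnD: "p \<in> F \<Longrightarrow> co p \<in> Ann \<Longrightarrow> fr.act p v0 = 0"
 unfolding Ann_def using co_eq act_congr by fastforce

lemma rho_H: "h \<in> H \<Longrightarrow> rho h v0 = sF (chi h) v0"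
 by (rule rho_diag) (simp add: Phi_H split: if_splits)

text \<open>Both sides are linear. On the coroot of node j the vacuum has as eigenvalue the power
  sum of degree 0, which is the number of sites of type j.\<close>

lemma chi_weight:
 assumes dom: "\<Lambda> \<in> dominant_weights n G"
  and cards: "\<And>j. j \<in> {1..n} \<Longrightarrow> card {s\<in>Sg. J s = j} = nat_pairing \<Lambda> (cv j)" and h: "h \<in> fin_cartan n G"
 shows "chi h = \<Lambda> h"
proof -
 have d: "\<Lambda> \<in> dual G (fin_cartan n G)" "\<And>i. i \<in> {1..n} \<Longrightarrow> \<Lambda> (cv i) \<in> \<nat>" using dom by (auto simp: dominant_weights_def)
 have "fin_cartan n G \<subseteq> {h \<in> fin_cartan n G. chi h = \<Lambda> h}" (is "_ \<subseteq> ?X")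
  unfolding fin_cartan_def
 proof (rule V.span_minimal)
  show "cv ` {1..n} \<subseteq> {h \<in> V.span (cv ` {1..n}). chi h = \<Lambda> h}"
  proof clarify
   fix j assume j: "j \<in> {1..n}"
   have "sF (chi (cv j)) v0 = sF (\<Sum>s\<in>{s\<in>Sg. J s = j}. b s ^ 0) v0"
    using act_eta[of j 0] rho_H[of "cv j"] cv_H[of j] j by (simp add: eta_0)
   hence "chi (cv j) = of_nat (card {s\<in>Sg. J s = j})" using sF_cancel by fastforce
   moreover obtain m where m: "\<Lambda> (cv j) = of_nat m" using d(2)[OF j] by (auto elim: Nats_cases)
   moreover have "nat_pairing \<Lambda> (cv j) = m" unfolding nat_pairing_def m by (rule the_equality) auto
   ultimately show "cv j \<in> V.span (cv ` {1..n}) \<and> chi (cv j) = \<Lambda> (cv j)" using cards[OF j] j by (simp add: V.span_base)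
  qed
  have z: "\<Lambda> 0 = 0"
  proof -
   have "\<Lambda> (sm 0 0) = 0 * \<Lambda> 0" using d(1) V.subspace_0[OF fin_cartan_subspace] unfolding dual_def by blast
   thus ?thesis by simp
  qed
  have "chi 0 = 0" using chi_sm[of 0 0] by simp
  thus "V.subspace {h \<in> V.span (cv ` {1..n}). chi h = \<Lambda> h}"
   using d(1) z unfolding V.subspace_def fin_cartan_def dual_def
   by (auto simp: chi_add chi_sm V.span_zero V.span_add V.span_scale)
 qed
 thus ?thesis using h by blast
qed

text \<open>These are the conditions on the left ideals whose intersection defines the left ideal of
  the Weyl relations, so that ideal is contained in \<open>Ann\<close>: the vacuum generates a
  quotient of the global Weyl module.\<close>

lemma Ann_family:
 assumes dom: "\<Lambda> \<in> dominant_weights n G" and cards: "\<And>j. j \<in> {1..n} \<Longrightarrow> card {s\<in>Sg. J s = j} = nat_pairing \<Lambda> (cv j)"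
 shows "additive_subgroup Ann U" "\<And>a x. a \<in> carrier U \<Longrightarrow> x \<in> Ann \<Longrightarrow> a \<otimes>\<^bsub>U\<^esub> x \<in> Ann" "weyl_relations n G \<Lambda> \<subseteq> Ann" "Ann \<subseteq> carrier U"
proof -
 show sub: "Ann \<subseteq> carrier U" by (auto simp: Ann_def U_carrier)
 have AnnI: "co p \<in> Ann" if "p \<in> F" "fr.act p v0 = 0" for p using that by (auto simp: Ann_def)
 have AnnE: "\<exists>p\<in>F. x = co p \<and> fr.act p v0 = 0" if "x \<in> Ann" for x using that by (auto simp: Ann_def)
 show "additive_subgroup Ann U"
 proof (rule subgroup_of_ring[OF U_ring sub])
  show "\<zero>\<^bsub>U\<^esub> \<in> Ann" unfolding co_0[symmetric] by (rule AnnI[OF fr_zero]) simp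
  fix x y assume "x \<in> Ann" "y \<in> Ann"
  then obtain p q where "p \<in> F" "x = co p" "fr.act p v0 = 0" "q \<in> F" "y = co q" "fr.act q v0 = 0" using AnnE by meson
  thus "x \<oplus>\<^bsub>U\<^esub> y \<in> Ann" by (simp add: co_add AnnI fr_add fr.act_add)
 next
  fix x assume "x \<in> Ann"
  then obtain p where "p \<in> F" "x = co p" "fr.act p v0 = 0" using AnnE by meson
  thus "\<ominus>\<^bsub>U\<^esub> x \<in> Ann" by (simp add: co_neg AnnI fr_minus fr.act_minus)
 qed
 show "a \<otimes>\<^bsub>U\<^esub> x \<in> Ann" if ax: "a \<in> carrier U" "x \<in> Ann" for a x
 proof -
  obtain q where "q \<in> F" "a = co q" using ax(1) unfolding U_carrier(1) by blast
  moreover obtain p where "p \<in> F" "x = co p" "fr.act p v0 = 0" using AnnE[OF ax(2)] by blast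
  ultimately show ?thesis by (simp add: co_mult AnnI fr_mult fr.act_mult)
 qed
 show "weyl_relations n G \<Lambda> \<subseteq> Ann"
  unfolding weyl_relations_def Let_def uea_embed_def
 proof (intro Un_least subsetI)
  fix X assume "X \<in> {co (letter x) | x. x \<in> current_n_plus n G}"
  then obtain x where "X = co (letter x)" "x \<in> current_n_plus n G" by blast
  thus "X \<in> Ann" using AnnI[OF fr_letter[OF n_plus_current]] act_n_plus by blast
 next
  fix X assume "X \<in> {co (letter h) \<ominus>\<^bsub>U\<^esub> scalar U (\<Lambda> h) | h. h \<in> fin_cartan n G}"
  then obtain h where X: "X = co (letter h) \<ominus>\<^bsub>U\<^esub> scalar U (\<Lambda> h)" and h: "h \<in> fin_cartan n G" by blast
  have lF: "letter h \<in> F" "scl (\<Lambda> h) \<in> F" by (rule fr_letter[OF fin_cartan_current[OF h]], rule fr_scalar)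
  have "X = co (letter h + - scl (\<Lambda> h))" unfolding X a_minus_def U_carrier(4) co_neg[OF lF(2)] by (rule co_add[OF lF(1) fr_minus[OF lF(2)]])
  moreover have "fr.act (letter h + - scl (\<Lambda> h)) v0 = 0"
   using rho_H[OF fin_cartan_H[OF h]] chi_weight[OF dom cards h] by (simp add: fr.act_diff fr.act_scalar)
  ultimately show "X \<in> Ann" using AnnI[OF fr_add[OF lF(1) fr_minus[OF lF(2)]]] by simp
 next
  fix X assume "X \<in> {co (letter x) [^]\<^bsub>U\<^esub> (nat_pairing \<Lambda> (coroot G \<alpha>) + 1) | x \<alpha>.
     \<alpha> \<in> fin_pos_roots n G \<and> x \<in> root_space G (- \<alpha>) \<and> x \<noteq> 0}"
  then obtain x \<alpha> where X: "X = co (letter x) [^]\<^bsub>U\<^esub> (nat_pairing \<Lambda> (coroot G \<alpha>) + 1)"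
   and x: "\<alpha> \<in> fin_pos_roots n G" "x \<in> root_space G (- \<alpha>)" "x \<noteq> 0" by blast
  have lF: "letter x \<in> F" by (rule fr_letter[OF fin_neg_current[OF x(1,2)]])
  obtain m where m: "chi (coroot G \<alpha>) = of_nat m" "(rho x ^^ Suc m) v0 = 0" "coroot G \<alpha> \<in> fin_cartan n G" using sl2_relation[OF x] by blast
  have "\<Lambda> (coroot G \<alpha>) = of_nat m" using chi_weight[OF dom cards m(3)] m(1) by simp
  hence "nat_pairing \<Lambda> (coroot G \<alpha>) = m" by (simp add: nat_pairing_def)
  hence "X = co (letter x ^ Suc m)" unfolding X co_pow[OF lF] by simp
  moreover have "fr.act (letter x ^ Suc m) v0 = 0" using m(2) by (simp only: pow_act)
  ultimately show "X \<in> Ann" using AnnI[OF fr_power[OF lF], of "Suc m"] by (simp only: )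
 qed
qed

end

section \<open>The left ideal of the Weyl relations, seen in the free ring\<close>

locale weyl_data = A2n2 G n for G :: "('g::ab_group_add) kac_moody" and n +
 fixes \<Lambda> :: "'g \<Rightarrow> complex"
 assumes dom: "\<Lambda> \<in> dominant_weights n G"
begin

definition Mm where "Mm j = nat_pairing \<Lambda> (cv j)"
definition JJ where "JJ = left_ideal_generated U (weyl_relations n G \<Lambda>)"
text \<open>The left ideal pulled back to representatives in the free ring, so that membership can
  be computed with words and congruences modulo \<open>UU\<close>.\<close>

definition Jp where "Jp p \<longleftrightarrow> p \<in> F \<and> co p \<in> JJ"
abbreviation VV where "VV \<equiv> {(i, r). 1 \<le> i \<and> i \<le> n \<and> 1 \<le> r \<and> r \<le> Mm i}"

lemma JJ_Ann:
 assumes "fock_data G n Sg J b" "\<And>j. j \<in> {1..n} \<Longrightarrow> card {s\<in>Sg. J s = j} = Mm j"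
 shows "JJ \<subseteq> fock_data.Ann G n Sg J b" "fock_data.Ann G n Sg J b \<subseteq> carrier U"
 using fock_data.Ann_family[OF assms(1) dom, folded Mm_def, OF assms(2)]
 unfolding JJ_def left_ideal_generated_def by blast+

text \<open>\<open>JJ\<close> is an intersection, and the annihilator of the vacuum of a Fock space
  with the right numbers of sites is one of the sets intersected.\<close>

lemma JJ_carrier: "JJ \<subseteq> carrier U"
proof (rule sites_exist[of Mm "\<lambda>_ _. 1"])
 fix Sg J b assume "fock_data G n Sg J b" "\<And>j. j \<in> {1..n} \<Longrightarrow> card {s\<in>Sg. J s = j} = Mm j"
 from JJ_Ann[OF this] show ?thesis by (rule subset_trans)
qed simp

lemma JJ_rel: "weyl_relations n G \<Lambda> \<subseteq> JJ" by (auto simp: JJ_def left_ideal_generated_def)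

lemma JJ_zero: "\<zero>\<^bsub>U\<^esub> \<in> JJ"
 by (auto simp: JJ_def left_ideal_generated_def additive_subgroup.zero_closed)

lemma JJ_add: "x \<in> JJ \<Longrightarrow> y \<in> JJ \<Longrightarrow> x \<oplus>\<^bsub>U\<^esub> y \<in> JJ"
 by (auto simp: JJ_def left_ideal_generated_def additive_subgroup.a_closed)

lemma JJ_lmult: "a \<in> carrier U \<Longrightarrow> x \<in> JJ \<Longrightarrow> a \<otimes>\<^bsub>U\<^esub> x \<in> JJ"
 by (auto simp: JJ_def left_ideal_generated_def)

lemma JJ_neg: "x \<in> JJ \<Longrightarrow> \<ominus>\<^bsub>U\<^esub> x \<in> JJ"
proof -
 interpret R: ring U by (rule U_ring)
 assume x: "x \<in> JJ"
 hence "x \<in> carrier U" using JJ_carrier by blast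
 hence "\<ominus>\<^bsub>U\<^esub> x = (\<ominus>\<^bsub>U\<^esub> \<one>\<^bsub>U\<^esub>) \<otimes>\<^bsub>U\<^esub> x" by (simp add: R.l_minus)
 thus ?thesis using JJ_lmult[OF _ x, of "\<ominus>\<^bsub>U\<^esub> \<one>\<^bsub>U\<^esub>"] by simp
qed

lemma Jp_F: "Jp p \<Longrightarrow> p \<in> F" by (simp add: Jp_def)

lemma Jp_UU: "p \<in> UU \<Longrightarrow> Jp p"
proof -
 assume p: "p \<in> UU"
 hence "co p = co 0" using co_eq[OF UU_F[OF p] fr_zero] by simp
 thus ?thesis using JJ_zero UU_F[OF p] by (simp add: Jp_def co_0)
qed

lemma Jp_add: "Jp p \<Longrightarrow> Jp q \<Longrightarrow> Jp (p + q)"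
 using JJ_add[of "co p" "co q"] by (simp add: Jp_def co_add fr_add)

lemma Jp_lmult: "a \<in> F \<Longrightarrow> Jp p \<Longrightarrow> Jp (a * p)"
 using JJ_lmult[of "co a" "co p"] by (simp add: Jp_def co_mult fr_mult U_carrier)

lemma Jp_neg: "Jp p \<Longrightarrow> Jp (- p)"
 using JJ_neg[of "co p"] by (simp add: Jp_def co_neg fr_minus)

lemma Jp_0: "Jp 0" by (rule Jp_UU[OF UU_zero])

lemma Jp_cong: "Jp p \<Longrightarrow> q - p \<in> UU \<Longrightarrow> Jp q"
 using Jp_add[of p "q - p"] Jp_UU[of "q - p"] by simp

lemma Jp_sum: "(\<And>k. k \<in> K \<Longrightarrow> Jp (f k)) \<Longrightarrow> Jp (sum f K)"
 by (induction K rule: infinite_finite_induct) (auto intro: Jp_0 Jp_add)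

lemma Jp_J0: "J0 p \<Longrightarrow> Jp p"
proof (induction rule: J0.induct)
 case (J0_pos a x)
 have "co (letter x) \<in> weyl_relations n G \<Lambda>" using J0_pos by (auto simp: weyl_relations_def Let_def uea_embed_def)
 hence "Jp (letter x)" using JJ_rel J0_pos fr_letter by (auto simp: Jp_def)
 thus ?case by (rule Jp_lmult[OF J0_pos(1)])
qed (auto intro: Jp_UU Jp_add)

lemma Jp_f: "1 \<le> j \<Longrightarrow> j \<le> n \<Longrightarrow> Jp (letter (gen_f G j) ^ (Mm j + 1))"
proof -
 assume j: "1 \<le> j" "j \<le> n"
 have lF: "letter (gen_f G j) \<in> F" by (rule fr_letter[OF fin_neg_current[OF al_fin[OF j] f_rs[OF j(2)]]])
 have "co (letter (gen_f G j)) [^]\<^bsub>U\<^esub> (nat_pairing \<Lambda> (coroot G (al j)) + 1) \<in> weyl_relations n G \<Lambda>"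
  unfolding weyl_relations_def Let_def uea_embed_def using al_fin[OF j] f_rs[OF j(2)] gen_nz(2)[OF j(2)] by blast
 hence "co (letter (gen_f G j) ^ (Mm j + 1)) \<in> JJ" using JJ_rel unfolding coroot_al[OF j] co_pow[OF lF] Mm_def by blast
 thus ?thesis unfolding Jp_def using fr_power[OF lF, of "Mm j + 1"] by blast
qed

lemma Jp_Ehat: "1 \<le> j \<Longrightarrow> j \<le> n \<Longrightarrow> r > Mm j \<Longrightarrow> Jp (Ehat (j, r))"
proof -
 assume j: "1 \<le> j" "j \<le> n" and r: "r > Mm j"
 obtain y where y: "y \<in> F" "J0 (Ehat (j, r) - y * letter (gen_f G j) ^ r)" using Ehat_rank_one[OF j, of r] r by auto
 have lF: "letter (gen_f G j) \<in> F" by (rule fr_letter[OF fin_neg_current[OF al_fin[OF j] f_rs[OF j(2)]]])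
 have "r = (r - (Mm j + 1)) + (Mm j + 1)" using r by simp
 hence "letter (gen_f G j) ^ r = letter (gen_f G j) ^ (r - (Mm j + 1)) * letter (gen_f G j) ^ (Mm j + 1)"
  using power_add[of "letter (gen_f G j)" "r - (Mm j + 1)" "Mm j + 1"] by (simp only: )
 hence "Jp (y * letter (gen_f G j) ^ r)" using Jp_lmult[OF y(1) Jp_lmult[OF fr_power[OF lF] Jp_f[OF j]]] by simp
 from Jp_add[OF Jp_J0[OF y(2)] this] show ?thesis by simp
qed

text \<open>In a left ideal the vanishing factor must stand on the right; the factors commute modulo
  \<open>UU\<close>, so it can be moved there.\<close>

lemma Jp_L:
 assumes v: "(j, r) \<in> Poly_Mapping.keys m" and j: "1 \<le> j" "j \<le> n" "r > Mm j"
 shows "Jp (L m)"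
proof -
 define m' where "m' = m - Poly_Mapping.single (j, r) 1"
 have "Poly_Mapping.lookup m (j, r) \<ge> 1" using v by (simp add: in_keys_iff Suc_le_eq)
 hence m: "m = Poly_Mapping.single (j, r) 1 + m'"
  by (intro poly_mapping_eqI) (auto simp: m'_def lookup_add lookup_minus lookup_single when_def)
 have 1: "Jp (L m' * Ehat (j, r))" by (rule Jp_lmult[OF AA_F[OF AA_L] Jp_Ehat[OF j]])
 have "Ehat (j, r) * L m' - L m' * Ehat (j, r) \<in> UU" by (rule cm_AA[OF AA_Ehat AA_L])
 hence "Jp (Ehat (j, r) * L m')" by (rule Jp_cong[OF 1])
 thus ?thesis using UU_sym[OF Ehat_L[of "(j, r)" m']] unfolding m[symmetric] by (rule Jp_cong)
qed

lemma Jp_injective: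
 assumes "over VV q" "Jp (Lin q)"
 shows "q = 0"
proof (rule grid_fixed[OF assms(1)])
 fix Sg J b assume fd: "fock_data G n Sg J b" and c: "\<And>j. j \<in> {1..n} \<Longrightarrow> card {s\<in>Sg. J s = j} = Mm j"
 have "co (Lin q) \<in> fock_data.Ann G n Sg J b" using JJ_Ann(1)[OF fd c] assms(2) by (auto simp: Jp_def)
 from fock_data.AnnD[OF fd _ this] fock_data.act_Lin[OF fd, of q] Jp_F[OF assms(2)]
 have e: "fock_data.sF (ev.psubst (site_tau Sg J b) q) (fock_data.v0 Sg J) = 0" by simp
 have "(0 :: (nat \<times> int) set \<Rightarrow> complex) = fock_data.sF 0 (fock_data.v0 Sg J)" by (simp add: fock_data.sF_def[OF fd] fun_eq_iff)
 from fock_data.sF_cancel[OF fd e[unfolded this]] show "ev.psubst (site_tau Sg J b) q = 0" .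
qed

subsection \<open>The commutative subalgebra\<close>

abbreviation Ch where "Ch \<equiv> current_h_plus n G"
abbreviation Fh where "Fh \<equiv> carrier (free_ring Ch)"
abbreviation KK where "KK \<equiv> uea_ideal G Ch"
abbreviation ch where "ch p \<equiv> KK +>\<^bsub>free_ring Ch\<^esub> p"
abbreviation UH where "UH \<equiv> current_h_uea n G"
abbreviation AN where "AN \<equiv> weyl_annihilator n G \<Lambda>"
abbreviation cl where "cl p \<equiv> AN +>\<^bsub>UH\<^esub> ch p"

lemma Fh_HH: "p \<in> Fh \<Longrightarrow> p \<in> carrier (free_ring HH)"
 using h_plus_HH unfolding free_ring_def by fastforce

lemma Fh_F: "p \<in> Fh \<Longrightarrow> p \<in> F" by (rule HH_F[OF Fh_HH])

lemma HH_br: "x \<in> HH \<Longrightarrow> y \<in> HH \<Longrightarrow> br x y = 0"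
proof -
 have z: "br 0 y = 0" "br x 0 = 0" for x y using br_sm_l[of 0 0 y] br_sm_r[of x 0 0] by simp_all
 have 1: "br x (eta j k) = 0" if "x \<in> HH" for x j k
 proof -
  have "HH \<subseteq> {x. br x (eta j k) = 0}" unfolding HH_def
   by (rule V.span_minimal) (auto simp: eta_commute V.subspace_def br_add_l br_sm_l z)
  thus ?thesis using that by blast
 qed
 assume x: "x \<in> HH" and y: "y \<in> HH"
 have "HH \<subseteq> {y. br x y = 0}" unfolding HH_def
  by (rule V.span_minimal) (auto simp: 1[OF x] V.subspace_def br_add_r br_sm_r z)
 thus "br x y = 0" using y by blast
qed

lemma Ch_subspace: "V.subspace Ch" by (simp add: current_h_plus_def sum_of_root_spaces_def)

lemma rel_Fh: "uea_relations G Ch \<subseteq> Fh"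
 by (rule uea_relations_carrier[OF Ch_subspace]) (simp add: HH_br h_plus_HH V.subspace_0[OF Ch_subspace])

lemma KK_ideal: "ideal KK (free_ring Ch)"
 unfolding uea_ideal_def by (rule ring.genideal_ideal[OF ring_free_ring rel_Fh])

lemma KK_UU: "KK \<subseteq> UU"
proof -
 have "KK \<subseteq> UU \<inter> Fh" unfolding uea_ideal_def[of G Ch]
 proof (rule ring.genideal_minimal[OF ring_free_ring])
  show "ideal (UU \<inter> Fh) (free_ring Ch)"
   by (rule free_ring_ideal) (auto intro: UU_zero UU_add UU_neg UU_lmult UU_rmult fr_zero fr_add fr_minus fr_mult Fh_F)
  have sub: "x \<in> Ch \<Longrightarrow> x \<in> Cg" for x by (rule HH_current[OF h_plus_HH])
  have "uea_relations G Ch \<subseteq> uea_relations G Cg" unfolding uea_relations_def using sub by blast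
  thus "uea_relations G Ch \<subseteq> UU \<inter> Fh" using UU_rel rel_Fh by blast
 qed
 thus ?thesis by blast
qed

text \<open>As \<open>KK\<close> lies in \<open>UU\<close>, adding \<open>UU\<close> to a coset of
  \<open>KK\<close> absorbs \<open>KK\<close> and leaves the coset of \<open>UU\<close> with the
  same representative.\<close>

lemma uh_co: "p \<in> Fh \<Longrightarrow> uea_map G Cg (ch p) = co p"
proof -
 assume p: "p \<in> Fh"
 have 0: "0 \<in> KK" using additive_subgroup.zero_closed[OF ideal.axioms(1)[OF KK_ideal]] by (simp add: fr_ops)
 have "uea_map G Cg (ch p) = {u + (k + p) | u k. u \<in> UU \<and> k \<in> KK}"
  by (auto simp: uea_map_def set_add_def' a_r_coset_def' fr_ops)
 also have "\<dots> = {u + p | u. u \<in> UU}"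
 proof (intro equalityI subsetI)
  fix x assume "x \<in> {u + (k + p) | u k. u \<in> UU \<and> k \<in> KK}"
  then obtain u k where "x = (u + k) + p" "u \<in> UU" "k \<in> UU" using KK_UU by (auto simp: add.assoc)
  thus "x \<in> {u + p | u. u \<in> UU}" using UU_add by blast
 next
  fix x assume "x \<in> {u + p | u. u \<in> UU}"
  then obtain u where "x = u + (0 + p)" "u \<in> UU" by auto
  thus "x \<in> {u + (k + p) | u k. u \<in> UU \<and> k \<in> KK}" using 0 by blast
 qed
 also have "\<dots> = co p" by (auto simp: a_r_coset_def' fr_ops)
 finally show ?thesis .
qed

lemma cyclic_zero:
 assumes a: "a \<in> carrier U"
 shows "JJ <+>\<^bsub>U\<^esub> (a <#\<^bsub>U\<^esub> (JJ +>\<^bsub>U\<^esub> \<one>\<^bsub>U\<^esub>)) = JJ \<longleftrightarrow> a \<in> JJ"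
proof -
 interpret R: ring U by (rule U_ring)
 have JC: "x \<in> carrier U" if "x \<in> JJ" for x using that JJ_carrier by blast
 have e: "JJ <+>\<^bsub>U\<^esub> (a <#\<^bsub>U\<^esub> (JJ +>\<^bsub>U\<^esub> \<one>\<^bsub>U\<^esub>)) = {y \<oplus>\<^bsub>U\<^esub> (a \<otimes>\<^bsub>U\<^esub> (x \<oplus>\<^bsub>U\<^esub> \<one>\<^bsub>U\<^esub>)) | x y. x \<in> JJ \<and> y \<in> JJ}"
  by (auto simp: set_add_def' a_r_coset_def' l_coset_def)
 have a1: "\<zero>\<^bsub>U\<^esub> \<oplus>\<^bsub>U\<^esub> \<one>\<^bsub>U\<^esub> = \<one>\<^bsub>U\<^esub>" by simp
 show ?thesis unfolding e
 proof
  assume h: "{y \<oplus>\<^bsub>U\<^esub> (a \<otimes>\<^bsub>U\<^esub> (x \<oplus>\<^bsub>U\<^esub> \<one>\<^bsub>U\<^esub>)) | x y. x \<in> JJ \<and> y \<in> JJ} = JJ"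
  have "\<zero>\<^bsub>U\<^esub> \<oplus>\<^bsub>U\<^esub> (a \<otimes>\<^bsub>U\<^esub> (\<zero>\<^bsub>U\<^esub> \<oplus>\<^bsub>U\<^esub> \<one>\<^bsub>U\<^esub>)) \<in> JJ" using JJ_zero h by blast
  thus "a \<in> JJ" using a by (simp add: a1)
 next
  assume aJ: "a \<in> JJ"
  show "{y \<oplus>\<^bsub>U\<^esub> (a \<otimes>\<^bsub>U\<^esub> (x \<oplus>\<^bsub>U\<^esub> \<one>\<^bsub>U\<^esub>)) | x y. x \<in> JJ \<and> y \<in> JJ} = JJ"
  proof (intro equalityI subsetI)
   fix z assume "z \<in> {y \<oplus>\<^bsub>U\<^esub> (a \<otimes>\<^bsub>U\<^esub> (x \<oplus>\<^bsub>U\<^esub> \<one>\<^bsub>U\<^esub>)) | x y. x \<in> JJ \<and> y \<in> JJ}"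
   then obtain x y where z: "z = y \<oplus>\<^bsub>U\<^esub> (a \<otimes>\<^bsub>U\<^esub> (x \<oplus>\<^bsub>U\<^esub> \<one>\<^bsub>U\<^esub>))" "x \<in> JJ" "y \<in> JJ" by blast
   have "a \<otimes>\<^bsub>U\<^esub> (x \<oplus>\<^bsub>U\<^esub> \<one>\<^bsub>U\<^esub>) = a \<otimes>\<^bsub>U\<^esub> x \<oplus>\<^bsub>U\<^esub> a" using a JC[OF z(2)] by (simp add: R.r_distr)
   thus "z \<in> JJ" unfolding z(1) using JJ_add[OF z(3) JJ_add[OF JJ_lmult[OF a z(2)] aJ]] by simp
  next
   fix z assume z: "z \<in> JJ"
   have "z = (z \<oplus>\<^bsub>U\<^esub> \<ominus>\<^bsub>U\<^esub> a) \<oplus>\<^bsub>U\<^esub> (a \<otimes>\<^bsub>U\<^esub> (\<zero>\<^bsub>U\<^esub> \<oplus>\<^bsub>U\<^esub> \<one>\<^bsub>U\<^esub>))"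
    unfolding a1 using a JC[OF z] by (simp add: R.a_assoc R.l_neg)
   thus "z \<in> {y \<oplus>\<^bsub>U\<^esub> (a \<otimes>\<^bsub>U\<^esub> (x \<oplus>\<^bsub>U\<^esub> \<one>\<^bsub>U\<^esub>)) | x y. x \<in> JJ \<and> y \<in> JJ}"
    using JJ_add[OF z JJ_neg[OF aJ]] JJ_zero by blast
  qed
 qed
qed

lemma UH_ring: "ring UH"
 unfolding current_h_uea_def uea_def by (rule ring_ext, rule ideal.quotient_is_ring, rule KK_ideal)

definition homw :: "nat \<Rightarrow> ('g word \<Rightarrow>\<^sub>0 complex) \<Rightarrow> bool" where
 "homw k p \<longleftrightarrow> (\<forall>w\<in>Poly_Mapping.keys p. \<exists>ks. list_all2 (\<lambda>x l. x \<in> Ch \<inter> current_component n G l) (letters w) ks \<and> sum_list ks = k)"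

lemma UH_carrier: "carrier UH = ch ` Fh" "\<zero>\<^bsub>UH\<^esub> = KK" "\<one>\<^bsub>UH\<^esub> = ch 1" "scalar UH c = ch (scl c)"
 "component UH k = ch ` {p. homw k p}"
 by (auto simp: current_h_uea_def uea_def quot_ops fr_ops homw_def)

lemma ch_add: "p \<in> Fh \<Longrightarrow> q \<in> Fh \<Longrightarrow> ch p \<oplus>\<^bsub>UH\<^esub> ch q = ch (p + q)"
 and ch_mult: "p \<in> Fh \<Longrightarrow> q \<in> Fh \<Longrightarrow> ch p \<otimes>\<^bsub>UH\<^esub> ch q = ch (p * q)"
 using quot_add[OF KK_ideal, of p q] quot_mult[OF KK_ideal, of p q]
 by (simp_all add: current_h_uea_def uea_def fr_ops)

lemma ch_eq: "p \<in> Fh \<Longrightarrow> q \<in> Fh \<Longrightarrow> ch p = ch q \<longleftrightarrow> p - q \<in> KK"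
 using quot_eq[OF KK_ideal, of p q] by (simp add: free_minus)

lemma ch_0: "ch 0 = \<zero>\<^bsub>UH\<^esub>"
proof -
 have "0 \<in> KK" using additive_subgroup.zero_closed[OF ideal.axioms(1)[OF KK_ideal]] by (simp add: fr_ops)
 thus ?thesis unfolding UH_carrier(2) by (rule ring.a_rcos_zero[OF ring_free_ring KK_ideal])
qed

lemma ch_neg: "p \<in> Fh \<Longrightarrow> \<ominus>\<^bsub>UH\<^esub> ch p = ch (- p)"
proof -
 assume p: "p \<in> Fh"
 interpret R: ring UH by (rule UH_ring)
 have "ch (- p) \<oplus>\<^bsub>UH\<^esub> ch p = \<zero>\<^bsub>UH\<^esub>" using ch_add[OF fr_minus[OF p] p] ch_0 by simp
 thus ?thesis using p fr_minus[OF p] by (intro R.minus_equality) (auto simp: UH_carrier)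
qed

lemma AN_eq: "AN = ch ` {p\<in>Fh. Jp p}"
proof -
 have "mod_act (global_weyl_module n G \<Lambda>) (uea_map G Cg (ch p)) (weyl_generator n G \<Lambda>) = mod_zero (global_weyl_module n G \<Lambda>) \<longleftrightarrow> Jp p"
  if "p \<in> Fh" for p
 proof -
  have "co p \<in> carrier U" using Fh_F[OF that] by (simp add: U_carrier)
  from cyclic_zero[OF this] show ?thesis
   using Fh_F[OF that] by (simp add: global_weyl_module_def cyclic_module_def weyl_generator_def uh_co[OF that] JJ_def[symmetric] Jp_def)
 qed
 thus ?thesis unfolding weyl_annihilator_def UH_carrier(1) by blast
qed

lemma AN_Jp: "p \<in> Fh \<Longrightarrow> ch p \<in> AN \<longleftrightarrow> Jp p"
proof
 assume p: "p \<in> Fh" and "ch p \<in> AN"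
 then obtain q where q: "q \<in> Fh" "Jp q" "ch p = ch q" unfolding AN_eq by blast
 hence "p - q \<in> UU" using ch_eq[OF p q(1)] KK_UU by blast
 thus "Jp p" by (rule Jp_cong[OF q(2)])
qed (auto simp: AN_eq)

text \<open>An annihilator is at first only a left ideal. Elements over \<open>HH\<close> commute
  modulo \<open>UU\<close>, which gives the multiplication from the other side.\<close>

lemma AN_ideal: "ideal AN UH"
proof (rule idealI[OF UH_ring])
 have sub: "AN \<subseteq> carrier UH" by (auto simp: AN_eq UH_carrier)
 have "additive_subgroup AN UH"
 proof (rule subgroup_of_ring[OF UH_ring sub])
  show "\<zero>\<^bsub>UH\<^esub> \<in> AN" unfolding ch_0[symmetric] using AN_Jp[OF fr_zero] Jp_0 by blast
  fix x y assume "x \<in> AN" "y \<in> AN"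
  then obtain p q where "p \<in> Fh" "x = ch p" "Jp p" "q \<in> Fh" "y = ch q" "Jp q" unfolding AN_eq by blast
  thus "x \<oplus>\<^bsub>UH\<^esub> y \<in> AN" using AN_Jp[OF fr_add[of p Ch q]] Jp_add[of p q] by (simp add: ch_add)
 next
  fix x assume "x \<in> AN"
  then obtain p where "p \<in> Fh" "x = ch p" "Jp p" unfolding AN_eq by blast
  thus "\<ominus>\<^bsub>UH\<^esub> x \<in> AN" using AN_Jp[OF fr_minus[of p Ch]] Jp_neg[of p] by (simp add: ch_neg)
 qed
 thus "subgroup AN (add_monoid UH)" by (rule additive_subgroup.a_subgroup)
 fix a x assume "a \<in> AN" and "x \<in> carrier UH"
 then obtain p q where pq: "p \<in> Fh" "a = ch p" "Jp p" "q \<in> Fh" "x = ch q" unfolding AN_eq UH_carrier(1) by blast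
 have l: "Jp (q * p)" by (rule Jp_lmult[OF Fh_F[OF pq(4)] pq(3)])
 thus "x \<otimes>\<^bsub>UH\<^esub> a \<in> AN" using AN_Jp[OF fr_mult[OF pq(4,1)]] pq by (simp add: ch_mult)
 have "Jp (p * q)" by (rule Jp_cong[OF l HH_commute[OF Fh_HH[OF pq(1)] Fh_HH[OF pq(4)]]])
 thus "a \<otimes>\<^bsub>UH\<^esub> x \<in> AN" using AN_Jp[OF fr_mult[OF pq(1,4)]] pq by (simp add: ch_mult)
qed

abbreviation WA where "WA \<equiv> weyl_algebra n G \<Lambda>"

lemma ch_in: "p \<in> Fh \<Longrightarrow> ch p \<in> carrier UH" by (simp add: UH_carrier)

lemma WA_ops: "carrier WA = cl ` Fh" "\<one>\<^bsub>WA\<^esub> = cl 1" "scalar WA c = cl (scl c)" "component WA k = cl ` {p. homw k p}"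
 by (simp_all add: weyl_algebra_def Let_def quot_ops UH_carrier image_image)

lemma cl_add: "p \<in> Fh \<Longrightarrow> q \<in> Fh \<Longrightarrow> cl p \<oplus>\<^bsub>WA\<^esub> cl q = cl (p + q)"
 and cl_mult: "p \<in> Fh \<Longrightarrow> q \<in> Fh \<Longrightarrow> cl p \<otimes>\<^bsub>WA\<^esub> cl q = cl (p * q)"
 using quot_add[OF AN_ideal ch_in ch_in, of p q] quot_mult[OF AN_ideal ch_in ch_in, of p q]
 by (simp_all add: weyl_algebra_def Let_def ch_add ch_mult)

lemma cl_eq: "p \<in> Fh \<Longrightarrow> q \<in> Fh \<Longrightarrow> cl p = cl q \<longleftrightarrow> Jp (p - q)"
proof -
 assume pq: "p \<in> Fh" "q \<in> Fh"
 have "ch p \<ominus>\<^bsub>UH\<^esub> ch q = ch (p - q)"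
  unfolding a_minus_def ch_neg[OF pq(2)] using ch_add[OF pq(1) fr_minus[OF pq(2)]] by simp
 thus ?thesis using quot_eq[OF AN_ideal ch_in[OF pq(1)] ch_in[OF pq(2)]] AN_Jp[OF fr_diff[OF pq]] by simp
qed

subsection \<open>Homogeneous elements\<close>

lemma homw_Fh: "homw k p \<Longrightarrow> p \<in> Fh"
 unfolding homw_def free_ring_def by (fastforce simp: list_all2_conv_all_nth in_set_conv_nth)

lemma homw_0: "homw k 0" by (simp add: homw_def)

lemma homw_scl: "homw 0 (scl c)"
 by (auto simp: homw_def zero_word_def intro!: exI[of _ "[]"])

lemma homw_add: "homw k p \<Longrightarrow> homw k q \<Longrightarrow> homw k (p + q)"
 using Poly_Mapping.keys_add[of p q] unfolding homw_def by blast

lemma homw_sum: "(\<And>i. i \<in> K \<Longrightarrow> homw k (f i)) \<Longrightarrow> homw k (sum f K)"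
 by (induction K rule: infinite_finite_induct) (auto intro: homw_0 homw_add)

lemma homw_mult:
 assumes "homw k p" "homw l q"
 shows "homw (k + l) (p * q)"
 unfolding homw_def
proof
 fix w assume "w \<in> Poly_Mapping.keys (p * q)"
 then obtain u v where w: "w = u + v" "u \<in> Poly_Mapping.keys p" "v \<in> Poly_Mapping.keys q"
  using Poly_Mapping.keys_mult[of p q] by auto
 let ?R = "\<lambda>x l. x \<in> Ch \<inter> current_component n G l"
 obtain ks where "list_all2 ?R (letters u) ks" "sum_list ks = k" using assms(1) w(2) unfolding homw_def by blast
 moreover obtain ls where "list_all2 ?R (letters v) ls" "sum_list ls = l" using assms(2) w(3) unfolding homw_def by blast
 ultimately have "list_all2 ?R (letters w) (ks @ ls) \<and> sum_list (ks @ ls) = k + l"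
  by (simp add: w(1) plus_word_def list_all2_appendI)
 thus "\<exists>ks. list_all2 ?R (letters w) ks \<and> sum_list ks = k + l" by blast
qed

lemma homw_eta: "k \<ge> 1 \<Longrightarrow> homw (2 * k) (letter (eta j k))"
 using eta_component[of k j] by (auto simp: homw_def letter_def intro!: exI[of _ "[2 * k]"])

lemma homw_Eh: "homw (2 * r) (Eh j r)"
proof (induction r rule: less_induct)
 case (less r)
 show ?case
 proof (cases r)
  case 0 thus ?thesis using homw_scl[of 1] by simp
 next
  case (Suc q)
  have "homw (2 * Suc q) (scl ((- 1) ^ k) * letter (eta j (Suc k)) * Eh j (q - k))" if "k \<le> q" for k
  proof -
   have "homw (0 + 2 * Suc k + 2 * (q - k)) (scl ((- 1) ^ k) * letter (eta j (Suc k)) * Eh j (q - k))"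
    by (intro homw_mult homw_scl homw_eta less) (use Suc that in auto)
   moreover have "0 + 2 * Suc k + 2 * (q - k) = 2 * Suc q" using that by simp
   ultimately show ?thesis by (simp only: )
  qed
  hence "homw (0 + 2 * Suc q) (Eh j (Suc q))" unfolding Eh.simps(2)[of j q] by (intro homw_mult homw_scl homw_sum) auto
  thus ?thesis using Suc by simp
 qed
qed

lemma wdeg_mono: "wdeg ww (mono (v # vs)) = 2 * snd v + wdeg ww (mono vs)"
 unfolding mono.simps wdeg_add by (simp add: wdeg_def case_prod_beta)

lemma homw_prodl: "(\<And>v. v \<in> set vs \<Longrightarrow> snd v \<ge> 1) \<Longrightarrow> homw (wdeg ww (mono vs)) (prodl vs)"
proof (induction vs)
 case Nil thus ?case using homw_scl[of 1] by (simp add: wdeg_def)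
next
 case (Cons v vs)
 have "Ehat v = Eh (fst v) (snd v)" using Cons.prems[of v] by (simp add: Ehat_def)
 hence "homw (2 * snd v) (Ehat v)" using homw_Eh by simp
 thus ?case unfolding wdeg_mono prodl.simps using Cons by (intro homw_mult) auto
qed

lemma homw_L:
 assumes "\<And>v. v \<in> Poly_Mapping.keys m \<Longrightarrow> snd v \<ge> 1"
 shows "homw (wdeg ww m) (L m)"
proof -
 define vs where "vs = (SOME vs. mono vs = m)"
 have m: "mono vs = m" unfolding vs_def by (rule someI_ex[OF ex_mono])
 have "snd v \<ge> 1" if "v \<in> set vs" for v
  using that assms[of v] lookup_mono[of vs v] unfolding m by (simp add: in_keys_iff count_eq_zero_iff)
 thus ?thesis using homw_prodl[of vs] unfolding L_def vs_def[symmetric] m by blast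
qed

lemma Lin_Fh: "over ({1..n} \<times> {1..}) q \<Longrightarrow> Lin q \<in> Fh"
 unfolding Lin_def
proof (intro fr_sum fr_mult fr_scalar)
 fix m assume "over ({1..n} \<times> {1..}) q" "m \<in> Poly_Mapping.keys q"
 hence "\<And>v. v \<in> Poly_Mapping.keys m \<Longrightarrow> snd v \<ge> 1" unfolding over_def by fastforce
 thus "L m \<in> Fh" by (rule homw_Fh[OF homw_L])
qed

lemma Lin_homw: "over ({1..n} \<times> {1..}) q \<Longrightarrow> homp ww k q \<Longrightarrow> homw k (Lin q)"
 unfolding Lin_def
proof (rule homw_sum)
 fix m assume o: "over ({1..n} \<times> {1..}) q" "homp ww k q" and m: "m \<in> Poly_Mapping.keys q"
 have "\<And>v. v \<in> Poly_Mapping.keys m \<Longrightarrow> snd v \<ge> 1" using o m unfolding over_def by fastforce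
 hence "homw (0 + wdeg ww m) (scl (Poly_Mapping.lookup q m) * L m)" by (intro homw_mult homw_scl homw_L)
 moreover have "wdeg ww m = k" using o m by (simp add: homp_def)
 ultimately show "homw k (scl (Poly_Mapping.lookup q m) * L m)" by simp
qed

lemma Theta_homp: "homw k p \<Longrightarrow> homp ww k (Theta p)"
 unfolding Theta_def mpr.act_def
proof (rule homp_sum)
 fix w assume p: "homw k p" and w: "w \<in> Poly_Mapping.keys p"
 obtain ks where ks: "list_all2 (\<lambda>x l. x \<in> Ch \<inter> current_component n G l) (letters w) ks" "sum_list ks = k"
  using p w unfolding homw_def by blast
 have "homp ww (sum_list ls) (wact (\<lambda>x q. theta x * q) xs 1)" if "list_all2 (\<lambda>x l. x \<in> Ch \<inter> current_component n G l) xs ls" for xs ls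
  using that
 proof (induction rule: list_all2_induct)
  case Nil thus ?case using homp_scalar[of ww 1] by simp
 next
  case (Cons x xs l ls) thus ?case using homp_mult[OF homp_theta[of x l], of "sum_list ls"] by simp
 qed
 from this[OF ks(1)] show "homp ww k (Poly_Mapping.single 0 (Poly_Mapping.lookup p w) * wact (\<lambda>x q. theta x * q) (letters w) 1)"
  using homp_mult[OF homp_scalar, of ww k _ "Poly_Mapping.lookup p w"] ks(2) by simp
qed

text \<open>For polynomials in the variables (j, r) with r >= 1, the discarded monomials contain a
  variable with r > \<open>Mm j\<close>, and their normal forms lie in the left ideal by
  \<open>Jp_L\<close>.\<close>

definition vpart :: "mp \<Rightarrow> mp" where
 "vpart q = (\<Sum>m\<in>{m\<in>Poly_Mapping.keys q. Poly_Mapping.keys m \<subseteq> VV}. Poly_Mapping.single m (Poly_Mapping.lookup q m))"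

lemma vpart_over: "over VV (vpart q)"
 unfolding vpart_def by (rule over_sum) (auto simp: over_def)

lemma vpart_homp: "homp ww k q \<Longrightarrow> homp ww k (vpart q)"
 unfolding vpart_def by (rule homp_sum) (auto simp: homp_def)

lemma Lin_sum: "Lin (sum f K) = (\<Sum>k\<in>K. Lin (f k))"
 by (induction K rule: infinite_finite_induct) (auto simp: Lin_add)

lemma Lin_vpart:
 assumes o: "over ({1..n} \<times> {1..}) q"
 shows "Jp (Lin q - Lin (vpart q))"
proof -
 let ?K = "{m\<in>Poly_Mapping.keys q. Poly_Mapping.keys m \<subseteq> VV}" and ?f = "\<lambda>m. scl (Poly_Mapping.lookup q m) * L m"
 have "Lin (vpart q) = sum ?f ?K" unfolding vpart_def Lin_sum Lin_single ..
 moreover have "Lin q = sum ?f (Poly_Mapping.keys q - ?K) + sum ?f ?K"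
  unfolding Lin_def by (rule sum.subset_diff) auto
 ultimately have "Lin q - Lin (vpart q) = sum ?f (Poly_Mapping.keys q - ?K)" by simp
 moreover have "Jp (sum ?f (Poly_Mapping.keys q - ?K))"
 proof (intro Jp_sum Jp_lmult fr_scalar)
  fix m assume m: "m \<in> Poly_Mapping.keys q - ?K"
  then obtain j r where jr: "(j, r) \<in> Poly_Mapping.keys m" "(j, r) \<notin> VV" by auto
  moreover have "(j, r) \<in> {1..n} \<times> {1..}" using o m jr(1) unfolding over_def by blast
  ultimately show "Jp (L m)" by (intro Jp_L[OF jr(1)]) auto
 qed
 ultimately show ?thesis by simp
qed

lemma VV_over: "over VV q \<Longrightarrow> over ({1..n} \<times> {1..}) q"
 by (rule over_mono) auto

lemma cl_Lin: "p \<in> Fh \<Longrightarrow> cl p = cl (Lin (vpart (Theta p)))"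
proof -
 assume p: "p \<in> Fh"
 have o: "over ({1..n} \<times> {1..}) (Theta p)" by (rule over_Theta[OF p over_theta_plus])
 have "Jp ((p - Lin (Theta p)) + (Lin (Theta p) - Lin (vpart (Theta p))))"
  by (rule Jp_add[OF Jp_UU[OF straighten[OF Fh_HH[OF p]]] Lin_vpart[OF o]])
 thus ?thesis using cl_eq[OF p Lin_Fh[OF VV_over[OF vpart_over]]] by simp
qed

text \<open>The inverse map takes the class of p to \<open>vpart (Theta p)\<close>. It preserves
  degrees because \<open>Theta\<close> and \<open>vpart\<close> do, so the components correspond and
  not only the rings.\<close>

lemma weyl_polynomial: "(\<lambda>q. cl (Lin q)) \<in> graded_algebra_iso (poly_algebra VV ww) WA"
proof -
 let ?A = "poly_algebra VV ww" and ?\<phi> = "\<lambda>q. cl (Lin q)"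
 have car: "q \<in> carrier ?A \<longleftrightarrow> over VV q" for q by (simp add: poly_algebra_def over_def)
 have ops: "monoid.mult ?A = (*)" "ring.add ?A = (+)" "\<one>\<^bsub>?A\<^esub> = 1" "scalar ?A = Poly_Mapping.single 0"
  by (simp_all add: poly_algebra_def)
 have comp: "q \<in> component ?A k \<longleftrightarrow> over VV q \<and> homp ww k q" for q k
  by (auto simp: poly_algebra_def over_def homp_def wdeg_def)
 have LF: "Lin q \<in> Fh" if "over VV q" for q using Lin_Fh[OF VV_over[OF that]] .
 have scalar: "?\<phi> (Poly_Mapping.single 0 c) = cl (scl c)" for c
 proof -
  have "scl c * (L 0 - 1) \<in> UU" by (rule UU_lmult[OF L_0 fr_scalar])
  hence "Jp (Lin (Poly_Mapping.single 0 c) - scl c)" by (intro Jp_UU) (simp add: Lin_single right_diff_distrib)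
  thus ?thesis using cl_eq[OF LF fr_scalar] by simp
 qed
 have hom: "?\<phi> \<in> ring_hom ?A WA"
 proof (rule ring_hom_memI)
  fix q assume "q \<in> carrier ?A"
  hence "over VV q" by (simp only: car)
  thus "?\<phi> q \<in> carrier WA" unfolding WA_ops by (intro imageI LF)
 next
  fix p q assume pq: "p \<in> carrier ?A" "q \<in> carrier ?A"
  hence o: "over VV p" "over VV q" by (simp_all only: car)
  have J: "Jp (Lin (p * q) - Lin p * Lin q)" by (rule Jp_UU[OF UU_sym[OF MpD[OF Mp_Lin]]])
  show "?\<phi> (p \<otimes>\<^bsub>?A\<^esub> q) = ?\<phi> p \<otimes>\<^bsub>WA\<^esub> ?\<phi> q"
   unfolding ops cl_mult[OF LF[OF o(1)] LF[OF o(2)]]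
   by (rule iffD2[OF cl_eq[OF LF[OF over_mult[OF o]] fr_mult[OF LF[OF o(1)] LF[OF o(2)]]] J])
  show "?\<phi> (p \<oplus>\<^bsub>?A\<^esub> q) = ?\<phi> p \<oplus>\<^bsub>WA\<^esub> ?\<phi> q"
   unfolding ops Lin_add by (rule cl_add[OF LF[OF o(1)] LF[OF o(2)], symmetric])
 next
  show "?\<phi> \<one>\<^bsub>?A\<^esub> = \<one>\<^bsub>WA\<^esub>" using scalar[of 1] unfolding ops WA_ops single_one .
 qed
 have "inj_on ?\<phi> (carrier ?A)"
 proof (rule inj_onI)
  fix p q assume pq: "p \<in> carrier ?A" "q \<in> carrier ?A" "?\<phi> p = ?\<phi> q"
  have o: "over VV p" "over VV q" using pq(1,2) by (simp_all only: car)
  have "Jp (Lin p - Lin q)" using cl_eq[OF LF[OF o(1)] LF[OF o(2)]] pq(3) by simp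
  moreover have "Lin p = Lin (p - q) + Lin q" unfolding Lin_add[symmetric] by simp
  ultimately have "Jp (Lin (p - q))" by simp
  hence "p - q = 0" by (rule Jp_injective[OF over_diff[OF o]])
  thus "p = q" by simp
 qed
 moreover have "?\<phi> ` carrier ?A = carrier WA"
 proof
  show "?\<phi> ` carrier ?A \<subseteq> carrier WA" using LF car unfolding WA_ops by blast
  show "carrier WA \<subseteq> ?\<phi> ` carrier ?A"
  proof
   fix x assume "x \<in> carrier WA"
   then obtain p where "p \<in> Fh" "x = cl p" unfolding WA_ops by blast
   thus "x \<in> ?\<phi> ` carrier ?A" using cl_Lin[of p] vpart_over car by blast
  qed
 qed
 ultimately have iso: "?\<phi> \<in> ring_iso ?A WA" using hom unfolding ring_iso_def bij_betw_def by blast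
 have gr: "?\<phi> ` component ?A k = component WA k" for k
 proof
  show "?\<phi> ` component ?A k \<subseteq> component WA k"
   unfolding WA_ops using Lin_homw[OF VV_over] comp by blast
  show "component WA k \<subseteq> ?\<phi> ` component ?A k"
  proof
   fix x assume "x \<in> component WA k"
   then obtain p where p: "homw k p" "x = cl p" unfolding WA_ops by blast
   have "vpart (Theta p) \<in> component ?A k" using vpart_over vpart_homp[OF Theta_homp[OF p(1)]] comp by blast
   thus "x \<in> ?\<phi> ` component ?A k" using cl_Lin[OF homw_Fh[OF p(1)]] p(2) by blast
  qed
 qed
 show ?thesis unfolding graded_algebra_iso_def mem_Collect_eq ops WA_ops(3)
  by (intro conjI allI iso scalar gr)
qed

end

theorem theorem1:
  fixes G :: "('g::ab_group_add) kac_moody" and n :: nat and \<Lambda> :: "'g \<Rightarrow> complex"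
  assumes "n \<ge> 1"
    and "affine_A2n2 n G"
    and "\<Lambda> \<in> dominant_weights n G"
  shows "is_graded_polynomial_algebra (weyl_algebra n G \<Lambda>)
           {(i, r). 1 \<le> i \<and> i \<le> n \<and> 1 \<le> r \<and> r \<le> nat_pairing \<Lambda> (simple_coroot G i)}
           (\<lambda>(i, r). 2 * r)"
proof -
  interpret weyl_data G n \<Lambda>
    using assms by unfold_locales
  show ?thesis
    using weyl_polynomial[unfolded Mm_def] unfolding is_graded_polynomial_algebra_def by blast
qed

end
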